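(* Let $u_n$ be distributed according to the Haar probability measure on the unitary group $U(n)$. Let $\epsilon_n\ge0$ with $\epsilon_n\to0$ and $1/n=O(\epsilon_n)$. Let $\ell\ge1$, $\delta>0$, and let $\phi^{(1)}_n,\dots,\phi^{(\ell)}_n$ be real numbers with $0\le\phi^{(1)}_n<\dots<\phi^{(\ell)}_n<2\pi-\delta$ for all $n$. Suppose that for all $i\ne j$, $$\frac{\log|\phi^{(j)}_n-\phi^{(i)}_n|}{\log\epsilon_n}\to c_{i,j}\in[0,\infty].$$ Then, as $n\to\infty$, the vector $$\frac{1}{\sqrt{-\log\epsilon_n}}\Big(\log Z\big(u_n,e^{\epsilon_n+\mathrm{i}\phi^{(1)}_n}\big),\dots,\log Z\big(u_n,e^{\epsilon_n+\mathrm{i}\phi^{(\ell)}_n}\big)\Big)$$ converges in law to a complex Gaussian vector $(Y_1,\dots,Y_\ell)$ with mean $0$, $\mathrm{cov}(Y_i,Y_i)=1$ and $\mathrm{cov}(Y_i,Y_j)=1\wedge c_{i,j}$ for $i\ne j$. Moreover, the same conclusion holds if instead $\epsilon_n\ge0$ satisfies $\epsilon_n=O(1/n)$, provided the hypothesis on the angles is replaced by $\frac{-\log|\phi^{(j)}_n-\phi^{(i)}_n|}{\log n}\to c_{i,j}\in[0,\infty]$ for all $i\ne j$ and the normalization $1/\sqrt{-\log\epsilon_n}$ is replaced by $1/\sqrt{\log n}$.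
   Context: For $u\in U(n)$, $Z(u,X)=\det(\mathrm{Id}-X^{-1}u)$. For $|X|>1$, $\log Z(u,X)=-\sum_{j\ge1}\frac{1}{j}\frac{\mathrm{Tr}(u^j)}{X^j}$ (principal branch, equal to $\sum_k\log(1-e^{\mathrm{i}\theta_k}/X)$ where $e^{\mathrm{i}\theta_k}$ are the eigenvalues); for $|X|=1$, $\log Z(u,X)$ is defined as the $L^2$-convergent series $-\sum_{j\ge1}\frac1j\frac{\mathrm{Tr}(u^j)}{X^j}$. A standard complex normal variable is $\frac{1}{\sqrt2}(\mathcal N_1+\mathrm{i}\mathcal N_2)$ with $\mathcal N_1,\mathcal N_2$ independent real standard normals; a complex Gaussian vector is one all of whose linear combinations are complex normal (of the form $\lambda+\mu Y$, $Y$ standard complex normal), with covariance $\mathrm{cov}(Y_i,Y_j)=\mathbb E(\overline{Y_i}Y_j)-\mathbb E(\overline{Y_i})\mathbb E(Y_j)$. $a\wedge b=\min(a,b)$. *)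

theory Defs
  imports
    "HOL-Probability.Probability"
    "HOL-Library.Landau_Symbols"
    "Jordan_Normal_Form.Schur_Decomposition"
begin

text \<open>Both HOL-Analysis and Jordan_Normal_Form use the infix dollar sign and the names
  \<open>det\<close> and \<open>mat\<close>.  Matrices of varying size are Jordan_Normal_Form matrices; the limit vectors
  live in the Euclidean space \<open>complex ^ 'l\<close>, whose components are written with \<open>vec_nth\<close>.\<close>

definition unitary_group :: "nat \<Rightarrow> complex mat set" where
  "unitary_group n = {A \<in> carrier_mat n n. mat_adjoint A * A = 1\<^sub>m n}"

text \<open>The Borel \<open>\<sigma>\<close>-algebra of the topology inherited from $n^2$-dimensional complex space,
  which is generated by the entries because that space is second countable.\<close>

definition unitary_borel :: "nat \<Rightarrow> complex mat measure" where
  "unitary_borel n = sigma (unitary_group n)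
     {{A \<in> unitary_group n. A $$ (i, j) \<in> B} | i j B. i < n \<and> j < n \<and> B \<in> sets borel}"

definition haar_prob :: "nat \<Rightarrow> complex mat measure \<Rightarrow> bool" where
  "haar_prob n \<mu> \<longleftrightarrow> prob_space \<mu> \<and> sets \<mu> = sets (unitary_borel n) \<and>
     (\<forall>V\<in>unitary_group n. distr \<mu> \<mu> (\<lambda>W. V * W) = \<mu>)"

definition haar_distributed :: "nat \<Rightarrow> 'w measure \<Rightarrow> ('w \<Rightarrow> complex mat) \<Rightarrow> bool" where
  "haar_distributed n P u \<longleftrightarrow> prob_space P \<and> u \<in> P \<rightarrow>\<^sub>M unitary_borel n \<and>
     haar_prob n (distr P (unitary_borel n) u)"

definition mat_trace :: "complex mat \<Rightarrow> complex" where
  "mat_trace A = (\<Sum>i<dim_row A. A $$ (i, i))"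

definition Z :: "complex mat \<Rightarrow> complex \<Rightarrow> complex" where
  "Z u X = Determinant.det (1\<^sub>m (dim_row u) - inverse X \<cdot>\<^sub>m u)"

definition logZ_term :: "complex mat \<Rightarrow> complex \<Rightarrow> nat \<Rightarrow> complex" where
  "logZ_term u X j = - (1 / of_nat j) * (mat_trace (u ^\<^sub>m j) / X ^ j)"

text \<open>The random variable \<open>\<omega> \<mapsto> log Z(u(\<omega>), X)\<close>, used for \<open>\<bar>X\<bar> \<ge> 1\<close> only.  On the unit circle
  it is the \<open>L\<^sup>2(P)\<close> limit of the partial sums, hence only determined almost surely: an arbitrary
  version is chosen.  The \<open>L\<^sup>2\<close> distance is a nonnegative (extended) integral, so that it is not
  zero by convention when the integral diverges.\<close>

definition logZ :: "'w measure \<Rightarrow> ('w \<Rightarrow> complex mat) \<Rightarrow> complex \<Rightarrow> 'w \<Rightarrow> complex" where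
  "logZ P u X = (if norm X = 1
     then (SOME L. L \<in> borel_measurable P \<and>
        (\<lambda>N. \<integral>\<^sup>+ \<omega>. ennreal ((norm (L \<omega> - (\<Sum>j=1..N. logZ_term (u \<omega>) X j)))\<^sup>2) \<partial>P)
          \<longlonglongrightarrow> 0)
     else (\<lambda>\<omega>. \<Sum>j. logZ_term (u \<omega>) X (Suc j)))"

text \<open>Random vectors in the limit are described by their laws, which are measures on the Borel
  sets.\<close>

definition std_complex_normal :: "complex measure" where
  "std_complex_normal = distr (std_normal_distribution \<Otimes>\<^sub>M std_normal_distribution) borel
     (\<lambda>(x, y). complex_of_real (1 / sqrt 2) * Complex x y)"

definition complex_normal :: "complex measure \<Rightarrow> bool" where
  "complex_normal \<nu> \<longleftrightarrow> (\<exists>a b. \<nu> = distr std_complex_normal borel (\<lambda>y. a + b * y))"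

definition complex_gaussian_vector :: "(complex ^ 'l) measure \<Rightarrow> bool" where
  "complex_gaussian_vector \<nu> \<longleftrightarrow> prob_space \<nu> \<and> sets \<nu> = sets borel \<and>
     (\<forall>a :: 'l \<Rightarrow> complex. complex_normal (distr \<nu> borel (\<lambda>y. \<Sum>i\<in>UNIV. a i * vec_nth y i)))"

definition cmean :: "(complex ^ 'l) measure \<Rightarrow> 'l \<Rightarrow> complex" where
  "cmean \<nu> i = (\<integral>y. vec_nth y i \<partial>\<nu>)"

definition ccov :: "(complex ^ 'l) measure \<Rightarrow> 'l \<Rightarrow> 'l \<Rightarrow> complex" where
  "ccov \<nu> i j = (\<integral>y. cnj (vec_nth y i) * vec_nth y j \<partial>\<nu>)
     - (\<integral>y. cnj (vec_nth y i) \<partial>\<nu>) * (\<integral>y. vec_nth y j \<partial>\<nu>)"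

text \<open>Measurability is part of the notion, since the integral of a non-measurable function is zero
  by convention.\<close>

definition converges_in_law ::
  "(nat \<Rightarrow> 'w measure) \<Rightarrow> (nat \<Rightarrow> 'w \<Rightarrow> 'a::topological_space) \<Rightarrow> 'a measure \<Rightarrow> bool" where
  "converges_in_law P X \<nu> \<longleftrightarrow>
     (\<forall>\<^sub>F n in sequentially. X n \<in> borel_measurable (P n)) \<and>
     (\<forall>f :: 'a \<Rightarrow> real. continuous_on UNIV f \<and> bounded (range f) \<longrightarrow>
        (\<lambda>n. \<integral>\<omega>. f (X n \<omega>) \<partial>P n) \<longlonglongrightarrow> (\<integral>y. f y \<partial>\<nu>))"

text \<open>The lemmas below check the convention for \<open>logZ\<close>: for \<open>\<bar>X\<bar> > 1\<close> the series is the sum of the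
  principal logarithms over the eigenvalues, and a logarithm of \<open>Z\<close>.\<close>

lemma mat_trace_mult_commute:
  assumes "A \<in> carrier_mat n n" "B \<in> carrier_mat n n"
  shows "mat_trace (A * B) = mat_trace (B * A)"
proof -
  have 1: "mat_trace (A * B) = (\<Sum>i<n. \<Sum>k<n. A $$ (i,k) * B $$ (k,i))"
    using assms by (auto simp: mat_trace_def scalar_prod_def atLeast0LessThan intro!: sum.cong)
  have 2: "mat_trace (B * A) = (\<Sum>i<n. \<Sum>k<n. B $$ (i,k) * A $$ (k,i))"
    using assms by (auto simp: mat_trace_def scalar_prod_def atLeast0LessThan intro!: sum.cong)
  show ?thesis unfolding 1 2 by (subst sum.swap) (simp add: mult.commute)
qed

lemma upper_triangular_mult_diag:
  fixes A B :: "complex mat"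
  assumes A: "A \<in> carrier_mat n n" and B: "B \<in> carrier_mat n n"
    and uA: "upper_triangular A" and uB: "upper_triangular B"
  shows "upper_triangular (A * B)" "\<And>i. i < n \<Longrightarrow> (A * B) $$ (i,i) = A $$ (i,i) * B $$ (i,i)"
proof -
  show "upper_triangular (A * B)"
  proof (rule upper_triangularI)
    fix i j assume ji: "j < i" and i: "i < dim_row (A * B)"
    have "(A * B) $$ (i,j) = (\<Sum>k\<in>{0..<n}. A $$ (i,k) * B $$ (k,j))"
      using A B i ji by (auto simp: scalar_prod_def)
    also have "\<dots> = 0"
    proof (rule sum.neutral, intro ballI)
      fix k assume k: "k \<in> {0..<n}"
      show "A $$ (i,k) * B $$ (k,j) = 0"
      proof (cases "k < i")
        case True
        then show ?thesis using upper_triangularD[OF uA True] A i by simp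
      next
        case False
        then have "j < k" using ji by simp
        then show ?thesis using upper_triangularD[OF uB \<open>j < k\<close>] B k by simp
      qed
    qed
    finally show "(A * B) $$ (i,j) = 0" .
  qed
  fix i assume i: "i < n"
  have "(A * B) $$ (i,i) = (\<Sum>k\<in>{0..<n}. A $$ (i,k) * B $$ (k,i))"
    using A B i by (auto simp: scalar_prod_def)
  also have "\<dots> = (\<Sum>k\<in>{0..<n}. if k = i then A $$ (i,i) * B $$ (i,i) else 0)"
  proof (rule sum.cong)
    fix k assume k: "k \<in> {0..<n}"
    consider "k < i" | "k = i" | "i < k" by linarith
    then show "A $$ (i,k) * B $$ (k,i) = (if k = i then A $$ (i,i) * B $$ (i,i) else 0)"
    proof cases
      case 1 then show ?thesis using upper_triangularD[OF uA 1] A i by simp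
    next
      case 3 then show ?thesis using upper_triangularD[OF uB 3] B k by simp
    qed simp
  qed simp
  also have "\<dots> = A $$ (i,i) * B $$ (i,i)" using i by simp
  finally show "(A * B) $$ (i,i) = A $$ (i,i) * B $$ (i,i)" .
qed

lemma upper_triangular_pow_diag:
  fixes B :: "complex mat"
  assumes B: "B \<in> carrier_mat n n" and uB: "upper_triangular B"
  shows "upper_triangular (B ^\<^sub>m k) \<and> (\<forall>i<n. (B ^\<^sub>m k) $$ (i,i) = (B $$ (i,i)) ^ k)"
proof (induction k)
  case 0
  then show ?case using B by auto
next
  case (Suc k)
  have c: "B ^\<^sub>m k \<in> carrier_mat n n" using B by simp
  show ?case
    using upper_triangular_mult_diag[OF c B _ uB] Suc by (auto simp: mult.commute)
qed

text \<open>Eigenvalues are listed with multiplicity by the roots of the characteristic polynomial.\<close>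

lemma mat_trace_pow_eigen:
  assumes A: "A \<in> carrier_mat n n" and cp: "char_poly A = (\<Prod>e\<leftarrow>es. [:- e, 1:])"
  shows "mat_trace (A ^\<^sub>m k) = (\<Sum>e\<leftarrow>es. e ^ k)"
    and "Z A X = (\<Prod>e\<leftarrow>es. 1 - e / X)"
proof -
  obtain B P Q where "schur_decomposition A es = (B,P,Q)"
    by (cases "schur_decomposition A es") auto
  from schur_decomposition[OF A cp this]
  have sim: "similar_mat_wit A B P Q" and uB: "upper_triangular B" and dB: "diag_mat B = es"
    by auto
  note w = similar_mat_witD2[OF A sim]
  have B: "B \<in> carrier_mat n n" and P: "P \<in> carrier_mat n n" and Q: "Q \<in> carrier_mat n n"
    and PQ: "P * Q = 1\<^sub>m n" and QP: "Q * P = 1\<^sub>m n" and APBQ: "A = P * B * Q"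
    using w by auto
  have Bk: "B ^\<^sub>m k \<in> carrier_mat n n" using B by simp
  have simk: "similar_mat_wit (A ^\<^sub>m k) (B ^\<^sub>m k) P Q" by (rule similar_mat_wit_pow[OF sim])
  have "A ^\<^sub>m k = P * (B ^\<^sub>m k) * Q"
    by (rule similar_mat_witD2(3)[OF pow_carrier_mat[OF A] simk])
  then have "mat_trace (A ^\<^sub>m k) = mat_trace (Q * (P * (B ^\<^sub>m k)))"
    using mat_trace_mult_commute[OF mult_carrier_mat[OF P Bk] Q] by simp
  also have "Q * (P * (B ^\<^sub>m k)) = B ^\<^sub>m k"
    unfolding assoc_mult_mat[OF Q P Bk, symmetric] QP by (rule left_mult_one_mat[OF Bk])
  also have "mat_trace (B ^\<^sub>m k) = (\<Sum>i<n. (B $$ (i,i)) ^ k)"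
    using upper_triangular_pow_diag[OF B uB, of k] Bk by (auto simp: mat_trace_def)
  also have "\<dots> = (\<Sum>e\<leftarrow>es. e ^ k)"
    unfolding dB[symmetric] using B
    by (simp add: diag_mat_def sum_list_sum_nth o_def atLeast0LessThan)
  finally show "mat_trace (A ^\<^sub>m k) = (\<Sum>e\<leftarrow>es. e ^ k)" .
  let ?C = "1\<^sub>m n - inverse X \<cdot>\<^sub>m B"
  have C: "?C \<in> carrier_mat n n"
    by (rule minus_carrier_mat) (use B in simp)
  have eq: "P * ?C * Q = 1\<^sub>m n - inverse X \<cdot>\<^sub>m A"
  proof -
    have PB: "P * B \<in> carrier_mat n n" using P B by simp
    have "P * ?C = P * 1\<^sub>m n - P * (inverse X \<cdot>\<^sub>m B)"
      by (rule mult_minus_distrib_mat[OF P]) (use B in auto)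
    also have "\<dots> = P - inverse X \<cdot>\<^sub>m (P * B)"
      unfolding mult_smult_distrib[OF P B] right_mult_one_mat[OF P] ..
    finally have "P * ?C * Q = P * Q - inverse X \<cdot>\<^sub>m (P * B) * Q"
      by (simp only:) (rule minus_mult_distrib_mat[OF P _ Q], use PB in simp)
    then show ?thesis unfolding mult_smult_assoc_mat[OF PB Q] PQ APBQ .
  qed
  have XA: "1\<^sub>m n - inverse X \<cdot>\<^sub>m A \<in> carrier_mat n n"
    by (rule minus_carrier_mat) (use A in simp)
  have "similar_mat (1\<^sub>m n - inverse X \<cdot>\<^sub>m A) ?C"
    using similar_mat_witI[OF PQ QP eq[symmetric] XA C P Q] unfolding similar_mat_def by blast
  then have "Determinant.det (1\<^sub>m n - inverse X \<cdot>\<^sub>m A) = Determinant.det ?C"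
    by (rule det_similar)
  also have "\<dots> = prod_list (diag_mat ?C)"
    by (rule det_upper_triangular[OF _ C], rule upper_triangularI)
      (use B upper_triangularD[OF uB] in auto)
  also have "diag_mat ?C = map (\<lambda>e. 1 - e / X) es"
    unfolding dB[symmetric] using B by (auto simp: diag_mat_def field_simps)
  finally show "Z A X = (\<Prod>e\<leftarrow>es. 1 - e / X)" using A by (auto simp: Z_def)
qed

lemma unitary_eigenvalue_norm:
  assumes A: "A \<in> unitary_group n" and e: "eigenvalue A e"
  shows "norm e = 1"
proof -
  have Ac: "A \<in> carrier_mat n n" and AA: "mat_adjoint A * A = 1\<^sub>m n"
    using A by (auto simp: unitary_group_def)
  have Aj: "mat_adjoint A \<in> carrier_mat n n" using Ac by (auto simp: mat_adjoint_def)
  obtain v where v: "v \<in> carrier_vec n" "v \<noteq> 0\<^sub>v n" and Av: "A *\<^sub>v v = e \<cdot>\<^sub>v v"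
    using e Ac by (auto simp: eigenvalue_def eigenvector_def)
  have adj: "(mat_adjoint A *\<^sub>v w) \<bullet>c v = w \<bullet>c (A *\<^sub>v v)" if w: "w \<in> carrier_vec n" for w
  proof -
    have "(mat_adjoint A *\<^sub>v w) \<bullet>c v
        = (\<Sum>i\<in>{0..<n}. \<Sum>j\<in>{0..<n}. cnj (A $$ (j,i)) * vec_index w j * cnj (vec_index v i))"
      using v w Ac Aj
      by (auto simp: scalar_prod_def mat_adjoint_def sum_distrib_right intro!: sum.cong)
    also have "\<dots>
        = (\<Sum>j\<in>{0..<n}. \<Sum>i\<in>{0..<n}. cnj (A $$ (j,i)) * vec_index w j * cnj (vec_index v i))"
      by (rule sum.swap)
    also have "\<dots> = w \<bullet>c (A *\<^sub>v v)"
      using v w Ac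
      by (auto simp: scalar_prod_def sum_distrib_left mult_ac intro!: sum.cong)
    finally show ?thesis .
  qed
  have "v \<bullet>c v = (mat_adjoint A *\<^sub>v (A *\<^sub>v v)) \<bullet>c v"
    using AA v Ac Aj by (simp flip: assoc_mult_mat_vec[of "mat_adjoint A" n n A n v])
  also have "\<dots> = (e \<cdot>\<^sub>v v) \<bullet>c (e \<cdot>\<^sub>v v)"
    using adj[of "A *\<^sub>v v"] v Ac by (simp add: Av)
  also have "\<dots> = e * cnj e * (v \<bullet>c v)"
    using v by (simp add: conjugate_smult_vec)
  finally have "e * cnj e = 1"
    using v by (simp add: conjugate_square_eq_0_vec)
  then have "(norm e)\<^sup>2 = 1" by (metis complex_norm_square of_real_1 of_real_eq_iff)
  then show ?thesis using norm_ge_zero[of e] by (simp only: power2_eq_1_iff) linarith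
qed

lemma logZ_eq_sum_Ln:
  assumes u: "u \<omega> \<in> unitary_group n" and X: "norm X > 1"
    and cp: "char_poly (u \<omega>) = (\<Prod>e\<leftarrow>es. [:- e, 1:])"
  shows "(\<lambda>j. logZ_term (u \<omega>) X (Suc j)) sums (\<Sum>e\<leftarrow>es. Ln (1 - e / X))"
    and "logZ P u X \<omega> = (\<Sum>e\<leftarrow>es. Ln (1 - e / X))"
    and "exp (logZ P u X \<omega>) = Z (u \<omega>) X"
proof -
  have c: "u \<omega> \<in> carrier_mat n n" using u by (auto simp: unitary_group_def)
  have ne: "norm e = 1" if "e \<in> set es" for e
    using that unitary_eigenvalue_norm[OF u] eigenvalue_root_char_poly[OF c, of e] cp
    by (auto simp: poly_prod_list prod_list_zero_iff)
  have s1: "(\<lambda>j. - ((e / X) ^ Suc j) / of_nat (Suc j)) sums Ln (1 - e / X)"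
    if "norm e = 1" for e
  proof -
    have "norm (- (e / X)) < 1" using that X by (simp add: norm_divide divide_less_eq)
    then have "(\<lambda>j. - ((e / X) ^ j) / of_nat j) sums Ln (1 - e / X)"
      using Ln_series'[of "- (e / X)"] by simp
    then show ?thesis
      using sums_Suc_iff[of "\<lambda>j. - ((e / X) ^ j) / of_nat j"] by simp
  qed
  have "(\<lambda>j. \<Sum>e\<leftarrow>es. - ((e / X) ^ Suc j) / of_nat (Suc j)) sums (\<Sum>e\<leftarrow>es. Ln (1 - e / X))"
    using ne
  proof (induction es)
    case (Cons e es)
    show ?case unfolding list.map sum_list.Cons
      by (rule sums_add[OF s1 Cons.IH]) (use Cons.prems in auto)
  qed simp
  moreover have "(\<Sum>e\<leftarrow>es. - ((e / X) ^ Suc j) / of_nat (Suc j)) = logZ_term (u \<omega>) X (Suc j)" for j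
  proof -
    have "(\<Sum>e\<leftarrow>xs. - ((e / X) ^ k) / b) = - (1 / b) * ((\<Sum>e\<leftarrow>xs. e ^ k) / X ^ k)" for xs k b
      by (induction xs) (auto simp: power_divide add_divide_distrib diff_divide_distrib)
    then show ?thesis unfolding logZ_term_def mat_trace_pow_eigen(1)[OF c cp] .
  qed
  ultimately show s: "(\<lambda>j. logZ_term (u \<omega>) X (Suc j)) sums (\<Sum>e\<leftarrow>es. Ln (1 - e / X))"
    by simp
  then show l: "logZ P u X \<omega> = (\<Sum>e\<leftarrow>es. Ln (1 - e / X))"
    using X by (auto simp: logZ_def sums_iff)
  have nz: "1 - e / X \<noteq> 0" if "e \<in> set es" for e
    using ne[OF that] X by (auto simp: field_simps)
  show "exp (logZ P u X \<omega>) = Z (u \<omega>) X"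
    unfolding l mat_trace_pow_eigen(2)[OF c cp] using nz
    by (induction es) (auto simp: exp_add)
qed

end

theory Submission
  imports Defs "HOL-Real_Asymp.Real_Asymp"
begin

text \<open>Integrating by parts on \<open>U(n)\<close> gives loop equations for the mixed moments of the traces
  \<open>tr U\<^sup>j\<close>.  As long as the total degree is at most \<open>n\<close> they determine the moments, and the moments of
  independent complex Gaussians of variance \<open>j\<close> solve them.  Truncating \<open>log Z\<close> after \<open>m = n / L\<close>
  terms, \<open>L \<rightarrow> \<infinity>\<close> being the normalisation, thus leaves a linear statistic whose moments are Gaussian
  up to an order tending to infinity, and its covariances are logarithmic sums
  \<open>\<Sum>j\<le>m. q\<^sup>j / j = min (log n) (- log \<epsilon>) (- log \<Delta>) + O(log L)\<close> with \<open>q = exp (- 2\<epsilon> + i\<Delta>)\<close>.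
  The terms with \<open>m < j \<le> n\<close> contribute \<open>O(log L)\<close> to the variance.  For \<open>j > n\<close> the variance of
  \<open>tr U\<^sup>j\<close> is not computed but only bounded on average: scaling a row of \<open>U\<close> by a phase
  decomposes the trace according to the number of visits to a coordinate, and the generating function
  of the resulting variances controls dyadic blocks, so that the tail contributes \<open>O(log log n)\<close>.\<close>

section \<open>Convergence in law from characteristic functions\<close>

text \<open>The Gaussian values solve the loop equations exactly, so the difference between a moment
  and its Gaussian value solves the homogeneous equations. There the wanted unknown has coefficient
  \<open>n\<close>, while the coefficients of the other unknowns of the same positive degree
  \<open>d\<close> sum to \<open>d - 1\<close>; for \<open>d \<le> n\<close> a supremum bound forces
  the difference to vanish. This says nothing beyond degree \<open>n\<close>, which is why high
  powers are treated by returns to a coordinate and why an average bound, off by a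
  \<open>log log n\<close>, is accepted: either the normalisation is of order \<open>log n\<close>,
  or \<open>exp (- 2 n \<epsilon>)\<close> already kills these terms. As only finitely many moments
  are Gaussian for each \<open>n\<close>, characteristic functions are compared through Taylor
  polynomials with explicit remainder. Both regimes of \<open>\<epsilon>\<close> are one argument
  for an abstract normalisation \<open>L\<close> that is asymptotic to the logarithmic cutoff.
  Positive semidefiniteness of the limit covariance is inherited from the variances that converge to
  it.\<close>

inductive trig_poly :: "('a::euclidean_space \<Rightarrow> complex) \<Rightarrow> bool" where
  base: "trig_poly (\<lambda>x. c * cis (x \<bullet> t))"
| add: "trig_poly f \<Longrightarrow> trig_poly g \<Longrightarrow> trig_poly (\<lambda>x. f x + g x)"

lemma trig_poly_const: "trig_poly (\<lambda>x. c)"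
  using trig_poly.base[of c 0] by simp

lemma trig_poly_mult_base: "trig_poly f \<Longrightarrow> trig_poly (\<lambda>x. f x * (c * cis (x \<bullet> t)))"
proof (induction rule: trig_poly.induct)
  case (base d s)
  have "(\<lambda>x. d * cis (x \<bullet> s) * (c * cis (x \<bullet> t))) = (\<lambda>x. (d * c) * cis (x \<bullet> (s + t)))"
    by (auto simp: inner_add_right algebra_simps simp flip: cis_mult)
  then show ?case using trig_poly.base by metis
next
  case (add f g)
  then show ?case using trig_poly.add by (simp add: distrib_right)
qed

lemma trig_poly_mult: "trig_poly g \<Longrightarrow> trig_poly f \<Longrightarrow> trig_poly (\<lambda>x. f x * g x)"
proof (induction rule: trig_poly.induct)
  case (base d s)
  then show ?case by (rule trig_poly_mult_base)
next
  case (add g1 g2)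
  then show ?case using trig_poly.add by (simp add: distrib_left)
qed

lemma trig_poly_sum:
  "finite I \<Longrightarrow> (\<And>i. i \<in> I \<Longrightarrow> trig_poly (f i)) \<Longrightarrow> trig_poly (\<lambda>x. \<Sum>i\<in>I. f i x)"
  by (induction rule: finite_induct) (auto intro: trig_poly_const trig_poly.add)

lemma trig_poly_sin: "trig_poly (\<lambda>x. complex_of_real (sin (a * (x \<bullet> b))))"
proof -
  have "(\<lambda>x. complex_of_real (sin (a * (x \<bullet> b))))
      = (\<lambda>x. (- \<i> / 2) * cis (x \<bullet> (a *\<^sub>R b)) + (\<i> / 2) * cis (x \<bullet> ((- a) *\<^sub>R b)))"
    by (auto simp: complex_eq_iff)
  then show ?thesis using trig_poly.add[OF trig_poly.base trig_poly.base] by metis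
qed

text \<open>Precomposing with bounded periodic coordinates turns polynomials, which are unbounded,
  into functions whose integrals are determined by the characteristic function.\<close>

definition sin_map :: "real \<Rightarrow> 'a::euclidean_space \<Rightarrow> 'a" where
  "sin_map a x = (\<Sum>b\<in>Basis. sin (a * (x \<bullet> b)) *\<^sub>R b)"

lemma trig_poly_polynomial_sin:
  assumes "real_polynomial_function p"
  shows "trig_poly (\<lambda>x. complex_of_real (p (sin_map a x)))"
  using assms
proof (induction rule: real_polynomial_function.induct)
  case (linear f)
  interpret bounded_linear f by fact
  have "complex_of_real (f (sin_map a x))
      = (\<Sum>b\<in>Basis. complex_of_real (sin (a * (x \<bullet> b))) * complex_of_real (f b))" for x
    by (simp add: sin_map_def sum scale)
  then show ?case
    by (simp only:) (intro trig_poly_sum trig_poly_mult trig_poly_sin trig_poly_const finite_Basis)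
next
  case (const c)
  then show ?case by (rule trig_poly_const)
next
  case (add f g)
  then show ?case using trig_poly.add by simp
next
  case (mult f g)
  then show ?case using trig_poly_mult by simp
qed

lemma trig_poly_bounded_measurable:
  assumes "trig_poly g"
  shows "g \<in> borel_measurable borel \<and> (\<exists>B. \<forall>x. norm (g x) \<le> B)"
  using assms
proof (induction rule: trig_poly.induct)
  case (base c t)
  have "(\<lambda>x. c * cis (x \<bullet> t)) \<in> borel_measurable borel"
    by (intro borel_measurable_continuous_onI continuous_intros)
  then show ?case by (auto simp: norm_mult)
next
  case (add f g)
  then obtain B C where "\<forall>x. norm (f x) \<le> B" "\<forall>x. norm (g x) \<le> C" by auto
  then have "\<forall>x. norm (f x + g x) \<le> B + C" by (meson add_mono norm_triangle_le)
  then show ?case using add by auto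
qed

lemma (in prob_space) integrable_bounded_comp:
  fixes g :: "'b::topological_space \<Rightarrow> 'c::{banach, second_countable_topology}"
  assumes "X \<in> borel_measurable M" "g \<in> borel_measurable borel" "\<And>x. norm (g x) \<le> B"
  shows "integrable M (\<lambda>\<omega>. g (X \<omega>))"
  by (rule integrable_const_bound[of _ B]) (use assms in auto)

lemma trig_poly_integral_tendsto:
  fixes X :: "nat \<Rightarrow> 'w \<Rightarrow> 'a::euclidean_space"
  assumes g: "trig_poly g"
    and P: "\<forall>\<^sub>F n in sequentially. prob_space (P n) \<and> X n \<in> borel_measurable (P n)"
    and \<nu>: "prob_space \<nu>" "sets \<nu> = sets borel"
    and char: "\<And>t. (\<lambda>n. \<integral>\<omega>. cis (X n \<omega> \<bullet> t) \<partial>P n) \<longlonglongrightarrow> (\<integral>y. cis (y \<bullet> t) \<partial>\<nu>)"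
  shows "(\<lambda>n. \<integral>\<omega>. g (X n \<omega>) \<partial>P n) \<longlonglongrightarrow> (\<integral>y. g y \<partial>\<nu>)"
  using g
proof (induction rule: trig_poly.induct)
  case (base c t)
  show ?case using tendsto_mult_left[OF char[of t], of c] by simp
next
  case (add f g)
  obtain B C where B: "\<And>x. norm (f x) \<le> B" "\<And>x. norm (g x) \<le> C"
    and m: "f \<in> borel_measurable borel" "g \<in> borel_measurable borel"
    using trig_poly_bounded_measurable add.hyps by metis
  interpret N: prob_space \<nu> by fact
  have id: "(\<lambda>y. y) \<in> borel_measurable \<nu>" using \<nu> by (simp add: measurable_ident_sets)
  have "(\<integral>y. f y + g y \<partial>\<nu>) = (\<integral>y. f y \<partial>\<nu>) + (\<integral>y. g y \<partial>\<nu>)"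
    by (intro Bochner_Integration.integral_add)
      (use N.integrable_bounded_comp[OF id m(1) B(1)] N.integrable_bounded_comp[OF id m(2) B(2)] in auto)
  moreover have "\<forall>\<^sub>F n in sequentially. (\<integral>\<omega>. f (X n \<omega>) \<partial>P n) + (\<integral>\<omega>. g (X n \<omega>) \<partial>P n)
      = (\<integral>\<omega>. f (X n \<omega>) + g (X n \<omega>) \<partial>P n)"
    using P
  proof eventually_elim
    case (elim n)
    then interpret p: prob_space "P n" by simp
    show ?case
      by (intro Bochner_Integration.integral_add[symmetric])
        (use p.integrable_bounded_comp[OF _ m(1) B(1)] p.integrable_bounded_comp[OF _ m(2) B(2)] elim in auto)
  qed
  ultimately show ?case
    using tendsto_add[OF add.IH] by (simp add: tendsto_cong)
qed

text \<open>On the cube of half-width \<open>R\<close> the function \<open>f\<close> agrees with a continuous function of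
  the coordinate sines \<open>sin (\<pi> x / 2R)\<close>; approximating the latter by a polynomial on the compact
  cube controls the approximation on the whole space.\<close>

lemma trig_poly_approximation:
  fixes f :: "'a::euclidean_space \<Rightarrow> real"
  assumes f: "continuous_on UNIV f" and B: "\<And>x. \<bar>f x\<bar> \<le> B" and "R > 0" "e > 0"
  obtains T where "trig_poly (\<lambda>x. complex_of_real (T x))"
    "\<And>x. \<bar>f x - T x\<bar> \<le> e + 2 * B * indicator {x. norm x > R} x"
proof -
  define a where "a = pi / (2 * R)"
  have a: "a > 0" using \<open>R > 0\<close> by (simp add: a_def)
  define F where "F s = f (\<Sum>b\<in>Basis. (arcsin (s \<bullet> b) / a) *\<^sub>R b)" for s :: 'a
  let ?S = "cbox (- One) One :: 'a set"
  have "continuous_on ?S F"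
    unfolding F_def
    by (intro continuous_on_compose2[OF f] continuous_intros) (use a in \<open>auto simp: mem_box\<close>)
  then obtain p where p: "real_polynomial_function p" "\<And>x. x \<in> ?S \<Longrightarrow> \<bar>F x - p x\<bar> < e"
    using Stone_Weierstrass_real_polynomial_function[of ?S F e] compact_cbox \<open>e > 0\<close> by metis
  have S: "sin_map a x \<in> ?S" for x :: 'a
    by (auto simp: sin_map_def mem_box inner_sum_left inner_Basis if_distrib cong: if_cong)
  have eq: "F (sin_map a x) = f x" if "norm x \<le> R" for x
  proof -
    have "arcsin (sin (a * (x \<bullet> b))) = a * (x \<bullet> b)" if b: "b \<in> Basis" for b
    proof -
      have "\<bar>x \<bullet> b\<bar> \<le> R" using Basis_le_norm[OF b, of x] \<open>norm x \<le> R\<close> by simp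
      then have "a * \<bar>x \<bullet> b\<bar> \<le> a * R" using a by (intro mult_left_mono) auto
      also have "a * R = pi / 2" using \<open>R > 0\<close> by (simp add: a_def)
      finally have "\<bar>a * (x \<bullet> b)\<bar> \<le> pi / 2" using a by (simp add: abs_mult)
      then show ?thesis by (intro arcsin_sin) auto
    qed
    then have "F (sin_map a x) = f (\<Sum>b\<in>Basis. (x \<bullet> b) *\<^sub>R b)"
      using a unfolding F_def
      by (intro arg_cong[of _ _ f] sum.cong)
        (auto simp: sin_map_def inner_sum_left inner_Basis if_distrib cong: if_cong)
    then show ?thesis by (simp add: euclidean_representation)
  qed
  have "\<bar>f x - p (sin_map a x)\<bar> \<le> e + 2 * B * indicator {x. norm x > R} x" for x
  proof (cases "norm x \<le> R")
    case True
    then show ?thesis using p(2)[OF S, of x] eq[OF True] by simp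
  next
    case False
    \<comment> \<open>Outside the ball \<open>F (sin_map a x)\<close> need not equal
      \<open>f x\<close>, but it is still a value of \<open>f\<close>; besides the uniform error
      \<open>e\<close> of the polynomial this costs at most \<open>2 * B\<close>.\<close>
    have "\<bar>F (sin_map a x)\<bar> \<le> B" unfolding F_def by (rule B)
    then show ?thesis using p(2)[OF S, of x] B[of x] False by simp
  qed
  then show ?thesis using that[of "\<lambda>x. p (sin_map a x)"] trig_poly_polynomial_sin[OF p(1)] by blast
qed

lemma (in prob_space) integral_diff_le_tail:
  fixes f :: "'b::real_normed_vector \<Rightarrow> real"
  assumes X: "X \<in> borel_measurable M"
    and f: "f \<in> borel_measurable borel" "\<And>x. \<bar>f x\<bar> \<le> B"
    and g: "g \<in> borel_measurable borel" "\<And>x. \<bar>g x\<bar> \<le> C"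
    and fg: "\<And>x. \<bar>f x - g x\<bar> \<le> e + 2 * B * indicator {x. norm x > R} x"
  shows "\<bar>(\<integral>\<omega>. f (X \<omega>) \<partial>M) - (\<integral>\<omega>. g (X \<omega>) \<partial>M)\<bar> \<le> e + 2 * B * prob {\<omega> \<in> space M. norm (X \<omega>) > R}"
proof -
  note [measurable] = X f(1) g(1)
  have i: "integrable M (\<lambda>\<omega>. f (X \<omega>))" "integrable M (\<lambda>\<omega>. g (X \<omega>))"
    using integrable_bounded_comp[OF X f(1), of B] integrable_bounded_comp[OF X g(1), of C] f g by auto
  let ?A = "{\<omega> \<in> space M. norm (X \<omega>) > R}"
  have A: "?A \<in> sets M" by measurable
  have iA: "integrable M (indicat_real ?A)" using A by (intro integrable_const_bound[of _ 1]) auto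
  have "\<bar>(\<integral>\<omega>. f (X \<omega>) \<partial>M) - (\<integral>\<omega>. g (X \<omega>) \<partial>M)\<bar> = \<bar>\<integral>\<omega>. f (X \<omega>) - g (X \<omega>) \<partial>M\<bar>"
    using i by simp
  also have "\<dots> \<le> (\<integral>\<omega>. \<bar>f (X \<omega>) - g (X \<omega>)\<bar> \<partial>M)"
    using integral_norm_bound[of M "\<lambda>\<omega>. f (X \<omega>) - g (X \<omega>)"] by simp
  also have "\<dots> \<le> (\<integral>\<omega>. e + 2 * B * indicator ?A \<omega> \<partial>M)"
  proof (intro integral_mono)
    show "integrable M (\<lambda>\<omega>. \<bar>f (X \<omega>) - g (X \<omega>)\<bar>)" using i by auto
    show "integrable M (\<lambda>\<omega>. e + 2 * B * indicator ?A \<omega>)"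
      using A by (intro integrable_const_bound[of _ "\<bar>e\<bar> + \<bar>2 * B\<bar>"])
        (auto simp: indicator_def)
  qed (use fg in \<open>auto simp: indicator_def\<close>)
  also have "\<dots> = e + 2 * B * prob ?A"
    using A iA by (subst Bochner_Integration.integral_add) (auto simp: prob_space)
  finally show ?thesis .
qed

text \<open>Tightness is a hypothesis because an \<open>L^1\<close> bound supplies it in the
  application. It makes the periodic approximation harmless: the error outside a large ball is
  bounded by the mass there, uniformly for large \<open>n\<close>.\<close>

theorem levy_continuity_euclidean:
  fixes X :: "nat \<Rightarrow> 'w \<Rightarrow> 'a::euclidean_space" and f :: "'a \<Rightarrow> real"
  assumes P: "\<forall>\<^sub>F n in sequentially. prob_space (P n) \<and> X n \<in> borel_measurable (P n)"
    and \<nu>: "prob_space \<nu>" "sets \<nu> = sets borel"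
    and char: "\<And>t. (\<lambda>n. \<integral>\<omega>. cis (X n \<omega> \<bullet> t) \<partial>P n) \<longlonglongrightarrow> (\<integral>y. cis (y \<bullet> t) \<partial>\<nu>)"
    and tight: "\<And>e. e > 0 \<Longrightarrow> \<exists>R. \<forall>\<^sub>F n in sequentially. measure (P n) {\<omega> \<in> space (P n). norm (X n \<omega>) > R} \<le> e"
    and f: "continuous_on UNIV f" "bounded (range f)"
  shows "(\<lambda>n. \<integral>\<omega>. f (X n \<omega>) \<partial>P n) \<longlonglongrightarrow> (\<integral>y. f y \<partial>\<nu>)"
proof (rule tendstoI)
  fix e :: real assume e: "e > 0"
  interpret N: prob_space \<nu> by fact
  obtain B where B: "B > 0" "\<And>x. \<bar>f x\<bar> \<le> B"
    using f(2) unfolding bounded_pos by auto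
  \<comment> \<open>Replacing \<open>f\<close> by \<open>T\<close> costs
    \<open>d + 2 * B * d\<close> on either side and the limit for \<open>T\<close> costs
    \<open>d\<close>: together \<open>3 * d + 4 * B * d\<close>, which is below
    \<open>e\<close>.\<close>
  define d where "d = e / (4 + 4 * B)"
  have d: "d > 0" using e B by (simp add: d_def)
  obtain R0 where R0: "\<forall>\<^sub>F n in sequentially. measure (P n) {\<omega> \<in> space (P n). norm (X n \<omega>) > R0} \<le> d"
    using tight[OF d] by auto
  have id: "(\<lambda>y. y) \<in> borel_measurable \<nu>" using \<nu> by (simp add: measurable_ident_sets)
  \<comment> \<open>A single law is tight by continuity from above, the complements of balls
    decreasing to the empty set.\<close>
  have "(\<lambda>k. N.prob {y \<in> space \<nu>. norm y > real k}) \<longlonglongrightarrow> N.prob (\<Inter>k. {y \<in> space \<nu>. norm y > real k})"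
    by (rule N.finite_Lim_measure_decseq) (use id in \<open>auto simp: decseq_def\<close>)
  moreover have "(\<Inter>k. {y \<in> space \<nu>. norm y > real k}) = {}"
    by (auto, meson linorder_not_less real_arch_simple)
  ultimately have "\<forall>\<^sub>F k in sequentially. N.prob {y \<in> space \<nu>. norm y > real k} < d"
    using d by (intro order_tendstoD(2)) auto
  then have "\<forall>\<^sub>F k in sequentially. N.prob {y \<in> space \<nu>. norm y > real k} < d \<and> real k > max R0 0"
    by (intro eventually_conj filterlim_real_sequentially[unfolded filterlim_at_top_dense, rule_format]) auto
  then obtain k where k: "N.prob {y \<in> space \<nu>. norm y > real k} < d" "real k > R0" "real k > 0"
    by (auto simp: eventually_sequentially)
  obtain T where T: "trig_poly (\<lambda>x. complex_of_real (T x))"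
    "\<And>x. \<bar>f x - T x\<bar> \<le> d + 2 * B * indicator {x. norm x > real k} x"
    using trig_poly_approximation[OF f(1) B(2) k(3) d] by blast
  obtain C where C: "\<And>x. \<bar>T x\<bar> \<le> C" and mT: "(\<lambda>x. complex_of_real (T x)) \<in> borel_measurable borel"
    using trig_poly_bounded_measurable[OF T(1)] by auto
  have mT': "T \<in> borel_measurable borel"
    using measurable_compose[OF mT borel_measurable_Re] by simp
  have mf: "f \<in> borel_measurable borel" using f(1) by (rule borel_measurable_continuous_onI)
  have "(\<lambda>n. \<integral>\<omega>. complex_of_real (T (X n \<omega>)) \<partial>P n) \<longlonglongrightarrow> (\<integral>y. complex_of_real (T y) \<partial>\<nu>)"
    by (rule trig_poly_integral_tendsto[OF T(1) P \<nu> char])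
  then have "(\<lambda>n. \<integral>\<omega>. T (X n \<omega>) \<partial>P n) \<longlonglongrightarrow> (\<integral>y. T y \<partial>\<nu>)"
    by (simp add: tendsto_of_real_iff)
  then have ev: "\<forall>\<^sub>F n in sequentially. dist (\<integral>\<omega>. T (X n \<omega>) \<partial>P n) (\<integral>y. T y \<partial>\<nu>) < d"
    using d by (rule tendstoD)
  have N1: "\<bar>(\<integral>y. f y \<partial>\<nu>) - (\<integral>y. T y \<partial>\<nu>)\<bar> \<le> d + 2 * B * d"
  proof -
    have "\<bar>(\<integral>y. f y \<partial>\<nu>) - (\<integral>y. T y \<partial>\<nu>)\<bar> \<le> d + 2 * B * N.prob {y \<in> space \<nu>. norm y > real k}"
      by (rule N.integral_diff_le_tail[OF id mf B(2) mT' C T(2)])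
    also have "\<dots> \<le> d + 2 * B * d" using k(1) B(1) by simp
    finally show ?thesis .
  qed
  show "\<forall>\<^sub>F n in sequentially. dist (\<integral>\<omega>. f (X n \<omega>) \<partial>P n) (\<integral>y. f y \<partial>\<nu>) < e"
    using P R0 ev
  proof eventually_elim
    case (elim n)
    then interpret p: prob_space "P n" by simp
    have X: "X n \<in> borel_measurable (P n)" using elim by simp
    have "measure (P n) {\<omega> \<in> space (P n). norm (X n \<omega>) > real k}
        \<le> measure (P n) {\<omega> \<in> space (P n). norm (X n \<omega>) > R0}"
      by (intro p.finite_measure_mono) (use X k in auto)
    then have pk: "measure (P n) {\<omega> \<in> space (P n). norm (X n \<omega>) > real k} \<le> d" using elim by simp
    have "\<bar>(\<integral>\<omega>. f (X n \<omega>) \<partial>P n) - (\<integral>\<omega>. T (X n \<omega>) \<partial>P n)\<bar>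
        \<le> d + 2 * B * measure (P n) {\<omega> \<in> space (P n). norm (X n \<omega>) > real k}"
      by (rule p.integral_diff_le_tail[OF X mf B(2) mT' C T(2)])
    also have "\<dots> \<le> d + 2 * B * d" using pk B(1) by simp
    finally have "\<bar>(\<integral>\<omega>. f (X n \<omega>) \<partial>P n) - (\<integral>\<omega>. T (X n \<omega>) \<partial>P n)\<bar> \<le> d + 2 * B * d" .
    moreover have "\<bar>(\<integral>\<omega>. T (X n \<omega>) \<partial>P n) - (\<integral>y. T y \<partial>\<nu>)\<bar> < d"
      using elim by (simp add: dist_real_def)
    ultimately have "\<bar>(\<integral>\<omega>. f (X n \<omega>) \<partial>P n) - (\<integral>y. f y \<partial>\<nu>)\<bar> < 3 * d + 4 * B * d"
      using N1 by linarith
    also have "\<dots> \<le> d * (4 + 4 * B)" using d by (simp add: algebra_simps)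
    also have "\<dots> = e" using B by (simp add: d_def)
    finally show ?case by (simp add: dist_real_def)
  qed
qed

text \<open>The continuity theorem for a constant sequence gives equal integrals of bounded
  continuous functions; these approximate indicators of closed sets from above, and the closed sets
  are a generator stable under intersection.\<close>

theorem char_uniqueness_euclidean:
  fixes \<mu> \<nu> :: "'a::euclidean_space measure"
  assumes \<mu>: "prob_space \<mu>" "sets \<mu> = sets borel" and \<nu>: "prob_space \<nu>" "sets \<nu> = sets borel"
    and char: "\<And>t. (\<integral>y. cis (y \<bullet> t) \<partial>\<mu>) = (\<integral>y. cis (y \<bullet> t) \<partial>\<nu>)"
  shows "\<mu> = \<nu>"
proof -
  interpret M: prob_space \<mu> by fact
  interpret N: prob_space \<nu> by fact
  have idM: "(\<lambda>y. y) \<in> borel_measurable \<mu>" using \<mu> by (simp add: measurable_ident_sets)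
  have idN: "(\<lambda>y. y) \<in> borel_measurable \<nu>" using \<nu> by (simp add: measurable_ident_sets)
  have int: "(\<integral>y. f y \<partial>\<mu>) = (\<integral>y. f y \<partial>\<nu>)"
    if f: "continuous_on UNIV f" "bounded (range f)" for f :: "'a \<Rightarrow> real"
  proof -
    have tight: "\<exists>R. \<forall>\<^sub>F n::nat in sequentially. M.prob {\<omega> \<in> space \<mu>. norm \<omega> > R} \<le> e" if "e > 0" for e
    proof -
      have "(\<lambda>k. M.prob {y \<in> space \<mu>. norm y > real k}) \<longlonglongrightarrow> M.prob (\<Inter>k. {y \<in> space \<mu>. norm y > real k})"
        by (rule M.finite_Lim_measure_decseq) (use idM in \<open>auto simp: decseq_def\<close>)
      moreover have "(\<Inter>k. {y \<in> space \<mu>. norm y > real k}) = {}"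
        by (auto, meson linorder_not_less real_arch_simple)
      ultimately have "\<forall>\<^sub>F k in sequentially. M.prob {y \<in> space \<mu>. norm y > real k} < e"
        using \<open>e > 0\<close> by (intro order_tendstoD(2)) auto
      then show ?thesis by (auto simp: eventually_sequentially intro: less_imp_le)
    qed
    have "(\<lambda>n::nat. \<integral>y. f y \<partial>\<mu>) \<longlonglongrightarrow> (\<integral>y. f y \<partial>\<nu>)"
      by (rule levy_continuity_euclidean[where P="\<lambda>_. \<mu>" and X="\<lambda>_ y. y"])
        (use \<mu> \<nu> idM char f tight in auto)
    then show ?thesis by (simp add: LIMSEQ_const_iff)
  qed
  have closed: "emeasure \<mu> C = emeasure \<nu> C" if C: "closed C" for C
  \<comment> \<open>\<open>infdist y {}\<close> is \<open>0\<close> by convention, so the functions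
    \<open>g k\<close> would be constantly \<open>1\<close> for the empty set.\<close>
  proof (cases "C = {}")
    case False
    define g where "g k y = max 0 (1 - real k * infdist y C)" for k y
    have gc: "continuous_on UNIV (g k)" for k
      unfolding g_def by (intro continuous_intros)
    have gb: "\<bar>g k y\<bar> \<le> 1" for k y
      unfolding g_def by (auto simp: infdist_nonneg)
    have lim: "(\<lambda>k. g k y) \<longlonglongrightarrow> indicator C y" for y
    proof (cases "y \<in> C")
      case True
      then show ?thesis by (simp add: g_def)
    next
      case False
      then have "infdist y C > 0"
        using C \<open>C \<noteq> {}\<close> by (simp add: infdist_pos_not_in_closed)
      then obtain K where K: "1 < real K * infdist y C" using ex_less_of_nat_mult by blast
      have "\<forall>k\<ge>K. g k y = 0"
      proof (intro allI impI)
        fix k assume "K \<le> k"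
        then have "real K * infdist y C \<le> real k * infdist y C"
          by (intro mult_right_mono) (auto simp: infdist_nonneg)
        then show "g k y = 0" using K by (simp add: g_def)
      qed
      then have "\<forall>\<^sub>F k in sequentially. g k y = 0" by (auto simp: eventually_sequentially)
      then show ?thesis using False by (simp add: tendsto_eventually)
    qed
    have conv: "(\<lambda>k. \<integral>y. g k y \<partial>m) \<longlonglongrightarrow> measure m C" if m: "prob_space m" "sets m = sets borel" for m
    proof -
      interpret m: prob_space m by fact
      have [measurable]: "g k \<in> borel_measurable m" for k
        using borel_measurable_continuous_onI[OF gc] m(2) measurable_cong_sets by blast
      have Cm: "C \<in> sets m" using C m(2) by simp
      have "(\<lambda>k. \<integral>y. g k y \<partial>m) \<longlonglongrightarrow> (\<integral>y. indicator C y \<partial>m)"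
        by (rule integral_dominated_convergence[where w="\<lambda>_. 1"])
          (use gb lim Cm in auto)
      then show ?thesis using Cm by simp
    qed
    have "(\<integral>y. g k y \<partial>\<mu>) = (\<integral>y. g k y \<partial>\<nu>)" for k
      by (rule int[OF gc]) (use gb in \<open>auto simp: bounded_iff\<close>)
    then have "measure \<mu> C = measure \<nu> C"
      using conv[OF \<mu>] conv[OF \<nu>] LIMSEQ_unique by simp
    then show ?thesis by (simp add: M.emeasure_eq_measure N.emeasure_eq_measure)
  qed simp
  show ?thesis
  proof (rule measure_eqI_generator_eq[where E="{C. closed C}" and \<Omega>=UNIV and A="\<lambda>_. UNIV"])
    show "Int_stable {C :: 'a set. closed C}" by (auto simp: Int_stable_def)
    show "sets \<mu> = sigma_sets UNIV {C. closed C}" using \<mu>(2) by (simp add: borel_eq_closed)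
    show "sets \<nu> = sigma_sets UNIV {C. closed C}" using \<nu>(2) by (simp add: borel_eq_closed)
  qed (use closed in auto)
qed

section \<open>Traces of powers of unitary matrices\<close>

definition pw :: "complex mat \<Rightarrow> nat \<Rightarrow> nat \<Rightarrow> nat \<Rightarrow> complex" where
  "pw U k a b = (U ^\<^sub>m k) $$ (a, b)"

lemma unitary_carrier: "U \<in> unitary_group n \<Longrightarrow> U \<in> carrier_mat n n"
  by (simp add: unitary_group_def)

lemma mat_adjoint_index:
  assumes "U \<in> carrier_mat n n" "i < n" "j < n"
  shows "mat_adjoint U $$ (i, j) = cnj (U $$ (j, i))"
  using assms by (auto simp: mat_adjoint_def mat_of_rows_def)

lemma mat_adjoint_carrier: "U \<in> carrier_mat n n \<Longrightarrow> mat_adjoint U \<in> carrier_mat n n"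
  by (auto simp: mat_adjoint_def)

lemma mat_mult_index:
  assumes "A \<in> carrier_mat n n" "B \<in> carrier_mat n n" "i < n" "j < n"
  shows "(A * B) $$ (i, j) = (\<Sum>k<n. A $$ (i, k) * B $$ (k, j))"
  using assms by (auto simp: scalar_prod_def atLeast0LessThan intro!: sum.cong)

lemma unitary_group_iff:
  "U \<in> unitary_group n \<longleftrightarrow> U \<in> carrier_mat n n \<and>
     (\<forall>i<n. \<forall>j<n. (\<Sum>k<n. cnj (U $$ (k, i)) * U $$ (k, j)) = of_bool (i = j))"
proof (cases "U \<in> carrier_mat n n")
  case True
  have c: "mat_adjoint U * U \<in> carrier_mat n n" using True mat_adjoint_carrier[OF True] by simp
  have "(mat_adjoint U * U = 1\<^sub>m n) \<longleftrightarrow>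
     (\<forall>i<n. \<forall>j<n. (mat_adjoint U * U) $$ (i, j) = of_bool (i = j))"
    using c by (auto simp: mat_eq_iff)
  also have "\<dots> \<longleftrightarrow> (\<forall>i<n. \<forall>j<n. (\<Sum>k<n. cnj (U $$ (k, i)) * U $$ (k, j)) = of_bool (i = j))"
    by (simp add: mat_mult_index[OF mat_adjoint_carrier[OF True] True] mat_adjoint_index[OF True])
  finally show ?thesis using True by (simp add: unitary_group_def)
qed (simp add: unitary_group_def)

lemma unitary_columns:
  assumes "U \<in> unitary_group n" "i < n" "j < n"
  shows "(\<Sum>k<n. cnj (U $$ (k, i)) * U $$ (k, j)) = of_bool (i = j)"
  using assms by (simp add: unitary_group_iff)

lemma unitary_rows:
  assumes U: "U \<in> unitary_group n" and ij: "i < n" "j < n"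
  shows "(\<Sum>k<n. U $$ (i, k) * cnj (U $$ (j, k))) = of_bool (i = j)"
proof -
  have c: "U \<in> carrier_mat n n" using U by (rule unitary_carrier)
  have "mat_adjoint U * U = 1\<^sub>m n" using U by (simp add: unitary_group_def)
  then have "U * mat_adjoint U = 1\<^sub>m n"
    by (rule mat_mult_left_right_inverse[OF mat_adjoint_carrier[OF c] c])
  then have "(U * mat_adjoint U) $$ (i, j) = of_bool (i = j)" using ij by simp
  then show ?thesis
    using ij by (simp add: mat_mult_index[OF c mat_adjoint_carrier[OF c]] mat_adjoint_index[OF c])
qed

lemma unitary_norm_preserving:
  assumes U: "U \<in> unitary_group n"
  shows "(\<Sum>a<n. (norm (\<Sum>b<n. U $$ (a, b) * x b))\<^sup>2) = (\<Sum>b<n. (norm (x b))\<^sup>2)"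
proof -
  have "complex_of_real (\<Sum>a<n. (norm (\<Sum>b<n. U $$ (a, b) * x b))\<^sup>2)
      = (\<Sum>a<n. (\<Sum>c<n. U $$ (a, c) * x c) * cnj (\<Sum>b<n. U $$ (a, b) * x b))"
    by (simp only: of_real_sum complex_norm_square)
  also have "\<dots> = (\<Sum>a<n. \<Sum>c<n. \<Sum>b<n. x c * cnj (x b) * (cnj (U $$ (a, b)) * U $$ (a, c)))"
    by (simp add: cnj_sum sum_product algebra_simps)
  also have "\<dots> = (\<Sum>c<n. \<Sum>a<n. \<Sum>b<n. x c * cnj (x b) * (cnj (U $$ (a, b)) * U $$ (a, c)))"
    by (rule sum.swap)
  also have "\<dots> = (\<Sum>c<n. \<Sum>b<n. \<Sum>a<n. x c * cnj (x b) * (cnj (U $$ (a, b)) * U $$ (a, c)))"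
    by (intro sum.cong refl sum.swap)
  also have "\<dots> = (\<Sum>c<n. \<Sum>b<n. x c * cnj (x b) * of_bool (b = c))"
    by (intro sum.cong refl) (simp add: unitary_columns[OF U] flip: sum_distrib_left)
  also have "\<dots> = (\<Sum>c<n. x c * cnj (x c))"
  proof (intro sum.cong refl)
    fix c assume "c \<in> {..<n}"
    then have "(\<Sum>b<n. x c * cnj (x b) * of_bool (b = c)) = (\<Sum>b<n. if b = c then x c * cnj (x b) else 0)"
      by (intro sum.cong) auto
    then show "(\<Sum>b<n. x c * cnj (x b) * of_bool (b = c)) = x c * cnj (x c)"
      using \<open>c \<in> {..<n}\<close> by simp
  qed
  also have "\<dots> = complex_of_real (\<Sum>b<n. (norm (x b))\<^sup>2)"
    by (simp only: of_real_sum complex_norm_square)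
  finally show ?thesis by (simp only: of_real_eq_iff)
qed

lemma unitary_entry_le_1:
  assumes U: "U \<in> unitary_group n" and "i < n" "j < n"
  shows "norm (U $$ (i, j)) \<le> 1"
proof -
  have "complex_of_real (\<Sum>k<n. (norm (U $$ (k, j)))\<^sup>2) = (\<Sum>k<n. cnj (U $$ (k, j)) * U $$ (k, j))"
    by (simp only: of_real_sum complex_norm_square mult.commute)
  also have "\<dots> = 1" using unitary_columns[OF U \<open>j < n\<close> \<open>j < n\<close>] by simp
  finally have "(\<Sum>k<n. (norm (U $$ (k, j)))\<^sup>2) = 1" by (simp only: of_real_eq_1_iff)
  moreover have "(norm (U $$ (i, j)))\<^sup>2 \<le> (\<Sum>k<n. (norm (U $$ (k, j)))\<^sup>2)"
    using \<open>i < n\<close> by (intro member_le_sum) auto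
  ultimately have "(norm (U $$ (i, j)))\<^sup>2 \<le> 1\<^sup>2" by simp
  then show ?thesis by (rule power2_le_imp_le) simp
qed

lemma unitary_mult:
  assumes V: "V \<in> unitary_group n" and U: "U \<in> unitary_group n"
  shows "V * U \<in> unitary_group n"
proof -
  note c = unitary_carrier[OF V] unitary_carrier[OF U]
  have "(\<Sum>k<n. cnj ((V * U) $$ (k, i)) * (V * U) $$ (k, j)) = of_bool (i = j)" if ij: "i < n" "j < n" for i j
  proof -
    have "(\<Sum>k<n. cnj ((V * U) $$ (k, i)) * (V * U) $$ (k, j))
       = (\<Sum>k<n. \<Sum>a<n. \<Sum>b<n. cnj (U $$ (a, i)) * U $$ (b, j) * (cnj (V $$ (k, a)) * V $$ (k, b)))"
      using ij
      by (simp add: mat_mult_index[OF c] cnj_sum del: index_mult_mat) (simp only: sum_product, simp only: mult_ac)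
    also have "\<dots> = (\<Sum>a<n. \<Sum>k<n. \<Sum>b<n. cnj (U $$ (a, i)) * U $$ (b, j) * (cnj (V $$ (k, a)) * V $$ (k, b)))"
      by (rule sum.swap)
    also have "\<dots> = (\<Sum>a<n. \<Sum>b<n. \<Sum>k<n. cnj (U $$ (a, i)) * U $$ (b, j) * (cnj (V $$ (k, a)) * V $$ (k, b)))"
      by (intro sum.cong refl sum.swap)
    also have "\<dots> = (\<Sum>a<n. \<Sum>b<n. cnj (U $$ (a, i)) * U $$ (b, j) * of_bool (a = b))"
      by (intro sum.cong refl) (simp add: unitary_columns[OF V] flip: sum_distrib_left)
    also have "\<dots> = (\<Sum>a<n. \<Sum>b<n. if a = b then cnj (U $$ (a, i)) * U $$ (b, j) else 0)"
      by (intro sum.cong refl) auto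
    also have "\<dots> = (\<Sum>a<n. cnj (U $$ (a, i)) * U $$ (a, j))"
      by (intro sum.cong refl) simp
    also have "\<dots> = of_bool (i = j)" using unitary_columns[OF U] ij by simp
    finally show ?thesis .
  qed
  then show ?thesis using c by (auto simp: unitary_group_iff)
qed

lemma unitary_one: "1\<^sub>m n \<in> unitary_group n"
  unfolding unitary_group_iff
proof (intro conjI allI impI)
  fix i j assume ij: "i < n" "j < n"
  have "(\<Sum>k<n. cnj (1\<^sub>m n $$ (k, i)) * 1\<^sub>m n $$ (k, j)) = (\<Sum>k<n. if k = i then of_bool (i = j) else 0 :: complex)"
    using ij by (intro sum.cong) auto
  then show "(\<Sum>k<n. cnj (1\<^sub>m n $$ (k, i)) * 1\<^sub>m n $$ (k, j)) = (of_bool (i = j) :: complex)"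
    using ij by simp
qed simp

lemma unitary_pow: "U \<in> unitary_group n \<Longrightarrow> U ^\<^sub>m k \<in> unitary_group n"
  by (induction k) (auto simp: unitary_one unitary_mult dest: unitary_carrier)

lemma pw_0: "U \<in> carrier_mat n n \<Longrightarrow> a < n \<Longrightarrow> b < n \<Longrightarrow> pw U 0 a b = of_bool (a = b)"
  by (simp add: pw_def)

lemma pw_Suc:
  "U \<in> carrier_mat n n \<Longrightarrow> a < n \<Longrightarrow> b < n \<Longrightarrow> pw U (Suc k) a b = (\<Sum>c<n. pw U k a c * U $$ (c, b))"
  by (simp add: pw_def mat_mult_index[of _ n] del: index_mult_mat)

lemma pw_1: "U \<in> carrier_mat n n \<Longrightarrow> pw U (Suc 0) a b = U $$ (a, b)"
  by (simp add: pw_def)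

lemma pw_add:
  assumes U: "U \<in> carrier_mat n n" and "a < n" "b < n"
  shows "pw U (j + k) a b = (\<Sum>c<n. pw U j a c * pw U k c b)"
  using \<open>b < n\<close>
proof (induction k arbitrary: b)
  case 0
  have "(\<Sum>c<n. pw U j a c * pw U 0 c b) = (\<Sum>c<n. if c = b then pw U j a c else 0)"
    by (intro sum.cong) (auto simp: pw_0[OF U] 0)
  then show ?case using 0 by simp
next
  case (Suc k)
  have "pw U (j + Suc k) a b = (\<Sum>d<n. (\<Sum>c<n. pw U j a c * pw U k c d) * U $$ (d, b))"
    using Suc by (simp add: pw_Suc[OF U \<open>a < n\<close>])
  also have "\<dots> = (\<Sum>d<n. \<Sum>c<n. pw U j a c * pw U k c d * U $$ (d, b))"
    by (simp add: sum_distrib_right)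
  also have "\<dots> = (\<Sum>c<n. \<Sum>d<n. pw U j a c * pw U k c d * U $$ (d, b))"
    by (rule sum.swap)
  also have "\<dots> = (\<Sum>c<n. pw U j a c * pw U (Suc k) c b)"
    using Suc by (simp add: pw_Suc[OF U] sum_distrib_left mult.assoc)
  finally show ?case .
qed

lemma pw_le_1: "U \<in> unitary_group n \<Longrightarrow> a < n \<Longrightarrow> b < n \<Longrightarrow> norm (pw U k a b) \<le> 1"
  unfolding pw_def using unitary_entry_le_1[OF unitary_pow] .

lemma pw_orthogonality:
  assumes U: "U \<in> unitary_group n" and "a < n" "b < n"
  shows "(\<Sum>c<n. pw U q a c * cnj (pw U q b c)) = of_bool (a = b)"
  unfolding pw_def by (rule unitary_rows[OF unitary_pow[OF U] assms(2,3)])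

text \<open>For unitary \<open>U\<close> the inverse is the adjoint, so a negative exponent is
  encoded by conjugating the transposed entry of the positive power. Conjugated traces become traces
  with negative exponent, and a mixed moment is indexed by one multiset of integers.\<close>

definition ipw :: "complex mat \<Rightarrow> int \<Rightarrow> nat \<Rightarrow> nat \<Rightarrow> complex" where
  "ipw U m a b = (if m \<ge> 0 then pw U (nat m) a b else cnj (pw U (nat (- m)) b a))"

definition ptr :: "complex mat \<Rightarrow> int \<Rightarrow> complex" where
  "ptr U m = (\<Sum>a<dim_row U. ipw U m a a)"

lemma ptr_eq: "U \<in> carrier_mat n n \<Longrightarrow> ptr U m = (\<Sum>a<n. ipw U m a a)"
  by (simp add: ptr_def)

lemma ptr_nat: "U \<in> carrier_mat n n \<Longrightarrow> ptr U (int k) = (\<Sum>a<n. pw U k a a)"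
  by (simp add: ptr_def ipw_def)

lemma ptr_uminus: "ptr U (- m) = cnj (ptr U m)"
  by (cases "m > 0"; cases "m = 0") (auto simp: ptr_def ipw_def cnj_sum pw_def intro!: sum.cong)

lemma ptr_trace: "U \<in> carrier_mat n n \<Longrightarrow> mat_trace (U ^\<^sub>m k) = ptr U (int k)"
  by (simp add: ptr_nat mat_trace_def pw_def)

lemma ptr_0: "U \<in> carrier_mat n n \<Longrightarrow> ptr U 0 = of_nat n"
  by (simp add: ptr_def ipw_def pw_def)

lemma norm_ptr_le:
  assumes "U \<in> unitary_group n"
  shows "norm (ptr U m) \<le> real n"
proof -
  have "norm (ptr U m) \<le> (\<Sum>a<n. norm (ipw U m a a))"
    unfolding ptr_eq[OF unitary_carrier[OF assms]] by (rule norm_sum)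
  also have "\<dots> \<le> (\<Sum>a<n. 1)"
    by (intro sum_mono) (auto simp: ipw_def pw_le_1[OF assms])
  finally show ?thesis by simp
qed

text \<open>Integer powers of a unitary matrix multiply by adding exponents. The cases differ in
  which factor is long enough to be split; row orthogonality of the common power then removes the
  rest.\<close>

lemma trace_pw_ipw:
  assumes U: "U \<in> unitary_group n"
  shows "(\<Sum>a<n. \<Sum>b<n. pw U k a b * ipw U m b a) = ptr U (int k + m)"
proof -
  note c = unitary_carrier[OF U]
  consider "m \<ge> 0" | "m < 0" "int k + m \<ge> 0" | "m < 0" "int k + m < 0" by linarith
  then show ?thesis
  proof cases
    case 1
    then have "nat (int k + m) = k + nat m" by simp
    then show ?thesis using 1 by (simp add: ptr_eq[OF c] ipw_def pw_add[OF c])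
  next
    case 2
    define q where "q = nat (- m)"
    define r where "r = nat (int k + m)"
    have k: "k = r + q" using 2 by (simp add: q_def r_def)
    have "(\<Sum>a<n. \<Sum>b<n. pw U k a b * ipw U m b a)
        = (\<Sum>a<n. \<Sum>b<n. \<Sum>c<n. pw U r a c * (pw U q c b * cnj (pw U q a b)))"
      using 2 by (simp add: ipw_def pw_add[OF c] k q_def[symmetric] sum_distrib_right mult.assoc)
    also have "\<dots> = (\<Sum>a<n. \<Sum>c<n. \<Sum>b<n. pw U r a c * (pw U q c b * cnj (pw U q a b)))"
      by (intro sum.cong refl sum.swap)
    also have "\<dots> = (\<Sum>a<n. \<Sum>c<n. pw U r a c * of_bool (c = a))"
      by (intro sum.cong refl) (simp add: pw_orthogonality[OF U] flip: sum_distrib_left)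
    also have "\<dots> = (\<Sum>a<n. \<Sum>c<n. if c = a then pw U r a c else 0)"
      by (intro sum.cong refl) auto
    also have "\<dots> = ptr U (int k + m)" using 2 by (simp add: ptr_eq[OF c] ipw_def r_def)
    finally show ?thesis .
  next
    case 3
    define q where "q = nat (- (int k + m))"
    have q: "nat (- m) = q + k" using 3 by (simp add: q_def)
    have "(\<Sum>a<n. \<Sum>b<n. pw U k a b * ipw U m b a)
        = (\<Sum>a<n. \<Sum>b<n. \<Sum>c<n. cnj (pw U q a c) * (pw U k a b * cnj (pw U k c b)))"
      using 3 by (simp add: ipw_def pw_add[OF c] q sum_distrib_left cnj_sum mult_ac)
    also have "\<dots> = (\<Sum>a<n. \<Sum>c<n. \<Sum>b<n. cnj (pw U q a c) * (pw U k a b * cnj (pw U k c b)))"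
      by (intro sum.cong refl sum.swap)
    also have "\<dots> = (\<Sum>a<n. \<Sum>c<n. cnj (pw U q a c) * of_bool (a = c))"
      by (intro sum.cong refl) (simp add: pw_orthogonality[OF U] flip: sum_distrib_left)
    also have "\<dots> = (\<Sum>a<n. \<Sum>c<n. if a = c then cnj (pw U q a c) else 0)"
      by (intro sum.cong refl) auto
    also have "\<dots> = ptr U (int k + m)" using 3 by (simp add: ptr_eq[OF c] ipw_def q_def)
    finally show ?thesis .
  qed
qed

text \<open>This is \<open>1 + (z - 1) v v^H\<close>: for a unit vector \<open>v\<close> it
  multiplies \<open>v\<close> by \<open>z\<close> and fixes the orthogonal complement. With
  \<open>z = cis t\<close> it runs through the one-parameter group generated by
  \<open>\<i> v v^H\<close>; for a basis vector \<open>v\<close>, multiplication by it scales one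
  row.\<close>

definition refl_mat :: "nat \<Rightarrow> (nat \<Rightarrow> complex) \<Rightarrow> complex \<Rightarrow> complex mat" where
  "refl_mat n v z = mat n n (\<lambda>(a, b). of_bool (a = b) + (z - 1) * v a * cnj (v b))"

lemma refl_mat_carrier: "refl_mat n v z \<in> carrier_mat n n"
  by (simp add: refl_mat_def)

lemma refl_mat_mult_index:
  assumes "U \<in> carrier_mat n n" "a < n" "b < n"
  shows "(refl_mat n v z * U) $$ (a, b) = U $$ (a, b) + (z - 1) * v a * (\<Sum>d<n. cnj (v d) * U $$ (d, b))"
proof -
  have "(refl_mat n v z * U) $$ (a, b)
      = (\<Sum>k<n. (if a = k then U $$ (k, b) else 0) + (z - 1) * v a * (cnj (v k) * U $$ (k, b)))"
    unfolding mat_mult_index[OF refl_mat_carrier assms]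
    using assms by (intro sum.cong refl) (auto simp: refl_mat_def algebra_simps)
  then show ?thesis using assms by (simp add: sum.distrib sum_distrib_left)
qed

lemma refl_mat_unitary:
  assumes v: "(\<Sum>a<n. (norm (v a))\<^sup>2) = 1" and z: "norm z = 1"
  shows "refl_mat n v z \<in> unitary_group n"
  unfolding unitary_group_iff
proof (intro conjI allI impI refl_mat_carrier)
  fix i j assume ij: "i < n" "j < n"
  have "(\<Sum>k<n. v k * cnj (v k)) = complex_of_real (\<Sum>k<n. (norm (v k))\<^sup>2)"
    by (simp only: of_real_sum complex_norm_square)
  then have vv: "(\<Sum>k<n. v k * cnj (v k)) = 1" by (simp only: v of_real_1)
  have "z * cnj z = complex_of_real ((norm z)\<^sup>2)" by (simp only: complex_norm_square)
  then have zz: "z * cnj z = 1" by (simp only: z power_one of_real_1)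
  have d: "(\<Sum>k<n. (if k = i then f k else 0)) = f i" if "i < n" for i and f :: "nat \<Rightarrow> complex"
    using that by simp
  have "(\<Sum>k<n. cnj (refl_mat n v z $$ (k, i)) * refl_mat n v z $$ (k, j))
     = (\<Sum>k<n. (if k = i then of_bool (i = j) else 0) + (if k = i then (z - 1) * v k * cnj (v j) else 0)
          + (if k = j then cnj (z - 1) * cnj (v k) * v i else 0)
          + (z - 1) * cnj (z - 1) * (v i * cnj (v j)) * (v k * cnj (v k)))"
  proof (intro sum.cong refl)
    fix k assume "k \<in> {..<n}"
    then have e: "refl_mat n v z $$ (k, i) = of_bool (k = i) + (z - 1) * v k * cnj (v i)"
      "refl_mat n v z $$ (k, j) = of_bool (k = j) + (z - 1) * v k * cnj (v j)"
      using ij by (auto simp: refl_mat_def)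
    have "(o1 + cnj (w * x * cnj y)) * (o2 + w * x * cnj t)
      = o1 * o2 + o1 * (w * x * cnj t) + o2 * (cnj w * cnj x * y) + w * cnj w * (y * cnj t) * (x * cnj x)"
      for o1 o2 w x y t :: complex
      by (simp add: distrib_left distrib_right mult_ac)
    note this[of "of_bool (k = i)" "z - 1" "v k" "v i" "of_bool (k = j)" "v j"]
    then show "cnj (refl_mat n v z $$ (k, i)) * refl_mat n v z $$ (k, j)
      = (if k = i then of_bool (i = j) else 0) + (if k = i then (z - 1) * v k * cnj (v j) else 0)
          + (if k = j then cnj (z - 1) * cnj (v k) * v i else 0)
          + (z - 1) * cnj (z - 1) * (v i * cnj (v j)) * (v k * cnj (v k))"
      unfolding e by (cases "k = i"; cases "k = j"; cases "i = j") simp_all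
  qed
  also have "\<dots> = of_bool (i = j) + (z - 1) * v i * cnj (v j) + cnj (z - 1) * cnj (v j) * v i
       + (z - 1) * cnj (z - 1) * (v i * cnj (v j)) * (\<Sum>k<n. v k * cnj (v k))"
    unfolding sum.distrib d[OF ij(1)] d[OF ij(2)] sum_distrib_left ..
  \<comment> \<open>The corrections combine by \<open>(z - 1) + cnj (z - 1) + (z - 1) * cnj (z - 1)
    = z * cnj z - 1\<close>.\<close>
  also have "\<dots> = of_bool (i = j) + (z * cnj z - 1) * (v i * cnj (v j))"
    unfolding vv by (simp add: algebra_simps)
  finally show "(\<Sum>k<n. cnj (refl_mat n v z $$ (k, i)) * refl_mat n v z $$ (k, j)) = of_bool (i = j)"
    by (simp only: zz) simp
qed

text \<open>Polarisation with unit vectors. Basis vectors kill the diagonal; the vectors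
  \<open>(e_c + w e_d) / sqrt 2\<close> with \<open>w = 1\<close> and \<open>w = \<i>\<close> then
  give the sum and the difference of \<open>y c d\<close> and \<open>y d c\<close>.\<close>

lemma quadratic_form_eq_0:
  fixes y :: "nat \<Rightarrow> nat \<Rightarrow> complex"
  assumes y: "\<And>v. (\<Sum>a<n. (norm (v a))\<^sup>2) = 1 \<Longrightarrow> (\<Sum>c<n. \<Sum>d<n. v c * cnj (v d) * y c d) = 0"
    and cd: "c < n" "d < n"
  shows "y c d = 0"
proof -
  have diag: "y a a = 0" if a: "a < n" for a
  proof -
    let ?v = "\<lambda>k. if k = a then 1 else 0 :: complex"
    have "(\<Sum>k<n. (norm (?v k))\<^sup>2) = (\<Sum>k<n. if k = a then 1 else 0)" by (intro sum.cong) auto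
    then have "(\<Sum>c<n. \<Sum>d<n. ?v c * cnj (?v d) * y c d) = 0" using a by (intro y) simp
    moreover have "(\<Sum>c<n. \<Sum>d<n. ?v c * cnj (?v d) * y c d) = (\<Sum>c<n. if c = a then y a a else 0)"
    proof (intro sum.cong refl)
      fix c
      have "(\<Sum>d<n. ?v c * cnj (?v d) * y c d) = (\<Sum>d<n. if d = a then ?v c * y c a else 0)"
        by (intro sum.cong) auto
      then show "(\<Sum>d<n. ?v c * cnj (?v d) * y c d) = (if c = a then y a a else 0)" using a by simp
    qed
    ultimately show ?thesis using a by simp
  qed
  show ?thesis
  proof (cases "c = d")
    case False
    have *: "cnj w * y c d + w * y d c = 0" if w: "norm w = 1" for w
    proof -
      let ?v = "\<lambda>k. complex_of_real (1 / sqrt 2) * ((if k = c then 1 else 0) + (if k = d then w else 0))"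
      have "(\<Sum>k<n. (norm (?v k))\<^sup>2) = (\<Sum>k<n. (if k = c then 1/2 else 0) + (if k = d then 1/2 else 0))"
        using False w by (intro sum.cong) (auto simp: norm_divide power_divide)
      also have "\<dots> = 1" using cd by (simp add: sum.distrib)
      finally have 0: "(\<Sum>a<n. \<Sum>b<n. ?v a * cnj (?v b) * y a b) = 0" by (rule y)
      have vv: "(\<Sum>k<n. ?v k * f k) = complex_of_real (1 / sqrt 2) * (f c + w * f d)" for f
      proof -
        have "(\<Sum>k<n. ?v k * f k) = complex_of_real (1 / sqrt 2) *
            (\<Sum>k<n. (if k = c then f k else 0) + (if k = d then w * f k else 0))"
          unfolding sum_distrib_left by (intro sum.cong) (auto simp: algebra_simps)
        then show ?thesis using cd by (simp add: sum.distrib)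
      qed
      have vc: "(\<Sum>k<n. cnj (?v k) * f k) = complex_of_real (1 / sqrt 2) * (f c + cnj w * f d)" for f
      proof -
        have "(\<Sum>k<n. cnj (?v k) * f k) = complex_of_real (1 / sqrt 2) *
            (\<Sum>k<n. (if k = c then f k else 0) + (if k = d then cnj w * f k else 0))"
          unfolding sum_distrib_left by (intro sum.cong) (auto simp: algebra_simps)
        then show ?thesis using cd by (simp add: sum.distrib)
      qed
      have "(\<Sum>a<n. \<Sum>b<n. ?v a * cnj (?v b) * y a b) = (\<Sum>a<n. ?v a * (\<Sum>b<n. cnj (?v b) * y a b))"
        by (simp only: sum_distrib_left mult.assoc)
      also have "\<dots> = complex_of_real (1 / sqrt 2) * complex_of_real (1 / sqrt 2)
          * (y c c + cnj w * y c d + w * (y d c + cnj w * y d d))"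
        unfolding vv vc by (simp add: algebra_simps)
      also have "\<dots> = complex_of_real (1 / sqrt 2) * complex_of_real (1 / sqrt 2)
          * (cnj w * y c d + w * y d c)"
        using diag cd by (simp add: algebra_simps)
      finally show ?thesis using 0 by simp
    qed
    have "y c d + y d c = 0" using *[of 1] by simp
    moreover have "\<i> * (y d c - y c d) = 0" using *[of \<i>] by (simp add: algebra_simps)
    ultimately show ?thesis by (simp add: algebra_simps)
  qed (use diag cd in simp)
qed

section \<open>Haar measure and the loop equations\<close>

lemma norm_cis_minus_1_le: "norm (cis t - 1) \<le> \<bar>t\<bar>"
  using iexp_approx1[of t 0] by (simp add: cis_conv_exp)

lemma has_vector_derivative_cis: "(cis has_vector_derivative (\<i> * cis x)) (at x)"
  using has_derivative_cis[OF has_derivative_ident, of x UNIV] by (simp add: has_vector_derivative_def)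

lemma borel_measurable_cnj:
  "f \<in> borel_measurable M \<Longrightarrow> (\<lambda>x. cnj (f x)) \<in> borel_measurable M"
  by (rule measurable_compose[OF _ borel_measurable_continuous_onI[OF continuous_on_cnj[OF continuous_on_id]]])

locale haar_unitary =
  fixes n :: nat and \<mu> :: "complex mat measure"
  assumes haar: "haar_prob n \<mu>"
begin

sublocale prob_space \<mu>
  using haar by (simp add: haar_prob_def)

lemma sets_eq: "sets \<mu> = sets (unitary_borel n)"
  using haar by (simp add: haar_prob_def)

lemma generators_Pow:
  "{{A \<in> unitary_group n. A $$ (i, j) \<in> B} | i j B. i < n \<and> j < n \<and> B \<in> sets borel} \<subseteq> Pow (unitary_group n)"
  by auto

lemma space_eq: "space \<mu> = unitary_group n"
  using sets_eq_imp_space_eq[OF sets_eq] generators_Pow by (simp add: unitary_borel_def space_measure_of)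

lemma entry_measurable: "i < n \<Longrightarrow> j < n \<Longrightarrow> (\<lambda>W. W $$ (i, j)) \<in> borel_measurable \<mu>"
proof (rule measurableI)
  fix B :: "complex set" assume "i < n" "j < n" "B \<in> sets borel"
  then have "{A \<in> unitary_group n. A $$ (i, j) \<in> B}
      \<in> sigma_sets (unitary_group n) {{A \<in> unitary_group n. A $$ (i, j) \<in> B} | i j B. i < n \<and> j < n \<and> B \<in> sets borel}"
    by (intro sigma_sets.Basic) blast
  then have "{A \<in> unitary_group n. A $$ (i, j) \<in> B} \<in> sets \<mu>"
    unfolding sets_eq unitary_borel_def sets_measure_of[OF generators_Pow] .
  then show "(\<lambda>W. W $$ (i, j)) -` B \<inter> space \<mu> \<in> sets \<mu>"
    by (simp add: space_eq vimage_def Int_def conj_commute)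
qed simp

lemma measurable_into:
  assumes "\<And>W. W \<in> unitary_group n \<Longrightarrow> F W \<in> unitary_group n"
    and "\<And>i j. i < n \<Longrightarrow> j < n \<Longrightarrow> (\<lambda>W. F W $$ (i, j)) \<in> borel_measurable \<mu>"
  shows "F \<in> measurable \<mu> \<mu>"
proof (rule measurable_sigma_sets)
  show "sets \<mu> = sigma_sets (unitary_group n)
      {{A \<in> unitary_group n. A $$ (i, j) \<in> B} | i j B. i < n \<and> j < n \<and> B \<in> sets borel}"
    unfolding sets_eq unitary_borel_def by (rule sets_measure_of[OF generators_Pow])
  show "F \<in> space \<mu> \<rightarrow> unitary_group n" using assms(1) by (simp add: space_eq)
  fix Y assume "Y \<in> {{A \<in> unitary_group n. A $$ (i, j) \<in> B} | i j B. i < n \<and> j < n \<and> B \<in> sets borel}"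
  then obtain i j B where ij: "i < n" "j < n" "B \<in> sets borel" and Y: "Y = {A \<in> unitary_group n. A $$ (i, j) \<in> B}"
    by blast
  have "F -` Y \<inter> space \<mu> = (\<lambda>W. F W $$ (i, j)) -` B \<inter> space \<mu>"
    using assms(1) by (auto simp: Y space_eq)
  then show "F -` Y \<inter> space \<mu> \<in> sets \<mu>"
    using measurable_sets[OF assms(2)[OF ij(1,2)] ij(3)] by simp
qed (rule generators_Pow)

lemma mult_measurable:
  assumes V: "V \<in> unitary_group n"
  shows "(\<lambda>W. V * W) \<in> measurable \<mu> \<mu>"
proof (rule measurable_into)
  fix i j assume ij: "i < n" "j < n"
  have "(\<lambda>W. \<Sum>k<n. V $$ (i, k) * W $$ (k, j)) \<in> borel_measurable \<mu>"
    using entry_measurable ij by measurable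
  moreover have "(V * W) $$ (i, j) = (\<Sum>k<n. V $$ (i, k) * W $$ (k, j))" if "W \<in> space \<mu>" for W
    using that ij V by (intro mat_mult_index) (auto simp: space_eq dest: unitary_carrier)
  ultimately show "(\<lambda>W. (V * W) $$ (i, j)) \<in> borel_measurable \<mu>"
    by (subst measurable_cong[where g="\<lambda>W. \<Sum>k<n. V $$ (i, k) * W $$ (k, j)"]) auto
qed (use unitary_mult[OF V] in simp)

lemma integral_invariant:
  fixes f :: "complex mat \<Rightarrow> 'b::{banach, second_countable_topology}"
  assumes V: "V \<in> unitary_group n" and f: "f \<in> borel_measurable \<mu>"
  shows "(\<integral>W. f (V * W) \<partial>\<mu>) = (\<integral>W. f W \<partial>\<mu>)"
proof -
  have "(\<integral>W. f W \<partial>\<mu>) = (\<integral>W. f W \<partial>distr \<mu> \<mu> (\<lambda>W. V * W))"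
    using haar V by (simp add: haar_prob_def)
  then show ?thesis by (simp add: integral_distr[OF mult_measurable[OF V] f])
qed

text \<open>Bounded measurable functions form an algebra with conjugation, which settles all
  integrability conditions at once; the bound is asked on the unitary group, which is the whole
  space of the measure.\<close>

definition bm :: "(complex mat \<Rightarrow> complex) \<Rightarrow> bool" where
  "bm f \<longleftrightarrow> f \<in> borel_measurable \<mu> \<and> (\<exists>C. \<forall>W\<in>unitary_group n. norm (f W) \<le> C)"

lemma bm_measurable: "bm f \<Longrightarrow> f \<in> borel_measurable \<mu>"
  by (simp add: bm_def)

lemma bm_integrable: "bm f \<Longrightarrow> integrable \<mu> f"
  unfolding bm_def using integrable_const_bound AE_I2[of \<mu>] space_eq by metis

lemma bm_const: "bm (\<lambda>_. c)"
  by (auto simp: bm_def)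

lemma bm_add: "bm f \<Longrightarrow> bm g \<Longrightarrow> bm (\<lambda>W. f W + g W)"
  unfolding bm_def by (auto intro!: exI order_trans[OF norm_triangle_ineq] add_mono)

lemma bm_mult: "bm f \<Longrightarrow> bm g \<Longrightarrow> bm (\<lambda>W. f W * g W)"
proof -
  assume "bm f" "bm g"
  then obtain C D where C: "\<And>W. W \<in> unitary_group n \<Longrightarrow> norm (f W) \<le> C"
    and D: "\<And>W. W \<in> unitary_group n \<Longrightarrow> norm (g W) \<le> D"
    and [measurable]: "f \<in> borel_measurable \<mu>" "g \<in> borel_measurable \<mu>" by (auto simp: bm_def)
  have "norm (f W * g W) \<le> \<bar>C\<bar> * \<bar>D\<bar>" if "W \<in> unitary_group n" for W
    unfolding norm_mult using C[OF that] D[OF that] by (intro mult_mono) auto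
  then show ?thesis unfolding bm_def by (auto intro!: exI[of _ "\<bar>C\<bar> * \<bar>D\<bar>"])
qed

lemma bm_cnj: "bm f \<Longrightarrow> bm (\<lambda>W. cnj (f W))"
  unfolding bm_def
  using borel_measurable_cnj by auto

lemma bm_sum: "finite I \<Longrightarrow> (\<And>i. i \<in> I \<Longrightarrow> bm (f i)) \<Longrightarrow> bm (\<lambda>W. \<Sum>i\<in>I. f i W)"
  by (induction rule: finite_induct) (auto intro: bm_const bm_add)

lemma bm_power: "bm f \<Longrightarrow> bm (\<lambda>W. f W ^ k)"
  by (induction k) (auto intro: bm_const bm_mult)

lemma bm_cong: "(\<And>W. W \<in> unitary_group n \<Longrightarrow> f W = g W) \<Longrightarrow> bm f \<longleftrightarrow> bm g"
  unfolding bm_def by (metis (no_types, lifting) measurable_cong space_eq)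

lemma bm_entry: "i < n \<Longrightarrow> j < n \<Longrightarrow> bm (\<lambda>W. W $$ (i, j))"
  unfolding bm_def using entry_measurable unitary_entry_le_1 by blast

lemma bm_pw: "a < n \<Longrightarrow> b < n \<Longrightarrow> bm (\<lambda>W. pw W k a b)"
proof (induction k arbitrary: b)
  case 0
  have "bm (\<lambda>W. of_bool (a = b))" by (rule bm_const)
  then show ?case by (subst bm_cong[where g="\<lambda>W. of_bool (a = b)"]) (auto simp: pw_0[of _ n] 0 dest: unitary_carrier)
next
  case (Suc k)
  have "bm (\<lambda>W. \<Sum>c<n. pw W k a c * W $$ (c, b))"
    using Suc by (intro bm_sum bm_mult bm_entry) auto
  then show ?case
    by (subst bm_cong[where g="\<lambda>W. \<Sum>c<n. pw W k a c * W $$ (c, b)"]) (auto simp: pw_Suc[of _ n] Suc dest: unitary_carrier)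
qed

lemma bm_ipw: "a < n \<Longrightarrow> b < n \<Longrightarrow> bm (\<lambda>W. ipw W m a b)"
  using bm_pw[of a b "nat m"] bm_cnj[OF bm_pw[of b a "nat (- m)"]] by (cases "m \<ge> 0") (simp_all add: ipw_def)

lemma bm_ptr: "bm (\<lambda>W. ptr W m)"
proof -
  have "bm (\<lambda>W. \<Sum>a<n. ipw W m a a)" by (intro bm_sum bm_ipw) auto
  then show ?thesis
    by (subst bm_cong[where g="\<lambda>W. \<Sum>a<n. ipw W m a a"]) (auto simp: ptr_eq[of _ n] dest: unitary_carrier)
qed

section \<open>Derivatives along one-parameter groups of unitary matrices\<close>

definition flow :: "(nat \<Rightarrow> complex) \<Rightarrow> real \<Rightarrow> complex mat \<Rightarrow> complex mat" where
  "flow v t W = refl_mat n v (cis t) * W"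

text \<open>\<open>g\<close> is the derivative of \<open>f\<close> along the flow, taken at time
  \<open>0\<close> from every starting matrix. The Lipschitz bound, uniform in the matrix, is
  carried along because it will dominate the difference quotients; it is inherited by sums and
  products.\<close>

definition nice :: "(nat \<Rightarrow> complex) \<Rightarrow> (complex mat \<Rightarrow> complex) \<Rightarrow> (complex mat \<Rightarrow> complex) \<Rightarrow> bool" where
  "nice v f g \<longleftrightarrow> f \<in> borel_measurable \<mu> \<and>
     (\<exists>C\<ge>0. \<forall>W\<in>unitary_group n. \<forall>t. norm (f W) \<le> C \<and> norm (f (flow v t W) - f W) \<le> C * \<bar>t\<bar>) \<and>
     (\<forall>W\<in>unitary_group n. ((\<lambda>t. f (flow v t W)) has_vector_derivative g W) (at 0))"

lemma flow_0: "W \<in> unitary_group n \<Longrightarrow> flow v 0 W = W"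
proof -
  assume "W \<in> unitary_group n"
  then have c: "W \<in> carrier_mat n n" by (rule unitary_carrier)
  have "refl_mat n v 1 = 1\<^sub>m n" by (auto simp: refl_mat_def mat_eq_iff)
  then show ?thesis using c by (simp add: flow_def)
qed

lemma flow_unitary:
  "(\<Sum>a<n. (norm (v a))\<^sup>2) = 1 \<Longrightarrow> W \<in> unitary_group n \<Longrightarrow> flow v t W \<in> unitary_group n"
  unfolding flow_def by (intro unitary_mult refl_mat_unitary) auto

lemma nice_const: "nice v (\<lambda>_. c) (\<lambda>_. 0)"
  by (auto simp: nice_def intro!: exI[of _ "norm c"])

lemma nice_add:
  assumes "nice v f f'" "nice v g g'"
  shows "nice v (\<lambda>W. f W + g W) (\<lambda>W. f' W + g' W)"
proof -
  obtain C D where CD: "C \<ge> 0" "D \<ge> 0"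
    "\<And>W t. W \<in> unitary_group n \<Longrightarrow> norm (f W) \<le> C \<and> norm (f (flow v t W) - f W) \<le> C * \<bar>t\<bar>"
    "\<And>W t. W \<in> unitary_group n \<Longrightarrow> norm (g W) \<le> D \<and> norm (g (flow v t W) - g W) \<le> D * \<bar>t\<bar>"
    using assms unfolding nice_def by meson
  have "norm (f W + g W) \<le> C + D \<and> norm (f (flow v t W) + g (flow v t W) - (f W + g W)) \<le> (C + D) * \<bar>t\<bar>"
    if "W \<in> unitary_group n" for W t
    using CD(3,4)[OF that, of t] norm_triangle_ineq[of "f W" "g W"]
      norm_triangle_ineq[of "f (flow v t W) - f W" "g (flow v t W) - g W"]
    by (auto simp: algebra_simps)
  then show ?thesis
    using assms CD(1,2) unfolding nice_def
    by (auto intro!: exI[of _ "C + D"] has_vector_derivative_add)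
qed

lemma nice_mult:
  assumes v: "(\<Sum>a<n. (norm (v a))\<^sup>2) = 1" and fg: "nice v f f'" "nice v g g'"
  shows "nice v (\<lambda>W. f W * g W) (\<lambda>W. f W * g' W + f' W * g W)"
proof -
  obtain C D where CD: "C \<ge> 0" "D \<ge> 0"
    "\<And>W t. W \<in> unitary_group n \<Longrightarrow> norm (f W) \<le> C \<and> norm (f (flow v t W) - f W) \<le> C * \<bar>t\<bar>"
    "\<And>W t. W \<in> unitary_group n \<Longrightarrow> norm (g W) \<le> D \<and> norm (g (flow v t W) - g W) \<le> D * \<bar>t\<bar>"
    using fg unfolding nice_def by meson
  have "norm (f W * g W) \<le> 2 * C * D \<and> norm (f (flow v t W) * g (flow v t W) - f W * g W) \<le> 2 * C * D * \<bar>t\<bar>"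
    if W: "W \<in> unitary_group n" for W t
  proof -
    note b = CD(3)[OF W, of t] CD(4)[OF W, of t] CD(4)[OF flow_unitary[OF v W, of t], of 0]
    have "norm (f W * g W) \<le> C * D" unfolding norm_mult using b CD by (intro mult_mono) auto
    moreover have "f (flow v t W) * g (flow v t W) - f W * g W
      = (f (flow v t W) - f W) * g (flow v t W) + f W * (g (flow v t W) - g W)" by (simp add: algebra_simps)
    moreover have "norm ((f (flow v t W) - f W) * g (flow v t W)) \<le> (C * \<bar>t\<bar>) * D"
      unfolding norm_mult using b CD by (intro mult_mono) auto
    moreover have "norm (f W * (g (flow v t W) - g W)) \<le> C * (D * \<bar>t\<bar>)"
      unfolding norm_mult using b CD by (intro mult_mono) auto
    moreover have "C * D \<ge> 0" using CD by simp
    ultimately show ?thesis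
      using norm_triangle_ineq[of "(f (flow v t W) - f W) * g (flow v t W)" "f W * (g (flow v t W) - g W)"]
      by (simp add: algebra_simps)
  qed
  moreover have "((\<lambda>t. f (flow v t W) * g (flow v t W)) has_vector_derivative f W * g' W + f' W * g W) (at 0)"
    if W: "W \<in> unitary_group n" for W
    using has_vector_derivative_mult[of "\<lambda>t. f (flow v t W)" "f' W" 0 UNIV "\<lambda>t. g (flow v t W)" "g' W"] fg W
    by (simp add: nice_def flow_0)
  ultimately show ?thesis
    using fg CD(1,2) unfolding nice_def by (auto intro!: exI[of _ "2 * C * D"])
qed

lemma nice_cnj:
  assumes "nice v f f'"
  shows "nice v (\<lambda>W. cnj (f W)) (\<lambda>W. cnj (f' W))"
proof -
  have "norm (cnj (f (flow v t W)) - cnj (f W)) = norm (f (flow v t W) - f W)" for t W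
    by (simp flip: complex_cnj_diff)
  then show ?thesis using assms unfolding nice_def by (auto intro!: has_vector_derivative_cnj borel_measurable_cnj)
qed

lemma nice_sum:
  "finite I \<Longrightarrow> (\<And>i. i \<in> I \<Longrightarrow> nice v (f i) (f' i)) \<Longrightarrow> nice v (\<lambda>W. \<Sum>i\<in>I. f i W) (\<lambda>W. \<Sum>i\<in>I. f' i W)"
  by (induction rule: finite_induct) (auto intro: nice_const nice_add)

lemma nice_cong:
  assumes v: "(\<Sum>a<n. (norm (v a))\<^sup>2) = 1" and "nice v f f'"
    and "\<And>W. W \<in> unitary_group n \<Longrightarrow> f W = g W" "\<And>W. W \<in> unitary_group n \<Longrightarrow> f' W = g' W"
  shows "nice v g g'"
proof -
  have m: "g \<in> borel_measurable \<mu> \<longleftrightarrow> f \<in> borel_measurable \<mu>"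
    by (intro measurable_cong) (simp add: assms space_eq)
  show ?thesis using assms(2) unfolding nice_def m
    by (simp add: assms(3)[symmetric] assms(4)[symmetric] flow_unitary[OF v])
qed

text \<open>If \<open>y c d\<close> is the derivative along the elementary matrix
  \<open>E_cd\<close>, this is the derivative along \<open>\<i> v v^H\<close>. Keeping every
  derivative in this form leaves a quadratic form in \<open>v\<close> that can be polarised at the
  end.\<close>

definition lin :: "(nat \<Rightarrow> complex) \<Rightarrow> (nat \<Rightarrow> nat \<Rightarrow> complex) \<Rightarrow> complex" where
  "lin v y = \<i> * (\<Sum>c<n. \<Sum>d<n. v c * cnj (v d) * y c d)"

lemma lin_cong: "(\<And>c d. c < n \<Longrightarrow> d < n \<Longrightarrow> y c d = y' c d) \<Longrightarrow> lin v y = lin v y'"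
  by (simp add: lin_def)

lemma lin_add: "lin v y + lin v y' = lin v (\<lambda>c d. y c d + y' c d)"
  by (simp add: lin_def sum.distrib distrib_left)

lemma lin_scale: "s * lin v y = lin v (\<lambda>c d. s * y c d)"
  by (simp add: lin_def sum_distrib_left mult_ac)

lemma lin_sum: "finite I \<Longrightarrow> (\<Sum>i\<in>I. lin v (y i)) = lin v (\<lambda>c d. \<Sum>i\<in>I. y i c d)"
  by (induction rule: finite_induct) (auto simp: lin_add, auto simp: lin_def)

text \<open>The minus sign comes from conjugating \<open>\<i>\<close>, the exchanged indices from
  conjugating \<open>v c * cnj (v d)\<close>.\<close>

lemma lin_cnj: "cnj (lin v y) = lin v (\<lambda>c d. - cnj (y d c))"
proof -
  have "cnj (lin v y) = - \<i> * (\<Sum>c<n. \<Sum>d<n. cnj (v c) * v d * cnj (y c d))"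
    by (simp add: lin_def cnj_sum)
  also have "(\<Sum>c<n. \<Sum>d<n. cnj (v c) * v d * cnj (y c d)) = (\<Sum>d<n. \<Sum>c<n. cnj (v c) * v d * cnj (y c d))"
    by (rule sum.swap)
  finally show ?thesis by (simp add: lin_def sum_negf mult_ac)
qed

lemma nice_entry:
  assumes v: "(\<Sum>a<n. (norm (v a))\<^sup>2) = 1" and ab: "a < n" "b < n"
  shows "nice v (\<lambda>W. W $$ (a, b)) (\<lambda>W. lin v (\<lambda>c d. of_bool (a = c) * W $$ (d, b)))"
proof -
  define S where "S W = (\<Sum>d<n. cnj (v d) * W $$ (d, b))" for W
  have fl: "flow v t W $$ (a, b) = W $$ (a, b) + (cis t - 1) * (v a * S W)" if "W \<in> unitary_group n" for t W
    unfolding flow_def S_def using refl_mat_mult_index[OF unitary_carrier[OF that] ab] by (simp add: mult.assoc)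
  have v1: "norm (v k) \<le> 1" if "k < n" for k
  proof -
    have "(norm (v k))\<^sup>2 \<le> 1\<^sup>2" using member_le_sum[of k "{..<n}" "\<lambda>a. (norm (v a))\<^sup>2"] that v by simp
    then show ?thesis by (rule power2_le_imp_le) simp
  qed
  have "norm (v a * S W) \<le> 1 * real n" if W: "W \<in> unitary_group n" for W
  proof -
    have "norm (S W) \<le> (\<Sum>d<n. norm (cnj (v d) * W $$ (d, b)))" unfolding S_def by (rule norm_sum)
    also have "\<dots> \<le> (\<Sum>d<n. 1 * 1)"
      unfolding norm_mult by (intro sum_mono mult_mono) (use v1 unitary_entry_le_1[OF W] ab in auto)
    finally have "norm (S W) \<le> real n" by simp
    then show ?thesis unfolding norm_mult using v1 ab by (intro mult_mono) auto
  qed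
  note vS = this[simplified]
  have "norm (W $$ (a, b)) \<le> real n + 1 \<and> norm (flow v t W $$ (a, b) - W $$ (a, b)) \<le> (real n + 1) * \<bar>t\<bar>"
    if W: "W \<in> unitary_group n" for W t
  proof -
    have "norm (flow v t W $$ (a, b) - W $$ (a, b)) = norm (cis t - 1) * norm (v a * S W)"
      unfolding fl[OF W] by (simp add: norm_mult)
    also have "\<dots> \<le> \<bar>t\<bar> * (real n + 1)"
      using norm_cis_minus_1_le[of t] vS[OF W] by (intro mult_mono) auto
    finally show ?thesis using unitary_entry_le_1[OF W ab] by (simp add: mult.commute)
  qed
  moreover have "((\<lambda>t. flow v t W $$ (a, b)) has_vector_derivative
      lin v (\<lambda>c d. of_bool (a = c) * W $$ (d, b))) (at 0)" if W: "W \<in> unitary_group n" for W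
  proof -
    have "((\<lambda>t. W $$ (a, b) + (cis t - 1) * (v a * S W)) has_vector_derivative
       (0 + (\<i> * cis 0 - 0) * (v a * S W))) (at 0)"
      by (intro has_vector_derivative_add has_vector_derivative_mult_left has_vector_derivative_diff
          has_vector_derivative_cis has_vector_derivative_const)
    moreover have "lin v (\<lambda>c d. of_bool (a = c) * W $$ (d, b)) = \<i> * (v a * S W)"
    proof -
      have "lin v (\<lambda>c d. of_bool (a = c) * W $$ (d, b)) = \<i> * (\<Sum>c<n. if c = a then v a * S W else 0)"
        unfolding lin_def S_def by (intro arg_cong[of _ _ "\<lambda>x. \<i> * x"] sum.cong)
          (auto simp: sum_distrib_left mult_ac)
      then show ?thesis using ab by simp
    qed
    ultimately show ?thesis by (simp add: fl[OF W])
  qed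
  ultimately show ?thesis
    unfolding nice_def using entry_measurable[OF ab] by (auto intro!: exI[of _ "real n + 1"])
qed

text \<open>Leibniz rule for \<open>U ^ k\<close> when \<open>U\<close> moves in the direction
  \<open>E_cd U\<close>: the matrix \<open>E_cd\<close> is inserted in front of one of the
  \<open>k\<close> factors. Hence \<open>s < k\<close>, and at least one factor stays on its
  right.\<close>

definition dpw :: "complex mat \<Rightarrow> nat \<Rightarrow> nat \<Rightarrow> nat \<Rightarrow> nat \<Rightarrow> nat \<Rightarrow> complex" where
  "dpw U k a b c d = (\<Sum>s<k. pw U s a c * pw U (k - s) d b)"

lemma dpw_Suc:
  assumes U: "U \<in> unitary_group n" and "a < n" "b < n" "c < n" "d < n"
  shows "dpw U (Suc k) a b c d = pw U k a c * U $$ (d, b) + (\<Sum>e<n. dpw U k a e c d * U $$ (e, b))"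
proof -
  have "(\<Sum>e<n. dpw U k a e c d * U $$ (e, b))
      = (\<Sum>e<n. \<Sum>s<k. pw U s a c * (pw U (k - s) d e * U $$ (e, b)))"
    by (simp add: dpw_def sum_distrib_right mult.assoc)
  also have "\<dots> = (\<Sum>s<k. \<Sum>e<n. pw U s a c * (pw U (k - s) d e * U $$ (e, b)))"
    by (rule sum.swap)
  also have "\<dots> = (\<Sum>s<k. pw U s a c * pw U (Suc k - s) d b)"
    by (intro sum.cong refl) (simp add: Suc_diff_le pw_Suc[OF unitary_carrier[OF U] assms(5,3)] sum_distrib_left)
  finally show ?thesis
    using assms by (simp add: dpw_def pw_1[OF unitary_carrier[OF U]])
qed

lemma nice_pw:
  assumes v: "(\<Sum>a<n. (norm (v a))\<^sup>2) = 1" and "a < n" "b < n"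
  shows "nice v (\<lambda>W. pw W k a b) (\<lambda>W. lin v (dpw W k a b))"
  using \<open>b < n\<close>
proof (induction k arbitrary: b)
  case 0
  show ?case
    by (rule nice_cong[OF v nice_const[of v "of_bool (a = b)"]])
      (auto simp: pw_0[of _ n] \<open>a < n\<close> 0 lin_def dpw_def dest: unitary_carrier)
next
  case (Suc k)
  have *: "nice v (\<lambda>W. \<Sum>e<n. pw W k a e * W $$ (e, b))
     (\<lambda>W. \<Sum>e<n. pw W k a e * lin v (\<lambda>c d. of_bool (e = c) * W $$ (d, b)) + lin v (dpw W k a e) * W $$ (e, b))"
    using Suc by (intro nice_sum nice_mult[OF v] nice_entry[OF v]) auto
  show ?case
  proof (rule nice_cong[OF v *])
    fix W assume W: "W \<in> unitary_group n"
    show "(\<Sum>e<n. pw W k a e * W $$ (e, b)) = pw W (Suc k) a b"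
      using pw_Suc[OF unitary_carrier[OF W] \<open>a < n\<close> \<open>b < n\<close>] by simp
    have "(\<Sum>e<n. pw W k a e * lin v (\<lambda>c d. of_bool (e = c) * W $$ (d, b)) + lin v (dpw W k a e) * W $$ (e, b))
      = lin v (\<lambda>c d. \<Sum>e<n. pw W k a e * (of_bool (e = c) * W $$ (d, b)) + W $$ (e, b) * dpw W k a e c d)"
      by (simp only: mult.commute[of "lin v _"] lin_scale lin_add lin_sum finite_lessThan)
    also have "\<dots> = lin v (dpw W (Suc k) a b)"
    proof (rule lin_cong)
      fix c d assume cd: "c < n" "d < n"
      have "(\<Sum>e<n. pw W k a e * (of_bool (e = c) * W $$ (d, b)))
          = (\<Sum>e<n. if e = c then pw W k a c * W $$ (d, b) else 0)" by (intro sum.cong) auto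
      then show "(\<Sum>e<n. pw W k a e * (of_bool (e = c) * W $$ (d, b)) + W $$ (e, b) * dpw W k a e c d)
        = dpw W (Suc k) a b c d"
        using cd Suc.prems \<open>a < n\<close> by (simp add: dpw_Suc[OF W] sum.distrib mult.commute)
    qed
    finally show "(\<Sum>e<n. pw W k a e * lin v (\<lambda>c d. of_bool (e = c) * W $$ (d, b)) + lin v (dpw W k a e) * W $$ (e, b))
      = lin v (dpw W (Suc k) a b)" .
  qed
qed

text \<open>By cyclicity of the trace all \<open>k\<close> insertion points contribute the same,
  which produces the factor \<open>k\<close>.\<close>

lemma nice_ptr_nat:
  assumes v: "(\<Sum>a<n. (norm (v a))\<^sup>2) = 1"
  shows "nice v (\<lambda>W. ptr W (int k)) (\<lambda>W. lin v (\<lambda>c d. of_nat k * pw W k d c))"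
proof (rule nice_cong[OF v])
  show "nice v (\<lambda>W. \<Sum>a<n. pw W k a a) (\<lambda>W. \<Sum>a<n. lin v (dpw W k a a))"
    by (intro nice_sum nice_pw[OF v]) auto
  fix W assume W: "W \<in> unitary_group n"
  note c = unitary_carrier[OF W]
  show "(\<Sum>a<n. pw W k a a) = ptr W (int k)" by (simp add: ptr_nat[OF c])
  show "(\<Sum>a<n. lin v (dpw W k a a)) = lin v (\<lambda>c d. of_nat k * pw W k d c)"
    unfolding lin_sum[OF finite_lessThan]
  proof (rule lin_cong)
    fix c d assume cd: "c < n" "d < n"
    have "(\<Sum>a<n. dpw W k a a c d) = (\<Sum>s<k. \<Sum>a<n. pw W (k - s) d a * pw W s a c)"
      unfolding dpw_def by (subst sum.swap) (simp add: mult.commute)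
    also have "\<dots> = (\<Sum>s<k. pw W k d c)"
      by (intro sum.cong refl) (simp add: cd flip: pw_add[OF c])
    finally show "(\<Sum>a<n. dpw W k a a c d) = of_nat k * pw W k d c" by simp
  qed
qed

lemma nice_ptr:
  assumes v: "(\<Sum>a<n. (norm (v a))\<^sup>2) = 1"
  shows "nice v (\<lambda>W. ptr W m) (\<lambda>W. lin v (\<lambda>c d. of_int m * ipw W m d c))"
proof (cases "m \<ge> 0")
  case True
  then show ?thesis using nice_ptr_nat[OF v, of "nat m"] by (simp add: ipw_def)
next
  case False
  \<comment> \<open>A negative power is the conjugate of a positive one; the sign in
    \<open>lin_cnj\<close> turns the factor \<open>- m\<close> into \<open>m\<close>.\<close>
  have "nice v (\<lambda>W. cnj (ptr W (int (nat (- m))))) (\<lambda>W. cnj (lin v (\<lambda>c d. of_nat (nat (- m)) * pw W (nat (- m)) d c)))"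
    by (intro nice_cnj nice_ptr_nat[OF v])
  then show ?thesis using False by (simp add: lin_cnj ipw_def flip: ptr_uminus)
qed

definition pprod :: "int multiset \<Rightarrow> complex mat \<Rightarrow> complex" where
  "pprod ms W = prod_mset (image_mset (ptr W) ms)"

lemma pprod_add: "pprod (add_mset m ms) W = ptr W m * pprod ms W"
  by (simp add: pprod_def)

lemma pprod_empty: "pprod {#} W = 1"
  by (simp add: pprod_def)

lemma bm_pprod: "bm (pprod ms)"
proof (induction ms)
  case empty
  then show ?case unfolding pprod_empty by (rule bm_const)
next
  case (add m ms)
  then show ?case unfolding pprod_add by (intro bm_mult bm_ptr)
qed

lemma nice_pprod:
  assumes v: "(\<Sum>a<n. (norm (v a))\<^sup>2) = 1"
  shows "nice v (pprod ms) (\<lambda>W. lin v (\<lambda>c d. \<Sum>m\<in>#ms. of_int m * ipw W m d c * pprod (ms - {#m#}) W))"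
proof (induction ms)
  case empty
  show ?case by (rule nice_cong[OF v nice_const[of v 1]]) (auto simp: pprod_empty lin_def)
next
  case (add k ms)
  note IH = nice_mult[OF v nice_ptr[OF v, of k] add.IH]
  show ?case
  proof (rule nice_cong[OF v IH])
    fix W assume W: "W \<in> unitary_group n"
    show "ptr W k * pprod ms W = pprod (add_mset k ms) W" by (simp add: pprod_add)
    show "ptr W k * lin v (\<lambda>c d. \<Sum>m\<in>#ms. of_int m * ipw W m d c * pprod (ms - {#m#}) W)
       + lin v (\<lambda>c d. of_int k * ipw W k d c) * pprod ms W
      = lin v (\<lambda>c d. \<Sum>m\<in>#add_mset k ms. of_int m * ipw W m d c * pprod (add_mset k ms - {#m#}) W)"
      unfolding mult.commute[of "lin v _"] lin_scale lin_add
    proof (rule lin_cong)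
      fix c d
      have "(\<Sum>m\<in>#ms. of_int m * ipw W m d c * pprod (add_mset k ms - {#m#}) W)
         = (\<Sum>m\<in>#ms. ptr W k * (of_int m * ipw W m d c * pprod (ms - {#m#}) W))"
      proof (intro arg_cong[of _ _ sum_mset] image_mset_cong)
        fix m assume "m \<in># ms"
        then obtain ms' where "ms = add_mset m ms'" by (metis multi_member_split)
        then show "of_int m * ipw W m d c * pprod (add_mset k ms - {#m#}) W
          = ptr W k * (of_int m * ipw W m d c * pprod (ms - {#m#}) W)"
          by (simp add: add_mset_commute[of k m] pprod_add)
      qed
      then show "ptr W k * (\<Sum>m\<in>#ms. of_int m * ipw W m d c * pprod (ms - {#m#}) W)
         + pprod ms W * (of_int k * ipw W k d c)
        = (\<Sum>m\<in>#add_mset k ms. of_int m * ipw W m d c * pprod (add_mset k ms - {#m#}) W)"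
        by (simp add: sum_mset_distrib_left multiset.map_comp o_def mult_ac)
    qed
  qed
qed

text \<open>By invariance each difference quotient has integral \<open>0\<close>. The Lipschitz
  constant dominates the quotients, so the limit may be taken under the integral, and
  \<open>g\<close> is measurable as their pointwise limit.\<close>

lemma nice_integral_eq_0:
  assumes v: "(\<Sum>a<n. (norm (v a))\<^sup>2) = 1" and "nice v f g"
  shows "(\<integral>W. g W \<partial>\<mu>) = 0"
proof -
  obtain C where f: "f \<in> borel_measurable \<mu>"
    and C: "\<And>W t. W \<in> unitary_group n \<Longrightarrow> norm (f W) \<le> C \<and> norm (f (flow v t W) - f W) \<le> C * \<bar>t\<bar>"
    and D: "\<And>W. W \<in> unitary_group n \<Longrightarrow> ((\<lambda>t. f (flow v t W)) has_vector_derivative g W) (at 0)"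
    using assms(2) unfolding nice_def by blast
  have fm: "(\<lambda>W. f (flow v t W)) \<in> borel_measurable \<mu>" for t
    unfolding flow_def using measurable_compose[OF mult_measurable[OF refl_mat_unitary[OF v]] f] by simp
  have int: "integrable \<mu> (\<lambda>W. f (flow v t W))" for t
    by (rule integrable_const_bound[of _ C]) (use C[OF flow_unitary[OF v]] fm in \<open>auto simp: space_eq\<close>)
  define t where "t N = 1 / real (Suc N)" for N
  define q where "q N W = (f (flow v (t N) W) - f W) /\<^sub>R t N" for N W
  have t: "t N > 0" for N by (simp add: t_def)
  have t0: "t \<longlonglongrightarrow> 0" unfolding t_def by (rule LIMSEQ_inverse_real_of_nat[unfolded inverse_eq_divide])
  have qm: "q N \<in> borel_measurable \<mu>" for N unfolding q_def using fm f by auto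
  have q0: "(\<integral>W. q N W \<partial>\<mu>) = 0" for N
  proof -
    have "integrable \<mu> f" by (rule integrable_const_bound[of _ C]) (use C f in \<open>auto simp: space_eq\<close>)
    then have "(\<integral>W. q N W \<partial>\<mu>) = ((\<integral>W. f (flow v (t N) W) \<partial>\<mu>) - (\<integral>W. f W \<partial>\<mu>)) /\<^sub>R t N"
      unfolding q_def using int by simp
    also have "(\<integral>W. f (flow v (t N) W) \<partial>\<mu>) = (\<integral>W. f W \<partial>\<mu>)"
      unfolding flow_def by (intro integral_invariant refl_mat_unitary[OF v] f) simp
    finally show ?thesis by simp
  qed
  have lim: "(\<lambda>N. q N W) \<longlonglongrightarrow> g W" if W: "W \<in> unitary_group n" for W
  proof -
    have "((\<lambda>h. norm ((f (flow v h W) - f (flow v 0 W)) - h *\<^sub>R g W) / norm h) \<longlongrightarrow> 0) (at 0)"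
      using D[OF W] by (simp add: has_vector_derivative_def has_derivative_iff_norm)
    then have "((\<lambda>h. norm ((f (flow v h W) - f (flow v 0 W)) /\<^sub>R h - g W)) \<longlongrightarrow> 0) (at 0)"
    proof (rule Lim_transform_eventually)
      have "norm (x - h *\<^sub>R g W) / norm h = norm (x /\<^sub>R h - g W)" if "h \<noteq> 0" for x and h :: real
      proof -
        have "x /\<^sub>R h - g W = (x - h *\<^sub>R g W) /\<^sub>R h" using that by (simp add: scaleR_diff_right)
        then show ?thesis by (simp add: divide_inverse mult.commute)
      qed
      then show "\<forall>\<^sub>F h in at 0. norm ((f (flow v h W) - f (flow v 0 W)) - h *\<^sub>R g W) / norm h
        = norm ((f (flow v h W) - f (flow v 0 W)) /\<^sub>R h - g W)"
        by (auto simp: eventually_at_filter)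
    qed
    then have "((\<lambda>h. (f (flow v h W) - f (flow v 0 W)) /\<^sub>R h) \<longlongrightarrow> g W) (at 0)"
      by (simp add: tendsto_norm_zero_iff LIM_zero_iff)
    then have "((\<lambda>h. (f (flow v h W) - f W) /\<^sub>R h) \<longlongrightarrow> g W) (at 0)" by (simp add: flow_0[OF W])
    moreover have "filterlim t (at 0) sequentially"
      using t0 t by (auto simp: filterlim_at intro!: always_eventually) (metis less_irrefl)
    ultimately show ?thesis unfolding q_def by (rule filterlim_compose)
  qed
  have gm: "g \<in> borel_measurable \<mu>"
    by (rule borel_measurable_LIMSEQ_metric[OF qm]) (use lim space_eq in auto)
  have "(\<lambda>N. \<integral>W. q N W \<partial>\<mu>) \<longlonglongrightarrow> (\<integral>W. g W \<partial>\<mu>)"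
  proof (rule integral_dominated_convergence[where w="\<lambda>_. C"])
    fix N
    have "norm (q N W) \<le> C" if W: "W \<in> unitary_group n" for W
    proof -
      have "norm (q N W) = norm (f (flow v (t N) W) - f W) / t N" using t[of N] by (simp add: q_def divide_inverse mult.commute)
      also have "\<dots> \<le> C * \<bar>t N\<bar> / t N" using C[OF W, of "t N"] t[of N] by (intro divide_right_mono) auto
      finally show ?thesis using t[of N] by simp
    qed
    then show "AE x in \<mu>. norm (q N x) \<le> C" by (auto simp: space_eq)
  qed (use gm qm lim space_eq in auto)
  then show ?thesis using q0 by (simp add: LIMSEQ_const_iff)
qed

section \<open>Loop equations\<close>

lemma sum_sum_mset: "finite A \<Longrightarrow> (\<Sum>a\<in>A. \<Sum>m\<in>#ms. f a m) = (\<Sum>m\<in>#ms. \<Sum>a\<in>A. f a m :: complex)"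
  by (induction ms) (auto simp: sum.distrib)

lemma bm_sum_mset: "(\<And>m. bm (f m)) \<Longrightarrow> bm (\<lambda>W. \<Sum>m\<in>#ms. f m W)"
  by (induction ms) (auto intro: bm_const bm_add)

lemma integral_sum_mset:
  "(\<And>m. bm (f m)) \<Longrightarrow> (\<integral>W. (\<Sum>m\<in>#ms. f m W) \<partial>\<mu>) = (\<Sum>m\<in>#ms. \<integral>W. f m W \<partial>\<mu>)"
  by (induction ms) (auto simp: bm_integrable bm_sum_mset)

definition moment :: "int multiset \<Rightarrow> complex" where
  "moment ms = (\<integral>W. pprod ms W \<partial>\<mu>)"

text \<open>The loop equations: the derivative of \<open>(U\<^sup>k)\<^sub>a\<^sub>b \<Prod> tr U\<^sup>m\<close> along the elementary matrix
  \<open>E\<^sub>a\<^sub>b\<close> has mean zero, summed over \<open>a, b\<close>.\<close>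

lemma elementary_derivative_mean_0:
  assumes ab: "a < n" "b < n" and cd: "c < n" "d < n"
  shows "(\<integral>W. dpw W k a b c d * pprod ms W
     + pw W k a b * (\<Sum>m\<in>#ms. of_int m * ipw W m d c * pprod (ms - {#m#}) W) \<partial>\<mu>) = 0"
    (is "(\<integral>W. ?Y c d W \<partial>\<mu>) = 0")
\<comment> \<open>The flows only reach the directions \<open>\<i> v v^H\<close>, that is, a
  quadratic form in the wanted integrals. As it vanishes for all unit vectors, every coefficient
  does, which is the statement for \<open>E_cd\<close>.\<close>
proof (rule quadratic_form_eq_0[where n=n, OF _ cd])
  fix v :: "nat \<Rightarrow> complex" assume v: "(\<Sum>a<n. (norm (v a))\<^sup>2) = 1"
  have Y: "bm (?Y c d)" if "c < n" "d < n" for c d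
    unfolding dpw_def using ab that
    by (intro bm_add bm_mult bm_sum bm_sum_mset bm_pw bm_pprod bm_const) (auto intro: bm_ipw bm_mult bm_const bm_pprod)
  have "nice v (\<lambda>W. pw W k a b * pprod ms W)
     (\<lambda>W. pw W k a b * lin v (\<lambda>c d. \<Sum>m\<in>#ms. of_int m * ipw W m d c * pprod (ms - {#m#}) W)
        + lin v (dpw W k a b) * pprod ms W)"
    by (intro nice_mult[OF v] nice_pw[OF v] nice_pprod[OF v] ab)
  then have "(\<integral>W. pw W k a b * lin v (\<lambda>c d. \<Sum>m\<in>#ms. of_int m * ipw W m d c * pprod (ms - {#m#}) W)
        + lin v (dpw W k a b) * pprod ms W \<partial>\<mu>) = 0"
    by (rule nice_integral_eq_0[OF v])
  also have "(\<lambda>W. pw W k a b * lin v (\<lambda>c d. \<Sum>m\<in>#ms. of_int m * ipw W m d c * pprod (ms - {#m#}) W)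
        + lin v (dpw W k a b) * pprod ms W) = (\<lambda>W. lin v (\<lambda>c d. ?Y c d W))"
    unfolding mult.commute[of "lin v _"] lin_scale lin_add by (simp add: add.commute mult.commute)
  also have "(\<integral>W. lin v (\<lambda>c d. ?Y c d W) \<partial>\<mu>) = \<i> * (\<Sum>c<n. \<Sum>d<n. v c * cnj (v d) * (\<integral>W. ?Y c d W \<partial>\<mu>))"
  proof -
    have i: "integrable \<mu> (\<lambda>W. v c * cnj (v d) * ?Y c d W)" if "c < n" "d < n" for c d
      by (intro bm_integrable bm_mult[OF bm_const Y[OF that]])
    have "(\<integral>W. (\<Sum>c<n. \<Sum>d<n. v c * cnj (v d) * ?Y c d W) \<partial>\<mu>)
        = (\<Sum>c<n. \<Sum>d<n. \<integral>W. v c * cnj (v d) * ?Y c d W \<partial>\<mu>)"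
      using i by (subst Bochner_Integration.integral_sum; force intro: sum.cong Bochner_Integration.integral_sum)
    then show ?thesis unfolding lin_def by simp
  qed
  finally show "(\<Sum>c<n. \<Sum>d<n. v c * cnj (v d) * (\<integral>W. ?Y c d W \<partial>\<mu>)) = 0" by simp
qed

text \<open>Taking \<open>(c, d) = (a, b)\<close> and summing turns insertions into products of
  traces: cutting \<open>tr U^k\<close> splits it in two, and acting on another trace merges the
  exponents \<open>m\<close> and \<open>k\<close>.\<close>

theorem loop_equation:
  assumes k: "k \<ge> 1"
  shows "of_nat n * moment (add_mset (int k) ms)
    + (\<Sum>s=1..<k. moment (add_mset (int s) (add_mset (int (k - s)) ms)))
    + (\<Sum>m\<in>#ms. of_int m * moment (add_mset (m + int k) (ms - {#m#}))) = 0"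
proof -
  define Y where "Y a b W = dpw W k a b a b * pprod ms W
     + pw W k a b * (\<Sum>m\<in>#ms. of_int m * ipw W m b a * pprod (ms - {#m#}) W)" for a b W
  have bmY: "bm (Y a b)" if "a < n" "b < n" for a b
    unfolding Y_def dpw_def using that
    by (intro bm_add bm_mult bm_sum bm_sum_mset bm_pw bm_pprod bm_const) (auto intro: bm_ipw bm_mult bm_const bm_pprod)
  have "(\<integral>W. (\<Sum>a<n. \<Sum>b<n. Y a b W) \<partial>\<mu>) = (\<Sum>a<n. \<Sum>b<n. \<integral>W. Y a b W \<partial>\<mu>)"
    by (subst Bochner_Integration.integral_sum; force intro: sum.cong Bochner_Integration.integral_sum bm_integrable bmY)
  also have "\<dots> = 0"
    unfolding Y_def using elementary_derivative_mean_0 by simp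
  finally have "(\<integral>W. (\<Sum>a<n. \<Sum>b<n. Y a b W) \<partial>\<mu>) = 0" .
  also have "(\<integral>W. (\<Sum>a<n. \<Sum>b<n. Y a b W) \<partial>\<mu>)
     = (\<integral>W. of_nat n * pprod (add_mset (int k) ms) W
        + (\<Sum>s=1..<k. pprod (add_mset (int s) (add_mset (int (k - s)) ms)) W)
        + (\<Sum>m\<in>#ms. of_int m * pprod (add_mset (m + int k) (ms - {#m#})) W) \<partial>\<mu>)"
  proof (rule Bochner_Integration.integral_cong[OF refl])
    fix W assume "W \<in> space \<mu>"
    then have W: "W \<in> unitary_group n" by (simp add: space_eq)
    note c = unitary_carrier[OF W]
    have "(\<Sum>a<n. \<Sum>b<n. dpw W k a b a b) = (\<Sum>a<n. \<Sum>s<k. \<Sum>b<n. pw W s a a * pw W (k - s) b b)"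
      unfolding dpw_def by (intro sum.cong refl sum.swap)
    also have "\<dots> = (\<Sum>s<k. \<Sum>a<n. \<Sum>b<n. pw W s a a * pw W (k - s) b b)"
      by (rule sum.swap)
    also have "\<dots> = (\<Sum>s<k. ptr W (int s) * ptr W (int (k - s)))"
      unfolding ptr_nat[OF c] sum_product ..
    \<comment> \<open>The cut at \<open>s = 0\<close> splits off \<open>tr 1 = n\<close>; this is
      the leading coefficient of the equation.\<close>
    also have "{..<k} = insert 0 {1..<k}" using k by auto
    also have "(\<Sum>s\<in>insert 0 {1..<k}. ptr W (int s) * ptr W (int (k - s)))
       = of_nat n * ptr W (int k) + (\<Sum>s=1..<k. ptr W (int s) * ptr W (int (k - s)))"
      by (subst sum.insert) (auto simp: ptr_0[OF c])
    finally have 1: "(\<Sum>a<n. \<Sum>b<n. dpw W k a b a b)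
       = of_nat n * ptr W (int k) + (\<Sum>s=1..<k. ptr W (int s) * ptr W (int (k - s)))" .
    have "(\<Sum>a<n. \<Sum>b<n. pw W k a b * (\<Sum>m\<in>#ms. of_int m * ipw W m b a * pprod (ms - {#m#}) W))
       = (\<Sum>a<n. \<Sum>b<n. \<Sum>m\<in>#ms. of_int m * (pw W k a b * ipw W m b a) * pprod (ms - {#m#}) W)"
      by (simp add: sum_mset_distrib_left multiset.map_comp o_def mult_ac)
    also have "\<dots> = (\<Sum>m\<in>#ms. \<Sum>a<n. \<Sum>b<n. of_int m * (pw W k a b * ipw W m b a) * pprod (ms - {#m#}) W)"
      by (simp add: sum_sum_mset)
    also have "\<dots> = (\<Sum>m\<in>#ms. of_int m * (\<Sum>a<n. \<Sum>b<n. pw W k a b * ipw W m b a) * pprod (ms - {#m#}) W)"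
      by (simp add: sum_distrib_left sum_distrib_right)
    also have "\<dots> = (\<Sum>m\<in>#ms. of_int m * pprod (add_mset (m + int k) (ms - {#m#})) W)"
      by (simp add: trace_pw_ipw[OF W] pprod_add add.commute mult.assoc)
    finally have 2: "(\<Sum>a<n. \<Sum>b<n. pw W k a b * (\<Sum>m\<in>#ms. of_int m * ipw W m b a * pprod (ms - {#m#}) W))
      = (\<Sum>m\<in>#ms. of_int m * pprod (add_mset (m + int k) (ms - {#m#})) W)" .
    have "(\<Sum>a<n. \<Sum>b<n. Y a b W) = (\<Sum>a<n. \<Sum>b<n. dpw W k a b a b) * pprod ms W
       + (\<Sum>a<n. \<Sum>b<n. pw W k a b * (\<Sum>m\<in>#ms. of_int m * ipw W m b a * pprod (ms - {#m#}) W))"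
      unfolding Y_def by (simp only: sum.distrib sum_distrib_right)
    then show "(\<Sum>a<n. \<Sum>b<n. Y a b W) = of_nat n * pprod (add_mset (int k) ms) W
        + (\<Sum>s=1..<k. pprod (add_mset (int s) (add_mset (int (k - s)) ms)) W)
        + (\<Sum>m\<in>#ms. of_int m * pprod (add_mset (m + int k) (ms - {#m#})) W)"
      unfolding 1 2 by (simp add: pprod_add distrib_right sum_distrib_right mult.assoc)
  qed
  also have "\<dots> = of_nat n * moment (add_mset (int k) ms)
    + (\<Sum>s=1..<k. moment (add_mset (int s) (add_mset (int (k - s)) ms)))
    + (\<Sum>m\<in>#ms. of_int m * moment (add_mset (m + int k) (ms - {#m#})))"
    unfolding moment_def
    by (subst Bochner_Integration.integral_add Bochner_Integration.integral_sum integral_sum_mset;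
        (simp add: bm_integrable bm_pprod bm_sum bm_sum_mset bm_mult bm_const bm_add)?)+
  finally show ?thesis .
qed

end

section \<open>Moments of traces\<close>

text \<open>Gaussian contractions are weighted by multiplicities. Writing the sum over occurrences
  with \<open>count\<close>, separately for the two signs, lets the merging terms be matched with
  them one exponent at a time.\<close>

lemma sum_mset_split:
  fixes f :: "int \<Rightarrow> 'b::comm_ring_1"
  assumes "\<And>m. m \<in># ms \<Longrightarrow> m \<noteq> 0 \<and> \<bar>m\<bar> \<le> int N"
  shows "(\<Sum>m\<in>#ms. f m) = (\<Sum>q=1..N. of_nat (count ms (int q)) * f (int q))
     + (\<Sum>q=1..N. of_nat (count ms (- int q)) * f (- int q))"
  using assms
proof (induction ms)
  case (add x ms)
  have x: "x \<noteq> 0" "\<bar>x\<bar> \<le> int N" using add.prems by auto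
  have IH: "(\<Sum>m\<in>#ms. f m) = (\<Sum>q=1..N. of_nat (count ms (int q)) * f (int q))
     + (\<Sum>q=1..N. of_nat (count ms (- int q)) * f (- int q))"
    by (rule add.IH) (use add.prems in auto)
  define q where "q = nat \<bar>x\<bar>"
  have q: "q \<in> {1..N}" using x by (auto simp: q_def)
  have pos: "(\<Sum>q=1..N. of_nat (count (add_mset x ms) (int q)) * f (int q))
    = (\<Sum>q=1..N. of_nat (count ms (int q)) * f (int q)) + (if x > 0 then f x else 0)"
  proof -
    have "(\<Sum>r=1..N. of_nat (count (add_mset x ms) (int r)) * f (int r))
      = (\<Sum>r=1..N. of_nat (count ms (int r)) * f (int r) + (if r = q then (if x > 0 then f x else 0) else 0))"
      using x by (intro sum.cong) (auto simp: q_def algebra_simps)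
    then show ?thesis using q by (simp add: sum.distrib)
  qed
  have neg: "(\<Sum>q=1..N. of_nat (count (add_mset x ms) (- int q)) * f (- int q))
    = (\<Sum>q=1..N. of_nat (count ms (- int q)) * f (- int q)) + (if x > 0 then 0 else f x)"
  proof -
    have "(\<Sum>r=1..N. of_nat (count (add_mset x ms) (- int r)) * f (- int r))
      = (\<Sum>r=1..N. of_nat (count ms (- int r)) * f (- int r) + (if r = q then (if x > 0 then 0 else f x) else 0))"
      using x by (intro sum.cong) (auto simp: q_def algebra_simps)
    then show ?thesis using q by (simp add: sum.distrib)
  qed
  show ?case unfolding pos neg using IH by (simp add: algebra_simps)
qed simp

text \<open>The two degrees are tracked separately: splitting and merging positive exponents
  preserves both, whereas merging exponents of opposite sign lowers both.\<close>

definition pos_degree :: "int multiset \<Rightarrow> int" where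
  "pos_degree ms = (\<Sum>m\<in>#ms. max m 0)"

definition neg_degree :: "int multiset \<Rightarrow> int" where
  "neg_degree ms = (\<Sum>m\<in>#ms. max (- m) 0)"

lemma degree_add [simp]:
  "pos_degree (add_mset m ms) = max m 0 + pos_degree ms"
  "neg_degree (add_mset m ms) = max (- m) 0 + neg_degree ms"
  by (simp_all add: pos_degree_def neg_degree_def)

lemma degree_empty [simp]: "pos_degree {#} = 0" "neg_degree {#} = 0"
  by (simp_all add: pos_degree_def neg_degree_def)

lemma degree_nonneg: "pos_degree ms \<ge> 0" "neg_degree ms \<ge> 0"
  by (induction ms) auto

lemma degree_uminus:
  "pos_degree (image_mset uminus ms) = neg_degree ms" "neg_degree (image_mset uminus ms) = pos_degree ms"
  by (induction ms) auto

lemma degree_remove: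
  assumes "m \<in># ms"
  shows "pos_degree (ms - {#m#}) = pos_degree ms - max m 0" "neg_degree (ms - {#m#}) = neg_degree ms - max (- m) 0"
  using insert_DiffM[OF assms] degree_add[of m "ms - {#m#}"] by simp_all

lemma abs_le_degree: "m \<in># ms \<Longrightarrow> \<bar>m\<bar> \<le> pos_degree ms + neg_degree ms"
proof -
  assume "m \<in># ms"
  then obtain ms' where "ms = add_mset m ms'" by (metis multi_member_split)
  then show ?thesis using degree_nonneg[of ms'] by simp
qed

lemma size_le_degree: "0 \<notin># ms \<Longrightarrow> int (size ms) \<le> pos_degree ms + neg_degree ms"
proof (induction ms)
  case (add m ms)
  then have "m \<noteq> 0" by auto
  then have "max m 0 + max (- m) 0 \<ge> 1" by auto
  then show ?case using add by auto
qed simp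

lemma count_image_uminus: "count (image_mset uminus ms) (m :: int) = count ms (- m)"
  by (induction ms) auto

lemma image_uminus_diff: "image_mset uminus (ms - {#m :: int#}) = image_mset uminus ms - {#- m#}"
proof (cases "m \<in># ms")
  case False
  then have "- m \<notin># image_mset uminus ms" by auto
  then show ?thesis using False by (simp add: diff_single_trivial)
qed (simp add: image_mset_Diff)

section \<open>The Gaussian solution of the loop equations and its uniqueness\<close>

context haar_unitary
begin

lemma pprod_uminus: "pprod (image_mset uminus ms) W = cnj (pprod ms W)"
  by (induction ms) (auto simp: pprod_add pprod_empty ptr_uminus)

lemma moment_uminus: "moment (image_mset uminus ms) = cnj (moment ms)"
  by (simp add: moment_def pprod_uminus)

lemma moment_0: "moment (add_mset 0 ms) = of_nat n * moment ms"
proof -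
  have "moment (add_mset 0 ms) = (\<integral>W. of_nat n * pprod ms W \<partial>\<mu>)"
    unfolding moment_def
    by (intro Bochner_Integration.integral_cong refl)
      (use ptr_0[OF unitary_carrier] in \<open>simp add: pprod_add space_eq\<close>)
  then show ?thesis by (simp add: moment_def)
qed

lemma norm_pprod_le: "W \<in> unitary_group n \<Longrightarrow> norm (pprod ms W) \<le> real n ^ size ms"
  by (induction ms) (auto simp: pprod_empty pprod_add norm_mult norm_ptr_le intro!: mult_mono)

lemma norm_moment_le: "norm (moment ms) \<le> real n ^ size ms"
proof -
  have "norm (moment ms) \<le> (\<integral>W. norm (pprod ms W) \<partial>\<mu>)" unfolding moment_def by (rule integral_norm_bound)
  also have "\<dots> \<le> (\<integral>W. real n ^ size ms \<partial>\<mu>)"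
    by (intro integral_mono integrable_norm bm_integrable bm_pprod) (auto simp: space_eq norm_pprod_le)
  finally show ?thesis by (simp add: prob_space)
qed

text \<open>The value for independent complex Gaussians with \<open>E |tr U^k|^2 = k\<close>:
  \<open>tr U^k\<close> is contracted with each occurrence of its conjugate, and with nothing
  else.\<close>

definition wick :: "nat \<Rightarrow> int multiset \<Rightarrow> complex" where
  "wick k ms = of_nat k * of_nat (count ms (- int k)) * moment (ms - {#- int k#})"

definition defect :: "nat \<Rightarrow> int multiset \<Rightarrow> complex" where
  "defect k ms = moment (add_mset (int k) ms) - wick k ms"

text \<open>The Gaussian prediction satisfies the loop equations exactly.  Contracting a negative part
  with a positive one lowers the degree, so that the induction hypothesis applies to it.\<close>

lemma wick_loop:
  assumes k: "k \<ge> 1" and nz: "0 \<notin># ms" and N: "\<And>m. m \<in># ms \<Longrightarrow> \<bar>m\<bar> \<le> int N"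
    and IH: "\<And>q. q > k \<Longrightarrow> - int q \<in># ms \<Longrightarrow>
      moment (add_mset (- int (q - k)) (ms - {#- int q#}))
        = of_nat (q - k) * of_nat (count (ms - {#- int q#}) (int (q - k))) * moment (ms - {#- int q#} - {#int (q - k)#})"
  shows "of_nat n * wick k ms + (\<Sum>s=1..<k. wick s (add_mset (int (k - s)) ms))
    + (\<Sum>q=1..N. of_nat (count ms (int q)) * (of_nat q * wick (k + q) (ms - {#int q#})))
    + (\<Sum>q=1..N+k. of_nat (count ms (- int q)) * (- of_nat q * moment (add_mset (int k - int q) (ms - {#- int q#})))) = 0"
proof -
  define E where "E q = of_nat (count ms (- int q)) * (- of_nat q * moment (add_mset (int k - int q) (ms - {#- int q#})))" for q
  \<comment> \<open>Merging \<open>k\<close> with \<open>- q\<close> depends on the sign of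
    \<open>k - q\<close>: for \<open>q < k\<close> it cancels the splitting terms, for
    \<open>q = k\<close> it gives \<open>tr 1 = n\<close> and cancels the leading term, and for
    \<open>q > k\<close> the hypothesis \<open>IH\<close> contracts it with a positive exponent,
    cancelling the positive merges. The upper end \<open>N + k\<close> makes the shift by
    \<open>k\<close> in the last case cover \<open>1..N\<close>.\<close>
  have "{1..N+k} = {1..<k} \<union> {k} \<union> {k+1..N+k}" using k by auto
  then have "(\<Sum>q=1..N+k. E q) = (\<Sum>q\<in>{1..<k} \<union> {k} \<union> {k+1..N+k}. E q)" by simp
  also have "\<dots> = (\<Sum>q=1..<k. E q) + E k + (\<Sum>q=k+1..N+k. E q)"
    by (subst sum.union_disjoint; (subst sum.union_disjoint)?) auto
  finally have split: "(\<Sum>q=1..N+k. E q) = (\<Sum>q=1..<k. E q) + E k + (\<Sum>q=k+1..N+k. E q)" .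
  have Ek: "E k = - of_nat n * wick k ms"
    by (simp add: E_def wick_def moment_0)
  have E1: "E s = - wick s (add_mset (int (k - s)) ms)" if s: "s \<in> {1..<k}" for s
  proof (cases "- int s \<in># ms")
    case True
    have "add_mset (int (k - s)) ms - {#- int s#} = add_mset (int k - int s) (ms - {#- int s#})"
      using s True by (auto simp: of_nat_diff)
    moreover have "count (add_mset (int (k - s)) ms) (- int s) = count ms (- int s)" using s by auto
    ultimately show ?thesis by (simp add: E_def wick_def mult_ac)
  next
    case False
    moreover have "count (add_mset (int (k - s)) ms) (- int s) = count ms (- int s)" using s by auto
    ultimately show ?thesis by (simp add: E_def wick_def not_in_iff)
  qed
  have E3: "E (q + k) = - (of_nat (count ms (int q)) * (of_nat q * wick (k + q) (ms - {#int q#})))" if q: "q \<ge> 1" for q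
  proof (cases "- int (q + k) \<in># ms")
    case True
    have ne: "int q \<noteq> - int (q + k)" using q by simp
    have c1: "count (ms - {#- int (q + k)#}) (int q) = count ms (int q)"
      "count (ms - {#int q#}) (- int (k + q)) = count ms (- int (q + k))"
      using ne by (auto simp: add.commute)
    have "moment (add_mset (- int q) (ms - {#- int (q + k)#}))
      = of_nat q * of_nat (count ms (int q)) * moment (ms - {#- int (q + k)#} - {#int q#})"
      using IH[of "q + k"] q True unfolding c1[symmetric] by simp
    then show ?thesis unfolding E_def wick_def c1
      by (simp add: diff_diff_add_mset add.commute[of k q] add_mset_commute) (simp add: algebra_simps)
  next
    case False
    then have "count (ms - {#int q#}) (- int (k + q)) = 0" by (simp add: not_in_iff add.commute)
    then show ?thesis using False by (simp add: E_def wick_def not_in_iff)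
  qed
  have "(\<Sum>q=k+1..N+k. E q) = (\<Sum>q=1..N. E (q + k))"
    using sum.shift_bounds_cl_nat_ivl[of E 1 k N] by (simp add: add.commute)
  also have "\<dots> = - (\<Sum>q=1..N. of_nat (count ms (int q)) * (of_nat q * wick (k + q) (ms - {#int q#})))"
    using E3 by (simp add: sum_negf)
  finally have S3: "(\<Sum>q=k+1..N+k. E q)
    = - (\<Sum>q=1..N. of_nat (count ms (int q)) * (of_nat q * wick (k + q) (ms - {#int q#})))" .
  have S1: "(\<Sum>q=1..<k. E q) = - (\<Sum>s=1..<k. wick s (add_mset (int (k - s)) ms))"
    using E1 by (simp add: sum_negf)
  show ?thesis unfolding E_def[symmetric] split S1 S3 Ek by simp
qed

text \<open>The merges with negative exponents occur identically in the loop equation and in the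
  identity for the prediction. Subtracting leaves a homogeneous equation between defects of the same
  degrees.\<close>

lemma defect_loop:
  assumes k: "k \<ge> 1" and nz: "0 \<notin># ms" and N: "\<And>m. m \<in># ms \<Longrightarrow> \<bar>m\<bar> \<le> int N"
    and IH: "\<And>q. q > k \<Longrightarrow> - int q \<in># ms \<Longrightarrow>
      moment (add_mset (- int (q - k)) (ms - {#- int q#}))
        = of_nat (q - k) * of_nat (count (ms - {#- int q#}) (int (q - k))) * moment (ms - {#- int q#} - {#int (q - k)#})"
  shows "of_nat n * defect k ms + (\<Sum>s=1..<k. defect s (add_mset (int (k - s)) ms))
    + (\<Sum>q=1..N. of_nat (count ms (int q)) * (of_nat q * defect (k + q) (ms - {#int q#}))) = 0"
proof -
  have ext: "(\<Sum>q=1..N+k. of_nat (count ms (- int q)) * g q) = (\<Sum>q=1..N. of_nat (count ms (- int q)) * g q)"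
    for g :: "nat \<Rightarrow> complex"
  proof (rule sum.mono_neutral_right)
    show "\<forall>q\<in>{1..N + k} - {1..N}. of_nat (count ms (- int q)) * g q = 0"
    proof
      fix q assume "q \<in> {1..N + k} - {1..N}"
      then have "- int q \<notin># ms" using N[of "- int q"] by auto
      then show "of_nat (count ms (- int q)) * g q = 0" by (simp add: not_in_iff)
    qed
  qed auto
  define A A' B B' E where "A = (\<Sum>s=1..<k. moment (add_mset (int s) (add_mset (int (k - s)) ms)))"
    and "A' = (\<Sum>s=1..<k. wick s (add_mset (int (k - s)) ms))"
    and "B = (\<Sum>q=1..N. of_nat (count ms (int q)) * (of_nat q * moment (add_mset (int (k + q)) (ms - {#int q#}))))"
    and "B' = (\<Sum>q=1..N. of_nat (count ms (int q)) * (of_nat q * wick (k + q) (ms - {#int q#})))"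
    and "E = (\<Sum>q=1..N. of_nat (count ms (- int q)) * (- of_nat q * moment (add_mset (int k - int q) (ms - {#- int q#}))))"
  have "(\<Sum>m\<in>#ms. of_int m * moment (add_mset (m + int k) (ms - {#m#}))) =
     (\<Sum>q=1..N. of_nat (count ms (int q)) * (of_int (int q) * moment (add_mset (int q + int k) (ms - {#int q#}))))
      + (\<Sum>q=1..N. of_nat (count ms (- int q)) * (of_int (- int q) * moment (add_mset (- int q + int k) (ms - {#- int q#}))))"
    using nz N by (intro sum_mset_split) auto
  also have "\<dots> = B + E"
    unfolding B_def E_def by (intro arg_cong2[where f="(+)"] sum.cong refl) (simp_all add: add.commute)
  finally have "of_nat n * moment (add_mset (int k) ms) + A + (B + E) = 0"
    using loop_equation[OF k, of ms] by (simp add: A_def)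
  moreover have "of_nat n * wick k ms + A' + B' + E = 0"
    using wick_loop[OF k nz N IH] unfolding ext A'_def B'_def E_def .
  moreover have "of_nat n * defect k ms + (A - A') + (B - B')
    = (of_nat n * moment (add_mset (int k) ms) + A + (B + E)) - (of_nat n * wick k ms + A' + B' + E)"
    by (simp add: defect_def algebra_simps)
  ultimately have "of_nat n * defect k ms + (A - A') + (B - B') = 0" by simp
  moreover have "A - A' = (\<Sum>s=1..<k. defect s (add_mset (int (k - s)) ms))"
    unfolding A_def A'_def by (simp add: defect_def sum_subtractf)
  moreover have "B - B' = (\<Sum>q=1..N. of_nat (count ms (int q)) * (of_nat q * defect (k + q) (ms - {#int q#})))"
    unfolding B_def B'_def by (simp only: defect_def sum_subtractf right_diff_distrib)
  ultimately show ?thesis by simp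
qed

text \<open>Conjugation exchanges the two signs, so a contraction formula for a positive exponent
  also serves a negative one.\<close>

lemma wick_uminus:
  assumes "moment (add_mset (int k) (image_mset uminus ms)) = wick k (image_mset uminus ms)"
  shows "moment (add_mset (- int k) ms) = of_nat k * of_nat (count ms (int k)) * moment (ms - {#int k#})"
proof -
  have "cnj (moment (add_mset (- int k) ms)) = moment (add_mset (int k) (image_mset uminus ms))"
    by (simp flip: moment_uminus)
  also have "\<dots> = of_nat k * of_nat (count ms (int k)) * cnj (moment (ms - {#int k#}))"
    using assms by (simp add: wick_def count_image_uminus flip: moment_uminus image_uminus_diff)
  also have "\<dots> = cnj (of_nat k * of_nat (count ms (int k)) * moment (ms - {#int k#}))" by simp
  finally show ?thesis by (simp only: complex_cnj_cancel_iff)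
qed

text \<open>Induction on the total degree deals with the merges of opposite signs. Among all pairs
  of the given degrees the homogeneous equation then bounds \<open>n\<close> times a defect by
  \<open>d - 1\<close> times the supremum of the defects, which is therefore \<open>0\<close> for
  \<open>d \<le> n\<close>.\<close>

theorem wick_formula:
  assumes "k \<ge> 1" "0 \<notin># ms" "pos_degree ms + int k \<le> int n" "neg_degree ms \<le> int n"
  shows "moment (add_mset (int k) ms) = wick k ms"
  using assms
proof (induction "nat (pos_degree ms + int k + neg_degree ms)" arbitrary: k ms rule: less_induct)
  case (less k0 ms0)
  define d where "d = nat (pos_degree ms0 + int k0)"
  define e where "e = neg_degree ms0"
  have d: "int d = pos_degree ms0 + int k0" using degree_nonneg[of ms0] by (simp add: d_def)
  have dn: "d \<le> n" "e \<le> int n" "d \<ge> 1" "e \<ge> 0"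
    using less.prems d degree_nonneg[of ms0] by (auto simp: e_def)
  \<comment> \<open>The class is closed under splitting and positive merging, so the supremum of the
    defects over it can be compared with itself.\<close>
  define T where "T = {(k, ms). k \<ge> 1 \<and> 0 \<notin># ms \<and> pos_degree ms + int k = int d \<and> neg_degree ms = e}"
  have T0: "(k0, ms0) \<in> T" using less.prems d by (simp add: T_def e_def)
  \<comment> \<open>A crude bound; it makes the supremum finite.\<close>
  define C where "C = real n ^ nat (int d + e) * (1 + real n * real_of_int (int d + e))"
  have nreal: "real n \<ge> 1" using dn by simp
  have bound: "norm (defect k ms) \<le> C" if "(k, ms) \<in> T" for k ms
  proof -
    have t: "k \<ge> 1" "0 \<notin># ms" "pos_degree ms + int k = int d" "neg_degree ms = e" using that by (auto simp: T_def)
    have s: "size ms < nat (int d + e)" using size_le_degree[OF t(2)] t by linarith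
    have m1: "norm (moment (add_mset (int k) ms)) \<le> real n ^ nat (int d + e)"
      using s by (intro order_trans[OF norm_moment_le] power_increasing nreal) auto
    have "size (ms - {#- int k#}) \<le> nat (int d + e)" using s size_mset_mono[of "ms - {#- int k#}" ms] by auto
    then have m2: "norm (moment (ms - {#- int k#})) \<le> real n ^ nat (int d + e)"
      by (intro order_trans[OF norm_moment_le] power_increasing nreal)
    have "real (count ms (- int k)) \<le> real_of_int (int d + e)"
      using s count_le_size[of ms "- int k"] by linarith
    moreover have "k \<le> n" using t dn degree_nonneg[of ms] by linarith
    ultimately have "norm (wick k ms) \<le> (real n * real_of_int (int d + e)) * real n ^ nat (int d + e)"
      unfolding wick_def norm_mult norm_of_nat using m2 dn by (intro mult_mono) auto
    moreover have "norm (defect k ms) \<le> norm (moment (add_mset (int k) ms)) + norm (wick k ms)"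
      unfolding defect_def by (rule norm_triangle_ineq4)
    ultimately show ?thesis using m1 by (simp add: C_def algebra_simps)
  qed
  define B where "B = (SUP (k, ms) \<in> T. norm (defect k ms))"
  have bdd: "bdd_above ((\<lambda>(k, ms). norm (defect k ms)) ` T)"
    by (rule bdd_aboveI2[of _ _ C]) (use bound in auto)
  have le_B: "norm (defect k ms) \<le> B" if "(k, ms) \<in> T" for k ms
    using cSUP_upper[OF that bdd] by (simp add: B_def)
  have B0: "B \<ge> 0" using le_B[OF T0] norm_ge_zero order_trans by blast
  \<comment> \<open>The splits contribute \<open>k - 1\<close>; the merges, counted with weight
    \<open>q\<close> and multiplicity, contribute \<open>pos_degree ms\<close>. Together this is
    \<open>d - 1\<close>.\<close>
  have step: "real n * norm (defect k ms) \<le> real (d - 1) * B" if "(k, ms) \<in> T" for k ms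
  proof -
    have t: "k \<ge> 1" "0 \<notin># ms" "pos_degree ms + int k = int d" "neg_degree ms = e" using that by (auto simp: T_def)
    define N where "N = nat (int d + e)"
    have N: "\<bar>m\<bar> \<le> int N" if "m \<in># ms" for m
      using abs_le_degree[OF that] t dn unfolding N_def by linarith
    \<comment> \<open>Merging \<open>k\<close> with \<open>- q\<close> leaves a negative exponent.
      Conjugation makes it positive and exchanges the two degrees, and the total degree has
      dropped.\<close>
    have IH: "moment (add_mset (- int (q - k)) (ms - {#- int q#}))
        = of_nat (q - k) * of_nat (count (ms - {#- int q#}) (int (q - k))) * moment (ms - {#- int q#} - {#int (q - k)#})"
      if q: "q > k" "- int q \<in># ms" for q
    proof (rule wick_uminus, rule less.hyps)
      let ?r = "image_mset uminus (ms - {#- int q#})"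
      have deg: "pos_degree ?r = e - int q" "neg_degree ?r = int d - int k"
        using t degree_remove[OF q(2)] by (simp_all add: degree_uminus)
      have "e \<ge> int q" using degree_nonneg(1)[of ?r] deg by simp
      then show "nat (pos_degree ?r + int (q - k) + neg_degree ?r) < nat (pos_degree ms0 + int k0 + neg_degree ms0)"
        unfolding deg using d q t(1) by (simp add: e_def[symmetric])
      show "q - k \<ge> 1" using q by simp
      show "0 \<notin># ?r" using t(2) by (auto dest: in_diffD)
      show "pos_degree ?r + int (q - k) \<le> int n" unfolding deg using q dn by simp
      show "neg_degree ?r \<le> int n" unfolding deg using dn by simp
    qed
    have A: "norm (\<Sum>s=1..<k. defect s (add_mset (int (k - s)) ms)) \<le> real (k - 1) * B"
    proof -
      have "(s, add_mset (int (k - s)) ms) \<in> T" if "s \<in> {1..<k}" for s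
        using that t by (auto simp: T_def of_nat_diff)
      then have "norm (\<Sum>s=1..<k. defect s (add_mset (int (k - s)) ms)) \<le> (\<Sum>s=1..<k. B)"
        by (intro order_trans[OF norm_sum] sum_mono le_B)
      then show ?thesis by simp
    qed
    have pd: "real_of_int (pos_degree ms) = (\<Sum>q=1..N. real (count ms (int q)) * real q)"
    proof -
      have "pos_degree ms = (\<Sum>q=1..N. int (count ms (int q)) * int q) + (\<Sum>q=1..N. int (count ms (- int q)) * 0)"
        unfolding pos_degree_def by (subst sum_mset_split[where N=N]) (use N t in force)+
      then show ?thesis by (simp add: of_int_sum)
    qed
    have D: "norm (\<Sum>q=1..N. of_nat (count ms (int q)) * (of_nat q * defect (k + q) (ms - {#int q#})))
      \<le> real_of_int (pos_degree ms) * B"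
    proof -
      have "norm (of_nat (count ms (int q)) * (of_nat q * defect (k + q) (ms - {#int q#})))
        \<le> real (count ms (int q)) * real q * B" if q: "q \<in> {1..N}" for q
      proof (cases "int q \<in># ms")
        case True
        have "(k + q, ms - {#int q#}) \<in> T"
          using t q degree_remove[OF True] by (auto simp: T_def dest: in_diffD)
        then show ?thesis using le_B
          by (simp add: norm_mult mult.assoc mult_left_mono)
      next
        case False
        then show ?thesis by (simp add: not_in_iff)
      qed
      then show ?thesis unfolding pd sum_distrib_right by (intro order_trans[OF norm_sum] sum_mono)
    qed
    have eq: "of_nat n * defect k ms = - (\<Sum>s=1..<k. defect s (add_mset (int (k - s)) ms))
      - (\<Sum>q=1..N. of_nat (count ms (int q)) * (of_nat q * defect (k + q) (ms - {#int q#})))"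
      using defect_loop[OF t(1,2) N IH] by (simp add: algebra_simps eq_neg_iff_add_eq_0)
    have "norm (of_nat n * defect k ms) \<le> real (k - 1) * B + real_of_int (pos_degree ms) * B"
      unfolding eq using A D norm_triangle_ineq4[of "- (\<Sum>s=1..<k. defect s (add_mset (int (k - s)) ms))"
        "\<Sum>q=1..N. of_nat (count ms (int q)) * (of_nat q * defect (k + q) (ms - {#int q#}))"]
      unfolding norm_minus_cancel by linarith
    also have "\<dots> = (real (k - 1) + real_of_int (pos_degree ms)) * B" by (simp add: distrib_right)
    also have "real (k - 1) + real_of_int (pos_degree ms) = real (d - 1)"
      using t(1,3) dn(3) by (simp add: of_nat_diff)
    finally show ?thesis by (simp add: norm_mult)
  qed
  have "B \<le> real (d - 1) / real n * B"
    unfolding B_def[of] 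
  proof (rule cSUP_least)
    show "T \<noteq> {}" using T0 by auto
    fix x assume "x \<in> T"
    then show "(case x of (k, ms) \<Rightarrow> norm (defect k ms)) \<le> real (d - 1) / real n * (SUP (k, ms) \<in> T. norm (defect k ms))"
      using step nreal unfolding B_def[symmetric] by (cases x) (auto simp: field_simps)
  qed
  then have "real n * B \<le> real (d - 1) * B" using nreal by (simp add: field_simps)
  then have "(real n - real (d - 1)) * B \<le> 0" by (simp add: algebra_simps)
  \<comment> \<open>The bound \<open>d \<le> n\<close> on the degree is used here: it makes the
    inequality for the supremum a strict contraction.\<close>
  moreover have "real n - real (d - 1) > 0" using dn by linarith
  ultimately have "B \<le> 0" by (simp add: mult_le_0_iff)
  then have "defect k0 ms0 = 0" using le_B[OF T0] by (metis norm_le_zero_iff order_trans)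
  then show ?case by (simp add: defect_def)
qed

end

section \<open>Linear statistics\<close>

context haar_unitary
begin

definition linear_stat :: "nat \<Rightarrow> (nat \<Rightarrow> complex) \<Rightarrow> complex mat \<Rightarrow> complex" where
  "linear_stat m \<alpha> W = (\<Sum>j=1..m. \<alpha> j * ptr W (int j))"

lemma bm_linear_stat: "bm (linear_stat m \<alpha>)"
  unfolding linear_stat_def by (intro bm_sum bm_mult bm_const bm_ptr) auto

text \<open>The multiset factor lets inductions on \<open>a\<close> and \<open>b\<close> peel off
  one statistic at a time: each peeled term becomes a single trace in \<open>ms\<close>.\<close>

definition mixed :: "nat \<Rightarrow> (nat \<Rightarrow> complex) \<Rightarrow> int multiset \<Rightarrow> nat \<Rightarrow> nat \<Rightarrow> complex" where
  "mixed m \<alpha> ms a b = (\<integral>W. pprod ms W * linear_stat m \<alpha> W ^ a * cnj (linear_stat m \<alpha> W) ^ b \<partial>\<mu>)"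

lemma bm_mixed: "bm (\<lambda>W. pprod ms W * linear_stat m \<alpha> W ^ a * cnj (linear_stat m \<alpha> W) ^ b)"
  by (intro bm_mult bm_power bm_cnj bm_pprod bm_linear_stat)

lemma mixed_0: "mixed m \<alpha> ms 0 0 = moment ms"
  by (simp add: mixed_def moment_def)

lemma integral_sum_bm:
  assumes "\<And>j. j \<in> I \<Longrightarrow> bm (f j)"
  shows "(\<integral>W. (\<Sum>j\<in>I. f j W) \<partial>\<mu>) = (\<Sum>j\<in>I. \<integral>W. f j W \<partial>\<mu>)"
  using assms by (intro Bochner_Integration.integral_sum bm_integrable) auto

lemma mixed_Suc_left:
  "mixed m \<alpha> ms (Suc a) b = (\<Sum>j=1..m. \<alpha> j * mixed m \<alpha> (add_mset (int j) ms) a b)"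
proof -
  have "mixed m \<alpha> ms (Suc a) b = (\<integral>W. (\<Sum>j=1..m. \<alpha> j * (pprod (add_mset (int j) ms) W
      * linear_stat m \<alpha> W ^ a * cnj (linear_stat m \<alpha> W) ^ b)) \<partial>\<mu>)"
    unfolding mixed_def
  proof (intro Bochner_Integration.integral_cong refl)
    fix W
    have "pprod ms W * linear_stat m \<alpha> W ^ Suc a * cnj (linear_stat m \<alpha> W) ^ b
      = (\<Sum>j=1..m. \<alpha> j * ptr W (int j)) * (pprod ms W * linear_stat m \<alpha> W ^ a * cnj (linear_stat m \<alpha> W) ^ b)"
      unfolding linear_stat_def[symmetric] by (simp only: power_Suc mult_ac)
    then show "pprod ms W * linear_stat m \<alpha> W ^ Suc a * cnj (linear_stat m \<alpha> W) ^ b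
      = (\<Sum>j=1..m. \<alpha> j * (pprod (add_mset (int j) ms) W * linear_stat m \<alpha> W ^ a * cnj (linear_stat m \<alpha> W) ^ b))"
      by (simp only: sum_distrib_right pprod_add mult.assoc)
  qed
  also have "\<dots> = (\<Sum>j=1..m. \<alpha> j * mixed m \<alpha> (add_mset (int j) ms) a b)"
    unfolding mixed_def
    by (subst integral_sum_bm[OF bm_mult[OF bm_const bm_mixed]]) simp
  finally show ?thesis .
qed

lemma mixed_Suc_right:
  "mixed m \<alpha> ms a (Suc b) = (\<Sum>j=1..m. cnj (\<alpha> j) * mixed m \<alpha> (add_mset (- int j) ms) a b)"
proof -
  have "mixed m \<alpha> ms a (Suc b) = (\<integral>W. (\<Sum>j=1..m. cnj (\<alpha> j) * (pprod (add_mset (- int j) ms) W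
      * linear_stat m \<alpha> W ^ a * cnj (linear_stat m \<alpha> W) ^ b)) \<partial>\<mu>)"
    unfolding mixed_def
  proof (intro Bochner_Integration.integral_cong refl)
    fix W
    have c: "cnj (linear_stat m \<alpha> W) = (\<Sum>j=1..m. cnj (\<alpha> j) * ptr W (- int j))"
      by (simp add: linear_stat_def cnj_sum ptr_uminus)
    have "pprod ms W * linear_stat m \<alpha> W ^ a * cnj (linear_stat m \<alpha> W) ^ Suc b
      = (\<Sum>j=1..m. cnj (\<alpha> j) * ptr W (- int j)) * (pprod ms W * linear_stat m \<alpha> W ^ a * cnj (linear_stat m \<alpha> W) ^ b)"
      unfolding c[symmetric] by (simp only: power_Suc mult_ac)
    then show "pprod ms W * linear_stat m \<alpha> W ^ a * cnj (linear_stat m \<alpha> W) ^ Suc b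
      = (\<Sum>j=1..m. cnj (\<alpha> j) * (pprod (add_mset (- int j) ms) W * linear_stat m \<alpha> W ^ a * cnj (linear_stat m \<alpha> W) ^ b))"
      by (simp only: sum_distrib_right pprod_add mult.assoc)
  qed
  also have "\<dots> = (\<Sum>j=1..m. cnj (\<alpha> j) * mixed m \<alpha> (add_mset (- int j) ms) a b)"
    unfolding mixed_def
    by (subst integral_sum_bm[OF bm_mult[OF bm_const bm_mixed]]) simp
  finally show ?thesis .
qed

text \<open>\<open>tr U^k\<close> is contracted with a conjugate trace in \<open>ms\<close> or with
  one of the \<open>b\<close> conjugate statistics, where its coefficient is
  \<open>cnj (\<alpha> k)\<close>. Each of these has degree at most \<open>m\<close>, hence
  \<open>b * m\<close> in the degree bound. The truncated \<open>b - 1\<close> at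
  \<open>b = 0\<close> is multiplied by \<open>0\<close>.\<close>

lemma mixed_wick_right:
  assumes k: "k \<ge> 1" "k \<le> m" and "0 \<notin># ms"
    and "pos_degree ms + int k \<le> int n" "neg_degree ms + int (b * m) \<le> int n"
  shows "mixed m \<alpha> (add_mset (int k) ms) 0 b
    = of_nat (k * count ms (- int k)) * mixed m \<alpha> (ms - {#- int k#}) 0 b
      + of_nat (k * b) * cnj (\<alpha> k) * mixed m \<alpha> ms 0 (b - 1)"
  using assms(3-)
proof (induction b arbitrary: ms)
  case 0
  then show ?case using k by (simp add: mixed_0 wick_formula wick_def)
next
  case (Suc b)
  have IH: "mixed m \<alpha> (add_mset (int k) (add_mset (- int j) ms)) 0 b
    = of_nat (k * count (add_mset (- int j) ms) (- int k)) * mixed m \<alpha> (add_mset (- int j) ms - {#- int k#}) 0 b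
      + of_nat (k * b) * cnj (\<alpha> k) * mixed m \<alpha> (add_mset (- int j) ms) 0 (b - 1)" if j: "j \<in> {1..m}" for j
    by (rule Suc.IH) (use Suc.prems j in auto)
  have c: "of_nat (k * count (add_mset (- int j) ms) (- int k)) * mixed m \<alpha> (add_mset (- int j) ms - {#- int k#}) 0 b
    = of_nat (k * count ms (- int k)) * mixed m \<alpha> (add_mset (- int j) (ms - {#- int k#})) 0 b
      + (if j = k then of_nat k * mixed m \<alpha> ms 0 b else 0)" for j
  proof (cases "- int k \<in># ms")
    case True
    then obtain ms' where "ms = add_mset (- int k) ms'" by (metis multi_member_split)
    then show ?thesis by (auto simp: algebra_simps add_mset_commute)
  next
    case False
    then show ?thesis by (auto simp: not_in_iff)
  qed
  have s: "of_nat (k * b) * cnj (\<alpha> k) * mixed m \<alpha> ms 0 (Suc (b - 1)) = of_nat (k * b) * cnj (\<alpha> k) * mixed m \<alpha> ms 0 b"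
    by (cases b) simp_all
  have "mixed m \<alpha> (add_mset (int k) ms) 0 (Suc b)
    = (\<Sum>j=1..m. cnj (\<alpha> j) * mixed m \<alpha> (add_mset (int k) (add_mset (- int j) ms)) 0 b)"
    unfolding mixed_Suc_right by (simp add: add_mset_commute)
  also have "\<dots> = (\<Sum>j=1..m. of_nat (k * count ms (- int k)) * (cnj (\<alpha> j) * mixed m \<alpha> (add_mset (- int j) (ms - {#- int k#})) 0 b)
      + (if j = k then cnj (\<alpha> k) * of_nat k * mixed m \<alpha> ms 0 b else 0)
      + of_nat (k * b) * cnj (\<alpha> k) * (cnj (\<alpha> j) * mixed m \<alpha> (add_mset (- int j) ms) 0 (b - 1)))"
  proof (intro sum.cong refl)
    fix j assume j: "j \<in> {1..m}"
    show "cnj (\<alpha> j) * mixed m \<alpha> (add_mset (int k) (add_mset (- int j) ms)) 0 b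
      = of_nat (k * count ms (- int k)) * (cnj (\<alpha> j) * mixed m \<alpha> (add_mset (- int j) (ms - {#- int k#})) 0 b)
      + (if j = k then cnj (\<alpha> k) * of_nat k * mixed m \<alpha> ms 0 b else 0)
      + of_nat (k * b) * cnj (\<alpha> k) * (cnj (\<alpha> j) * mixed m \<alpha> (add_mset (- int j) ms) 0 (b - 1))"
      unfolding IH[OF j] c by (cases "j = k") (simp_all add: algebra_simps)
  qed
  also have "\<dots> = of_nat (k * count ms (- int k)) * mixed m \<alpha> (ms - {#- int k#}) 0 (Suc b)
      + cnj (\<alpha> k) * of_nat k * mixed m \<alpha> ms 0 b + of_nat (k * b) * cnj (\<alpha> k) * mixed m \<alpha> ms 0 b"
    unfolding sum.distrib sum_distrib_left[symmetric] mixed_Suc_right[symmetric] s using k by simp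
  finally show ?case by (simp add: algebra_simps)
qed

text \<open>The unconjugated statistics only add positive exponents, which are never contracted with
  \<open>tr U^k\<close>; they are carried along by linearity.\<close>

lemma mixed_wick:
  assumes k: "k \<ge> 1" "k \<le> m" and "0 \<notin># ms"
    and "pos_degree ms + int k + int (a * m) \<le> int n" "neg_degree ms + int (b * m) \<le> int n"
  shows "mixed m \<alpha> (add_mset (int k) ms) a b
    = of_nat (k * count ms (- int k)) * mixed m \<alpha> (ms - {#- int k#}) a b
      + of_nat (k * b) * cnj (\<alpha> k) * mixed m \<alpha> ms a (b - 1)"
  using assms(3-)
proof (induction a arbitrary: ms)
  case 0
  then show ?case using k by (simp add: mixed_wick_right)
next
  case (Suc a)
  have IH: "mixed m \<alpha> (add_mset (int k) (add_mset (int j) ms)) a b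
    = of_nat (k * count (add_mset (int j) ms) (- int k)) * mixed m \<alpha> (add_mset (int j) ms - {#- int k#}) a b
      + of_nat (k * b) * cnj (\<alpha> k) * mixed m \<alpha> (add_mset (int j) ms) a (b - 1)" if j: "j \<in> {1..m}" for j
    by (rule Suc.IH) (use Suc.prems j in auto)
  have c: "of_nat (k * count (add_mset (int j) ms) (- int k)) * mixed m \<alpha> (add_mset (int j) ms - {#- int k#}) a b
    = of_nat (k * count ms (- int k)) * mixed m \<alpha> (add_mset (int j) (ms - {#- int k#})) a b"
    if j: "j \<in> {1..m}" for j
  proof (cases "- int k \<in># ms")
    case True
    then obtain ms' where "ms = add_mset (- int k) ms'" by (metis multi_member_split)
    then show ?thesis using j by (auto simp: add_mset_commute)
  next
    case False
    then show ?thesis using j by (auto simp: not_in_iff)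
  qed
  have "mixed m \<alpha> (add_mset (int k) ms) (Suc a) b
    = (\<Sum>j=1..m. \<alpha> j * mixed m \<alpha> (add_mset (int k) (add_mset (int j) ms)) a b)"
    unfolding mixed_Suc_left by (simp add: add_mset_commute)
  also have "\<dots> = (\<Sum>j=1..m. of_nat (k * count ms (- int k)) * (\<alpha> j * mixed m \<alpha> (add_mset (int j) (ms - {#- int k#})) a b)
      + of_nat (k * b) * cnj (\<alpha> k) * (\<alpha> j * mixed m \<alpha> (add_mset (int j) ms) a (b - 1)))"
    by (intro sum.cong refl) (simp add: IH c algebra_simps)
  also have "\<dots> = of_nat (k * count ms (- int k)) * mixed m \<alpha> (ms - {#- int k#}) (Suc a) b
      + of_nat (k * b) * cnj (\<alpha> k) * mixed m \<alpha> ms (Suc a) (b - 1)"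
    unfolding sum.distrib sum_distrib_left[symmetric] mixed_Suc_left[symmetric] ..
  finally show ?case .
qed

lemma mixed_cnj: "mixed m \<alpha> {#} b a = cnj (mixed m \<alpha> {#} a b)"
proof -
  have "mixed m \<alpha> {#} b a
    = (\<integral>W. cnj (pprod {#} W * linear_stat m \<alpha> W ^ a * cnj (linear_stat m \<alpha> W) ^ b) \<partial>\<mu>)"
    unfolding mixed_def
    by (intro Bochner_Integration.integral_cong refl) (simp add: pprod_empty mult.commute)
  then show ?thesis by (simp only: Bochner_Integration.integral_cnj mixed_def)
qed

text \<open>Gaussian integration by parts for the statistic: contracting
  \<open>\<alpha> k tr U^k\<close> with a conjugate statistic gives \<open>k |\<alpha> k|^2\<close>,
  and the sum over \<open>k\<close> is the variance.\<close>

lemma mixed_Suc_Suc: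
  assumes "Suc a * m \<le> n" "b * m \<le> n"
  shows "mixed m \<alpha> {#} (Suc a) b
    = of_nat b * of_real (\<Sum>k=1..m. real k * (norm (\<alpha> k))\<^sup>2) * mixed m \<alpha> {#} a (b - 1)"
proof -
  have "mixed m \<alpha> {#} (Suc a) b = (\<Sum>k=1..m. \<alpha> k * mixed m \<alpha> (add_mset (int k) {#}) a b)"
    by (rule mixed_Suc_left)
  also have "\<dots> = (\<Sum>k=1..m. of_nat b * of_real (real k * (norm (\<alpha> k))\<^sup>2) * mixed m \<alpha> {#} a (b - 1))"
  proof (intro sum.cong refl)
    fix k assume k: "k \<in> {1..m}"
    have "int k + int (a * m) \<le> int n"
    proof -
      have "k + a * m \<le> m + a * m" using k by simp
      also have "\<dots> \<le> n" using assms(1) by simp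
      finally show ?thesis by (simp only: of_nat_add[symmetric] of_nat_le_iff)
    qed
    moreover have "int (b * m) \<le> int n" using assms(2) by (simp only: of_nat_le_iff)
    ultimately have "mixed m \<alpha> (add_mset (int k) {#}) a b = of_nat (k * b) * cnj (\<alpha> k) * mixed m \<alpha> {#} a (b - 1)"
      using mixed_wick[of k m "{#}" a b \<alpha>] k by simp
    moreover have "complex_of_real (real k * (norm (\<alpha> k))\<^sup>2) = of_nat k * (\<alpha> k * cnj (\<alpha> k))"
      by (simp only: of_real_mult of_real_of_nat_eq complex_norm_square)
    ultimately show "\<alpha> k * mixed m \<alpha> (add_mset (int k) {#}) a b
       = of_nat b * of_real (real k * (norm (\<alpha> k))\<^sup>2) * mixed m \<alpha> {#} a (b - 1)"
      by (simp only: of_nat_mult mult_ac)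
  qed
  finally show ?thesis by (simp only: of_real_sum sum_distrib_left sum_distrib_right)
qed

lemma mixed_moment:
  assumes "a * m \<le> n" "b * m \<le> n"
  shows "mixed m \<alpha> {#} a b
    = (if a = b then fact a * of_real (\<Sum>k=1..m. real k * (norm (\<alpha> k))\<^sup>2) ^ a else 0)"
  using assms
proof (induction a arbitrary: b)
  case 0
  show ?case
  proof (cases b)
    case (Suc c)
    have "mixed m \<alpha> {#} (Suc c) 0 = 0" using mixed_Suc_Suc[of c m 0] 0 Suc by simp
    then show ?thesis using Suc mixed_cnj[of m \<alpha> 0 "Suc c"] by simp
  qed (simp add: mixed_0 moment_def pprod_empty prob_space)
next
  case (Suc a)
  have le: "a * m \<le> n" using Suc.prems(1) by simp
  show ?case
  proof (cases b)
    case 0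
    then show ?thesis using mixed_Suc_Suc[OF Suc.prems(1), of 0] by simp
  next
    case (Suc c)
    then have "c * m \<le> n" using Suc.prems(2) by simp
    then show ?thesis
      using mixed_Suc_Suc[OF \<open>Suc a * m \<le> n\<close> \<open>b * m \<le> n\<close>] Suc.IH[OF le, of c] Suc by (simp add: algebra_simps)
  qed
qed

definition variance_stat :: "nat \<Rightarrow> (nat \<Rightarrow> complex) \<Rightarrow> real" where
  "variance_stat m \<alpha> = (\<Sum>k=1..m. real k * (norm (\<alpha> k))\<^sup>2)"

text \<open>In the binomial expansion of \<open>((S + cnj S) / 2) ^ K\<close> only the balanced term
  survives. The values are those of a centred real Gaussian with half the variance of
  \<open>S\<close>.\<close>

lemma real_moment:
  assumes "K * m \<le> n"
  shows "(\<integral>W. Re (linear_stat m \<alpha> W) ^ K \<partial>\<mu>)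
    = (if even K then fact K / fact (K div 2) * (variance_stat m \<alpha> / 4) ^ (K div 2) else 0)"
proof -
  let ?S = "linear_stat m \<alpha>"
  have "complex_of_real (\<integral>W. Re (?S W) ^ K \<partial>\<mu>) = (\<integral>W. complex_of_real (Re (?S W) ^ K) \<partial>\<mu>)"
    by (rule integral_complex_of_real[symmetric])
  also have "\<dots> = (\<integral>W. (\<Sum>q\<le>K. of_nat (K choose q) / 2 ^ K * (pprod {#} W * ?S W ^ q * cnj (?S W) ^ (K - q))) \<partial>\<mu>)"
  proof (intro Bochner_Integration.integral_cong refl)
    fix W
    have "complex_of_real (Re (?S W) ^ K) = ((?S W + cnj (?S W)) / 2) ^ K"
      by (simp add: complex_add_cnj)
    also have "\<dots> = (\<Sum>q\<le>K. of_nat (K choose q) * ?S W ^ q * cnj (?S W) ^ (K - q)) / 2 ^ K"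
      by (simp add: power_divide binomial_ring)
    finally show "complex_of_real (Re (?S W) ^ K)
      = (\<Sum>q\<le>K. of_nat (K choose q) / 2 ^ K * (pprod {#} W * ?S W ^ q * cnj (?S W) ^ (K - q)))"
      by (simp add: sum_divide_distrib pprod_empty mult.assoc)
  qed
  also have "\<dots> = (\<Sum>q\<le>K. of_nat (K choose q) / 2 ^ K * mixed m \<alpha> {#} q (K - q))"
    unfolding mixed_def by (subst integral_sum_bm[OF bm_mult[OF bm_const bm_mixed]]) simp
  also have "\<dots> = (\<Sum>q\<le>K. if q = K div 2 then (if even K then of_nat (K choose q) / 2 ^ K * (fact q * of_real (variance_stat m \<alpha>) ^ q) else 0) else 0)"
  proof (intro sum.cong refl)
    fix q assume q: "q \<in> {..K}"
    have "q * m \<le> K * m" "(K - q) * m \<le> K * m" using q by (auto intro: mult_right_mono)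
    then have "mixed m \<alpha> {#} q (K - q) = (if q = K - q then fact q * of_real (variance_stat m \<alpha>) ^ q else 0)"
      unfolding variance_stat_def by (intro mixed_moment) (use assms in linarith)+
    moreover have "q = K - q \<longleftrightarrow> q = K div 2 \<and> even K" using q by auto presburger+
    ultimately show "of_nat (K choose q) / 2 ^ K * mixed m \<alpha> {#} q (K - q)
      = (if q = K div 2 then (if even K then of_nat (K choose q) / 2 ^ K * (fact q * of_real (variance_stat m \<alpha>) ^ q) else 0) else 0)"
      by simp
  qed
  also have "\<dots> = (if even K then of_nat (K choose (K div 2)) / 2 ^ K * (fact (K div 2) * of_real (variance_stat m \<alpha>) ^ (K div 2)) else 0)"
    by simp
  also have "\<dots> = complex_of_real (if even K then fact K / fact (K div 2) * (variance_stat m \<alpha> / 4) ^ (K div 2) else 0)"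
  proof (cases "even K")
    case True
    then obtain q where K: "K = 2 * q" by (elim evenE)
    have "fact q * fact q * ((2 * q) choose q) = (fact (2 * q) :: nat)"
      using binomial_fact_lemma[of q "2 * q"] by (simp add: mult_2)
    then have "fact q * fact q * of_nat ((2 * q) choose q) = (fact (2 * q) :: complex)"
      by (metis of_nat_fact of_nat_mult)
    then have "of_nat ((2 * q) choose q) * fact q = (fact (2 * q) / fact q :: complex)"
      by (simp add: field_simps)
    note ch = this
    have "of_nat ((2 * q) choose q) / 2 ^ (2 * q) * (fact q * of_real (variance_stat m \<alpha>) ^ q)
      = (of_nat ((2 * q) choose q) * fact q) * (of_real (variance_stat m \<alpha>) ^ q / (4 ^ q :: complex))"
      by (simp add: power_mult)
    also have "\<dots> = fact (2 * q) / fact q * (of_real (variance_stat m \<alpha>) ^ q / 4 ^ q)"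
      unfolding ch ..
    finally show ?thesis unfolding K by (simp add: power_divide)
  qed simp
  finally show ?thesis by (simp only: of_real_eq_iff)
qed

text \<open>Moments are Gaussian only up to order \<open>n / m\<close>, so the characteristic
  function is compared with a Taylor polynomial. Stopping just before the even order
  \<open>2 * L\<close> makes the remainder an ordinary moment, which is also known.\<close>

lemma char_linear_stat:
  assumes "2 * L * m \<le> n"
  shows "norm ((\<integral>W. cis (Re (linear_stat m \<alpha> W)) \<partial>\<mu>) - of_real (\<Sum>q<L. (- variance_stat m \<alpha> / 4) ^ q / fact q))
    \<le> (variance_stat m \<alpha> / 4) ^ L / fact L"
proof (cases "L = 0")
  case True
  have "norm (\<integral>W. cis (Re (linear_stat m \<alpha> W)) \<partial>\<mu>) \<le> (\<integral>W. norm (cis (Re (linear_stat m \<alpha> W))) \<partial>\<mu>)"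
    by (rule integral_norm_bound)
  then show ?thesis using True by (simp add: prob_space)
next
  case False
  let ?X = "\<lambda>W. Re (linear_stat m \<alpha> W)" and ?v = "variance_stat m \<alpha>"
  obtain K where K: "2 * L = Suc K" using False by (cases "2 * L") auto
  obtain C where C: "\<And>W. W \<in> unitary_group n \<Longrightarrow> norm (linear_stat m \<alpha> W) \<le> C"
    using bm_linear_stat unfolding bm_def by blast
  have Xm: "?X \<in> borel_measurable \<mu>"
    using bm_measurable[OF bm_linear_stat] by measurable
  have cm: "(\<lambda>W. cis (?X W)) \<in> borel_measurable \<mu>"
    by (rule measurable_compose[OF bm_measurable[OF bm_linear_stat]])
      (intro borel_measurable_continuous_onI continuous_intros)
  have XC: "\<bar>?X W\<bar> \<le> C" if "W \<in> unitary_group n" for W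
    using C[OF that] abs_Re_le_cmod[of "linear_stat m \<alpha> W"] by linarith
  have iX: "integrable \<mu> (\<lambda>W. ?X W ^ k)" for k
    by (rule integrable_const_bound[of _ "C ^ k"])
      (use Xm XC in \<open>auto simp: space_eq power_abs intro!: power_mono\<close>)
  have ic: "integrable \<mu> (\<lambda>W. cis (?X W))"
    by (rule integrable_const_bound[of _ 1]) (use cm in auto)
  have iT: "integrable \<mu> (\<lambda>W. (\<i> * of_real (?X W)) ^ k / fact k)" for k
  proof -
    have "integrable \<mu> (\<lambda>W. \<i> ^ k / fact k * complex_of_real (?X W ^ k))"
      by (intro integrable_mult_right integrable_of_real iX)
    then show ?thesis by (simp add: power_mult_distrib)
  qed
  have "(\<integral>W. (\<Sum>k\<le>K. (\<i> * of_real (?X W)) ^ k / fact k) \<partial>\<mu>)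
    = (\<Sum>k\<le>K. \<i> ^ k / fact k * complex_of_real (\<integral>W. ?X W ^ k \<partial>\<mu>))"
  proof -
    have "(\<integral>W. (\<Sum>k\<le>K. (\<i> * of_real (?X W)) ^ k / fact k) \<partial>\<mu>)
       = (\<Sum>k\<le>K. \<integral>W. (\<i> * of_real (?X W)) ^ k / fact k \<partial>\<mu>)"
      using iT by (intro Bochner_Integration.integral_sum) auto
    also have "\<dots> = (\<Sum>k\<le>K. \<integral>W. \<i> ^ k / fact k * complex_of_real (?X W ^ k) \<partial>\<mu>)"
      by (simp add: power_mult_distrib)
    finally show ?thesis by (simp only: integral_mult_right_zero integral_complex_of_real)
  qed
  also have "\<dots> = (\<Sum>k<2 * L. \<i> ^ k / fact k * complex_of_real (if even k then fact k / fact (k div 2) * (?v / 4) ^ (k div 2) else 0))"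
  proof -
    have "{..K} = {..<2 * L}" using K by auto
    moreover have "k * m \<le> n" if "k < 2 * L" for k
      using that assms mult_right_mono[of k "2 * L" m] by linarith
    ultimately show ?thesis using real_moment by (intro sum.cong) auto
  qed
  also have "\<dots> = of_real (\<Sum>q<L. (- ?v / 4) ^ q / fact q)"
  proof (induction L)
    case (Suc L)
    have "{..<2 * Suc L} = insert (2 * L) (insert (Suc (2 * L)) {..<2 * L})" by auto
    then show ?case using Suc by (simp add: power_mult power_mult_distrib[of "-1" "?v/4", simplified] power_divide power_minus')
  qed simp
  finally have T: "(\<integral>W. (\<Sum>k\<le>K. (\<i> * of_real (?X W)) ^ k / fact k) \<partial>\<mu>) = of_real (\<Sum>q<L. (- ?v / 4) ^ q / fact q)" .
  have "norm ((\<integral>W. cis (?X W) \<partial>\<mu>) - (\<integral>W. (\<Sum>k\<le>K. (\<i> * of_real (?X W)) ^ k / fact k) \<partial>\<mu>))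
     = norm (\<integral>W. cis (?X W) - (\<Sum>k\<le>K. (\<i> * of_real (?X W)) ^ k / fact k) \<partial>\<mu>)"
    using ic iT by (subst Bochner_Integration.integral_diff) auto
  also have "\<dots> \<le> (\<integral>W. norm (cis (?X W) - (\<Sum>k\<le>K. (\<i> * of_real (?X W)) ^ k / fact k)) \<partial>\<mu>)"
    by (rule integral_norm_bound)
  also have "\<dots> \<le> (\<integral>W. ?X W ^ (2 * L) / fact (2 * L) \<partial>\<mu>)"
  proof (intro integral_mono)
    show "integrable \<mu> (\<lambda>W. norm (cis (?X W) - (\<Sum>k\<le>K. (\<i> * of_real (?X W)) ^ k / fact k)))"
      using ic iT by (intro integrable_norm Bochner_Integration.integrable_diff Bochner_Integration.integrable_sum) auto
    show "integrable \<mu> (\<lambda>W. ?X W ^ (2 * L) / fact (2 * L))" using iX by simp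
    fix W
    show "norm (cis (?X W) - (\<Sum>k\<le>K. (\<i> * of_real (?X W)) ^ k / fact k)) \<le> ?X W ^ (2 * L) / fact (2 * L)"
      using iexp_approx1[of "?X W" K] unfolding K[symmetric] by (simp add: cis_conv_exp power_even_abs)
  qed
  also have "\<dots> = (?v / 4) ^ L / fact L"
    using real_moment[of "2 * L" m \<alpha>] assms by simp
  finally show ?thesis unfolding T .
qed

text \<open>Multiplication by a scalar of modulus one preserves the measure; the angle
  \<open>pi / (p - q)\<close> reverses the sign of a function of bidegree
  \<open>(p, q)\<close>.\<close>

lemma integral_phase_eq_0:
  fixes f :: "complex mat \<Rightarrow> complex"
  assumes f: "f \<in> borel_measurable \<mu>" and "p \<noteq> q"
    and hom: "\<And>W \<theta>. W \<in> unitary_group n \<Longrightarrow> f ((cis \<theta> \<cdot>\<^sub>m 1\<^sub>m n) * W) = cis (real p * \<theta>) * cis (- real q * \<theta>) * f W"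
  shows "(\<integral>W. f W \<partial>\<mu>) = 0"
proof -
  define \<theta> where "\<theta> = pi / (real p - real q)"
  have V: "cis \<theta> \<cdot>\<^sub>m 1\<^sub>m n \<in> unitary_group n"
    unfolding unitary_group_iff
  proof (intro conjI allI impI)
    fix i j assume ij: "i < n" "j < n"
    have "(\<Sum>k<n. cnj ((cis \<theta> \<cdot>\<^sub>m 1\<^sub>m n) $$ (k, i)) * (cis \<theta> \<cdot>\<^sub>m 1\<^sub>m n) $$ (k, j))
      = (\<Sum>k<n. if k = i then of_bool (i = j) else 0)"
      using ij by (intro sum.cong) (auto simp: cis_cnj cis_mult)
    then show "(\<Sum>k<n. cnj ((cis \<theta> \<cdot>\<^sub>m 1\<^sub>m n) $$ (k, i)) * (cis \<theta> \<cdot>\<^sub>m 1\<^sub>m n) $$ (k, j)) = of_bool (i = j)"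
      using ij by simp
  qed simp
  have pq: "real p * \<theta> - real q * \<theta> = pi"
  proof -
    have "real p * \<theta> - real q * \<theta> = (real p - real q) * \<theta>" by (simp add: left_diff_distrib)
    then show ?thesis using \<open>p \<noteq> q\<close> by (simp add: \<theta>_def)
  qed
  have "(\<integral>W. f W \<partial>\<mu>) = (\<integral>W. f ((cis \<theta> \<cdot>\<^sub>m 1\<^sub>m n) * W) \<partial>\<mu>)"
    by (rule integral_invariant[OF V f, symmetric])
  also have "\<dots> = (\<integral>W. - f W \<partial>\<mu>)"
    by (intro Bochner_Integration.integral_cong refl) (simp add: hom space_eq cis_mult pq)
  finally show ?thesis by simp
qed

lemma scalar_mult_index:
  fixes z :: complex
  shows "W \<in> carrier_mat n n \<Longrightarrow> a < n \<Longrightarrow> b < n \<Longrightarrow> ((z \<cdot>\<^sub>m 1\<^sub>m n) * W) $$ (a, b) = z * W $$ (a, b)"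
proof -
  assume *: "W \<in> carrier_mat n n" "a < n" "b < n"
  have "((z \<cdot>\<^sub>m 1\<^sub>m n) * W) $$ (a, b) = (\<Sum>k<n. (z \<cdot>\<^sub>m 1\<^sub>m n) $$ (a, k) * W $$ (k, b))"
    using * by (intro mat_mult_index) auto
  also have "\<dots> = (\<Sum>k<n. if k = a then z * W $$ (a, b) else 0)"
    using * by (intro sum.cong) auto
  finally show ?thesis using * by simp
qed

lemma scalar_mult_carrier: "(W :: complex mat) \<in> carrier_mat n n \<Longrightarrow> (z \<cdot>\<^sub>m 1\<^sub>m n) * W \<in> carrier_mat n n"
  by (rule mult_carrier_mat[of _ n n]) auto

lemma pw_scalar:
  "W \<in> carrier_mat n n \<Longrightarrow> a < n \<Longrightarrow> b < n \<Longrightarrow> pw ((z \<cdot>\<^sub>m 1\<^sub>m n) * W) k a b = z ^ k * pw W k a b"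
proof (induction k arbitrary: b)
  case 0
  then show ?case by (simp add: pw_0[OF scalar_mult_carrier] pw_0[of _ n])
next
  case (Suc k)
  have c: "(z \<cdot>\<^sub>m 1\<^sub>m n) * W \<in> carrier_mat n n" using Suc.prems by (intro scalar_mult_carrier)
  show ?case
    using Suc by (simp add: pw_Suc[OF c] pw_Suc[OF Suc.prems(1)] scalar_mult_index sum_distrib_left mult_ac del: index_mult_mat)
qed

lemma ptr_scalar:
  assumes "W \<in> carrier_mat n n"
  shows "ptr ((z \<cdot>\<^sub>m 1\<^sub>m n) * W) (int k) = z ^ k * ptr W (int k)"
proof -
  have c: "(z \<cdot>\<^sub>m 1\<^sub>m n) * W \<in> carrier_mat n n" using assms by (rule scalar_mult_carrier)
  show ?thesis by (simp add: ptr_nat[OF c] ptr_nat[OF assms] pw_scalar[OF assms] sum_distrib_left)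
qed

lemma ptr_orthogonal:
  assumes "j \<noteq> k"
  shows "(\<integral>W. ptr W (int j) * cnj (ptr W (int k)) \<partial>\<mu>) = 0"
proof (rule integral_phase_eq_0[OF _ assms])
  show "(\<lambda>W. ptr W (int j) * cnj (ptr W (int k))) \<in> borel_measurable \<mu>"
    by (intro bm_measurable bm_mult bm_cnj bm_ptr)
qed (auto simp: ptr_scalar[OF unitary_carrier] Complex.DeMoivre cis_cnj mult_ac)

definition trace_var :: "nat \<Rightarrow> real" where
  "trace_var j = (\<integral>W. (norm (ptr W (int j)))\<^sup>2 \<partial>\<mu>)"

lemma trace_var_complex: "complex_of_real (trace_var j) = (\<integral>W. ptr W (int j) * cnj (ptr W (int j)) \<partial>\<mu>)"
  unfolding trace_var_def by (simp only: integral_complex_of_real[symmetric] complex_norm_square)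

lemma trace_var_eq: "1 \<le> j \<Longrightarrow> j \<le> n \<Longrightarrow> trace_var j = real j"
proof -
  assume j: "1 \<le> j" "j \<le> n"
  have "complex_of_real (trace_var j) = moment (add_mset (int j) {#- int j#})"
    unfolding trace_var_complex moment_def
    by (intro Bochner_Integration.integral_cong refl) (simp add: pprod_add pprod_empty ptr_uminus)
  also have "\<dots> = wick j {#- int j#}" using j by (intro wick_formula) auto
  also have "\<dots> = of_nat j" by (simp add: wick_def moment_def pprod_empty prob_space)
  finally show ?thesis by (metis of_real_eq_iff of_real_of_nat_eq)
qed

lemma trace_var_le: "0 \<le> trace_var j \<and> trace_var j \<le> (real n)\<^sup>2"
proof
  show "0 \<le> trace_var j" unfolding trace_var_def by simp
  have "trace_var j \<le> (\<integral>W. (real n)\<^sup>2 \<partial>\<mu>)"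
    unfolding trace_var_def
  proof (rule integral_mono)
    show "integrable \<mu> (\<lambda>W. (norm (ptr W (int j)))\<^sup>2)"
      by (rule integrable_const_bound[of _ "(real n)\<^sup>2"])
        (use bm_measurable[OF bm_ptr] norm_ptr_le in \<open>auto simp: space_eq intro!: power_mono\<close>)
  qed (use norm_ptr_le in \<open>auto simp: space_eq intro!: power_mono\<close>)
  then show "trace_var j \<le> (real n)\<^sup>2" by (simp add: prob_space)
qed

lemma integral_norm_sum_ptr:
  assumes "finite I"
  shows "(\<integral>W. (norm (\<Sum>j\<in>I. \<alpha> j * ptr W (int j)))\<^sup>2 \<partial>\<mu>) = (\<Sum>j\<in>I. (norm (\<alpha> j))\<^sup>2 * trace_var j)"
proof -
  have "complex_of_real (\<integral>W. (norm (\<Sum>j\<in>I. \<alpha> j * ptr W (int j)))\<^sup>2 \<partial>\<mu>)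
     = (\<integral>W. (\<Sum>j\<in>I. \<alpha> j * ptr W (int j)) * cnj (\<Sum>j\<in>I. \<alpha> j * ptr W (int j)) \<partial>\<mu>)"
    by (simp only: integral_complex_of_real[symmetric] complex_norm_square)
  also have "\<dots> = (\<integral>W. (\<Sum>j\<in>I. \<Sum>k\<in>I. \<alpha> j * cnj (\<alpha> k) * (ptr W (int j) * cnj (ptr W (int k)))) \<partial>\<mu>)"
    by (simp only: cnj_sum complex_cnj_mult sum_product) (simp only: mult_ac)
  also have "\<dots> = (\<Sum>j\<in>I. \<integral>W. (\<Sum>k\<in>I. \<alpha> j * cnj (\<alpha> k) * (ptr W (int j) * cnj (ptr W (int k)))) \<partial>\<mu>)"
    by (intro integral_sum_bm bm_sum bm_mult bm_const bm_ptr bm_cnj assms)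
  also have "\<dots> = (\<Sum>j\<in>I. \<Sum>k\<in>I. \<integral>W. \<alpha> j * cnj (\<alpha> k) * (ptr W (int j) * cnj (ptr W (int k))) \<partial>\<mu>)"
    by (intro sum.cong refl integral_sum_bm bm_mult bm_const bm_ptr bm_cnj)
  also have "\<dots> = (\<Sum>j\<in>I. \<Sum>k\<in>I. if k = j then \<alpha> j * cnj (\<alpha> j) * of_real (trace_var j) else 0)"
    by (intro sum.cong refl) (auto simp: trace_var_complex ptr_orthogonal)
  also have "\<dots> = (\<Sum>j\<in>I. \<alpha> j * cnj (\<alpha> j) * of_real (trace_var j))"
    using assms by simp
  also have "\<dots> = complex_of_real (\<Sum>j\<in>I. (norm (\<alpha> j))\<^sup>2 * trace_var j)"
    by (simp only: of_real_sum of_real_mult complex_norm_square)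
  finally show ?thesis by (simp only: of_real_eq_iff)
qed

end

text \<open>For a fixed order \<open>L\<close> the bound holds once \<open>n\<close> is large. The
  order is therefore chosen first, from the limit variance \<open>s\<close>, and only then
  \<open>n\<close>.\<close>

lemma char_limit:
  fixes c :: "nat \<Rightarrow> complex" and v :: "nat \<Rightarrow> real"
  assumes v: "v \<longlonglongrightarrow> s"
    and c: "\<And>L. \<forall>\<^sub>F n in sequentially. norm (c n - of_real (\<Sum>q<L. (- v n / 4) ^ q / fact q)) \<le> (v n / 4) ^ L / fact L"
  shows "c \<longlonglongrightarrow> of_real (exp (- s / 4))"
proof (rule tendstoI)
  fix e :: real assume e: "e > 0"
  have S: "(\<lambda>q. x ^ q / fact q) sums exp x" for x :: real
  proof -
    have "(\<lambda>q. x ^ q / fact q) = (\<lambda>q. x ^ q /\<^sub>R fact q)"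
      by (simp add: fun_eq_iff field_simps)
    then show ?thesis using exp_converges[of x] by (simp only:)
  qed
  have "(\<lambda>L. \<Sum>q<L. (- s / 4) ^ q / fact q) \<longlonglongrightarrow> exp (- s / 4)" using S by (simp add: sums_def)
  moreover have "(\<lambda>L. (s / 4) ^ L / fact L) \<longlonglongrightarrow> 0"
    by (rule summable_LIMSEQ_zero[OF sums_summable[OF S]])
  ultimately have "\<forall>\<^sub>F L in sequentially. dist (\<Sum>q<L. (- s / 4) ^ q / fact q) (exp (- s / 4)) < e / 4
     \<and> (s / 4) ^ L / fact L < e / 4"
    using e by (intro eventually_conj tendstoD order_tendstoD(2)) auto
  then obtain L where L: "dist (\<Sum>q<L. (- s / 4) ^ q / fact q) (exp (- s / 4)) < e / 4" "(s / 4) ^ L / fact L < e / 4"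
    by (auto simp: eventually_sequentially)
  have "(\<lambda>n. \<Sum>q<L. (- v n / 4) ^ q / fact q) \<longlonglongrightarrow> (\<Sum>q<L. (- s / 4) ^ q / fact q)"
    by (intro tendsto_intros v) auto
  then have 1: "\<forall>\<^sub>F n in sequentially. dist (\<Sum>q<L. (- v n / 4) ^ q / fact q) (\<Sum>q<L. (- s / 4) ^ q / fact q) < e / 4"
    using e by (intro tendstoD) auto
  have "(\<lambda>n. (v n / 4) ^ L / fact L) \<longlonglongrightarrow> (s / 4) ^ L / fact L"
    by (intro tendsto_intros v) auto
  then have 2: "\<forall>\<^sub>F n in sequentially. (v n / 4) ^ L / fact L < e / 4"
    using L(2) by (rule order_tendstoD(2))
  show "\<forall>\<^sub>F n in sequentially. dist (c n) (of_real (exp (- s / 4))) < e"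
    using c[of L] 1 2
  proof eventually_elim
    case (elim n)
    have 3: "norm (complex_of_real (\<Sum>q<L. (- v n / 4) ^ q / fact q) - of_real (exp (- s / 4))) < e / 2"
      using elim(2) L(1) unfolding of_real_diff[symmetric] norm_of_real dist_real_def by linarith
    have tri: "norm (c n - B) \<le> norm (c n - A) + norm (A - B)" for A B
      using norm_triangle_ineq[of "c n - A" "A - B"] by simp
    show ?case
      using tri[of "of_real (exp (- s / 4))" "of_real (\<Sum>q<L. (- v n / 4) ^ q / fact q)"] 3 elim(1,3) e
      unfolding dist_norm by linarith
  qed
qed

section \<open>Variance of the traces of high powers\<close>

text \<open>Tonelli's theorem for double series, by way of unordered sums.\<close>

lemma sums_swap_nonneg:
  fixes f :: "nat \<Rightarrow> nat \<Rightarrow> real"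
  assumes nn: "\<And>k j. f k j \<ge> 0" and C: "\<And>k. f k sums C k" and T: "C sums T"
    and R: "\<And>j. (\<lambda>k. f k j) sums R j"
  shows "R sums T"
proof -
  have Cn: "C k \<ge> 0" for k using suminf_nonneg[OF sums_summable[OF C[of k]] nn] sums_unique[OF C[of k]] by simp
  have hC: "((\<lambda>j. f k j) has_sum C k) UNIV" for k
    using C nn by (intro sums_nonneg_imp_has_sum) auto
  have hT: "(C has_sum T) UNIV" using T Cn by (intro sums_nonneg_imp_has_sum) auto
  have "(\<lambda>(k, j). f k j) summable_on (UNIV \<times> UNIV)"
    using summable_on_SigmaI[where A=UNIV and f="\<lambda>(k, j). f k j" and g=C and B="\<lambda>_. UNIV"] hC has_sum_imp_summable[OF hT] nn by simp
  then have "((\<lambda>(k, j). f k j) has_sum T) (UNIV \<times> UNIV)"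
    using has_sum_SigmaI[where A=UNIV and f="\<lambda>(k, j). f k j" and g=C and B="\<lambda>_. UNIV" and S=T] hC hT by simp
  then have "((\<lambda>(j, k). f k j) has_sum T) (UNIV \<times> UNIV)"
    using has_sum_swap[where f="\<lambda>(k, j). f k j" and S=T and A=UNIV and B=UNIV] by (simp add: case_prod_unfold)
  then have "(R has_sum T) UNIV"
    using has_sum_SigmaD[where f="\<lambda>(j, k). f k j" and S=T and A=UNIV and B="\<lambda>_. UNIV" and g=R] sums_nonneg_imp_has_sum[OF R nn] by simp
  then show ?thesis by (rule has_sum_imp_sums)
qed

text \<open>First return amplitudes of the coordinate \<open>i\<close> under \<open>U\<close>.\<close>

primrec excursion :: "nat \<Rightarrow> complex mat \<Rightarrow> nat \<Rightarrow> nat \<Rightarrow> nat \<Rightarrow> complex" where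
  "excursion n U i 0 l = of_bool (l = i)"
| "excursion n U i (Suc q) l = (if l = i then 0 else (\<Sum>p<n. U $$ (l, p) * excursion n U i q p))"

text \<open>\<open>excursion n U i q l\<close> is the weighted sum over paths of \<open>q\<close>
  steps from \<open>l\<close> that meet \<open>i\<close> only at their end. A first return is one
  step from \<open>i\<close> followed by such a path, hence the index \<open>q - 1\<close> and the
  separate value at \<open>0\<close>.\<close>

definition first_return :: "nat \<Rightarrow> complex mat \<Rightarrow> nat \<Rightarrow> nat \<Rightarrow> complex" where
  "first_return n U i q = (if q = 0 then 0 else (\<Sum>p<n. U $$ (i, p) * excursion n U i (q - 1) p))"

text \<open>Weighted sum over closed paths of \<open>j\<close> steps at \<open>i\<close> with
  exactly \<open>k\<close> returns, cut at the first return.\<close>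

primrec kth_return :: "nat \<Rightarrow> complex mat \<Rightarrow> nat \<Rightarrow> nat \<Rightarrow> nat \<Rightarrow> complex" where
  "kth_return n U i 0 j = of_bool (j = 0)"
| "kth_return n U i (Suc k) j = (\<Sum>q\<le>j. first_return n U i q * kth_return n U i k (j - q))"

lemma kth_return_eq_0: "j < k \<Longrightarrow> kth_return n U i k j = 0"
proof (induction k arbitrary: j)
  case (Suc k)
  have "first_return n U i q * kth_return n U i k (j - q) = 0" if "q \<le> j" for q
  proof (cases "q = 0")
    case False
    then have "j - q < k" using that Suc.prems by auto
    then show ?thesis using Suc.IH by simp
  qed (simp add: first_return_def)
  then show ?case unfolding kth_return.simps by (intro sum.neutral) auto
qed simp

text \<open>An excursion step applies \<open>U\<close> and then kills the coordinate
  \<open>i\<close>; neither increases the norm.\<close>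

lemma excursion_norm_le:
  assumes U: "U \<in> unitary_group n" and i: "i < n"
  shows "(\<Sum>l<n. (norm (excursion n U i q l))\<^sup>2) \<le> 1"
proof (induction q)
  case 0
  have "(\<Sum>l<n. (norm (excursion n U i 0 l))\<^sup>2) = (\<Sum>l<n. if l = i then 1 else 0)"
    by (intro sum.cong) auto
  then show ?case using i by simp
next
  case (Suc q)
  have "(\<Sum>l<n. (norm (excursion n U i (Suc q) l))\<^sup>2)
    \<le> (\<Sum>l<n. (norm (\<Sum>p<n. U $$ (l, p) * excursion n U i q p))\<^sup>2)"
    by (intro sum_mono) auto
  also have "\<dots> = (\<Sum>l<n. (norm (excursion n U i q l))\<^sup>2)" by (rule unitary_norm_preserving[OF U])
  finally show ?case using Suc by simp
qed

lemma first_return_le_1: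
  assumes U: "U \<in> unitary_group n" and i: "i < n"
  shows "norm (first_return n U i q) \<le> 1"
proof (cases q)
  case (Suc r)
  have "(norm (first_return n U i q))\<^sup>2 \<le> (\<Sum>l<n. (norm (\<Sum>p<n. U $$ (l, p) * excursion n U i r p))\<^sup>2)"
    unfolding first_return_def using i Suc
      member_le_sum[of i "{..<n}" "\<lambda>l. (norm (\<Sum>p<n. U $$ (l, p) * excursion n U i r p))\<^sup>2"] by simp
  also have "\<dots> \<le> 1\<^sup>2" using excursion_norm_le[OF U i] by (simp add: unitary_norm_preserving[OF U])
  finally show ?thesis by (rule power2_le_imp_le) simp
qed (simp add: first_return_def)

lemma excursion_le_1:
  assumes U: "U \<in> unitary_group n" and i: "i < n" and l: "l < n"
  shows "norm (excursion n U i q l) \<le> 1"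
proof -
  have "(norm (excursion n U i q l))\<^sup>2 \<le> 1\<^sup>2"
    using member_le_sum[of l "{..<n}" "\<lambda>l. (norm (excursion n U i q l))\<^sup>2"] excursion_norm_le[OF U i, of q] l by simp
  then show ?thesis by (rule power2_le_imp_le) simp
qed

text \<open>Multiplying the row \<open>i\<close> of \<open>U\<close> by \<open>z\<close> multiplies the first return amplitudes by \<open>z\<close>, which
  marks the visits to \<open>i\<close>.\<close>

definition row_scale :: "nat \<Rightarrow> nat \<Rightarrow> complex \<Rightarrow> complex mat" where
  "row_scale n i z = refl_mat n (\<lambda>k. of_bool (k = i)) z"

lemma sum_of_bool_eq: "finite A \<Longrightarrow> (\<Sum>d\<in>A. of_bool (d = i) * f d) = (if i \<in> A then f i else (0::complex))"
proof -
  assume "finite A"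
  have "(\<Sum>d\<in>A. of_bool (d = i) * f d) = (\<Sum>d\<in>A. if d = i then f d else 0)" by (intro sum.cong) auto
  then show ?thesis using \<open>finite A\<close> by simp
qed

lemma row_scale_index:
  assumes "U \<in> carrier_mat n n" "a < n" "b < n" "i < n"
  shows "(row_scale n i z * U) $$ (a, b) = (if a = i then z else 1) * U $$ (a, b)"
proof -
  have "(\<Sum>d<n. cnj (of_bool (d = i)) * U $$ (d, b)) = (\<Sum>d<n. of_bool (d = i) * U $$ (d, b))"
    by (intro sum.cong) auto
  also have "\<dots> = U $$ (i, b)" using assms by (subst sum_of_bool_eq) auto
  finally have "(\<Sum>d<n. cnj (of_bool (d = i)) * U $$ (d, b)) = U $$ (i, b)" .
  then show ?thesis
    unfolding row_scale_def refl_mat_mult_index[OF assms(1-3)] by (auto simp: algebra_simps)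
qed

lemma unit_basis_norm: "(i :: nat) < n \<Longrightarrow> (\<Sum>a<n. (norm (of_bool (a = i) :: complex))\<^sup>2) = 1"
proof -
  assume "i < n"
  have "(\<Sum>a<n. (norm (of_bool (a = i) :: complex))\<^sup>2) = (\<Sum>a<n. if a = i then 1 else 0)"
    by (intro sum.cong) auto
  then show ?thesis using \<open>i < n\<close> by simp
qed

lemma row_scale_unitary: "i < n \<Longrightarrow> norm z = 1 \<Longrightarrow> row_scale n i z \<in> unitary_group n"
  unfolding row_scale_def by (intro refl_mat_unitary unit_basis_norm)

lemma excursion_row_scale:
  assumes U: "U \<in> carrier_mat n n" and i: "i < n"
  shows "l < n \<Longrightarrow> excursion n (row_scale n i z * U) i q l = excursion n U i q l"
  by (induction q arbitrary: l) (auto simp: row_scale_index[OF U _ _ i] simp del: index_mult_mat intro!: sum.cong)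

lemma first_return_row_scale:
  assumes U: "U \<in> carrier_mat n n" and i: "i < n"
  shows "first_return n (row_scale n i z * U) i q = z * first_return n U i q"
  unfolding first_return_def using i
  by (auto simp: row_scale_index[OF U _ _ i] excursion_row_scale[OF U i] sum_distrib_left mult.assoc
      simp del: index_mult_mat)

lemma kth_return_row_scale:
  assumes U: "U \<in> carrier_mat n n" and i: "i < n"
  shows "kth_return n (row_scale n i z * U) i k j = z ^ k * kth_return n U i k j"
  by (induction k arbitrary: j)
    (auto simp: first_return_row_scale[OF U i] sum_distrib_left mult_ac)

text \<open>The paths make \<open>m\<close> free steps from \<open>i\<close> and then
  \<open>q\<close> steps that avoid \<open>i\<close> until the end. Each is cut at its last visit to
  \<open>i\<close> before the end, at time \<open>m - p\<close>. The extra term is nonzero for the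
  empty path only.\<close>

lemma pw_excursion:
  assumes U: "U \<in> carrier_mat n n" and i: "i < n"
  shows "(\<Sum>l<n. pw U m i l * excursion n U i q l)
    = (\<Sum>p=1..m. first_return n U i (q + p) * pw U (m - p) i i) + excursion n U i (q + m) i"
proof (induction m arbitrary: q)
  case 0
  have "(\<Sum>l<n. pw U 0 i l * excursion n U i q l) = (\<Sum>l<n. of_bool (l = i) * excursion n U i q l)"
    using i by (intro sum.cong) (auto simp: pw_0[OF U])
  then show ?case using i by (simp add: sum_of_bool_eq)
next
  case (Suc m)
  have "(\<Sum>l<n. pw U (Suc m) i l * excursion n U i q l)
    = (\<Sum>l<n. \<Sum>c<n. pw U m i c * (U $$ (c, l) * excursion n U i q l))"
    using i by (simp add: pw_Suc[OF U] sum_distrib_right mult.assoc)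
  also have "\<dots> = (\<Sum>c<n. \<Sum>l<n. pw U m i c * (U $$ (c, l) * excursion n U i q l))"
    by (rule sum.swap)
  also have "\<dots> = (\<Sum>c<n. pw U m i c * excursion n U i (Suc q) c
      + of_bool (c = i) * (pw U m i i * first_return n U i (Suc q)))"
  proof (intro sum.cong refl)
    fix c
    show "(\<Sum>l<n. pw U m i c * (U $$ (c, l) * excursion n U i q l))
      = pw U m i c * excursion n U i (Suc q) c + of_bool (c = i) * (pw U m i i * first_return n U i (Suc q))"
      by (cases "c = i") (simp_all add: first_return_def sum_distrib_left)
  qed
  also have "\<dots> = (\<Sum>p=1..m. first_return n U i (Suc q + p) * pw U (m - p) i i) + excursion n U i (Suc q + m) i
      + pw U m i i * first_return n U i (Suc q)"
    unfolding sum.distrib Suc.IH using i by (simp add: sum_of_bool_eq)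
  also have "(\<Sum>p=1..m. first_return n U i (Suc q + p) * pw U (m - p) i i)
     = (\<Sum>p=2..Suc m. first_return n U i (q + p) * pw U (Suc m - p) i i)"
    by (rule sum.reindex_bij_witness[of _ "\<lambda>p. p - 1" Suc]) auto
  also have "{2..Suc m} = {1..Suc m} - {1}" by auto
  also have "(\<Sum>p\<in>{1..Suc m} - {1}. first_return n U i (q + p) * pw U (Suc m - p) i i)
     = (\<Sum>p=1..Suc m. first_return n U i (q + p) * pw U (Suc m - p) i i) - first_return n U i (q + 1) * pw U m i i"
    by (subst sum_diff1) auto
  finally show ?case by (simp add: algebra_simps)
qed

lemma pw_diag_renewal:
  assumes U: "U \<in> carrier_mat n n" and i: "i < n" and "j \<ge> 1"
  shows "pw U j i i = (\<Sum>q\<le>j. first_return n U i q * pw U (j - q) i i)"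
proof -
  have "(\<Sum>l<n. pw U j i l * excursion n U i 0 l) = (\<Sum>l<n. of_bool (l = i) * pw U j i l)"
    by (simp add: mult.commute)
  then have "pw U j i i = (\<Sum>l<n. pw U j i l * excursion n U i 0 l)" using i by (simp add: sum_of_bool_eq)
  also have "\<dots> = (\<Sum>p=1..j. first_return n U i p * pw U (j - p) i i) + excursion n U i j i"
    using pw_excursion[OF U i, of j 0] by simp
  also have "excursion n U i j i = 0" using \<open>j \<ge> 1\<close> by (cases j) auto
  also have "(\<Sum>p=1..j. first_return n U i p * pw U (j - p) i i) = (\<Sum>q\<le>j. first_return n U i q * pw U (j - q) i i)"
    by (rule sum.mono_neutral_left) (auto simp: first_return_def not_less_eq_eq)
  finally show ?thesis by simp
qed

text \<open>Iterating the renewal equation sorts closed paths by their number of returns. Each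
  return takes at least one step, so the ranges of \<open>k\<close> can be enlarged to a common
  one.\<close>

lemma pw_diag_kth_return:
  assumes U: "U \<in> carrier_mat n n" and i: "i < n"
  shows "pw U j i i = (\<Sum>k\<le>j. kth_return n U i k j)"
proof (induction j rule: less_induct)
  case (less j)
  show ?case
  proof (cases "j = 0")
    case True
    then show ?thesis using i by (simp add: pw_0[OF U])
  next
    case False
    then have j1: "j \<ge> 1" by simp
    have "pw U j i i = (\<Sum>q\<le>j. first_return n U i q * (\<Sum>k\<le>j. kth_return n U i k (j - q)))"
      unfolding pw_diag_renewal[OF U i j1]
    proof (intro sum.cong refl)
      fix q assume "q \<in> {..j}"
      show "first_return n U i q * pw U (j - q) i i = first_return n U i q * (\<Sum>k\<le>j. kth_return n U i k (j - q))"
      proof (cases "q = 0")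
        case False
        then have "pw U (j - q) i i = (\<Sum>k\<le>j - q. kth_return n U i k (j - q))"
          using less.IH[of "j - q"] \<open>j \<noteq> 0\<close> by simp
        also have "\<dots> = (\<Sum>k\<le>j. kth_return n U i k (j - q))"
          by (rule sum.mono_neutral_left) (auto simp: kth_return_eq_0)
        finally show ?thesis by simp
      qed (simp add: first_return_def)
    qed
    also have "\<dots> = (\<Sum>k\<le>j. kth_return n U i (Suc k) j)"
      unfolding sum_distrib_left by (subst sum.swap) simp
    also have "\<dots> = (\<Sum>k=1..Suc j. kth_return n U i k j)"
      by (rule sum.reindex_bij_witness[of _ "\<lambda>k. k - 1" Suc]) auto
    also have "\<dots> = (\<Sum>k=1..j. kth_return n U i k j)" by (simp add: kth_return_eq_0 del: kth_return.simps)
    also have "\<dots> = (\<Sum>k\<le>j. kth_return n U i k j)"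
      by (rule sum.mono_neutral_left) (use False in \<open>auto simp: not_less_eq_eq\<close>)
    finally show ?thesis .
  qed
qed

context haar_unitary
begin

lemma integral_antisymmetric:
  fixes f :: "complex mat \<Rightarrow> complex"
  assumes "f \<in> borel_measurable \<mu>" "V \<in> unitary_group n" "\<And>W. W \<in> unitary_group n \<Longrightarrow> f (V * W) = - f W"
  shows "(\<integral>W. f W \<partial>\<mu>) = 0"
proof -
  have "(\<integral>W. f W \<partial>\<mu>) = (\<integral>W. f (V * W) \<partial>\<mu>)" by (rule integral_invariant[OF assms(2,1), symmetric])
  also have "\<dots> = (\<integral>W. - f W \<partial>\<mu>)"
    by (intro Bochner_Integration.integral_cong refl) (simp add: assms(3) space_eq)
  finally show ?thesis by simp
qed

lemma bm_excursion: "l < n \<Longrightarrow> bm (\<lambda>W. excursion n W i q l)"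
proof (induction q arbitrary: l)
  case (Suc q)
  then show ?case by (cases "l = i") (auto intro!: bm_const bm_sum bm_mult bm_entry)
qed (simp add: bm_const)

lemma bm_first_return: "i < n \<Longrightarrow> bm (\<lambda>W. first_return n W i q)"
  unfolding first_return_def by (cases "q = 0") (auto intro!: bm_const bm_sum bm_mult bm_entry bm_excursion)

lemma bm_kth_return: "i < n \<Longrightarrow> bm (\<lambda>W. kth_return n W i k j)"
  by (induction k arbitrary: j) (auto intro!: bm_const bm_sum bm_mult bm_first_return)

lemma row_scale_flow: "row_scale n i (cis t) * W = flow (\<lambda>k. of_bool (k = i)) t W"
  by (simp add: row_scale_def flow_def)

lemma row_scale_row_scale:
  assumes W: "W \<in> carrier_mat n n" and i: "i < n"
  shows "row_scale n i z * (row_scale n i w * W) = row_scale n i (z * w) * W"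
proof -
  have c: "row_scale n i w \<in> carrier_mat n n" for w by (simp add: row_scale_def refl_mat_carrier)
  have c': "row_scale n i w * W \<in> carrier_mat n n" for w by (rule mult_carrier_mat[OF c W])
  have "(row_scale n i z * (row_scale n i w * W)) $$ (a, b) = (row_scale n i (z * w) * W) $$ (a, b)"
    if "a < n" "b < n" for a b
    unfolding row_scale_index[OF c' that i] row_scale_index[OF W that i] by simp
  moreover have "row_scale n i z * (row_scale n i w * W) \<in> carrier_mat n n" by (rule mult_carrier_mat[OF c c'])
  moreover note c'[of "z * w"]
  ultimately show ?thesis by (intro eq_matI) (simp_all only: carrier_mat_def mem_Collect_eq)
qed

lemma ptr_row_scale_derivative_0:
  assumes W: "W \<in> unitary_group n" and i: "i < n"
  shows "((\<lambda>t. ptr (row_scale n i (cis t) * W) (int j)) has_vector_derivative \<i> * of_nat j * pw W j i i) (at 0)"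
proof -
  have "((\<lambda>t. ptr (row_scale n i (cis t) * W) (int j)) has_vector_derivative
     lin (\<lambda>k. of_bool (k = i)) (\<lambda>c d. of_nat j * pw W j d c)) (at 0)"
    unfolding row_scale_flow
    using nice_ptr_nat[OF unit_basis_norm[OF i], of j] W unfolding nice_def by blast
  moreover have "lin (\<lambda>k. of_bool (k = i)) (\<lambda>c d. of_nat j * pw W j d c) = \<i> * of_nat j * pw W j i i"
  proof -
    have "(\<Sum>c<n. \<Sum>d<n. of_bool (c = i) * cnj (of_bool (d = i)) * (of_nat j * pw W j d c))
       = (\<Sum>c<n. of_bool (c = i) * (\<Sum>d<n. of_bool (d = i) * (of_nat j * pw W j d c)))"
      unfolding sum_distrib_left by (intro sum.cong refl) auto
    also have "\<dots> = of_nat j * pw W j i i" using i by (simp only: sum_of_bool_eq finite_lessThan lessThan_iff if_True)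
    finally show ?thesis unfolding lin_def by simp
  qed
  ultimately show ?thesis by simp
qed

text \<open>The scalings form a group, so the derivative at \<open>s\<close> is the derivative at
  \<open>0\<close> for the matrix already scaled by \<open>cis s\<close>.\<close>

lemma ptr_row_scale_derivative:
  assumes W: "W \<in> unitary_group n" and i: "i < n"
  shows "((\<lambda>t. ptr (row_scale n i (cis t) * W) (int j)) has_vector_derivative
     \<i> * of_nat j * pw (row_scale n i (cis s) * W) j i i) (at s)"
proof -
  have W': "row_scale n i (cis s) * W \<in> unitary_group n"
    by (intro unitary_mult row_scale_unitary W i) simp
  have eq: "ptr (row_scale n i (cis (t - s)) * (row_scale n i (cis s) * W)) (int j) = ptr (row_scale n i (cis t) * W) (int j)" for t
    by (simp add: row_scale_row_scale[OF unitary_carrier[OF W] i] cis_mult)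
  have "((\<lambda>t. ptr (row_scale n i (cis t) * (row_scale n i (cis s) * W)) (int j)) has_vector_derivative
     \<i> * of_nat j * pw (row_scale n i (cis s) * W) j i i) (at (s - s))"
    using ptr_row_scale_derivative_0[OF W' i] by simp
  then have "((\<lambda>t. ptr (row_scale n i (cis t) * (row_scale n i (cis s) * W)) (int j)) \<circ> (\<lambda>t. t - s) has_vector_derivative
     1 *\<^sub>R (\<i> * of_nat j * pw (row_scale n i (cis s) * W) j i i)) (at s)"
    by (intro vector_diff_chain_at) (auto intro!: derivative_eq_intros simp: has_real_derivative_iff_has_vector_derivative[symmetric])
  then show ?thesis by (simp add: o_def eq)
qed

text \<open>Only the part of \<open>tr U\<^sup>j\<close> that does not pass through \<open>i\<close> is invariant under scaling row \<open>i\<close>.\<close>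

definition avoiding :: "nat \<Rightarrow> nat \<Rightarrow> complex mat \<Rightarrow> complex" where
  "avoiding i j W = ptr W (int j) - (\<Sum>k=1..j. of_nat j / of_nat k * kth_return n W i k j)"

text \<open>Along the scaling the trace has derivative \<open>\<i> j (U^j)_ii\<close>, and
  \<open>(U^j)_ii\<close> is the sum of the return terms with phases \<open>cis (k s)\<close>. The
  weight \<open>j / k\<close> gives the subtracted sum the same derivative: a cyclic path with
  \<open>k\<close> visits to \<open>i\<close> has \<open>j\<close> starting points, of which
  \<open>k\<close> are at \<open>i\<close>.\<close>

lemma avoiding_row_scale:
  assumes W: "W \<in> unitary_group n" and i: "i < n" and j: "j \<ge> 1"
  shows "avoiding i j (row_scale n i (cis \<theta>) * W) = avoiding i j W"
proof -
  note c = unitary_carrier[OF W]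
  have W': "row_scale n i (cis s) * W \<in> unitary_group n" for s
    by (intro unitary_mult row_scale_unitary W i) simp
  have one: "row_scale n i (cis 0) * W = W"
    unfolding row_scale_flow by (rule flow_0[OF W])
  define g where "g t = avoiding i j (row_scale n i (cis t) * W)" for t
  have geq: "g t = ptr (row_scale n i (cis t) * W) (int j)
     - (\<Sum>k=1..j. of_nat j / of_nat k * (cis (real k * t) * kth_return n W i k j))" for t
    by (simp add: g_def avoiding_def kth_return_row_scale[OF c i] Complex.DeMoivre)
  have "(g has_vector_derivative 0) (at s)" for s
  proof -
    have d: "((\<lambda>t. cis (real k * t)) has_vector_derivative \<i> * of_nat k * cis (real k * s)) (at s)" for k
    proof -
      have "(cis \<circ> (\<lambda>t. real k * t) has_vector_derivative real k *\<^sub>R (\<i> * cis (real k * s))) (at s)"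
        by (intro vector_diff_chain_at has_vector_derivative_cis)
          (auto intro!: derivative_eq_intros simp: has_real_derivative_iff_has_vector_derivative[symmetric])
      then show ?thesis by (simp add: o_def scaleR_conv_of_real mult_ac)
    qed
    have "(g has_vector_derivative (\<i> * of_nat j * pw (row_scale n i (cis s) * W) j i i
      - (\<Sum>k=1..j. of_nat j / of_nat k * (\<i> * of_nat k * cis (real k * s) * kth_return n W i k j)))) (at s)"
      unfolding geq[abs_def]
      by (intro has_vector_derivative_diff has_vector_derivative_sum has_vector_derivative_mult_right
          has_vector_derivative_mult_left ptr_row_scale_derivative[OF W i] d)
    moreover have "pw (row_scale n i (cis s) * W) j i i = (\<Sum>k=1..j. cis (real k * s) * kth_return n W i k j)"
    proof -
      have "pw (row_scale n i (cis s) * W) j i i = (\<Sum>k\<le>j. cis (real k * s) * kth_return n W i k j)"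
        by (simp add: pw_diag_kth_return[OF unitary_carrier[OF W'] i] kth_return_row_scale[OF c i] Complex.DeMoivre)
      also have "\<dots> = (\<Sum>k=1..j. cis (real k * s) * kth_return n W i k j)"
        by (rule sum.mono_neutral_right) (use j in \<open>auto simp: not_less_eq_eq\<close>)
      finally show ?thesis .
    qed
    moreover have "(\<Sum>k=1..j. of_nat j / of_nat k * (\<i> * of_nat k * cis (real k * s) * kth_return n W i k j))
      = \<i> * of_nat j * (\<Sum>k=1..j. cis (real k * s) * kth_return n W i k j)"
      unfolding sum_distrib_left by (intro sum.cong) auto
    ultimately show ?thesis by simp
  qed
  then obtain c where "\<And>x. x \<in> UNIV \<Longrightarrow> g x = c"
    using has_vector_derivative_zero_constant[of UNIV g] by (metis convex_UNIV has_vector_derivative_at_within)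
  then have "g \<theta> = g 0" by (metis UNIV_I)
  then show ?thesis by (simp only: g_def one)
qed

definition return_var :: "nat \<Rightarrow> nat \<Rightarrow> nat \<Rightarrow> real" where
  "return_var i k j = (\<integral>W. (norm (kth_return n W i k j))\<^sup>2 \<partial>\<mu>)"

lemma return_var_nonneg: "return_var i k j \<ge> 0"
  by (simp add: return_var_def)

lemma return_var_complex: "complex_of_real (return_var i k j) = (\<integral>W. kth_return n W i k j * cnj (kth_return n W i k j) \<partial>\<mu>)"
  unfolding return_var_def by (simp only: integral_complex_of_real[symmetric] complex_norm_square)

text \<open>Under scaling of row \<open>i\<close> the \<open>k\<close>-th return term has degree
  \<open>k\<close> and the avoiding part degree \<open>0\<close>. Parts of different degree are
  orthogonal, so only products with equal \<open>k\<close> remain, with the weight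
  \<open>j / k\<close> from the trace.\<close>

lemma integral_diag_trace:
  assumes i: "i < n" and j: "j \<ge> 1"
  shows "(\<integral>W. pw W j i i * cnj (ptr W (int j)) \<partial>\<mu>) = of_real (\<Sum>k=1..j. real j / real k * return_var i k j)"
proof -
  let ?B = "\<lambda>k W. kth_return n W i k j"
  have bma: "bm (avoiding i j)"
  proof -
    have "bm (\<lambda>W. ptr W (int j) + (\<Sum>k=1..j. (- (of_nat j / of_nat k)) * ?B k W))"
      by (intro bm_add bm_ptr bm_sum bm_mult bm_const bm_kth_return i) auto
    then show ?thesis unfolding avoiding_def by (simp add: sum_negf)
  qed
  \<comment> \<open>The angle \<open>pi / k\<close> reverses the sign of the term of degree
    \<open>k\<close> and fixes the avoiding part.\<close>
  have rot: "\<exists>V\<in>unitary_group n. \<forall>W\<in>unitary_group n. ?B k (V * W) = - ?B k W \<and> avoiding i j (V * W) = avoiding i j W"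
    if "k \<ge> 1" for k
  proof -
    have "cis (pi / real k) ^ k = -1" using that by (simp add: Complex.DeMoivre)
    then show ?thesis
      using i j by (intro bexI[of _ "row_scale n i (cis (pi / real k))"])
        (auto simp: kth_return_row_scale[OF unitary_carrier i] avoiding_row_scale row_scale_unitary)
  qed
  have zC: "(\<integral>W. ?B k W * cnj (avoiding i j W) \<partial>\<mu>) = 0" if k: "k \<ge> 1" for k
  proof -
    obtain V where V: "V \<in> unitary_group n" "\<forall>W\<in>unitary_group n. ?B k (V * W) = - ?B k W \<and> avoiding i j (V * W) = avoiding i j W"
      using rot[OF k] by blast
    show ?thesis
      by (rule integral_antisymmetric[OF bm_measurable[OF bm_mult[OF bm_kth_return[OF i] bm_cnj[OF bma]]] V(1)])
        (use V(2) in auto)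
  qed
  have zB: "(\<integral>W. ?B k W * cnj (?B l W) \<partial>\<mu>) = 0" if kl: "k \<noteq> l" for k l
  proof -
    define \<theta> where "\<theta> = pi / (real k - real l)"
    have V: "row_scale n i (cis \<theta>) \<in> unitary_group n" by (intro row_scale_unitary i) simp
    have "real k * \<theta> - real l * \<theta> = (real k - real l) * \<theta>" by (simp add: left_diff_distrib)
    also have "\<dots> = pi" using kl by (simp add: \<theta>_def)
    finally have e: "cis (real k * \<theta>) * cnj (cis (real l * \<theta>)) = - 1" by (simp add: cis_cnj cis_mult)
    show ?thesis
    proof (rule integral_antisymmetric[OF bm_measurable[OF bm_mult[OF bm_kth_return[OF i] bm_cnj[OF bm_kth_return[OF i]]]] V])
      fix W assume "W \<in> unitary_group n"
      then have "?B k (row_scale n i (cis \<theta>) * W) * cnj (?B l (row_scale n i (cis \<theta>) * W))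
        = (cis (real k * \<theta>) * cnj (cis (real l * \<theta>))) * (?B k W * cnj (?B l W))"
        by (simp add: kth_return_row_scale[OF unitary_carrier i] Complex.DeMoivre mult_ac)
      then show "?B k (row_scale n i (cis \<theta>) * W) * cnj (?B l (row_scale n i (cis \<theta>) * W)) = - (?B k W * cnj (?B l W))"
        unfolding e by simp
    qed
  qed
  have "(\<integral>W. pw W j i i * cnj (ptr W (int j)) \<partial>\<mu>)
    = (\<integral>W. (\<Sum>k=1..j. ?B k W * cnj (avoiding i j W) + (\<Sum>l=1..j. of_nat j / of_nat l * (?B k W * cnj (?B l W)))) \<partial>\<mu>)"
  proof (intro Bochner_Integration.integral_cong refl)
    fix W assume "W \<in> space \<mu>"
    then have c: "W \<in> carrier_mat n n" by (auto simp: space_eq unitary_carrier)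
    have p: "pw W j i i = (\<Sum>k=1..j. ?B k W)"
      unfolding pw_diag_kth_return[OF c i]
      by (rule sum.mono_neutral_right) (use j in \<open>auto simp: not_less_eq_eq\<close>)
    have t: "ptr W (int j) = avoiding i j W + (\<Sum>k=1..j. of_nat j / of_nat k * ?B k W)"
      by (simp add: avoiding_def)
    show "pw W j i i * cnj (ptr W (int j))
      = (\<Sum>k=1..j. ?B k W * cnj (avoiding i j W) + (\<Sum>l=1..j. of_nat j / of_nat l * (?B k W * cnj (?B l W))))"
    proof -
      have "pw W j i i * cnj (ptr W (int j))
        = (\<Sum>k=1..j. ?B k W) * cnj (avoiding i j W) + (\<Sum>k=1..j. ?B k W) * (\<Sum>l=1..j. of_nat j / of_nat l * cnj (?B l W))"
        unfolding p t by (simp add: cnj_sum distrib_left)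
      also have "\<dots> = (\<Sum>k=1..j. ?B k W * cnj (avoiding i j W))
        + (\<Sum>k=1..j. \<Sum>l=1..j. ?B k W * (of_nat j / of_nat l * cnj (?B l W)))"
        unfolding sum_product by (simp only: sum_distrib_right)
      finally show ?thesis by (simp only: sum.distrib mult.left_commute)
    qed
  qed
  also have "\<dots> = (\<Sum>k=1..j. (\<integral>W. ?B k W * cnj (avoiding i j W) \<partial>\<mu>)
      + (\<Sum>l=1..j. of_nat j / of_nat l * (\<integral>W. ?B k W * cnj (?B l W) \<partial>\<mu>)))"
  proof -
    have b: "bm (\<lambda>W. ?B k W * cnj (?B l W))" for k l by (intro bm_mult bm_cnj bm_kth_return i)
    have b': "bm (\<lambda>W. ?B k W * cnj (avoiding i j W))" for k by (intro bm_mult bm_cnj bm_kth_return i bma)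
    have b'': "bm (\<lambda>W. \<Sum>l=1..j. of_nat j / of_nat l * (?B k W * cnj (?B l W)))" for k
      by (intro bm_sum bm_mult[OF bm_const b]) simp
    have "(\<integral>W. (\<Sum>l=1..j. of_nat j / of_nat l * (?B k W * cnj (?B l W))) \<partial>\<mu>)
      = (\<Sum>l=1..j. \<integral>W. of_nat j / of_nat l * (?B k W * cnj (?B l W)) \<partial>\<mu>)" for k
      by (rule integral_sum_bm[OF bm_mult[OF bm_const b]])
    then have e: "(\<integral>W. ?B k W * cnj (avoiding i j W) + (\<Sum>l=1..j. of_nat j / of_nat l * (?B k W * cnj (?B l W))) \<partial>\<mu>)
      = (\<integral>W. ?B k W * cnj (avoiding i j W) \<partial>\<mu>) + (\<Sum>l=1..j. of_nat j / of_nat l * (\<integral>W. ?B k W * cnj (?B l W) \<partial>\<mu>))" for k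
      by (simp only: Bochner_Integration.integral_add[OF bm_integrable[OF b'] bm_integrable[OF b'']] integral_mult_right_zero)
    show ?thesis unfolding integral_sum_bm[OF bm_add[OF b' b'']] e ..
  qed
  also have "\<dots> = (\<Sum>k=1..j. \<Sum>l=1..j. if l = k then of_nat j / of_nat k * of_real (return_var i k j) else 0)"
  proof (intro sum.cong refl)
    fix k assume "k \<in> {1..j}"
    then have "(\<integral>W. ?B k W * cnj (avoiding i j W) \<partial>\<mu>) = 0" using zC by simp
    moreover have "of_nat j / of_nat l * (\<integral>W. ?B k W * cnj (?B l W) \<partial>\<mu>)
      = (if l = k then of_nat j / of_nat k * of_real (return_var i k j) else 0)" for l
      using zB[of k l] by (auto simp: return_var_complex)
    ultimately show "(\<integral>W. ?B k W * cnj (avoiding i j W) \<partial>\<mu>)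
      + (\<Sum>l=1..j. of_nat j / of_nat l * (\<integral>W. ?B k W * cnj (?B l W) \<partial>\<mu>))
      = (\<Sum>l=1..j. if l = k then of_nat j / of_nat k * of_real (return_var i k j) else 0)" by simp
  qed
  also have "\<dots> = of_real (\<Sum>k=1..j. real j / real k * return_var i k j)" by simp
  finally show ?thesis .
qed

text \<open>The variance becomes a sum of nonnegative terms; this is what later permits exchanging
  the sums over lengths and over numbers of returns.\<close>

lemma trace_var_returns:
  assumes "j \<ge> 1"
  shows "trace_var j / real j = (\<Sum>i<n. \<Sum>k=1..j. return_var i k j / real k)"
proof -
  have "complex_of_real (trace_var j) = (\<integral>W. (\<Sum>i<n. pw W j i i * cnj (ptr W (int j))) \<partial>\<mu>)"
    unfolding trace_var_complex
    by (intro Bochner_Integration.integral_cong refl)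
      (use ptr_nat[OF unitary_carrier] in \<open>simp add: space_eq sum_distrib_right\<close>)
  also have "\<dots> = (\<Sum>i<n. \<integral>W. pw W j i i * cnj (ptr W (int j)) \<partial>\<mu>)"
    by (intro integral_sum_bm bm_mult bm_pw bm_cnj bm_ptr) auto
  also have "\<dots> = complex_of_real (\<Sum>i<n. \<Sum>k=1..j. real j / real k * return_var i k j)"
    using assms by (simp add: integral_diag_trace)
  finally have "trace_var j = (\<Sum>i<n. \<Sum>k=1..j. real j / real k * return_var i k j)"
    by (simp only: of_real_eq_iff)
  also have "\<dots> = real j * (\<Sum>i<n. \<Sum>k=1..j. return_var i k j / real k)"
    by (simp add: sum_distrib_left)
  finally show ?thesis using assms by simp
qed

end

section \<open>Generating functions of the return variances\<close>

context haar_unitary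
begin

definition return_gf :: "nat \<Rightarrow> real \<Rightarrow> complex mat \<Rightarrow> complex" where
  "return_gf i \<rho> W = (\<Sum>j. of_real \<rho> ^ j * first_return n W i j)"

text \<open>A \<open>k\<close>-fold convolution has the \<open>k\<close>-th power as generating
  function. The bound by a geometric series is crude and serves as a dominating constant.\<close>

lemma kth_return_gf:
  assumes \<rho>: "0 < \<rho>" "\<rho> < 1" and W: "W \<in> unitary_group n" and i: "i < n"
  shows "summable (\<lambda>j. norm (of_real \<rho> ^ j * kth_return n W i k j)) \<and>
    (\<lambda>j. of_real \<rho> ^ j * kth_return n W i k j) sums return_gf i \<rho> W ^ k \<and>
    (\<Sum>j. norm (of_real \<rho> ^ j * kth_return n W i k j)) \<le> (1 / (1 - \<rho>)) ^ k"
proof (induction k)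
  case 0
  have "(\<lambda>j. of_real \<rho> ^ j * kth_return n W i 0 j) = (\<lambda>j. if j = 0 then 1 else 0)" by auto
  moreover have "(\<lambda>j. norm (of_real \<rho> ^ j * kth_return n W i 0 j)) = (\<lambda>j. if j = 0 then 1 else 0)" by auto
  ultimately show ?case using sums_single[of 0 "\<lambda>_. 1 :: real"] sums_single[of 0 "\<lambda>_. 1 :: complex"]
    by (simp add: sums_iff)
next
  case (Suc k)
  define a where "a j = of_real \<rho> ^ j * first_return n W i j" for j
  define b where "b k j = of_real \<rho> ^ j * kth_return n W i k j" for k j
  have an: "norm (a j) \<le> \<rho> ^ j" for j
    using first_return_le_1[OF W i, of j] \<rho> by (simp add: a_def norm_mult norm_power mult_left_le)
  have geo: "summable (\<lambda>j. \<rho> ^ j)" using \<rho> by (intro summable_geometric) simp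
  have as: "summable (\<lambda>j. norm (a j))"
    by (rule summable_comparison_test'[OF geo, of 0]) (use an in auto)
  have a1: "(\<Sum>j. norm (a j)) \<le> 1 / (1 - \<rho>)"
    using suminf_le[OF an as geo] \<rho> by (simp add: suminf_geometric)
  have IH: "summable (\<lambda>j. norm (b k j))" "b k sums return_gf i \<rho> W ^ k" "(\<Sum>j. norm (b k j)) \<le> (1 / (1 - \<rho>)) ^ k"
    using Suc by (auto simp: b_def[abs_def])
  have conv: "b (Suc k) j = (\<Sum>q\<le>j. a q * b k (j - q))" for j
  proof -
    have "b (Suc k) j = (\<Sum>q\<le>j. of_real \<rho> ^ (q + (j - q)) * (first_return n W i q * kth_return n W i k (j - q)))"
      unfolding b_def kth_return.simps sum_distrib_left by (intro sum.cong) auto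
    then show ?thesis unfolding a_def b_def power_add by (simp only: mult_ac)
  qed
  have C: "b (Suc k) sums ((\<Sum>j. a j) * (\<Sum>j. b k j))"
    using Cauchy_product_sums[OF as IH(1)] by (simp add: conv[abs_def])
  have N: "(\<lambda>j. \<Sum>q\<le>j. norm (a q) * norm (b k (j - q))) sums ((\<Sum>j. norm (a j)) * (\<Sum>j. norm (b k j)))"
    by (rule Cauchy_product_sums) (use as IH(1) in auto)
  have le: "norm (b (Suc k) j) \<le> (\<Sum>q\<le>j. norm (a q) * norm (b k (j - q)))" for j
    unfolding conv by (rule order_trans[OF norm_sum]) (simp add: norm_mult)
  have s: "summable (\<lambda>j. norm (b (Suc k) j))"
    by (rule summable_comparison_test'[OF sums_summable[OF N], of 0]) (use le in auto)
  have "(\<Sum>j. norm (b (Suc k) j)) \<le> (\<Sum>j. norm (a j)) * (\<Sum>j. norm (b k j))"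
    using suminf_le[OF le s sums_summable[OF N]] sums_unique[OF N] by simp
  also have "\<dots> \<le> 1 / (1 - \<rho>) * (1 / (1 - \<rho>)) ^ k"
    using a1 IH(3) \<rho> suminf_nonneg[OF IH(1)] by (intro mult_mono) auto
  finally have "(\<Sum>j. norm (b (Suc k) j)) \<le> (1 / (1 - \<rho>)) ^ Suc k" by simp
  moreover have "(\<Sum>j. a j) = return_gf i \<rho> W" by (simp add: return_gf_def a_def)
  ultimately show ?case
    using s C sums_unique[OF IH(2)] unfolding b_def[symmetric] by simp
qed

lemma bm_gf_measurable: "i < n \<Longrightarrow> return_gf i \<rho> \<in> borel_measurable \<mu>"
  unfolding return_gf_def using bm_measurable[OF bm_first_return] by (intro borel_measurable_suminf) auto

lemma first_return_scalar:
  assumes W: "W \<in> carrier_mat n n" and i: "i < n"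
  shows "first_return n ((z \<cdot>\<^sub>m 1\<^sub>m n) * W) i q = z ^ q * first_return n W i q"
proof -
  have ex: "l < n \<Longrightarrow> excursion n ((z \<cdot>\<^sub>m 1\<^sub>m n) * W) i q l = z ^ q * excursion n W i q l" for q l
    by (induction q arbitrary: l)
      (auto simp: scalar_mult_index[OF W] sum_distrib_left mult_ac simp del: index_mult_mat)
  show ?thesis
    unfolding first_return_def using i
    by (cases q) (auto simp: scalar_mult_index[OF W] ex sum_distrib_left mult_ac simp del: index_mult_mat)
qed

lemma kth_return_scalar:
  assumes W: "W \<in> carrier_mat n n" and i: "i < n"
  shows "kth_return n ((z \<cdot>\<^sub>m 1\<^sub>m n) * W) i k j = z ^ j * kth_return n W i k j"
proof (induction k arbitrary: j)
  case (Suc k)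
  have "kth_return n ((z \<cdot>\<^sub>m 1\<^sub>m n) * W) i (Suc k) j
     = (\<Sum>q\<le>j. (z ^ q * first_return n W i q) * (z ^ (j - q) * kth_return n W i k (j - q)))"
    by (simp add: first_return_scalar[OF W i] Suc)
  also have "\<dots> = (\<Sum>q\<le>j. z ^ j * (first_return n W i q * kth_return n W i k (j - q)))"
  proof (intro sum.cong refl)
    fix q assume "q \<in> {..j}"
    then have "z ^ j = z ^ q * z ^ (j - q)" by (simp flip: power_add)
    then show "(z ^ q * first_return n W i q) * (z ^ (j - q) * kth_return n W i k (j - q))
      = z ^ j * (first_return n W i q * kth_return n W i k (j - q))" by (simp only: mult_ac)
  qed
  finally show ?case by (simp add: sum_distrib_left)
next
  case 0
  show ?case by (cases "j = 0") auto
qed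

text \<open>Parseval's identity: a scalar phase multiplies the term of length \<open>j\<close> by
  its \<open>j\<close>-th power, so different lengths are orthogonal.\<close>

lemma return_var_gf:
  assumes \<rho>: "0 < \<rho>" "\<rho> < 1" and i: "i < n"
  shows "(\<lambda>j. \<rho> ^ (2 * j) * return_var i k j) sums (\<integral>W. norm (return_gf i \<rho> W) ^ (2 * k) \<partial>\<mu>)"
proof -
  define b where "b j W = of_real \<rho> ^ j * kth_return n W i k j" for j W
  have bb: "bm (b j)" for j unfolding b_def by (intro bm_mult bm_const bm_kth_return i)
  define M where "M = (1 / (1 - \<rho>)) ^ k"
  have part: "(\<integral>W. (norm (\<Sum>j<J. b j W))\<^sup>2 \<partial>\<mu>) = (\<Sum>j<J. \<rho> ^ (2 * j) * return_var i k j)" for J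
  proof -
    have "complex_of_real (\<integral>W. (norm (\<Sum>j<J. b j W))\<^sup>2 \<partial>\<mu>)
       = (\<integral>W. (\<Sum>j<J. b j W) * cnj (\<Sum>j<J. b j W) \<partial>\<mu>)"
      by (simp only: integral_complex_of_real[symmetric] complex_norm_square)
    also have "\<dots> = (\<integral>W. (\<Sum>j<J. \<Sum>l<J. b j W * cnj (b l W)) \<partial>\<mu>)"
      by (simp only: cnj_sum sum_product)
    also have "\<dots> = (\<Sum>j<J. \<integral>W. (\<Sum>l<J. b j W * cnj (b l W)) \<partial>\<mu>)"
      by (intro integral_sum_bm bm_sum bm_mult bb bm_cnj) auto
    also have "\<dots> = (\<Sum>j<J. \<Sum>l<J. \<integral>W. b j W * cnj (b l W) \<partial>\<mu>)"
      by (intro sum.cong refl integral_sum_bm bm_mult bb bm_cnj)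
    also have "\<dots> = (\<Sum>j<J. \<Sum>l<J. if l = j then of_real (\<rho> ^ (2 * j) * return_var i k j) else 0)"
    proof (intro sum.cong refl)
      fix j l
      show "(\<integral>W. b j W * cnj (b l W) \<partial>\<mu>) = (if l = j then of_real (\<rho> ^ (2 * j) * return_var i k j) else 0)"
      proof (cases "l = j")
        case True
        have "(\<integral>W. b j W * cnj (b j W) \<partial>\<mu>)
          = (\<integral>W. of_real (\<rho> ^ (2 * j)) * (kth_return n W i k j * cnj (kth_return n W i k j)) \<partial>\<mu>)"
        proof (intro Bochner_Integration.integral_cong refl)
          fix W
          have "complex_of_real (\<rho> ^ (2 * j)) = of_real \<rho> ^ j * of_real \<rho> ^ j" by (simp add: mult_2 power_add)
          then show "b j W * cnj (b j W) = of_real (\<rho> ^ (2 * j)) * (kth_return n W i k j * cnj (kth_return n W i k j))"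
            by (simp add: b_def mult_ac del: of_real_power)
        qed
        then show ?thesis using True by (simp add: return_var_complex)
      next
        case False
        have "(\<integral>W. b j W * cnj (b l W) \<partial>\<mu>) = 0"
        proof (rule integral_phase_eq_0[of _ j l])
          show "(\<lambda>W. b j W * cnj (b l W)) \<in> borel_measurable \<mu>"
            by (intro bm_measurable bm_mult bb bm_cnj)
        qed (use False in \<open>auto simp: b_def kth_return_scalar[OF unitary_carrier i] Complex.DeMoivre cis_cnj mult_ac\<close>)
        then show ?thesis using False by simp
      qed
    qed
    also have "\<dots> = of_real (\<Sum>j<J. \<rho> ^ (2 * j) * return_var i k j)" by simp
    finally show ?thesis by (simp only: of_real_eq_iff)
  qed
  have bnd: "norm (\<Sum>j<J. b j W) \<le> M" if W: "W \<in> unitary_group n" for W J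
  proof -
    note g = kth_return_gf[OF \<rho> W i, of k]
    have "norm (\<Sum>j<J. b j W) \<le> (\<Sum>j<J. norm (b j W))" by (rule norm_sum)
    also have "\<dots> \<le> (\<Sum>j. norm (b j W))"
      using g by (intro sum_le_suminf) (auto simp: b_def)
    also have "\<dots> \<le> M" using g by (simp add: b_def M_def)
    finally show ?thesis .
  qed
  have "(\<lambda>J. \<integral>W. (norm (\<Sum>j<J. b j W))\<^sup>2 \<partial>\<mu>) \<longlonglongrightarrow> (\<integral>W. norm (return_gf i \<rho> W) ^ (2 * k) \<partial>\<mu>)"
  proof (rule integral_dominated_convergence[where w="\<lambda>_. M\<^sup>2"])
    show "(\<lambda>W. norm (return_gf i \<rho> W) ^ (2 * k)) \<in> borel_measurable \<mu>"
      using bm_gf_measurable[OF i] by measurable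
    show "(\<lambda>W. (norm (\<Sum>j<J. b j W))\<^sup>2) \<in> borel_measurable \<mu>" for J
      using bm_measurable[OF bb] by measurable
    show "AE W in \<mu>. (\<lambda>J. (norm (\<Sum>j<J. b j W))\<^sup>2) \<longlonglongrightarrow> norm (return_gf i \<rho> W) ^ (2 * k)"
    proof (rule AE_I2)
      fix W assume "W \<in> space \<mu>"
      then have "(\<lambda>J. \<Sum>j<J. b j W) \<longlonglongrightarrow> return_gf i \<rho> W ^ k"
        using kth_return_gf[OF \<rho> _ i, of W k] by (simp add: space_eq sums_def b_def)
      then have "(\<lambda>J. (norm (\<Sum>j<J. b j W))\<^sup>2) \<longlonglongrightarrow> (norm (return_gf i \<rho> W ^ k))\<^sup>2"
        by (intro tendsto_intros)
      then show "(\<lambda>J. (norm (\<Sum>j<J. b j W))\<^sup>2) \<longlonglongrightarrow> norm (return_gf i \<rho> W) ^ (2 * k)"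
        by (simp add: norm_power power_mult[symmetric] mult.commute)
    qed
    show "AE W in \<mu>. norm ((norm (\<Sum>j<J. b j W))\<^sup>2) \<le> M\<^sup>2" for J
      using bnd by (intro AE_I2) (auto simp: space_eq intro!: power_mono)
  qed simp
  then show ?thesis unfolding part sums_def .
qed

text \<open>The excursion resolvent \<open>(1 - \<rho> P U)\<^sup>-\<^sup>1 e\<^sub>i\<close>, where \<open>P\<close> kills the coordinate \<open>i\<close>.\<close>

definition excursion_gf :: "nat \<Rightarrow> real \<Rightarrow> complex mat \<Rightarrow> nat \<Rightarrow> complex" where
  "excursion_gf i \<rho> W l = (\<Sum>q. of_real \<rho> ^ q * excursion n W i q l)"

lemma excursion_gf_sums:
  assumes \<rho>: "0 < \<rho>" "\<rho> < 1" and W: "W \<in> unitary_group n" and i: "i < n" and l: "l < n"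
  shows "(\<lambda>q. of_real \<rho> ^ q * excursion n W i q l) sums excursion_gf i \<rho> W l"
proof -
  have geo: "summable (\<lambda>j. \<rho> ^ j)" using \<rho> by (intro summable_geometric) simp
  have "summable (\<lambda>q. of_real \<rho> ^ q * excursion n W i q l)"
    by (rule summable_comparison_test'[OF geo, of 0])
      (use excursion_le_1[OF W i l] \<rho> in \<open>auto simp: norm_mult norm_power mult_left_le\<close>)
  then show ?thesis by (simp add: excursion_gf_def summable_sums)
qed

text \<open>In vector form \<open>w = e_i + \<rho> P U w\<close>, while the coordinate
  \<open>i\<close> of \<open>\<rho> U w\<close>, which \<open>P\<close> kills, is the return
  generating function.\<close>

lemma excursion_gf_eq:
  assumes \<rho>: "0 < \<rho>" "\<rho> < 1" and W: "W \<in> unitary_group n" and i: "i < n"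
  shows "l < n \<Longrightarrow> l \<noteq> i \<Longrightarrow> excursion_gf i \<rho> W l = of_real \<rho> * (\<Sum>p<n. W $$ (l, p) * excursion_gf i \<rho> W p)"
    and "excursion_gf i \<rho> W i = 1"
    and "return_gf i \<rho> W = of_real \<rho> * (\<Sum>p<n. W $$ (i, p) * excursion_gf i \<rho> W p)"
proof -
  have S: "(\<lambda>q. of_real \<rho> * (\<Sum>p<n. W $$ (l, p) * (of_real \<rho> ^ q * excursion n W i q p)))
    sums (of_real \<rho> * (\<Sum>p<n. W $$ (l, p) * excursion_gf i \<rho> W p))" for l
    by (intro sums_mult sums_sum excursion_gf_sums[OF \<rho> W i]) auto
  {
    assume l: "l < n" "l \<noteq> i"
    have "of_real \<rho> * (\<Sum>p<n. W $$ (l, p) * (of_real \<rho> ^ q * excursion n W i q p))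
      = of_real \<rho> ^ Suc q * excursion n W i (Suc q) l" for q
      using l by (simp add: sum_distrib_left mult_ac)
    then have "(\<lambda>q. of_real \<rho> ^ Suc q * excursion n W i (Suc q) l) sums
       (of_real \<rho> * (\<Sum>p<n. W $$ (l, p) * excursion_gf i \<rho> W p))" using S[of l] by (simp only:)
    then have "(\<lambda>q. of_real \<rho> ^ q * excursion n W i q l) sums
       (of_real \<rho> * (\<Sum>p<n. W $$ (l, p) * excursion_gf i \<rho> W p))"
      using l sums_Suc_iff[of "\<lambda>q. of_real \<rho> ^ q * excursion n W i q l"] by simp
    then show "excursion_gf i \<rho> W l = of_real \<rho> * (\<Sum>p<n. W $$ (l, p) * excursion_gf i \<rho> W p)"
      using excursion_gf_sums[OF \<rho> W i l(1)] sums_unique2 by blast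
  }
  have "(\<lambda>q. of_real \<rho> ^ q * excursion n W i q i) = (\<lambda>q. if q = 0 then 1 else 0)"
    by (rule ext, rename_tac q, case_tac q) auto
  then show "excursion_gf i \<rho> W i = 1"
    using sums_single[of 0 "\<lambda>_. 1 :: complex"] by (simp add: excursion_gf_def sums_iff)
  have "of_real \<rho> * (\<Sum>p<n. W $$ (i, p) * (of_real \<rho> ^ q * excursion n W i q p))
      = of_real \<rho> ^ Suc q * first_return n W i (Suc q)" for q
    by (simp add: first_return_def sum_distrib_left mult_ac)
  then have "(\<lambda>q. of_real \<rho> ^ Suc q * first_return n W i (Suc q)) sums
     (of_real \<rho> * (\<Sum>p<n. W $$ (i, p) * excursion_gf i \<rho> W p))" using S[of i] by (simp only:)
  then have "(\<lambda>q. of_real \<rho> ^ q * first_return n W i q) sums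
     (of_real \<rho> * (\<Sum>p<n. W $$ (i, p) * excursion_gf i \<rho> W p))"
    using sums_Suc_iff[of "\<lambda>q. of_real \<rho> ^ q * first_return n W i q"] by (simp add: first_return_def)
  then show "return_gf i \<rho> W = of_real \<rho> * (\<Sum>p<n. W $$ (i, p) * excursion_gf i \<rho> W p)"
    by (simp add: return_gf_def sums_iff)
qed

definition excursion_norm :: "nat \<Rightarrow> real \<Rightarrow> complex mat \<Rightarrow> real" where
  "excursion_norm i \<rho> W = L2_set (\<lambda>l. norm (excursion_gf i \<rho> W l)) {..<n}"

lemma L2_set_unitary:
  assumes "W \<in> unitary_group n"
  shows "L2_set (\<lambda>l. norm (\<Sum>p<n. W $$ (l, p) * x p)) {..<n} = L2_set (\<lambda>l. norm (x l)) {..<n}"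
  using unitary_norm_preserving[OF assms, of x] by (simp add: L2_set_def)

text \<open>\<open>\<rho> U w\<close> agrees with \<open>w\<close> away from \<open>i\<close>, is
  the return function at \<open>i\<close>, and has \<open>\<rho>\<close> times the norm of
  \<open>w\<close>. As \<open>w\<close> has coordinate \<open>1\<close> at \<open>i\<close>,
  comparing squared norms expresses the distance of the return function from modulus one by a
  resolvent norm.\<close>

lemma return_gf_norm:
  assumes \<rho>: "0 < \<rho>" "\<rho> < 1" and W: "W \<in> unitary_group n" and i: "i < n"
  shows "1 - (norm (return_gf i \<rho> W))\<^sup>2 = (1 - \<rho>\<^sup>2) * (excursion_norm i \<rho> W)\<^sup>2"
    and "excursion_norm i \<rho> W \<ge> 1"
proof -
  let ?w = "excursion_gf i \<rho> W" and ?y = "\<lambda>l. \<Sum>p<n. W $$ (l, p) * excursion_gf i \<rho> W p"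
  note e = excursion_gf_eq[OF \<rho> W i]
  have N: "(excursion_norm i \<rho> W)\<^sup>2 = (\<Sum>l<n. (norm (?w l))\<^sup>2)"
    by (simp add: excursion_norm_def L2_set_def sum_nonneg)
  have split: "(\<Sum>l<n. f l) = f i + (\<Sum>l\<in>{..<n} - {i}. f l)" for f :: "nat \<Rightarrow> real"
    using i by (subst sum.remove[of _ i]) auto
  have "\<rho>\<^sup>2 * (excursion_norm i \<rho> W)\<^sup>2 = (\<Sum>l<n. (norm (of_real \<rho> * ?y l))\<^sup>2)"
    unfolding N unitary_norm_preserving[OF W, of ?w, symmetric]
    by (simp only: norm_mult power_mult_distrib norm_of_real power2_abs sum_distrib_left[symmetric])
  also have "\<dots> = (norm (return_gf i \<rho> W))\<^sup>2 + (\<Sum>l\<in>{..<n} - {i}. (norm (?w l))\<^sup>2)"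
    unfolding split e(3) using e(1) by simp
  also have "(\<Sum>l\<in>{..<n} - {i}. (norm (?w l))\<^sup>2) = (excursion_norm i \<rho> W)\<^sup>2 - 1"
    unfolding N split e(2) by simp
  finally show "1 - (norm (return_gf i \<rho> W))\<^sup>2 = (1 - \<rho>\<^sup>2) * (excursion_norm i \<rho> W)\<^sup>2"
    by (simp add: algebra_simps)
  have "1 = norm (?w i)" using e(2) by simp
  also have "\<dots> \<le> excursion_norm i \<rho> W"
    unfolding excursion_norm_def using i by (intro member_le_L2_set) auto
  finally show "excursion_norm i \<rho> W \<ge> 1" .
qed

text \<open>Resolvent identity: the difference \<open>d\<close> of the two resolvents vanishes at
  \<open>i\<close> and elsewhere satisfies \<open>d = \<rho>' U d + (\<rho>' - \<rho>) U w\<close>.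
  As \<open>\<rho> - \<rho>' \<le> 1 - \<rho>'\<close>, its norm is at most that of
  \<open>w\<close>.\<close>

lemma excursion_norm_compare:
  assumes \<rho>: "0 < \<rho>'" "\<rho>' < \<rho>" "\<rho> < 1" and W: "W \<in> unitary_group n" and i: "i < n"
  shows "excursion_norm i \<rho>' W \<le> 2 * excursion_norm i \<rho> W"
proof -
  let ?w = "excursion_gf i \<rho> W" and ?v = "excursion_gf i \<rho>' W"
  let ?d = "\<lambda>l. ?v l - ?w l"
  let ?L = "\<lambda>x. L2_set (\<lambda>l. norm (x l :: complex)) {..<n}"
  have r: "0 < \<rho>" "\<rho>' < 1" using \<rho> by auto
  note ew = excursion_gf_eq[OF r(1) \<rho>(3) W i] and ev = excursion_gf_eq[OF \<rho>(1) r(2) W i]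
  have tri: "?L (\<lambda>l. x l + y l) \<le> ?L x + ?L y" for x y
  proof -
    have "?L (\<lambda>l. x l + y l) \<le> L2_set (\<lambda>l. norm (x l) + norm (y l)) {..<n}"
      by (intro L2_set_mono norm_triangle_ineq norm_ge_zero)
    also have "\<dots> \<le> ?L x + ?L y" by (rule L2_set_triangle_ineq)
    finally show ?thesis .
  qed
  have scale: "?L (\<lambda>l. c * x l) = norm c * ?L x" for c x
    by (simp add: norm_mult L2_set_right_distrib)
  have "norm (?d l) \<le> norm (of_real \<rho>' * (\<Sum>p<n. W $$ (l, p) * ?d p) + of_real (\<rho>' - \<rho>) * (\<Sum>p<n. W $$ (l, p) * ?w p))"
    if l: "l < n" for l
  proof (cases "l = i")
    case False
    have "?d l = of_real \<rho>' * (\<Sum>p<n. W $$ (l, p) * ?d p) + of_real (\<rho>' - \<rho>) * (\<Sum>p<n. W $$ (l, p) * ?w p)"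
      unfolding ew(1)[OF l False] ev(1)[OF l False] by (simp add: right_diff_distrib sum_subtractf algebra_simps)
    then show ?thesis by simp
  qed (use ew(2) ev(2) in simp)
  then have "?L ?d \<le> ?L (\<lambda>l. of_real \<rho>' * (\<Sum>p<n. W $$ (l, p) * ?d p) + of_real (\<rho>' - \<rho>) * (\<Sum>p<n. W $$ (l, p) * ?w p))"
    by (intro L2_set_mono) auto
  also have "\<dots> \<le> ?L (\<lambda>l. of_real \<rho>' * (\<Sum>p<n. W $$ (l, p) * ?d p)) + ?L (\<lambda>l. of_real (\<rho>' - \<rho>) * (\<Sum>p<n. W $$ (l, p) * ?w p))"
    by (rule tri)
  also have "\<dots> = \<rho>' * ?L ?d + (\<rho> - \<rho>') * ?L ?w"
    unfolding scale L2_set_unitary[OF W] norm_of_real using \<rho> by simp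
  finally have "(1 - \<rho>') * ?L ?d \<le> (\<rho> - \<rho>') * ?L ?w" by (simp add: algebra_simps)
  also have "\<dots> \<le> (1 - \<rho>') * ?L ?w" using \<rho> by (intro mult_right_mono) auto
  finally have "?L ?d \<le> ?L ?w" using r by simp
  moreover have "?L ?v \<le> ?L ?w + ?L ?d" using tri[of ?w ?d] by simp
  ultimately show ?thesis by (simp add: excursion_norm_def)
qed

text \<open>Equal to the sum over \<open>k\<close> of \<open>E |F|^(2 k) / k\<close> with
  \<open>F\<close> the return generating function, that is, to the share of the coordinate
  \<open>i\<close> in the power series with coefficients \<open>trace_var j / j\<close>.\<close>

definition log_defect :: "nat \<Rightarrow> real \<Rightarrow> real" where
  "log_defect i \<rho> = (\<integral>W. - ln (1 - (norm (return_gf i \<rho> W))\<^sup>2) \<partial>\<mu>)"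

lemma return_gf_norm_le:
  assumes \<rho>: "0 < \<rho>" "\<rho> < 1" and W: "W \<in> unitary_group n" and i: "i < n"
  shows "(norm (return_gf i \<rho> W))\<^sup>2 \<le> \<rho>\<^sup>2"
proof -
  have "1 \<le> (excursion_norm i \<rho> W)\<^sup>2" using return_gf_norm(2)[OF assms] by simp
  then have "(1 - \<rho>\<^sup>2) * 1 \<le> (1 - \<rho>\<^sup>2) * (excursion_norm i \<rho> W)\<^sup>2"
    using \<rho> by (intro mult_left_mono) (auto simp: power_le_one)
  then show ?thesis using return_gf_norm(1)[OF assms] by simp
qed

lemma log_defect_integrable:
  assumes \<rho>: "0 < \<rho>" "\<rho> < 1" and i: "i < n"
  shows "integrable \<mu> (\<lambda>W. - ln (1 - (norm (return_gf i \<rho> W))\<^sup>2))"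
proof (rule integrable_const_bound[of _ "- ln (1 - \<rho>\<^sup>2)"])
  have r: "\<rho>\<^sup>2 < 1" using \<rho> by (simp add: power_less_one_iff abs_square_less_1)
  show "(\<lambda>W. - ln (1 - (norm (return_gf i \<rho> W))\<^sup>2)) \<in> borel_measurable \<mu>"
    using bm_gf_measurable[OF i] by measurable
  have "norm (- ln (1 - (norm (return_gf i \<rho> W))\<^sup>2)) \<le> - ln (1 - \<rho>\<^sup>2)" if "W \<in> unitary_group n" for W
  proof -
    have "ln (1 - \<rho>\<^sup>2) \<le> ln (1 - (norm (return_gf i \<rho> W))\<^sup>2)"
      using return_gf_norm_le[OF \<rho> that i] r by (intro ln_mono) auto
    moreover have "ln (1 - (norm (return_gf i \<rho> W))\<^sup>2) \<le> 0"
      using return_gf_norm_le[OF \<rho> that i] r by (subst ln_le_zero_iff) auto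
    ultimately show ?thesis by simp
  qed
  then show "AE W in \<mu>. norm (- ln (1 - (norm (return_gf i \<rho> W))\<^sup>2)) \<le> - ln (1 - \<rho>\<^sup>2)"
    by (intro AE_I2) (simp add: space_eq)
qed

text \<open>Approaching the unit circle costs only a logarithm. By \<open>return_gf_norm\<close> the
  integrand is minus the logarithm of \<open>(1 - \<rho>^2) N^2\<close> with \<open>N\<close> the
  resolvent norm, and \<open>N' \<le> 2 N\<close> gives the factor \<open>4\<close>.\<close>

lemma log_defect_compare:
  assumes \<rho>: "0 < \<rho>'" "\<rho>' < \<rho>" "\<rho> < 1" and i: "i < n"
  shows "log_defect i \<rho> \<le> log_defect i \<rho>' + ln (4 * (1 - \<rho>'\<^sup>2) / (1 - \<rho>\<^sup>2))"
proof -
  have r: "0 < \<rho>" "\<rho>' < 1" using \<rho> by auto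
  have sq: "1 - \<rho>\<^sup>2 > 0" "1 - \<rho>'\<^sup>2 > 0" using \<rho> by (simp_all add: abs_square_less_1)
  let ?c = "ln (4 * (1 - \<rho>'\<^sup>2) / (1 - \<rho>\<^sup>2))"
  have "- ln (1 - (norm (return_gf i \<rho> W))\<^sup>2) \<le> - ln (1 - (norm (return_gf i \<rho>' W))\<^sup>2) + ?c"
    if W: "W \<in> unitary_group n" for W
  proof -
    let ?N = "excursion_norm i \<rho> W" and ?N' = "excursion_norm i \<rho>' W"
    note e = return_gf_norm[OF r(1) \<rho>(3) W i] and e' = return_gf_norm[OF \<rho>(1) r(2) W i]
    have "?N'\<^sup>2 \<le> (2 * ?N)\<^sup>2" using excursion_norm_compare[OF \<rho> W i] e'(2) by (intro power_mono) auto
    then have "(1 - \<rho>'\<^sup>2) * ?N'\<^sup>2 \<le> (1 - \<rho>'\<^sup>2) * (2 * ?N)\<^sup>2" using sq by (intro mult_left_mono) auto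
    also have "\<dots> = (4 * (1 - \<rho>'\<^sup>2) / (1 - \<rho>\<^sup>2)) * ((1 - \<rho>\<^sup>2) * ?N\<^sup>2)"
      using sq by (simp add: power_mult_distrib)
    finally have "ln ((1 - \<rho>'\<^sup>2) * ?N'\<^sup>2) \<le> ln ((4 * (1 - \<rho>'\<^sup>2) / (1 - \<rho>\<^sup>2)) * ((1 - \<rho>\<^sup>2) * ?N\<^sup>2))"
      using sq e'(2) by (intro ln_mono) auto
    also have "\<dots> = ?c + ln ((1 - \<rho>\<^sup>2) * ?N\<^sup>2)"
      using sq e(2) by (intro ln_mult_pos) auto
    finally show ?thesis unfolding e(1) e'(1) by simp
  qed
  then have "log_defect i \<rho> \<le> (\<integral>W. - ln (1 - (norm (return_gf i \<rho>' W))\<^sup>2) + ?c \<partial>\<mu>)"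
    unfolding log_defect_def
    by (intro integral_mono log_defect_integrable[OF r(1) \<rho>(3) i] Bochner_Integration.integrable_add
        log_defect_integrable[OF \<rho>(1) r(2) i]) (auto simp: space_eq)
  also have "\<dots> = log_defect i \<rho>' + ?c"
    unfolding log_defect_def
    using log_defect_integrable[OF \<rho>(1) r(2) i] by (subst Bochner_Integration.integral_add) (auto simp: prob_space)
  finally show ?thesis .
qed

text \<open>The return decomposition is summed over \<open>j\<close>; after exchanging the sums, the
  sum over \<open>k\<close> is the series of a logarithm.\<close>

lemma trace_var_gf:
  assumes \<rho>: "0 < \<rho>" "\<rho> < 1"
  shows "(\<lambda>j. \<rho> ^ (2 * j) * (trace_var j / real j)) sums (\<Sum>i<n. log_defect i \<rho>)"
proof -
  have r: "\<rho>\<^sup>2 < 1" using \<rho> by (simp add: abs_square_less_1)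
  have one: "(\<lambda>j. \<rho> ^ (2 * j) * (\<Sum>k=1..j. return_var i k j / real k)) sums log_defect i \<rho>" if i: "i < n" for i
  proof -
    define f where "f k j = \<rho> ^ (2 * j) * return_var i k j / real k" for k j
    define C where "C k = (\<integral>W. norm (return_gf i \<rho> W) ^ (2 * k) / real k \<partial>\<mu>)" for k
    have "f k sums C k" for k
      unfolding f_def C_def integral_divide_zero by (intro sums_divide return_var_gf \<rho> i)
    moreover have "C sums log_defect i \<rho>"
    proof -
      have le: "norm (return_gf i \<rho> W) ^ (2 * k) / real k \<le> (\<rho>\<^sup>2) ^ k" if "W \<in> unitary_group n" for W k
      proof (cases "k = 0")
        case False
        have "norm (return_gf i \<rho> W) ^ (2 * k) \<le> (\<rho>\<^sup>2) ^ k"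
          unfolding power_mult by (rule power_mono[OF return_gf_norm_le[OF \<rho> that i]]) simp
        moreover have "norm (return_gf i \<rho> W) ^ (2 * k) / real k \<le> norm (return_gf i \<rho> W) ^ (2 * k) / 1"
          using False by (intro divide_left_mono) auto
        ultimately show ?thesis by simp
      qed simp
      have geo: "summable (\<lambda>k. (\<rho>\<^sup>2) ^ k)" using r by (intro summable_geometric) simp
      have int: "integrable \<mu> (\<lambda>W. norm (return_gf i \<rho> W) ^ (2 * k) / real k)" for k
        by (rule integrable_const_bound[of _ "(\<rho>\<^sup>2) ^ k"])
          (use le bm_gf_measurable[OF i] in \<open>auto simp: space_eq\<close>)
      have "(\<lambda>k. \<integral>W. norm (return_gf i \<rho> W) ^ (2 * k) / real k \<partial>\<mu>) sums
        (\<integral>W. (\<Sum>k. norm (return_gf i \<rho> W) ^ (2 * k) / real k) \<partial>\<mu>)"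
      proof (rule sums_integral[OF int])
        show "AE W in \<mu>. summable (\<lambda>k. norm (norm (return_gf i \<rho> W) ^ (2 * k) / real k))"
        proof (rule AE_I2)
          fix W assume "W \<in> space \<mu>"
          then show "summable (\<lambda>k. norm (norm (return_gf i \<rho> W) ^ (2 * k) / real k))"
            by (intro summable_comparison_test'[OF geo, of 0]) (use le in \<open>auto simp: space_eq\<close>)
        qed
        have "(\<integral>W. norm (norm (return_gf i \<rho> W) ^ (2 * k) / real k) \<partial>\<mu>) \<le> (\<rho>\<^sup>2) ^ k" for k
        proof -
          have "(\<integral>W. norm (norm (return_gf i \<rho> W) ^ (2 * k) / real k) \<partial>\<mu>) \<le> (\<integral>W. (\<rho>\<^sup>2) ^ k \<partial>\<mu>)"
            using le int by (intro integral_mono) (auto simp: space_eq)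
          then show ?thesis by (simp add: prob_space)
        qed
        then show "summable (\<lambda>k. \<integral>W. norm (norm (return_gf i \<rho> W) ^ (2 * k) / real k) \<partial>\<mu>)"
          by (intro summable_comparison_test'[OF geo, of 0]) auto
      qed
      also have "(\<integral>W. (\<Sum>k. norm (return_gf i \<rho> W) ^ (2 * k) / real k) \<partial>\<mu>) = log_defect i \<rho>"
        unfolding log_defect_def
      proof (intro Bochner_Integration.integral_cong refl)
        fix W assume "W \<in> space \<mu>"
        then have "(norm (return_gf i \<rho> W))\<^sup>2 \<le> \<rho>\<^sup>2" using return_gf_norm_le[OF \<rho> _ i] by (simp add: space_eq)
        then have "\<bar>- (norm (return_gf i \<rho> W))\<^sup>2\<bar> < 1" using r by simp
        from ln_series'[OF this]
        have "(\<lambda>k. - (- ((norm (return_gf i \<rho> W))\<^sup>2 ^ k / real k))) sums - ln (1 - (norm (return_gf i \<rho> W))\<^sup>2)"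
          by (intro sums_minus) (simp add: )
        then show "(\<Sum>k. norm (return_gf i \<rho> W) ^ (2 * k) / real k) = - ln (1 - (norm (return_gf i \<rho> W))\<^sup>2)"
          by (simp add: sums_iff power_mult)
      qed
      finally show ?thesis by (simp add: C_def[abs_def])
    qed
    moreover have "(\<lambda>k. f k j) sums (\<rho> ^ (2 * j) * (\<Sum>k=1..j. return_var i k j / real k))" for j
    proof -
      have "(\<lambda>k. f k j) sums (\<Sum>k\<in>{1..j}. f k j)"
      proof (rule sums_finite)
        fix k assume "k \<notin> {1..j}"
        then show "f k j = 0" by (cases "k = 0") (auto simp: f_def return_var_def kth_return_eq_0)
      qed simp
      then show ?thesis by (simp add: f_def sum_distrib_left)
    qed
    ultimately show ?thesis
      by (rule sums_swap_nonneg[rotated]) (auto simp: f_def return_var_nonneg)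
  qed
  have "(\<lambda>j. \<Sum>i<n. \<rho> ^ (2 * j) * (\<Sum>k=1..j. return_var i k j / real k)) sums (\<Sum>i<n. log_defect i \<rho>)"
    by (intro sums_sum one) auto
  moreover have "(\<Sum>i<n. \<rho> ^ (2 * j) * (\<Sum>k=1..j. return_var i k j / real k)) = \<rho> ^ (2 * j) * (trace_var j / real j)" for j
    using trace_var_returns[of j] by (cases "j = 0") (auto simp: sum_distrib_left)
  ultimately show ?thesis by simp
qed

text \<open>With \<open>\<rho> = sqrt (1 - \<sigma>)\<close> the weight
  \<open>\<rho> ^ (2 * j)\<close> is \<open>(1 - \<sigma>) ^ j\<close>. Each of the \<open>n\<close>
  coordinates pays the logarithm once, hence the factor \<open>n\<close>.\<close>

lemma trace_gf_compare:
  assumes \<sigma>: "0 < \<sigma>" "\<sigma> \<le> \<sigma>'" "\<sigma>' < 1"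
  shows "(\<Sum>j. (1 - \<sigma>) ^ j * (trace_var j / real j)) \<le> (\<Sum>j. (1 - \<sigma>') ^ j * (trace_var j / real j)) + real n * ln (4 * \<sigma>' / \<sigma>)"
    and "summable (\<lambda>j. (1 - \<sigma>) ^ j * (trace_var j / real j))"
proof -
  have S: "(\<lambda>j. (1 - s) ^ j * (trace_var j / real j)) sums (\<Sum>i<n. log_defect i (sqrt (1 - s)))"
    if "0 < s" "s < 1" for s
    using trace_var_gf[of "sqrt (1 - s)"] that by (simp add: power_mult)
  then show "summable (\<lambda>j. (1 - \<sigma>) ^ j * (trace_var j / real j))" using \<sigma> by (auto simp: sums_iff)
  show "(\<Sum>j. (1 - \<sigma>) ^ j * (trace_var j / real j)) \<le> (\<Sum>j. (1 - \<sigma>') ^ j * (trace_var j / real j)) + real n * ln (4 * \<sigma>' / \<sigma>)"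
  proof (cases "\<sigma> = \<sigma>'")
    case True
    have "ln (4 * \<sigma>' / \<sigma>) \<ge> 0" using True \<sigma> by simp
    then show ?thesis using True by simp
  next
    case False
    have "(\<Sum>i<n. log_defect i (sqrt (1 - \<sigma>))) \<le> (\<Sum>i<n. log_defect i (sqrt (1 - \<sigma>')) + ln (4 * \<sigma>' / \<sigma>))"
    proof (rule sum_mono)
      fix i assume "i \<in> {..<n}"
      then have "log_defect i (sqrt (1 - \<sigma>)) \<le> log_defect i (sqrt (1 - \<sigma>')) + ln (4 * (1 - (sqrt (1 - \<sigma>'))\<^sup>2) / (1 - (sqrt (1 - \<sigma>))\<^sup>2))"
        using False \<sigma> by (intro log_defect_compare) auto
      then show "log_defect i (sqrt (1 - \<sigma>)) \<le> log_defect i (sqrt (1 - \<sigma>')) + ln (4 * \<sigma>' / \<sigma>)"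
        using \<sigma> by simp
    qed
    then show ?thesis using S[of \<sigma>] S[of \<sigma>'] \<sigma> by (simp add: sums_iff sum.distrib)
  qed
qed

text \<open>Starting point of the comparison. For \<open>1 \<le> j \<le> n\<close> the variance is
  \<open>j\<close>, and \<open>s = 2 ln n / n\<close> is large enough for the damping at
  \<open>j > n\<close> to beat the trivial bound \<open>trace_var j \<le> n^2\<close>, because
  \<open>(1 - s) ^ n \<le> 1 / n^2\<close>.\<close>

lemma trace_gf_initial:
  assumes n: "n \<ge> 8"
  shows "2 * ln (real n) / real n < 1"
    and "(\<Sum>j. (1 - 2 * ln (real n) / real n) ^ j * (trace_var j / real j)) \<le> real n"
proof -
  define s where "s = 2 * ln (real n) / real n"
  define q where "q = 1 - s"
  have ln1: "ln (real n) \<ge> 1"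
  proof -
    have "exp 1 \<le> real n" using exp_le n by linarith
    then show ?thesis using n by (subst ln_ge_iff) auto
  qed
  \<comment> \<open>A linear bound on the logarithm at \<open>sqrt n\<close>; then
    \<open>4 * sqrt n - 4 < n\<close> amounts to \<open>(sqrt n - 2)^2 > 0\<close>.\<close>
  have "ln (real n) = 2 * ln (sqrt (real n))" using n by (simp add: ln_sqrt)
  also have "ln (sqrt (real n)) \<le> sqrt (real n) - 1" using n by (intro ln_le_minus_one) auto
  finally have "2 * ln (real n) \<le> 4 * sqrt (real n) - 4" by simp
  also have "\<dots> < sqrt (real n) * sqrt (real n)"
  proof -
    have "sqrt (real n) > 2" using n by (intro real_less_rsqrt) auto
    then have "(sqrt (real n) - 2)\<^sup>2 > 0" by auto
    then show ?thesis by (simp add: power2_eq_square algebra_simps)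
  qed
  finally have s1: "s < 1" using n by (simp add: s_def field_simps)
  then show "2 * ln (real n) / real n < 1" by (simp add: s_def)
  have s0: "s > 0" using ln1 n by (simp add: s_def)
  have q: "0 < q" "q < 1" using s0 s1 by (auto simp: q_def)
  have geo: "(\<lambda>j. q ^ j) sums (1 / s)" using geometric_sums[of q] q by (simp add: q_def)
  have tail: "(\<lambda>j. if j > n then q ^ j else 0) sums (q ^ Suc n / s)"
  proof -
    have "(\<lambda>j. q ^ (j + Suc n)) sums (q ^ Suc n / s)"
      using sums_mult[OF geo, of "q ^ Suc n"] by (simp add: power_add mult_ac)
    then have "(\<lambda>j. if j + Suc n > n then q ^ (j + Suc n) else 0) sums (q ^ Suc n / s)" by simp
    then show ?thesis using sums_iff_shift[of "\<lambda>j. if j > n then q ^ j else 0" "Suc n" "q ^ Suc n / s"] by simp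
  qed
  have bound: "q ^ j * (trace_var j / real j) \<le> q ^ j + real n * (if j > n then q ^ j else 0)" for j
  proof -
    have qj: "q ^ j \<ge> 0" using q by simp
    consider "j = 0" | "1 \<le> j" "j \<le> n" | "j > n" by linarith
    then show ?thesis
    proof cases
      case 3
      have "trace_var j / real j \<le> (real n)\<^sup>2 / real n"
        using trace_var_le[of j] 3 n by (intro frac_le) auto
      then have "trace_var j / real j \<le> real n" using n by (simp add: power2_eq_square)
      then have "q ^ j * (trace_var j / real j) \<le> q ^ j * real n" using qj by (rule mult_left_mono)
      then show ?thesis using 3 qj by (simp add: mult.commute)
    qed (use qj trace_var_eq[of j] in auto)
  qed
  have S: "(\<lambda>j. q ^ j + real n * (if j > n then q ^ j else 0)) sums (1 / s + real n * (q ^ Suc n / s))"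
    by (intro sums_add sums_mult geo tail)
  have sm: "summable (\<lambda>j. q ^ j * (trace_var j / real j))"
    using trace_gf_compare(2)[OF s0 order_refl s1] by (simp only: q_def)
  have "(\<Sum>j. q ^ j * (trace_var j / real j)) \<le> 1 / s + real n * (q ^ Suc n / s)"
    using suminf_le[OF bound sm sums_summable[OF S]] unfolding sums_unique[OF S, symmetric] .
  also have "\<dots> \<le> real n / 2 + real n / 2"
  proof -
    have inv_s: "1 / s \<le> real n / 2" using ln1 n by (simp add: s_def field_simps)
    have "q ^ Suc n \<le> q ^ n" using q by (intro power_decreasing) auto
    also have "\<dots> \<le> exp (- s) ^ n" using q exp_ge_add_one_self[of "- s"] by (intro power_mono) (auto simp: q_def)
    also have "exp (- s) ^ n = exp (- 2 * ln (real n))"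
      using n by (simp add: exp_of_nat_mult[symmetric] s_def)
    also have "\<dots> = 1 / (real n)\<^sup>2"
    proof -
      have "exp (- 2 * ln (real n)) = inverse (exp (ln (real n) + ln (real n)))" by (simp flip: exp_minus)
      then show ?thesis using n by (simp only: exp_add exp_ln) (simp add: power2_eq_square divide_inverse)
    qed
    finally have "real n * q ^ Suc n \<le> real n * (1 / (real n)\<^sup>2)" by (intro mult_left_mono) auto
    also have "\<dots> \<le> 1" using n by (simp add: power2_eq_square)
    finally have "(real n * q ^ Suc n) * (1 / s) \<le> 1 * (1 / s)" using s0 by (intro mult_right_mono) auto
    then show ?thesis using inv_s by simp
  qed
  finally show "(\<Sum>j. (1 - 2 * ln (real n) / real n) ^ j * (trace_var j / real j)) \<le> real n"
    by (simp add: q_def s_def)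
qed

text \<open>With \<open>s = 1 / M\<close> the weight \<open>(1 - s) ^ j\<close> stays above
  \<open>1 / 4\<close> up to the end \<open>M\<close> of the block, so the block is bounded by the
  generating function at \<open>s\<close>. Reaching \<open>s\<close> from the starting point costs
  \<open>n * ln (16 * ln n * 2 ^ a)\<close>; one factor \<open>1 / j\<close> gives the decay
  \<open>1 / 2 ^ a\<close>.\<close>

lemma dyadic_block:
  assumes n: "n \<ge> 8"
  shows "(\<Sum>j=2 ^ a * n + 1..2 ^ Suc a * n. trace_var j / (real j)\<^sup>2)
    \<le> 4 / 2 ^ a * (1 + ln (16 * ln (real n)) + real a * ln 2)"
proof -
  define M where "M = 2 ^ Suc a * n"
  define s where "s = 1 / real M"
  define s' where "s' = 2 * ln (real n) / real n"
  have M: "M \<ge> 2" "M = 2 * (2 ^ a * n)" using n by (auto simp: M_def intro: order_trans[of 2 "2 * n"])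
  have ln1: "ln (real n) \<ge> 1"
  proof -
    have "exp 1 \<le> real n" using exp_le n by linarith
    then show ?thesis using n by (subst ln_ge_iff) auto
  qed
  have s0: "s > 0" using M by (simp add: s_def)
  have ss: "s \<le> s'"
  proof -
    have "n \<le> M" unfolding M_def by simp
    then have "s \<le> 1 / real n" using n unfolding s_def by (intro divide_left_mono) auto
    also have "\<dots> \<le> s'" using ln1 n by (simp add: s'_def divide_right_mono)
    finally show ?thesis .
  qed
  have s1: "s' < 1" using trace_gf_initial(1)[OF n] by (simp add: s'_def)
  have quarter: "(1 - s) ^ j \<ge> 1 / 4" if "j \<le> M" for j
  proof -
    \<comment> \<open>Bernoulli's inequality at \<open>M / 2\<close>, then squared; at
      \<open>M\<close> itself it would only give \<open>0\<close>.\<close>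
    have "1 / 2 \<le> 1 + real (2 ^ a * n) * (- s)" using M n by (simp add: s_def)
    also have "\<dots> \<le> (1 + (- s)) ^ (2 ^ a * n)" using ss s1 by (intro Bernoulli_inequality) auto
    finally have "(1 / 2)\<^sup>2 \<le> ((1 - s) ^ (2 ^ a * n))\<^sup>2" by (intro power_mono) auto
    also have "\<dots> = (1 - s) ^ M" unfolding M(2) by (simp add: power_mult[symmetric] mult.commute)
    also have "\<dots> \<le> (1 - s) ^ j" using that s0 ss s1 by (intro power_decreasing) auto
    finally show ?thesis by (simp add: power2_eq_square)
  qed
  let ?N = "2 ^ a * real n"
  have N0: "?N > 0" using n by simp
  have sm: "summable (\<lambda>j. (1 - s) ^ j * (trace_var j / real j))" by (rule trace_gf_compare(2)[OF s0 ss s1])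
  have nonneg: "(1 - s) ^ j * (trace_var j / real j) \<ge> 0" for j
    using ss s1 trace_var_le[of j] by (intro mult_nonneg_nonneg divide_nonneg_nonneg) auto
  have "(\<Sum>j=2 ^ a * n + 1..2 ^ Suc a * n. trace_var j / (real j)\<^sup>2)
    \<le> (\<Sum>j=2 ^ a * n + 1..2 ^ Suc a * n. 4 / ?N * ((1 - s) ^ j * (trace_var j / real j)))"
  proof (rule sum_mono)
    fix j assume j: "j \<in> {2 ^ a * n + 1..2 ^ Suc a * n}"
    have jN: "?N \<le> real j"
    proof -
      have "real (2 ^ a * n) \<le> real j" using j by (intro of_nat_mono) simp
      then show ?thesis by simp
    qed
    have t: "trace_var j / real j \<ge> 0" using trace_var_le[of j] by simp
    have "trace_var j / (real j)\<^sup>2 = (1 / real j) * (trace_var j / real j)" by (simp add: power2_eq_square)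
    also have "\<dots> \<le> (4 / ?N * (1 - s) ^ j) * (trace_var j / real j)"
    proof (rule mult_right_mono[OF _ t])
      have "1 / real j \<le> 1 / ?N" using jN N0 by (intro divide_left_mono) auto
      also have "\<dots> = 4 / ?N * (1 / 4)" by simp
      also have "\<dots> \<le> 4 / ?N * (1 - s) ^ j" using quarter[of j] j N0 by (intro mult_left_mono) (auto simp: M_def)
      finally show "1 / real j \<le> 4 / ?N * (1 - s) ^ j" .
    qed
    finally show "trace_var j / (real j)\<^sup>2 \<le> 4 / ?N * ((1 - s) ^ j * (trace_var j / real j))" by (simp only: mult.assoc)
  qed
  also have "\<dots> = 4 / ?N * (\<Sum>j=2 ^ a * n + 1..2 ^ Suc a * n. (1 - s) ^ j * (trace_var j / real j))"
    by (simp add: sum_distrib_left)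
  also have "\<dots> \<le> 4 / ?N * (\<Sum>j. (1 - s) ^ j * (trace_var j / real j))"
    using N0 nonneg by (intro mult_left_mono sum_le_suminf sm) auto
  also have "\<dots> \<le> 4 / ?N * (real n + real n * ln (4 * s' / s))"
    using N0 trace_gf_compare(1)[OF s0 ss s1] trace_gf_initial(2)[OF n] by (intro mult_left_mono) (auto simp: s'_def)
  also have "4 * s' / s = 16 * ln (real n) * 2 ^ a"
    using n by (simp add: s_def s'_def M_def field_simps)
  also have "ln (16 * ln (real n) * 2 ^ a) = ln (16 * ln (real n)) + real a * ln 2"
    using ln1 by (subst ln_mult_pos) (auto simp: ln_realpow)
  also have "4 / ?N * (real n + real n * (ln (16 * ln (real n)) + real a * ln 2))
    = 4 / 2 ^ a * (1 + ln (16 * ln (real n)) + real a * ln 2)"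
  proof -
    have "4 / ?N * (real n + real n * y) = 4 / 2 ^ a * (1 + y)" for y
    proof -
      have "real n + real n * y = real n * (1 + y)" by (simp only: distrib_left mult_1_right)
      then show ?thesis using n by simp
    qed
    then show ?thesis by (simp only: add.assoc)
  qed
  finally show ?thesis .
qed

text \<open>The blocks decay geometrically up to the factor \<open>a\<close>, so their sum has the
  order \<open>ln (ln n)\<close> of the first one.\<close>

theorem trace_var_tail:
  assumes n: "n \<ge> 8"
  shows "(\<Sum>j=n + 1..J. trace_var j / (real j)\<^sup>2) \<le> 8 * (2 + ln (16 * ln (real n)))"
proof -
  have ln1: "ln (real n) \<ge> 1"
  proof -
    have "exp 1 \<le> real n" using exp_le n by linarith
    then show ?thesis using n by (subst ln_ge_iff) auto
  qed
  define K where "K = 1 + ln (16 * ln (real n))"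
  have K: "K \<ge> 0" using ln1 by (simp add: K_def)
  \<comment> \<open>The brackets are the partial sums over \<open>a < A\<close> of
    \<open>1 / 2 ^ a\<close> and of \<open>a / 2 ^ a\<close> in closed form.\<close>
  have dy: "(\<Sum>j=n + 1..2 ^ A * n. trace_var j / (real j)\<^sup>2)
    \<le> 4 * (K * (2 - 2 / 2 ^ A) + ln 2 * (2 - (2 * real A + 2) / 2 ^ A))" for A
  proof (induction A)
    case (Suc A)
    have "(\<Sum>j=n + 1..2 ^ Suc A * n. trace_var j / (real j)\<^sup>2)
      = (\<Sum>j=n + 1..2 ^ A * n. trace_var j / (real j)\<^sup>2) + (\<Sum>j=2 ^ A * n + 1..2 ^ Suc A * n. trace_var j / (real j)\<^sup>2)"
    proof -
      have "{n + 1..c} = {n + 1..b} \<union> {b + 1..c}" if "n \<le> b" "b \<le> c" for b c :: nat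
        using that by auto
      then have "{n + 1..2 ^ Suc A * n} = {n + 1..2 ^ A * n} \<union> {2 ^ A * n + 1..2 ^ Suc A * n}" by simp
      then show ?thesis by (simp only:) (rule sum.union_disjoint, auto)
    qed
    also have "\<dots> \<le> 4 * (K * (2 - 2 / 2 ^ A) + ln 2 * (2 - (2 * real A + 2) / 2 ^ A)) + 4 / 2 ^ A * (K + real A * ln 2)"
      using Suc dyadic_block[OF n, of A] unfolding K_def by (intro add_mono) auto
    also have "\<dots> = 4 * (K * (2 - 2 / 2 ^ Suc A) + ln 2 * (2 - (2 * real (Suc A) + 2) / 2 ^ Suc A))"
    proof -
      define p where "p = 1 / (2::real) ^ A"
      have e: "2 / 2 ^ A = 2 * p" "(2 * real A + 2) / 2 ^ A = (2 * real A + 2) * p" "4 / 2 ^ A = 4 * p"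
        "2 / 2 ^ Suc A = p" "(2 * real (Suc A) + 2) / 2 ^ Suc A = (real A + 2) * p"
        by (simp_all add: p_def add_divide_distrib)
      show ?thesis unfolding e by (simp only: algebra_simps)
    qed
    finally show ?case .
  qed simp
  define A where "A = J"
  have A: "J < 2 ^ A" unfolding A_def by (rule less_exp)
  have "(2::nat) ^ A \<le> 2 ^ A * n" using n by simp
  then have "J \<le> 2 ^ A * n" using A by linarith
  then have "(\<Sum>j=n + 1..J. trace_var j / (real j)\<^sup>2) \<le> (\<Sum>j=n + 1..2 ^ A * n. trace_var j / (real j)\<^sup>2)"
    using trace_var_le by (intro sum_mono2) auto
  also have "\<dots> \<le> 4 * (K * (2 - 2 / 2 ^ A) + ln 2 * (2 - (2 * real A + 2) / 2 ^ A))" by (rule dy)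
  also have "\<dots> \<le> 4 * (K * 2 + 1 * 2)"
  proof -
    have "ln 2 * (2 - (2 * real A + 2) / 2 ^ A) \<le> ln 2 * 2" by (intro mult_left_mono) auto
    moreover have "K * (2 - 2 / 2 ^ A) \<le> K * 2" using K by (intro mult_left_mono) auto
    moreover have "4 * (x + y) \<le> 4 * (K * 2 + 1 * 2)" if "y \<le> l * 2" "x \<le> K * 2" "l < 1" for x y l :: real
    proof -
      have "y \<le> 1 * 2" using that by simp
      then show ?thesis using that by (intro mult_left_mono add_mono) auto
    qed
    ultimately show ?thesis using ln_2_less_1 by blast
  qed
  also have "\<dots> = 8 * (2 + ln (16 * ln (real n)))" by (simp add: K_def)
  finally show ?thesis .
qed

end

section \<open>Logarithmic sums\<close>

text \<open>Summation by parts. In \<open>step\<close> the boundary terms at both ends are kept, so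
  that raising \<open>b\<close> changes the expression only by
  \<open>q ^ Suc b * (1 / (b + 1) - 1 / b)\<close> and the bounds telescope.\<close>

lemma abel_tail_bound:
  fixes q :: complex
  assumes q: "norm q \<le> 1" "q \<noteq> 1" and a: "a \<ge> 1"
  shows "norm (\<Sum>j=a..b. q ^ j / of_nat j) \<le> 2 / (norm (1 - q) * real a)"
proof (cases "a \<le> b")
  case True
  have pow: "norm (q ^ j) \<le> 1" for j using q by (simp add: norm_power power_le_one)
  have step: "norm ((1 - q) * (\<Sum>j=a..b. q ^ j / of_nat j) + q ^ Suc b / of_nat b - q ^ a / of_nat a) \<le> 1 / real a - 1 / real b"
    using True
  proof (induction b rule: dec_induct)
    case base
    have "(1 - q) * (\<Sum>j=a..a. q ^ j / of_nat j) + q ^ Suc a / of_nat a - q ^ a / of_nat a = 0"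
      using a by (simp add: field_simps)
    then show ?case by simp
  next
    case (step b)
    have b: "b \<ge> 1" using step a by simp
    have "(1 - q) * (\<Sum>j=a..Suc b. q ^ j / of_nat j) + q ^ Suc (Suc b) / of_nat (Suc b) - q ^ a / of_nat a
      = ((1 - q) * (\<Sum>j=a..b. q ^ j / of_nat j) + q ^ Suc b / of_nat b - q ^ a / of_nat a)
        + q ^ Suc b * of_real (1 / real (Suc b) - 1 / real b)"
    proof -
      have "(\<Sum>j=a..Suc b. q ^ j / of_nat j) = (\<Sum>j=a..b. q ^ j / of_nat j) + q ^ Suc b / of_nat (Suc b)"
        using step by simp
      moreover have "(1 - q) * (S + x / y) + q * x / y - z = ((1 - q) * S + x / w - z) + x * (1 / y - 1 / w)"
        for S x y w z :: complex
        by (simp add: distrib_left left_diff_distrib right_diff_distrib diff_divide_distrib)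
      ultimately show ?thesis
        by (simp only: of_real_diff of_real_divide of_real_of_nat_eq of_real_1 power_Suc)
    qed
    also have "norm \<dots> \<le> (1 / real a - 1 / real b) + 1 * (1 / real b - 1 / real (Suc b))"
    proof (rule order_trans[OF norm_triangle_ineq], rule add_mono)
      have "1 / real (Suc b) \<le> 1 / real b" using b by (intro divide_left_mono) auto
      then have "norm (complex_of_real (1 / real (Suc b) - 1 / real b)) = 1 / real b - 1 / real (Suc b)"
        unfolding norm_of_real by linarith
      moreover have "1 / real b - 1 / real (Suc b) \<ge> 0" using \<open>1 / real (Suc b) \<le> 1 / real b\<close> by simp
      ultimately show "norm (q ^ Suc b * of_real (1 / real (Suc b) - 1 / real b)) \<le> 1 * (1 / real b - 1 / real (Suc b))"
        unfolding norm_mult using pow[of "Suc b"] by (metis mult_right_mono)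
    qed (use step in simp)
    finally show ?case by simp
  qed
  have "norm ((1 - q) * (\<Sum>j=a..b. q ^ j / of_nat j))
    = norm (((1 - q) * (\<Sum>j=a..b. q ^ j / of_nat j) + q ^ Suc b / of_nat b - q ^ a / of_nat a)
        + (- (q ^ Suc b / of_nat b)) + q ^ a / of_nat a)" by simp
  also have "\<dots> \<le> (1 / real a - 1 / real b) + 1 / real b + 1 / real a"
  proof (intro order_trans[OF norm_triangle_ineq] add_mono)
    show "norm (- (q ^ Suc b / of_nat b)) \<le> 1 / real b"
      unfolding norm_minus_cancel norm_divide norm_of_nat using pow[of "Suc b"] by (rule divide_right_mono) simp
    show "norm (q ^ a / of_nat a) \<le> 1 / real a"
      unfolding norm_divide norm_of_nat using pow[of a] by (rule divide_right_mono) simp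
  qed (rule step)
  finally have "norm (1 - q) * norm (\<Sum>j=a..b. q ^ j / of_nat j) \<le> 2 / real a" by (simp add: norm_mult)
  moreover have "norm (1 - q) > 0" using q by simp
  ultimately have "norm (\<Sum>j=a..b. q ^ j / of_nat j) \<le> 2 / real a / norm (1 - q)"
    by (subst pos_le_divide_eq) (auto simp: mult.commute)
  then show ?thesis by (simp add: mult.commute)
qed (use a in auto)

text \<open>For \<open>\<kappa> > 0\<close> this is \<open>min (ln m) (- ln \<kappa>)\<close>. The
  case distinction makes \<open>\<kappa> = 0\<close> mean no cutoff, which points on the unit circle
  require.\<close>

definition log_cutoff :: "nat \<Rightarrow> real \<Rightarrow> real" where
  "log_cutoff m \<kappa> = (if \<kappa> * real m \<le> 1 then ln (real m) else ln (1 / \<kappa>))"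

lemma harm_le_ln: "m \<ge> 1 \<Longrightarrow> harm m \<le> 1 + ln (real m)"
proof (induction m rule: nat_induct_at_least)
  case base
    then show ?case by (simp add: harm_def)
  next
  case (Suc m)
    have "ln (real m / real (Suc m)) \<le> real m / real (Suc m) - 1"
      using Suc by (intro ln_le_minus_one) auto
    moreover have "ln (real m / real (Suc m)) = ln (real m) - ln (real (Suc m))" using Suc by (simp add: ln_div)
    moreover have "real m / real (Suc m) - 1 = - (1 / real (Suc m))" by (simp add: field_simps)
    ultimately show ?case using Suc by (simp add: harm_Suc inverse_eq_divide)
qed

lemma sum_inverse_ln:
  assumes "m \<ge> 1"
  shows "\<bar>(\<Sum>j=1..m. 1 / real j) - ln (real m)\<bar> \<le> 1"
proof -
  have h: "(\<Sum>j=1..m. 1 / real j) = harm m" by (simp add: harm_def inverse_eq_divide)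
  have "ln (real m) \<le> ln (real m + 1)" using assms by simp
  moreover have "harm m \<le> 1 + ln (real m)" using assms by (rule harm_le_ln)
  ultimately show ?thesis using ln_le_harm[of m] unfolding h by (simp add: abs_le_iff)
qed

lemma norm_one_minus_power_le:
  fixes q :: complex
  assumes "norm q \<le> 1"
  shows "norm (q ^ j - 1) \<le> real j * norm (1 - q)"
proof (induction j)
  case (Suc j)
  have "q ^ Suc j - 1 = q * (q ^ j - 1) + (q - 1)" by (simp add: algebra_simps)
  then have "norm (q ^ Suc j - 1) \<le> norm q * norm (q ^ j - 1) + norm (q - 1)"
    by (metis norm_mult norm_triangle_ineq)
  also have "\<dots> \<le> 1 * norm (q ^ j - 1) + norm (1 - q)"
    using assms by (intro add_mono mult_right_mono) (auto simp: norm_minus_commute)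
  finally show ?case using Suc by (simp add: algebra_simps)
qed simp

text \<open>The powers \<open>q\<^sup>j\<close> are close to \<open>1\<close> for \<open>j \<le> 1/\<kappa>\<close> and cancel beyond that.\<close>

lemma log_series_cutoff:
  fixes q :: complex
  assumes q: "norm q \<le> 1" and m: "m \<ge> 1" and \<kappa>: "0 \<le> \<kappa>" "\<kappa> \<le> K" and "c > 0" "K \<ge> 1"
    and up: "norm (1 - q) \<le> 3 * \<kappa>" and lo: "c * \<kappa> \<le> norm (1 - q)"
  shows "norm ((\<Sum>j=1..m. q ^ j / of_nat j) - of_real (log_cutoff m \<kappa>)) \<le> 5 + 2 / c + ln K"
proof -
  have head: "norm ((\<Sum>j=1..J. q ^ j / of_nat j) - of_real (\<Sum>j=1..J. 1 / real j)) \<le> 3" if J: "\<kappa> * real J \<le> 1" for J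
  proof -
    have "norm ((\<Sum>j=1..J. q ^ j / of_nat j) - of_real (\<Sum>j=1..J. 1 / real j)) = norm (\<Sum>j=1..J. (q ^ j - 1) / of_nat j)"
      by (simp add: sum_subtractf diff_divide_distrib)
    also have "\<dots> \<le> (\<Sum>j=1..J. norm ((q ^ j - 1) / of_nat j))" by (rule norm_sum)
    also have "\<dots> \<le> (\<Sum>j=1..J. 3 * \<kappa>)"
    proof (rule sum_mono)
      fix j assume j: "j \<in> {1..J}"
      have "norm (q ^ j - 1) \<le> real j * (3 * \<kappa>)"
        using norm_one_minus_power_le[OF q, of j] up mult_left_mono[OF up, of "real j"] by linarith
      then show "norm ((q ^ j - 1) / of_nat j) \<le> 3 * \<kappa>"
        using j by (simp add: norm_divide field_simps)
    qed
    also have "\<dots> = 3 * (\<kappa> * real J)" by simp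
    finally show ?thesis using J by linarith
  qed
  have K0: "ln K \<ge> 0" using \<open>K \<ge> 1\<close> by simp
  have c0: "2 / c \<ge> 0" using \<open>c > 0\<close> by simp
  show ?thesis
  proof (cases "\<kappa> * real m \<le> 1")
    case True
    have "norm (of_real (\<Sum>j=1..m. 1 / real j) - complex_of_real (ln (real m))) \<le> 1"
      using sum_inverse_ln[OF m] by (simp only: of_real_diff[symmetric] norm_of_real)
    then have "norm ((\<Sum>j=1..m. q ^ j / of_nat j) - of_real (ln (real m))) \<le> 3 + 1"
      using head[OF True] by (rule norm_diff_triangle_le[rotated])
    moreover have "log_cutoff m \<kappa> = ln (real m)" using True by (simp add: log_cutoff_def)
    ultimately show ?thesis using K0 c0 by (simp only:)
  next
    case False
    have \<kappa>0: "\<kappa> > 0" using False \<kappa>(1) by (cases "\<kappa> = 0") auto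
    have "c * \<kappa> > 0" using \<kappa>0 \<open>c > 0\<close> by simp
    then have q1: "q \<noteq> 1" using lo by auto
    define J where "J = nat \<lfloor>1 / \<kappa>\<rfloor>"
    have J: "real J \<le> 1 / \<kappa>" "1 / \<kappa> < real J + 1" using \<kappa>0 by (auto simp: J_def)
    have J1: "\<kappa> * real J \<le> 1" using J(1) \<kappa>0 by (simp add: field_simps)
    have "1 / \<kappa> < real m" using False \<kappa>0 by (simp add: field_simps)
    then have Jm: "J < m" using J(1) by linarith
    have split: "(\<Sum>j=1..m. q ^ j / of_nat j) = (\<Sum>j=1..J. q ^ j / of_nat j) + (\<Sum>j=J+1..m. q ^ j / of_nat j)"
    proof -
      have "{1..m} = {1..J} \<union> {J+1..m}" using Jm by auto
      then show ?thesis by (simp only:) (rule sum.union_disjoint, auto)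
    qed
    have tail: "norm (\<Sum>j=J+1..m. q ^ j / of_nat j) \<le> 2 / c"
    proof -
      have "norm (\<Sum>j=J+1..m. q ^ j / of_nat j) \<le> 2 / (norm (1 - q) * real (J + 1))"
        by (rule abel_tail_bound[OF q q1]) simp
      also have "\<dots> \<le> 2 / (c * \<kappa> * (1 / \<kappa>))"
        using lo J \<kappa>0 \<open>c > 0\<close> q1 by (intro divide_left_mono mult_mono mult_pos_pos) auto
      also have "\<dots> = 2 / c" using \<kappa>0 by simp
      finally show ?thesis .
    qed
    have main: "\<bar>(\<Sum>j=1..J. 1 / real j) - ln (1 / \<kappa>)\<bar> \<le> 2 + ln K"
    \<comment> \<open>\<open>J = 0\<close> means \<open>\<kappa> > 1\<close>: the sum is empty, and
      \<open>- ln (1 / \<kappa>)\<close> is at most \<open>ln K\<close>.\<close>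
    proof (cases "J = 0")
      case True
      have "ln (1 / \<kappa>) \<le> 0" using J True \<kappa>0 by (subst ln_le_zero_iff) auto
      moreover have "- ln (1 / \<kappa>) \<le> ln K" using \<kappa> \<kappa>0 by (simp add: ln_div)
      ultimately show ?thesis using True by simp
    next
      case False
      have "ln (real J) \<le> ln (1 / \<kappa>)" using J False \<kappa>0 by (intro ln_mono) auto
      moreover have "ln (1 / \<kappa>) \<le> ln (2 * real J)" using J False \<kappa>0 by (intro ln_mono) auto
      moreover have "ln (2 * real J) \<le> 1 + ln (real J)" using False ln_2_less_1 by (simp add: ln_mult)
      ultimately show ?thesis using sum_inverse_ln[of J] False K0 by (simp add: abs_le_iff)
    qed
    have "norm (of_real (\<Sum>j=1..J. 1 / real j) - complex_of_real (ln (1 / \<kappa>))) \<le> 2 + ln K"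
      using main by (simp only: of_real_diff[symmetric] norm_of_real)
    then have "norm ((\<Sum>j=1..J. q ^ j / of_nat j) - of_real (ln (1 / \<kappa>))) \<le> 3 + (2 + ln K)"
      using head[OF J1] by (rule norm_diff_triangle_le[rotated])
    then have "norm ((\<Sum>j=1..J. q ^ j / of_nat j) - of_real (ln (1 / \<kappa>)) + (\<Sum>j=J+1..m. q ^ j / of_nat j)) \<le> 3 + (2 + ln K) + 2 / c"
      using tail by (rule norm_triangle_mono)
    moreover have "(\<Sum>j=1..J. q ^ j / of_nat j) - of_real (ln (1 / \<kappa>)) + (\<Sum>j=J+1..m. q ^ j / of_nat j)
      = (\<Sum>j=1..m. q ^ j / of_nat j) - of_real (log_cutoff m \<kappa>)"
      unfolding split using False by (simp add: log_cutoff_def)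
    ultimately show ?thesis by simp
  qed
qed

text \<open>Concavity of the sine on \<open>[0, pi]\<close>. The slope \<open>sin b / b\<close> is
  positive only for \<open>b < pi\<close>, which the gap \<open>\<delta>\<close> between the angles
  will ensure.\<close>

lemma sin_ge_chord:
  assumes "0 \<le> x" "x \<le> b" "0 < b" "b \<le> pi"
  shows "sin b / b * x \<le> sin x"
proof -
  have "convex_on {0..pi} (\<lambda>x. - sin x)"
    by (rule f''_ge0_imp_convex[where f'="\<lambda>x. - cos x" and f''=sin])
      (auto intro!: derivative_eq_intros simp: sin_ge_zero)
  then have "- sin ((1 - x / b) *\<^sub>R 0 + (x / b) *\<^sub>R b) \<le> (1 - x / b) * (- sin 0) + (x / b) * (- sin b)"
    using assms by (intro convex_onD) auto
  then show ?thesis using assms by (simp add: mult.commute)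
qed

text \<open>\<open>|1 - q|\<close> is comparable with the larger of radial and angular distance, its
  square being \<open>(1 - r)^2 + 4 r sin^2 (\<Delta> / 2)\<close>. For the lower bound
  \<open>\<delta>\<close> keeps \<open>|\<Delta>|\<close> away from \<open>2 * pi\<close>, where
  \<open>cis \<Delta>\<close> would come back to \<open>1\<close>.\<close>

lemma norm_one_minus_bounds:
  assumes \<epsilon>: "0 \<le> \<epsilon>" "\<epsilon> \<le> 1" and \<delta>: "0 < \<delta>" "\<delta> < 2 * pi" and \<Delta>: "\<bar>\<Delta>\<bar> \<le> 2 * pi - \<delta>"
  defines "b \<equiv> pi - \<delta> / 2"
  defines "q \<equiv> complex_of_real (exp (- 2 * \<epsilon>)) * cis \<Delta>"
  shows "norm (1 - q) \<le> 3 * max \<epsilon> \<bar>\<Delta>\<bar>"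
    and "min (exp (- 2)) (exp (- 1) * (sin b / b)) * max \<epsilon> \<bar>\<Delta>\<bar> \<le> norm (1 - q)"
proof -
  define r where "r = exp (- 2 * \<epsilon>)"
  have r: "0 < r" "r \<le> 1" "exp (- 2) \<le> r" using \<epsilon> by (auto simp: r_def)
  have "1 - q = of_real (1 - r) + of_real r * (1 - cis \<Delta>)" by (simp add: q_def r_def algebra_simps)
  then have "norm (1 - q) \<le> norm (complex_of_real (1 - r)) + norm (complex_of_real r) * norm (1 - cis \<Delta>)"
    by (metis norm_mult norm_triangle_ineq)
  also have "\<dots> \<le> 2 * \<epsilon> + 1 * \<bar>\<Delta>\<bar>"
  proof (intro add_mono mult_mono)
    show "norm (complex_of_real (1 - r)) \<le> 2 * \<epsilon>"
      using r exp_ge_add_one_self[of "- 2 * \<epsilon>"] unfolding norm_of_real r_def by simp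
    show "norm (1 - cis \<Delta>) \<le> \<bar>\<Delta>\<bar>"
      using iexp_approx1[of \<Delta> 0] by (simp add: cis_conv_exp norm_minus_commute)
  qed (use r in auto)
  finally show "norm (1 - q) \<le> 3 * max \<epsilon> \<bar>\<Delta>\<bar>" by linarith
  have b: "0 < b" "b < pi" using \<delta> by (auto simp: b_def)
  have sb: "sin b / b \<ge> 0" using b by (simp add: sin_ge_zero)
  have sq: "(norm (1 - q))\<^sup>2 = (1 - r)\<^sup>2 + 4 * r * (sin (\<Delta> / 2))\<^sup>2"
  proof -
    have "(norm (1 - q))\<^sup>2 = (1 - r * cos \<Delta>)\<^sup>2 + (r * sin \<Delta>)\<^sup>2"
      unfolding q_def r_def[symmetric] cmod_power2 by simp
    also have "\<dots> = 1 - 2 * r * cos \<Delta> + ((r * sin \<Delta>)\<^sup>2 + (r * cos \<Delta>)\<^sup>2)" by (simp add: power2_eq_square algebra_simps)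
    also have "(r * sin \<Delta>)\<^sup>2 + (r * cos \<Delta>)\<^sup>2 = r\<^sup>2 * ((sin \<Delta>)\<^sup>2 + (cos \<Delta>)\<^sup>2)"
      by (simp only: power_mult_distrib distrib_left)
    also have "1 - 2 * r * cos \<Delta> + r\<^sup>2 * ((sin \<Delta>)\<^sup>2 + (cos \<Delta>)\<^sup>2) = (1 - r)\<^sup>2 + 2 * r * (1 - cos \<Delta>)"
      by (simp add: power2_eq_square algebra_simps)
    also have "1 - cos \<Delta> = 2 * (sin (\<Delta> / 2))\<^sup>2" using cos_double_sin[of "\<Delta> / 2"] by simp
    finally show ?thesis by simp
  qed
  have l1: "exp (- 2) * \<epsilon> \<le> norm (1 - q)"
  proof -
    \<comment> \<open>This gives \<open>1 - r \<ge> 2 r \<epsilon>\<close>, and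
      \<open>r \<ge> exp (- 2)\<close> because \<open>\<epsilon> \<le> 1\<close>.\<close>
    have "1 + 2 * \<epsilon> \<le> exp (2 * \<epsilon>)" by (rule exp_ge_add_one_self)
    then have "r * (1 + 2 * \<epsilon>) \<le> r * exp (2 * \<epsilon>)" using r by (intro mult_left_mono) auto
    also have "r * exp (2 * \<epsilon>) = 1" by (simp add: r_def exp_minus)
    finally have "2 * (r * \<epsilon>) \<le> 1 - r" by (simp add: algebra_simps)
    moreover have "exp (- 2) * \<epsilon> \<le> r * \<epsilon>" using r \<epsilon> by (intro mult_right_mono) auto
    moreover have "r * \<epsilon> \<ge> 0" using r \<epsilon> by simp
    ultimately have "exp (- 2) * \<epsilon> \<le> 1 - r" by linarith
    also have "1 - r \<le> norm (1 - q)"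
    proof (rule power2_le_imp_le)
      show "(1 - r)\<^sup>2 \<le> (norm (1 - q))\<^sup>2" unfolding sq using r by simp
    qed simp
    finally show ?thesis .
  qed
  have l2: "exp (- 1) * (sin b / b) * \<bar>\<Delta>\<bar> \<le> norm (1 - q)"
  proof (rule power2_le_imp_le)
    have "sin b / b * (\<bar>\<Delta>\<bar> / 2) \<le> sin (\<bar>\<Delta>\<bar> / 2)" using b \<Delta> by (intro sin_ge_chord) (auto simp: b_def)
    then have "(sin b / b * (\<bar>\<Delta>\<bar> / 2))\<^sup>2 \<le> (sin (\<bar>\<Delta>\<bar> / 2))\<^sup>2" using sb by (intro power_mono mult_nonneg_nonneg) auto
    also have "(sin (\<bar>\<Delta>\<bar> / 2))\<^sup>2 = (sin (\<Delta> / 2))\<^sup>2" by (cases "\<Delta> \<ge> 0") auto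
    finally have s: "(sin b / b * (\<bar>\<Delta>\<bar> / 2))\<^sup>2 \<le> (sin (\<Delta> / 2))\<^sup>2" .
    have "(exp (- 1) * (sin b / b) * \<bar>\<Delta>\<bar>)\<^sup>2 = 4 * exp (- 2) * (sin b / b * (\<bar>\<Delta>\<bar> / 2))\<^sup>2"
      by (simp add: power_mult_distrib power_divide exp_of_nat_mult[symmetric])
    also have "\<dots> \<le> 4 * r * (sin (\<Delta> / 2))\<^sup>2" using s r by (intro mult_mono) auto
    also have "\<dots> \<le> (norm (1 - q))\<^sup>2" unfolding sq by simp
    finally show "(exp (- 1) * (sin b / b) * \<bar>\<Delta>\<bar>)\<^sup>2 \<le> (norm (1 - q))\<^sup>2" .
  qed simp
  show "min (exp (- 2)) (exp (- 1) * (sin b / b)) * max \<epsilon> \<bar>\<Delta>\<bar> \<le> norm (1 - q)"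
  proof (cases "\<epsilon> \<le> \<bar>\<Delta>\<bar>")
    case True
    have "min (exp (- 2)) (exp (- 1) * (sin b / b)) * \<bar>\<Delta>\<bar> \<le> exp (- 1) * (sin b / b) * \<bar>\<Delta>\<bar>" by (intro mult_right_mono) auto
    then show ?thesis using l2 True by (simp add: max_def)
  next
    case False
    have "min (exp (- 2)) (exp (- 1) * (sin b / b)) * \<epsilon> \<le> exp (- 2) * \<epsilon>" using \<epsilon> by (intro mult_right_mono) auto
    then show ?thesis using l1 False by (simp add: max_def)
  qed
qed

lemma log_series_cutoff_uniform:
  assumes \<delta>: "0 < \<delta>" "\<delta> < 2 * pi"
  obtains C where "\<And>\<epsilon> \<Delta> m. 0 \<le> \<epsilon> \<Longrightarrow> \<epsilon> \<le> 1 \<Longrightarrow> \<bar>\<Delta>\<bar> \<le> 2 * pi - \<delta> \<Longrightarrow> m \<ge> 1 \<Longrightarrow>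
    norm ((\<Sum>j=1..m. (complex_of_real (exp (- 2 * \<epsilon>)) * cis \<Delta>) ^ j / of_nat j)
      - of_real (log_cutoff m (max \<epsilon> \<bar>\<Delta>\<bar>))) \<le> C"
proof -
  define b where "b = pi - \<delta> / 2"
  have b: "0 < b" "b < pi" using \<delta> by (auto simp: b_def)
  define c where "c = min (exp (- 2)) (exp (- 1) * (sin b / b))"
  have c: "c > 0" using b sin_gt_zero[of b] by (simp add: c_def)
  have "norm ((\<Sum>j=1..m. (complex_of_real (exp (- 2 * \<epsilon>)) * cis \<Delta>) ^ j / of_nat j)
      - of_real (log_cutoff m (max \<epsilon> \<bar>\<Delta>\<bar>))) \<le> 5 + 2 / c + ln (2 * pi)"
    if h: "0 \<le> \<epsilon>" "\<epsilon> \<le> 1" "\<bar>\<Delta>\<bar> \<le> 2 * pi - \<delta>" "m \<ge> 1" for \<epsilon> \<Delta> m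
  proof (rule log_series_cutoff)
    have p: "2 * pi \<ge> 1" using pi_gt3 by linarith
    then show "2 * pi \<ge> 1" .
    show "max \<epsilon> \<bar>\<Delta>\<bar> \<le> 2 * pi" using h \<delta> p by simp
    show "norm (1 - complex_of_real (exp (- 2 * \<epsilon>)) * cis \<Delta>) \<le> 3 * max \<epsilon> \<bar>\<Delta>\<bar>"
      using norm_one_minus_bounds(1)[OF h(1,2) \<delta> h(3)] .
    show "c * max \<epsilon> \<bar>\<Delta>\<bar> \<le> norm (1 - complex_of_real (exp (- 2 * \<epsilon>)) * cis \<Delta>)"
      using norm_one_minus_bounds(2)[OF h(1,2) \<delta> h(3)] unfolding c_def b_def .
  qed (use h c in \<open>auto simp: norm_mult\<close>)
  then show ?thesis using that by blast
qed

text \<open>Cholesky factorisation, one index at a time: the Schur complement of a positive diagonal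
  entry is again positive semidefinite, and a zero diagonal entry forces its row to vanish.\<close>

lemma psd_factorization:
  fixes \<Gamma> :: "'a \<Rightarrow> 'a \<Rightarrow> real"
  assumes "finite I" and sym: "\<And>i j. i \<in> I \<Longrightarrow> j \<in> I \<Longrightarrow> \<Gamma> i j = \<Gamma> j i"
    and psd: "\<And>x. 0 \<le> (\<Sum>i\<in>I. \<Sum>j\<in>I. x i * x j * \<Gamma> i j)"
  shows "\<exists>B. \<forall>i\<in>I. \<forall>j\<in>I. \<Gamma> i j = (\<Sum>k\<in>I. B i k * B j k)"
  using assms
proof (induction I arbitrary: \<Gamma> rule: finite_induct)
  case (insert a I)
  have expand: "(\<Sum>i\<in>insert a I. \<Sum>j\<in>insert a I. x i * x j * G i j)
    = x a * x a * G a a + 2 * x a * (\<Sum>i\<in>I. x i * G i a) + (\<Sum>i\<in>I. \<Sum>j\<in>I. x i * x j * G i j)"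
    if "\<And>i. i \<in> I \<Longrightarrow> G a i = G i a" for x and G :: "'a \<Rightarrow> 'a \<Rightarrow> real"
  proof -
    have "(\<Sum>j\<in>I. x a * x j * G a j) = x a * (\<Sum>i\<in>I. x i * G i a)"
      unfolding sum_distrib_left using that by (intro sum.cong) auto
    moreover have "(\<Sum>i\<in>I. x i * x a * G i a) = x a * (\<Sum>i\<in>I. x i * G i a)"
      unfolding sum_distrib_left by (intro sum.cong) auto
    ultimately show ?thesis using insert.hyps by (simp add: sum.distrib)
  qed
  have symI: "\<And>i j. i \<in> I \<Longrightarrow> j \<in> I \<Longrightarrow> \<Gamma> i j = \<Gamma> j i" "\<And>i. i \<in> I \<Longrightarrow> \<Gamma> a i = \<Gamma> i a"
    using insert.prems(1) by auto
  have q: "0 \<le> x a * x a * \<Gamma> a a + 2 * x a * (\<Sum>i\<in>I. x i * \<Gamma> i a) + (\<Sum>i\<in>I. \<Sum>j\<in>I. x i * x j * \<Gamma> i j)" for x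
    using insert.prems(2)[of x] expand[of \<Gamma> x] symI by simp
  have aa: "\<Gamma> a a \<ge> 0"
  proof -
    have "(\<Sum>i\<in>I. (if i = a then 1 else 0) * \<Gamma> i a) = 0" "(\<Sum>i\<in>I. \<Sum>j\<in>I. (if i = a then 1 else 0) * (if j = a then 1 else 0) * \<Gamma> i j) = 0"
      using insert.hyps by (auto intro!: sum.neutral)
    then show ?thesis using q[of "\<lambda>i. if i = a then 1 else 0"] by simp
  qed
  show ?case
  proof (cases "\<Gamma> a a = 0")
    case True
    have za: "\<Gamma> i a = 0" if i: "i \<in> I" for i
    proof (rule ccontr)
      assume ne: "\<Gamma> i a \<noteq> 0"
      \<comment> \<open>Chosen so that the form takes the value \<open>- 1\<close>; it is affine in
        \<open>s\<close> because \<open>\<Gamma> a a = 0\<close>.\<close>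
      define s where "s = - (\<Gamma> i i + 1) / (2 * \<Gamma> i a)"
      let ?x = "\<lambda>j. if j = a then s else if j = i then 1 else 0"
      have ia: "i \<noteq> a" using i insert.hyps by auto
      have "(\<Sum>j\<in>I. ?x j * \<Gamma> j a) = (\<Sum>j\<in>I. if j = i then \<Gamma> i a else 0)"
        using insert.hyps ia by (intro sum.cong) auto
      then have 1: "(\<Sum>j\<in>I. ?x j * \<Gamma> j a) = \<Gamma> i a" using i insert.hyps by simp
      have "(\<Sum>j\<in>I. \<Sum>k\<in>I. ?x j * ?x k * \<Gamma> j k) = (\<Sum>j\<in>I. if j = i then \<Gamma> i i else 0)"
      proof (intro sum.cong refl)
        fix j assume j: "j \<in> I"
        have "(\<Sum>k\<in>I. ?x j * ?x k * \<Gamma> j k) = (\<Sum>k\<in>I. if k = i then (if j = i then \<Gamma> i i else 0) else 0)"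
          using insert.hyps ia j by (intro sum.cong) auto
        then show "(\<Sum>k\<in>I. ?x j * ?x k * \<Gamma> j k) = (if j = i then \<Gamma> i i else 0)" using i insert.hyps by simp
      qed
      then have 2: "(\<Sum>j\<in>I. \<Sum>k\<in>I. ?x j * ?x k * \<Gamma> j k) = \<Gamma> i i" using i insert.hyps by simp
      have "0 \<le> 2 * s * \<Gamma> i a + \<Gamma> i i" using q[of ?x] True unfolding 1 2 by simp
      also have "\<dots> = - 1" using ne by (simp add: s_def field_simps)
      finally show False by simp
    qed
    have psdI: "0 \<le> (\<Sum>i\<in>I. \<Sum>j\<in>I. x i * x j * \<Gamma> i j)" for x
    proof -
      have "(\<Sum>i\<in>I. x i * \<Gamma> i a) = 0" using za by simp
      then show ?thesis using q[of x] True by simp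
    qed
    obtain B where B: "\<forall>i\<in>I. \<forall>j\<in>I. \<Gamma> i j = (\<Sum>k\<in>I. B i k * B j k)"
      using insert.IH[OF symI(1) psdI] by blast
    define B' where "B' i k = (if i = a \<or> k = a then 0 else B i k)" for i k
    have "\<Gamma> i j = (\<Sum>k\<in>insert a I. B' i k * B' j k)" if ij: "i \<in> insert a I" "j \<in> insert a I" for i j
    proof (cases "i = a \<or> j = a")
      case True
      then have "(\<Sum>k\<in>insert a I. B' i k * B' j k) = 0" by (auto simp: B'_def intro!: sum.neutral)
      moreover have "\<Gamma> i j = 0" using True ij za symI(2) \<open>\<Gamma> a a = 0\<close> by auto
      ultimately show ?thesis by simp
    next
      case False
      then have "(\<Sum>k\<in>I. B' i k * B' j k) = (\<Sum>k\<in>I. B i k * B j k)"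
        using insert.hyps by (intro sum.cong) (auto simp: B'_def)
      then show ?thesis using False ij B insert.hyps by (simp add: B'_def)
    qed
    then show ?thesis by blast
  next
    case False
    then have pos: "\<Gamma> a a > 0" using aa by simp
    define G where "G i j = \<Gamma> i j - \<Gamma> i a * \<Gamma> j a / \<Gamma> a a" for i j
    have psdG: "0 \<le> (\<Sum>i\<in>I. \<Sum>j\<in>I. x i * x j * G i j)" for x
    proof -
      define S where "S = (\<Sum>i\<in>I. x i * \<Gamma> i a)"
      \<comment> \<open>The coordinate \<open>a\<close> is set to the minimiser of the form;
        completing the square there leaves the Schur complement.\<close>
      define y where "y i = (if i = a then - S / \<Gamma> a a else x i)" for i
      have y: "y i = x i" if "i \<in> I" for i using that insert.hyps by (auto simp: y_def)
      have "(\<Sum>i\<in>I. \<Sum>j\<in>I. x i * x j * G i j)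
        = (\<Sum>i\<in>I. \<Sum>j\<in>I. x i * x j * \<Gamma> i j) - (\<Sum>i\<in>I. \<Sum>j\<in>I. (x i * \<Gamma> i a) * (x j * \<Gamma> j a)) / \<Gamma> a a"
        by (simp add: G_def sum_subtractf sum_divide_distrib algebra_simps)
      also have "(\<Sum>i\<in>I. \<Sum>j\<in>I. (x i * \<Gamma> i a) * (x j * \<Gamma> j a)) = S * S"
        by (simp add: S_def sum_product)
      also have "(\<Sum>i\<in>I. \<Sum>j\<in>I. x i * x j * \<Gamma> i j) - S * S / \<Gamma> a a
        = y a * y a * \<Gamma> a a + 2 * y a * (\<Sum>i\<in>I. y i * \<Gamma> i a) + (\<Sum>i\<in>I. \<Sum>j\<in>I. y i * y j * \<Gamma> i j)"
      proof -
        have "(\<Sum>i\<in>I. y i * \<Gamma> i a) = S" unfolding S_def using y by (intro sum.cong) auto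
        moreover have "(\<Sum>i\<in>I. \<Sum>j\<in>I. y i * y j * \<Gamma> i j) = (\<Sum>i\<in>I. \<Sum>j\<in>I. x i * x j * \<Gamma> i j)"
          using y by (intro sum.cong refl) auto
        moreover have "y a = - S / \<Gamma> a a" by (simp add: y_def)
        ultimately show ?thesis using pos by (simp add: field_simps)
      qed
      also have "\<dots> \<ge> 0" by (rule q)
      finally show ?thesis .
    qed
    have symG: "G i j = G j i" if "i \<in> I" "j \<in> I" for i j using symI(1)[OF that] by (simp add: G_def)
    obtain B where B: "\<forall>i\<in>I. \<forall>j\<in>I. G i j = (\<Sum>k\<in>I. B i k * B j k)"
      using insert.IH[OF symG psdG] by blast
    define B' where "B' i k = (if k = a then \<Gamma> i a / sqrt (\<Gamma> a a) else if i = a then 0 else B i k)" for i k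
    have "\<Gamma> i j = (\<Sum>k\<in>insert a I. B' i k * B' j k)" if ij: "i \<in> insert a I" "j \<in> insert a I" for i j
    proof -
      have sa: "B' i a * B' j a = \<Gamma> i a * \<Gamma> j a / \<Gamma> a a" using pos by (simp add: B'_def)
      have "(\<Sum>k\<in>I. B' i k * B' j k) = (if i = a \<or> j = a then 0 else G i j)"
      proof (cases "i = a \<or> j = a")
        case True
        then show ?thesis using insert.hyps by (auto simp: B'_def intro!: sum.neutral)
      next
        case False
        then have "(\<Sum>k\<in>I. B' i k * B' j k) = (\<Sum>k\<in>I. B i k * B j k)"
          using insert.hyps by (intro sum.cong) (auto simp: B'_def)
        then show ?thesis using False ij B by simp
      qed
      then have "(\<Sum>k\<in>insert a I. B' i k * B' j k) = \<Gamma> i a * \<Gamma> j a / \<Gamma> a a + (if i = a \<or> j = a then 0 else G i j)"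
        using insert.hyps sa by simp
      also have "\<dots> = \<Gamma> i j" using pos ij symI by (auto simp: G_def)
      finally show ?thesis by simp
    qed
    then show ?thesis by blast
  qed
qed simp

section \<open>Complex Gaussian vectors\<close>

lemma std_complex_normal_measurable:
  "(\<lambda>(x, y). complex_of_real (1 / sqrt 2) * Complex x y)
     \<in> borel_measurable (std_normal_distribution \<Otimes>\<^sub>M std_normal_distribution)"
proof -
  have "(\<lambda>(x, y). complex_of_real (1 / sqrt 2) * Complex x y)
    = (\<lambda>p. complex_of_real (1 / sqrt 2) * (complex_of_real (fst p) + \<i> * complex_of_real (snd p)))"
    by (auto simp: complex_eq_iff)
  then show ?thesis by simp
qed

lemma std_complex_normal_prob: "prob_space std_complex_normal"
proof -
  interpret p: pair_prob_space std_normal_distribution std_normal_distribution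
    by (intro pair_prob_space.intro pair_sigma_finite.intro prob_space_imp_sigma_finite prob_space_normal_density) simp_all
  show ?thesis unfolding std_complex_normal_def by (rule p.prob_space_distr[OF std_complex_normal_measurable])
qed

lemma sets_std_complex_normal [simp]: "sets std_complex_normal = sets borel"
  by (simp add: std_complex_normal_def)

lemma char_std_complex_normal:
  "(\<integral>y. cis (y \<bullet> t) \<partial>std_complex_normal) = of_real (exp (- (norm t)\<^sup>2 / 4))"
proof -
  let ?N = std_normal_distribution
  interpret p: pair_prob_space ?N ?N
    by (intro pair_prob_space.intro pair_sigma_finite.intro prob_space_imp_sigma_finite prob_space_normal_density) simp_all
  have one: "(\<integral>x. cis (s * x) \<partial>?N) = of_real (exp (- s\<^sup>2 / 2))" for s
    using fun_cong[OF char_std_normal_distribution, of s] by (simp add: char_def cis_conv_exp)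
  define a b where "a = Re t / sqrt 2" and "b = Im t / sqrt 2"
  have m: "(\<lambda>y. cis (y \<bullet> t)) \<in> borel_measurable borel"
    by (intro borel_measurable_continuous_onI continuous_intros)
  have "(\<integral>y. cis (y \<bullet> t) \<partial>std_complex_normal)
    = (\<integral>p. cis ((case p of (x, y) \<Rightarrow> complex_of_real (1 / sqrt 2) * Complex x y) \<bullet> t) \<partial>(?N \<Otimes>\<^sub>M ?N))"
    unfolding std_complex_normal_def by (rule integral_distr[OF std_complex_normal_measurable m])
  also have "\<dots> = (\<integral>p. cis (a * fst p) * cis (b * snd p) \<partial>(?N \<Otimes>\<^sub>M ?N))"
    by (intro Bochner_Integration.integral_cong refl) (auto simp: a_def b_def inner_complex_def cis_mult algebra_simps)
  also have "\<dots> = (\<integral>x. (\<integral>y. cis (a * x) * cis (b * y) \<partial>?N) \<partial>?N)"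
  proof -
    have "(\<lambda>p. cis (a * fst p) * cis (b * snd p)) \<in> borel_measurable (borel \<Otimes>\<^sub>M borel)"
      unfolding borel_prod by (intro borel_measurable_continuous_onI continuous_intros)
    then have "integrable (?N \<Otimes>\<^sub>M ?N) (\<lambda>p. cis (a * fst p) * cis (b * snd p))"
      by (intro p.P.integrable_const_bound[of _ 1]) (auto simp: norm_mult cong: measurable_cong_sets)
    from p.integral_fst'[OF this] show ?thesis by simp
  qed
  also have "\<dots> = of_real (exp (- a\<^sup>2 / 2)) * of_real (exp (- b\<^sup>2 / 2))" by (simp add: one)
  also have "\<dots> = of_real (exp (- a\<^sup>2 / 2 + - b\<^sup>2 / 2))" by (simp only: of_real_mult[symmetric] exp_add)
  also have "- a\<^sup>2 / 2 + - b\<^sup>2 / 2 = - (norm t)\<^sup>2 / 4"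
    by (simp add: a_def b_def cmod_power2 power_divide)
  finally show ?thesis .
qed

lemma std_normal_moments:
  "integrable std_normal_distribution (\<lambda>x. x)" "integrable std_normal_distribution (\<lambda>x. x\<^sup>2)"
  "(\<integral>x. x \<partial>std_normal_distribution) = 0" "(\<integral>x. x\<^sup>2 \<partial>std_normal_distribution) = 1"
  using integrable_std_normal_distribution_moment[of 1] integrable_std_normal_distribution_moment[of 2]
    integral_std_normal_distribution_moment_odd[of 1] std_normal_distribution_even_moments(1)[of 1]
  by simp_all

lemma std_complex_normal_moments:
  "integrable std_complex_normal (\<lambda>y. y)" "(\<integral>y. y \<partial>std_complex_normal) = 0"
  "integrable std_complex_normal (\<lambda>y. cnj y * y)" "(\<integral>y. cnj y * y \<partial>std_complex_normal) = 1"
proof -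
  let ?N = std_normal_distribution
  let ?h = "\<lambda>(x, y). complex_of_real (1 / sqrt 2) * Complex x y"
  interpret n: prob_space ?N by (rule prob_space_normal_density) simp
  interpret p: pair_prob_space ?N ?N
    by (intro pair_prob_space.intro pair_sigma_finite.intro prob_space_imp_sigma_finite prob_space_normal_density) simp_all
  have dfst: "distr (?N \<Otimes>\<^sub>M ?N) ?N fst = ?N" by (rule n.distr_pair_fst) 
  have dsnd: "distr (?N \<Otimes>\<^sub>M ?N) ?N snd = ?N"
  proof -
    have "distr (?N \<Otimes>\<^sub>M ?N) ?N snd = distr (distr (?N \<Otimes>\<^sub>M ?N) (?N \<Otimes>\<^sub>M ?N) (\<lambda>(x, y). (y, x))) ?N snd"
      using p.distr_pair_swap by simp
    also have "\<dots> = distr (?N \<Otimes>\<^sub>M ?N) ?N fst"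
      by (subst distr_distr) (auto simp: comp_def case_prod_unfold)
    finally show ?thesis using dfst by simp
  qed
  have F: "integrable (?N \<Otimes>\<^sub>M ?N) (\<lambda>p. f (fst p))" "(\<integral>p. f (fst p) \<partial>(?N \<Otimes>\<^sub>M ?N)) = (\<integral>x. f x \<partial>?N)"
    "integrable (?N \<Otimes>\<^sub>M ?N) (\<lambda>p. f (snd p))" "(\<integral>p. f (snd p) \<partial>(?N \<Otimes>\<^sub>M ?N)) = (\<integral>x. f x \<partial>?N)"
    if f: "integrable ?N f" for f :: "real \<Rightarrow> real"
  proof -
    have m: "f \<in> borel_measurable ?N" using f by auto
    show "integrable (?N \<Otimes>\<^sub>M ?N) (\<lambda>p. f (fst p))"
      using f dfst by (metis integrable_distr measurable_fst)
    show "integrable (?N \<Otimes>\<^sub>M ?N) (\<lambda>p. f (snd p))"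
      using f dsnd by (metis integrable_distr measurable_snd)
    show "(\<integral>p. f (fst p) \<partial>(?N \<Otimes>\<^sub>M ?N)) = (\<integral>x. f x \<partial>?N)"
      using integral_distr[OF measurable_fst[of ?N ?N] m] unfolding dfst by simp
    show "(\<integral>p. f (snd p) \<partial>(?N \<Otimes>\<^sub>M ?N)) = (\<integral>x. f x \<partial>?N)"
      using integral_distr[OF measurable_snd[of ?N ?N] m] unfolding dsnd by simp
  qed
  have h1: "?h p = complex_of_real (fst p / sqrt 2) + \<i> * complex_of_real (snd p / sqrt 2)" for p
    by (auto simp: complex_eq_iff case_prod_unfold)
  have h2: "cnj (?h p) * ?h p = complex_of_real ((fst p)\<^sup>2 / 2 + (snd p)\<^sup>2 / 2)" for p
    by (auto simp: complex_eq_iff case_prod_unfold power2_eq_square)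
  note F1 = F[OF std_normal_moments(1)] and F2 = F[OF std_normal_moments(2)]
  have m: "(\<lambda>y::complex. y) \<in> borel_measurable borel" "(\<lambda>y. cnj y * y) \<in> borel_measurable borel"
    by (intro borel_measurable_continuous_onI continuous_intros)+
  have i1: "integrable (?N \<Otimes>\<^sub>M ?N) ?h"
    unfolding h1[abs_def] using F1 by (intro Bochner_Integration.integrable_add integrable_mult_right integrable_of_real) auto
  show "integrable std_complex_normal (\<lambda>y. y)"
    unfolding std_complex_normal_def integrable_distr_eq[OF std_complex_normal_measurable m(1)] by (rule i1)
  have i2: "integrable (?N \<Otimes>\<^sub>M ?N) (\<lambda>p. cnj (?h p) * ?h p)"
    unfolding h2 using F2 by (intro integrable_of_real Bochner_Integration.integrable_add) auto
  show "integrable std_complex_normal (\<lambda>y. cnj y * y)"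
    unfolding std_complex_normal_def integrable_distr_eq[OF std_complex_normal_measurable m(2)] by (rule i2)
  have "(\<integral>y. y \<partial>std_complex_normal) = (\<integral>p. ?h p \<partial>(?N \<Otimes>\<^sub>M ?N))"
    unfolding std_complex_normal_def by (rule integral_distr[OF std_complex_normal_measurable m(1)])
  also have "\<dots> = (\<integral>p. complex_of_real (fst p / sqrt 2) \<partial>(?N \<Otimes>\<^sub>M ?N)) + \<i> * (\<integral>p. complex_of_real (snd p / sqrt 2) \<partial>(?N \<Otimes>\<^sub>M ?N))"
    unfolding h1 using F1 by (subst Bochner_Integration.integral_add) auto
  also have "\<dots> = 0" using F1 std_normal_moments(3) by (simp only: integral_complex_of_real integral_divide_zero) simp
  finally show "(\<integral>y. y \<partial>std_complex_normal) = 0" .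
  have "(\<integral>y. cnj y * y \<partial>std_complex_normal) = (\<integral>p. cnj (?h p) * ?h p \<partial>(?N \<Otimes>\<^sub>M ?N))"
    unfolding std_complex_normal_def by (rule integral_distr[OF std_complex_normal_measurable m(2)])
  also have "\<dots> = complex_of_real (\<integral>p. (fst p)\<^sup>2 / 2 + (snd p)\<^sup>2 / 2 \<partial>(?N \<Otimes>\<^sub>M ?N))"
    unfolding h2 by (rule integral_complex_of_real)
  also have "(\<integral>p. (fst p)\<^sup>2 / 2 + (snd p)\<^sup>2 / 2 \<partial>(?N \<Otimes>\<^sub>M ?N)) = 1"
    using F2 std_normal_moments(4) by (subst Bochner_Integration.integral_add) auto
  finally show "(\<integral>y. cnj y * y \<partial>std_complex_normal) = 1" by simp
qed

lemma inner_real_mult: "(complex_of_real r * x) \<bullet> y = r * (x \<bullet> y)"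
  by (simp add: inner_complex_def algebra_simps)

lemma inner_real_mult_right: "x \<bullet> (complex_of_real r * y) = r * (x \<bullet> y)"
  by (simp add: inner_complex_def algebra_simps)

lemma inner_cnj_shift: "(a * x) \<bullet> (y :: complex) = x \<bullet> (cnj a * y)"
  by (simp add: inner_complex_def algebra_simps)

lemma borel_measurable_vec:
  fixes f :: "'w \<Rightarrow> (complex, 'l::finite) Finite_Cartesian_Product.vec"
  assumes "\<And>i. (\<lambda>w. vec_nth (f w) i) \<in> borel_measurable M"
  shows "f \<in> borel_measurable M"
  by (subst borel_measurable_euclidean_space)
    (auto simp: Basis_vec_def inner_axis intro!: borel_measurable_inner assms)

lemma borel_measurable_vec_nth:
  "(\<lambda>y :: (complex, 'l::finite) Finite_Cartesian_Product.vec. vec_nth y i) \<in> borel_measurable borel"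
  by (intro borel_measurable_continuous_onI linear_continuous_on bounded_linear_vec_nth)

text \<open>The law is the image of independent standard complex normals under a real matrix
  \<open>B\<close> with \<open>B B^T = \<Gamma>\<close>.\<close>

theorem gaussian_vector_exists:
  fixes \<Gamma> :: "'l::finite \<Rightarrow> 'l \<Rightarrow> real"
  assumes sym: "\<And>i j. \<Gamma> i j = \<Gamma> j i" and psd: "\<And>x. 0 \<le> (\<Sum>i\<in>UNIV. \<Sum>j\<in>UNIV. x i * x j * \<Gamma> i j)"
  obtains \<nu> :: "(complex, 'l) Finite_Cartesian_Product.vec measure" where
    "complex_gaussian_vector \<nu>" "\<And>i. cmean \<nu> i = 0" "\<And>i j. ccov \<nu> i j = of_real (\<Gamma> i j)"
    "\<And>t. (\<integral>y. cis (y \<bullet> t) \<partial>\<nu>) = of_real (exp (- (\<Sum>i\<in>UNIV. \<Sum>j\<in>UNIV. \<Gamma> i j * (vec_nth t i \<bullet> vec_nth t j)) / 4))"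
proof -
  obtain B :: "'l \<Rightarrow> 'l \<Rightarrow> real" where B: "\<And>i j. \<Gamma> i j = (\<Sum>k\<in>UNIV. B i k * B j k)"
  proof -
    have "\<exists>B :: 'l \<Rightarrow> 'l \<Rightarrow> real. \<forall>i\<in>UNIV. \<forall>j\<in>UNIV. \<Gamma> i j = (\<Sum>k\<in>UNIV. B i k * B j k)"
      by (rule psd_factorization[OF finite_class.finite_UNIV]) (rule sym, rule psd)
    then show ?thesis using that by blast
  qed
  let ?P = "Pi\<^sub>M (UNIV :: 'l set) (\<lambda>_. std_complex_normal)"
  interpret scn: prob_space std_complex_normal by (rule std_complex_normal_prob)
  interpret pp: product_prob_space "\<lambda>_ :: 'l. std_complex_normal" UNIV
    by unfold_locales
  define h where "h g = (\<chi> i. \<Sum>k\<in>UNIV. complex_of_real (B i k) * g k)" for g :: "'l \<Rightarrow> complex"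
  have comp: "(\<lambda>g. g k) \<in> borel_measurable ?P" for k
    using measurable_component_singleton[of k UNIV "\<lambda>_. std_complex_normal"]
    by (simp cong: measurable_cong_sets)
  have hm: "h \<in> borel_measurable ?P"
    unfolding h_def
    by (rule borel_measurable_vec) (simp, intro borel_measurable_sum borel_measurable_times comp borel_measurable_const)
  define \<nu> where "\<nu> = distr ?P borel h"
  have sn: "sets \<nu> = sets borel" by (simp add: \<nu>_def)
  have pn: "prob_space \<nu>" unfolding \<nu>_def by (rule prob_space.prob_space_distr[OF pp.P.prob_space_axioms hm])
  have int: "(\<integral>y. f y \<partial>\<nu>) = (\<integral>g. f (h g) \<partial>?P)" if "f \<in> borel_measurable borel" for f :: "_ \<Rightarrow> complex"
    unfolding \<nu>_def by (rule integral_distr[OF hm that])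
  have char: "(\<integral>y. cis (y \<bullet> t) \<partial>\<nu>)
     = (\<Prod>k\<in>UNIV. of_real (exp (- (norm (\<Sum>i\<in>UNIV. complex_of_real (B i k) * vec_nth t i))\<^sup>2 / 4)))" for t
  proof -
    have m: "(\<lambda>y. cis (y \<bullet> t)) \<in> borel_measurable borel"
      by (intro borel_measurable_continuous_onI continuous_intros)
    have "(\<integral>y. cis (y \<bullet> t) \<partial>\<nu>) = (\<integral>g. cis (h g \<bullet> t) \<partial>?P)" by (rule int[OF m])
    also have "\<dots> = (\<integral>g. (\<Prod>k\<in>UNIV. cis (g k \<bullet> (\<Sum>i\<in>UNIV. complex_of_real (B i k) * vec_nth t i))) \<partial>?P)"
    proof (intro Bochner_Integration.integral_cong refl)
      fix g :: "'l \<Rightarrow> complex"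
      have "h g \<bullet> t = (\<Sum>i\<in>UNIV. \<Sum>k\<in>UNIV. B i k * (g k \<bullet> vec_nth t i))"
        by (simp add: h_def inner_vec_def inner_sum_left inner_real_mult)
      also have "\<dots> = (\<Sum>k\<in>UNIV. \<Sum>i\<in>UNIV. B i k * (g k \<bullet> vec_nth t i))" by (rule sum.swap)
      also have "\<dots> = (\<Sum>k\<in>UNIV. g k \<bullet> (\<Sum>i\<in>UNIV. complex_of_real (B i k) * vec_nth t i))"
        by (simp only: inner_sum_right inner_real_mult_right)
      finally show "cis (h g \<bullet> t) = (\<Prod>k\<in>UNIV. cis (g k \<bullet> (\<Sum>i\<in>UNIV. complex_of_real (B i k) * vec_nth t i)))"
        by (simp only: cis_conv_exp of_real_sum sum_distrib_left exp_sum[OF finite_class.finite_UNIV])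
    qed
    also have "\<dots> = (\<Prod>k\<in>UNIV. \<integral>y. cis (y \<bullet> (\<Sum>i\<in>UNIV. complex_of_real (B i k) * vec_nth t i)) \<partial>std_complex_normal)"
    proof (rule pp.product_integral_prod[OF finite_class.finite_UNIV])
      fix k
      have "(\<lambda>y. cis (y \<bullet> (\<Sum>i\<in>UNIV. complex_of_real (B i k) * vec_nth t i))) \<in> borel_measurable borel"
        by (intro borel_measurable_continuous_onI continuous_intros)
      then show "integrable std_complex_normal (\<lambda>y. cis (y \<bullet> (\<Sum>i\<in>UNIV. complex_of_real (B i k) * vec_nth t i)))"
        by (intro scn.integrable_const_bound[of _ 1]) (auto cong: measurable_cong_sets)
    qed
    finally show ?thesis unfolding char_std_complex_normal .
  qed
  have quad: "(\<Sum>k\<in>UNIV. (norm (\<Sum>i\<in>UNIV. complex_of_real (B i k) * x i))\<^sup>2) = (\<Sum>i\<in>UNIV. \<Sum>j\<in>UNIV. \<Gamma> i j * (x i \<bullet> x j))"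
    for x :: "'l \<Rightarrow> complex"
  proof -
    have "(\<Sum>k\<in>UNIV. (norm (\<Sum>i\<in>UNIV. complex_of_real (B i k) * x i))\<^sup>2)
      = (\<Sum>k\<in>UNIV. \<Sum>i\<in>UNIV. \<Sum>j\<in>UNIV. B i k * B j k * (x i \<bullet> x j))"
      unfolding power2_norm_eq_inner inner_sum_left
      by (simp only: inner_sum_right inner_real_mult inner_real_mult_right sum_distrib_left mult.assoc mult.left_commute)
    also have "\<dots> = (\<Sum>i\<in>UNIV. \<Sum>k\<in>UNIV. \<Sum>j\<in>UNIV. B i k * B j k * (x i \<bullet> x j))" by (rule sum.swap)
    also have "\<dots> = (\<Sum>i\<in>UNIV. \<Sum>j\<in>UNIV. \<Sum>k\<in>UNIV. B i k * B j k * (x i \<bullet> x j))"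
      by (intro sum.cong refl sum.swap)
    finally show ?thesis by (simp add: B sum_distrib_right)
  qed
  have gauss: "complex_normal (distr \<nu> borel (\<lambda>y. \<Sum>i\<in>UNIV. a i * vec_nth y i))" for a :: "'l \<Rightarrow> complex"
  proof -
    \<comment> \<open>A linear combination of independent standard complex normals is distributed
      like one of them times the Euclidean norm of the coefficients, because their characteristic
      function depends on \<open>norm t\<close> only. A real factor \<open>b\<close> therefore
      suffices.\<close>
    define b where "b = complex_of_real (sqrt (\<Sum>k\<in>UNIV. (norm (\<Sum>i\<in>UNIV. complex_of_real (B i k) * cnj (a i)))\<^sup>2))"
    let ?f = "\<lambda>y :: (complex, 'l) Finite_Cartesian_Product.vec. \<Sum>i\<in>UNIV. a i * vec_nth y i"
    have fm: "?f \<in> borel_measurable \<nu>"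
      unfolding measurable_cong_sets[OF sn refl]
      by (intro borel_measurable_sum borel_measurable_times borel_measurable_const borel_measurable_vec_nth)
    have gm: "(\<lambda>y. 0 + b * y) \<in> borel_measurable std_complex_normal"
      using borel_measurable_continuous_onI[of "\<lambda>y. 0 + b * y"] by (auto intro!: continuous_intros cong: measurable_cong_sets)
    have "distr \<nu> borel ?f = distr std_complex_normal borel (\<lambda>y. 0 + b * y)"
    proof (rule char_uniqueness_euclidean)
      show "prob_space (distr \<nu> borel ?f)" by (rule prob_space.prob_space_distr[OF pn fm])
      show "prob_space (distr std_complex_normal borel (\<lambda>y. 0 + b * y))" by (rule scn.prob_space_distr[OF gm])
      fix t :: complex
      have m: "(\<lambda>y. cis (y \<bullet> t)) \<in> borel_measurable borel"
        by (intro borel_measurable_continuous_onI continuous_intros)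
      have "(\<integral>y. cis (y \<bullet> t) \<partial>distr \<nu> borel ?f) = (\<integral>y. cis (?f y \<bullet> t) \<partial>\<nu>)" by (rule integral_distr[OF fm m])
      also have "\<dots> = (\<integral>y. cis (y \<bullet> (\<chi> i. cnj (a i) * t)) \<partial>\<nu>)"
        by (simp add: inner_vec_def inner_sum_left inner_cnj_shift)
      also have "\<dots> = (\<Prod>k\<in>UNIV. of_real (exp (- (norm ((\<Sum>i\<in>UNIV. complex_of_real (B i k) * cnj (a i)) * t))\<^sup>2 / 4)))"
        unfolding char by (simp add: sum_distrib_right mult.assoc)
      also have "\<dots> = of_real (exp (\<Sum>k\<in>UNIV. - (norm ((\<Sum>i\<in>UNIV. complex_of_real (B i k) * cnj (a i)) * t))\<^sup>2 / 4))"
        by (simp only: exp_sum[OF finite_class.finite_UNIV] of_real_prod)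
      also have "(\<Sum>k\<in>UNIV. - (norm ((\<Sum>i\<in>UNIV. complex_of_real (B i k) * cnj (a i)) * t))\<^sup>2 / 4) = - (norm (cnj b * t))\<^sup>2 / 4"
      proof -
        have "(norm b)\<^sup>2 = (\<Sum>k\<in>UNIV. (norm (\<Sum>i\<in>UNIV. complex_of_real (B i k) * cnj (a i)))\<^sup>2)"
          unfolding b_def norm_of_real by (simp add: sum_nonneg)
        then show ?thesis
          by (simp add: norm_mult power_mult_distrib sum_distrib_right[symmetric] sum_divide_distrib[symmetric] sum_negf)
      qed
      also have "of_real (exp (- (norm (cnj b * t))\<^sup>2 / 4)) = (\<integral>y. cis (y \<bullet> (cnj b * t)) \<partial>std_complex_normal)"
        by (rule char_std_complex_normal[symmetric])
      also have "\<dots> = (\<integral>y. cis ((0 + b * y) \<bullet> t) \<partial>std_complex_normal)" by (simp add: inner_cnj_shift)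
      also have "\<dots> = (\<integral>y. cis (y \<bullet> t) \<partial>distr std_complex_normal borel (\<lambda>y. 0 + b * y))"
        by (rule integral_distr[OF gm m, symmetric])
      finally show "(\<integral>y. cis (y \<bullet> t) \<partial>distr \<nu> borel ?f) = (\<integral>y. cis (y \<bullet> t) \<partial>distr std_complex_normal borel (\<lambda>y. 0 + b * y))" .
    qed simp_all
    then show ?thesis unfolding complex_normal_def by blast
  qed
  have coord: "integrable ?P (\<lambda>g. f (g k))" "(\<integral>g. f (g k) \<partial>?P) = (\<integral>y. f y \<partial>std_complex_normal)"
    if f: "integrable std_complex_normal f" for f :: "complex \<Rightarrow> complex" and k
  proof -
    have d: "distr ?P std_complex_normal (\<lambda>g. g k) = std_complex_normal" by (rule pp.PiM_component) simp
    have mk: "(\<lambda>g. g k) \<in> measurable ?P std_complex_normal" by (rule measurable_component_singleton) simp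
    have fm: "f \<in> borel_measurable std_complex_normal" using f by auto
    show "integrable ?P (\<lambda>g. f (g k))" using integrable_distr_eq[OF mk fm] f unfolding d by simp
    show "(\<integral>g. f (g k) \<partial>?P) = (\<integral>y. f y \<partial>std_complex_normal)" using integral_distr[OF mk fm] unfolding d by simp
  qed
  have cross: "integrable ?P (\<lambda>g. cnj (g k) * g l) \<and> (\<integral>g. cnj (g k) * g l \<partial>?P) = of_bool (k = l)" for k l
  proof (cases "k = l")
    case True
    then show ?thesis using coord[OF std_complex_normal_moments(3), of k] std_complex_normal_moments(4) by simp
  next
    case False
    \<comment> \<open>Writes \<open>cnj (g k) * g l\<close> as a product over all coordinates, so
      that the product measure factors the integral; the factor at \<open>l\<close> has mean
      \<open>0\<close>.\<close>
    define f where "f m = (\<lambda>y :: complex. (if m = k then cnj y else 1) * (if m = l then y else 1))" for m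
    have fi: "integrable std_complex_normal (f m)" for m
      using False std_complex_normal_moments(1) unfolding f_def by (cases "m = k"; cases "m = l") simp_all
    have eq: "(\<Prod>m\<in>UNIV. f m (g m)) = cnj (g k) * g l" for g
      by (simp add: f_def prod.distrib)
    have "(\<integral>g. (\<Prod>m\<in>UNIV. f m (g m)) \<partial>?P) = (\<Prod>m\<in>UNIV. \<integral>y. f m y \<partial>std_complex_normal)"
      by (rule pp.product_integral_prod[OF finite_class.finite_UNIV fi])
    also have "\<dots> = 0"
    proof (rule prod_zero[OF finite_class.finite_UNIV])
      have "(\<integral>y. f l y \<partial>std_complex_normal) = 0"
        using False std_complex_normal_moments(2) unfolding f_def by simp
      then show "\<exists>a\<in>UNIV. (\<integral>y. f a y \<partial>std_complex_normal) = 0" by blast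
    qed
    finally have "(\<integral>g. cnj (g k) * g l \<partial>?P) = 0" unfolding eq .
    moreover have "integrable ?P (\<lambda>g. \<Prod>m\<in>UNIV. f m (g m))"
      by (rule pp.product_integrable_prod[OF finite_class.finite_UNIV fi])
    ultimately show ?thesis using False unfolding eq by simp
  qed
  have mean: "(\<integral>y. vec_nth y i \<partial>\<nu>) = 0" for i
  proof -
    have "(\<integral>y. vec_nth y i \<partial>\<nu>) = (\<integral>g. (\<Sum>k\<in>UNIV. complex_of_real (B i k) * g k) \<partial>?P)"
      unfolding int[OF borel_measurable_vec_nth] by (simp add: h_def)
    also have "\<dots> = (\<Sum>k\<in>UNIV. \<integral>g. complex_of_real (B i k) * g k \<partial>?P)"
      using coord(1)[OF std_complex_normal_moments(1)] by (intro Bochner_Integration.integral_sum) auto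
    also have "\<dots> = 0" using coord(2)[OF std_complex_normal_moments(1)] std_complex_normal_moments(2) by simp
    finally show ?thesis .
  qed
  have cov: "ccov \<nu> i j = of_real (\<Gamma> i j)" for i j
  proof -
    have m: "(\<lambda>y :: (complex, 'l) Finite_Cartesian_Product.vec. cnj (vec_nth y i) * vec_nth y j) \<in> borel_measurable borel"
      by (intro borel_measurable_times borel_measurable_cnj borel_measurable_vec_nth)
    have "(\<integral>y. cnj (vec_nth y i) * vec_nth y j \<partial>\<nu>)
      = (\<integral>g. (\<Sum>k\<in>UNIV. \<Sum>l\<in>UNIV. complex_of_real (B i k * B j l) * (cnj (g k) * g l)) \<partial>?P)"
      unfolding int[OF m]
    proof (intro Bochner_Integration.integral_cong refl)
      fix g :: "'l \<Rightarrow> complex"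
      have "cnj (vec_nth (h g) i) * vec_nth (h g) j
        = (\<Sum>k\<in>UNIV. complex_of_real (B i k) * cnj (g k)) * (\<Sum>l\<in>UNIV. complex_of_real (B j l) * g l)"
        by (simp add: h_def)
      then show "cnj (vec_nth (h g) i) * vec_nth (h g) j
        = (\<Sum>k\<in>UNIV. \<Sum>l\<in>UNIV. complex_of_real (B i k * B j l) * (cnj (g k) * g l))"
        by (simp only: sum_product) (intro sum.cong refl, simp add: mult_ac)
    qed
    also have "\<dots> = (\<Sum>k\<in>UNIV. \<Sum>l\<in>UNIV. complex_of_real (B i k * B j l) * of_bool (k = l))"
      using cross
      by (subst Bochner_Integration.integral_sum; (intro sum.cong refl)?)
        (auto intro!: Bochner_Integration.integrable_sum simp: Bochner_Integration.integral_sum)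
    also have "\<dots> = (\<Sum>k\<in>UNIV. \<Sum>l\<in>UNIV. if k = l then complex_of_real (B i k * B j k) else 0)"
      by (intro sum.cong refl) auto
    also have "\<dots> = of_real (\<Gamma> i j)" by (simp add: B)
    finally show ?thesis using mean by (simp add: ccov_def)
  qed
  have char': "(\<integral>y. cis (y \<bullet> t) \<partial>\<nu>) = of_real (exp (- (\<Sum>i\<in>UNIV. \<Sum>j\<in>UNIV. \<Gamma> i j * (vec_nth t i \<bullet> vec_nth t j)) / 4))" for t
  proof -
    have "(\<integral>y. cis (y \<bullet> t) \<partial>\<nu>) = of_real (exp (\<Sum>k\<in>UNIV. - (norm (\<Sum>i\<in>UNIV. complex_of_real (B i k) * vec_nth t i))\<^sup>2 / 4))"
      unfolding char by (simp only: exp_sum[OF finite_class.finite_UNIV] of_real_prod)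
    also have "(\<Sum>k\<in>UNIV. - (norm (\<Sum>i\<in>UNIV. complex_of_real (B i k) * vec_nth t i))\<^sup>2 / 4)
      = - (\<Sum>k\<in>UNIV. (norm (\<Sum>i\<in>UNIV. complex_of_real (B i k) * vec_nth t i))\<^sup>2) / 4"
      by (simp add: sum_divide_distrib[symmetric] sum_negf)
    finally show ?thesis unfolding quad .
  qed
  show ?thesis
    by (rule that[of \<nu>]) (use pn sn gauss mean cov char' in \<open>auto simp: complex_gaussian_vector_def cmean_def\<close>)
qed

section \<open>The series of the logarithm\<close>

lemma sum_inverse_square_le:
  assumes "N \<ge> 1"
  shows "(\<Sum>j=N + 1..J. 1 / (real j)\<^sup>2) \<le> 1 / real N"
proof (cases "N \<le> J")
  case True
  then have "(\<Sum>j=N + 1..J. 1 / (real j)\<^sup>2) \<le> 1 / real N - 1 / real J"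
  proof (induction J rule: dec_induct)
    case (step J)
    have J: "J \<ge> 1" using step.hyps assms by simp
    have "1 / (real (Suc J))\<^sup>2 \<le> 1 / (real J * real (Suc J))"
      using J by (intro divide_left_mono) (auto simp: power2_eq_square)
    also have "\<dots> = 1 / real J - 1 / real (Suc J)" using J by (simp add: field_simps)
    finally show ?case using step by simp
  qed simp
  also have "\<dots> \<le> 1 / real N" by simp
  finally show ?thesis .
qed simp

text \<open>Fatou's lemma, for nonnegative integrals so that integrability of the limit can be
  concluded rather than assumed.\<close>

lemma (in prob_space) nn_integral_limit_le:
  fixes S :: "nat \<Rightarrow> 'a \<Rightarrow> complex"
  assumes m: "\<And>k. S k \<in> borel_measurable M" "T \<in> borel_measurable M"
    and lim: "AE \<omega> in M. (\<lambda>k. S k \<omega>) \<longlonglongrightarrow> L \<omega>"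
    and C: "\<forall>\<^sub>F k in sequentially. (\<integral>\<^sup>+ \<omega>. ennreal ((norm (S k \<omega> - T \<omega>))\<^sup>2) \<partial>M) \<le> C"
  shows "(\<integral>\<^sup>+ \<omega>. ennreal ((norm (L \<omega> - T \<omega>))\<^sup>2) \<partial>M) \<le> C"
proof -
  have "(\<integral>\<^sup>+ \<omega>. ennreal ((norm (L \<omega> - T \<omega>))\<^sup>2) \<partial>M)
    = (\<integral>\<^sup>+ \<omega>. liminf (\<lambda>k. ennreal ((norm (S k \<omega> - T \<omega>))\<^sup>2)) \<partial>M)"
  proof (rule nn_integral_cong_AE)
    show "AE \<omega> in M. ennreal ((norm (L \<omega> - T \<omega>))\<^sup>2) = liminf (\<lambda>k. ennreal ((norm (S k \<omega> - T \<omega>))\<^sup>2))"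
      using lim
    proof eventually_elim
      case (elim \<omega>)
      have "(\<lambda>k. ennreal ((norm (S k \<omega> - T \<omega>))\<^sup>2)) \<longlonglongrightarrow> ennreal ((norm (L \<omega> - T \<omega>))\<^sup>2)"
        by (intro tendsto_ennrealI tendsto_intros elim)
      then show ?case by (rule lim_imp_Liminf[OF trivial_limit_sequentially, symmetric])
    qed
  qed
  also have "\<dots> \<le> liminf (\<lambda>k. \<integral>\<^sup>+ \<omega>. ennreal ((norm (S k \<omega> - T \<omega>))\<^sup>2) \<partial>M)"
    by (rule nn_integral_liminf) (use m in measurable)
  also have "\<dots> \<le> liminf (\<lambda>k. C)" by (rule Liminf_mono[OF C])
  finally show ?thesis by (simp add: Liminf_const)
qed

locale haar_variable = prob_space P for P :: "'w measure" +
  fixes n :: nat and u :: "'w \<Rightarrow> complex mat"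
  assumes haar_u: "haar_distributed n P u" and n1: "n \<ge> 1"
begin

definition law where "law = distr P (unitary_borel n) u"

sublocale U: haar_unitary n law
  using haar_u by unfold_locales (simp add: haar_distributed_def law_def)

lemma u_measurable: "u \<in> measurable P law"
  using haar_u by (simp add: haar_distributed_def law_def)

lemma u_unitary: "\<omega> \<in> space P \<Longrightarrow> u \<omega> \<in> unitary_group n"
  using measurable_space[OF u_measurable] U.space_eq by simp

lemma law_distr: "distr P law u = law"
  by (simp add: law_def cong: distr_cong)

lemma integral_law:
  fixes f :: "complex mat \<Rightarrow> 'b::{banach, second_countable_topology}"
  assumes "f \<in> borel_measurable law"
  shows "(\<integral>\<omega>. f (u \<omega>) \<partial>P) = (\<integral>W. f W \<partial>law)"
  using integral_distr[OF u_measurable assms] by (simp add: law_distr)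

lemma measurable_law: "f \<in> borel_measurable law \<Longrightarrow> (\<lambda>\<omega>. f (u \<omega>)) \<in> borel_measurable P"
  by (rule measurable_compose[OF u_measurable])

lemma logZ_term_eq: "\<omega> \<in> space P \<Longrightarrow> logZ_term (u \<omega>) X j = - (1 / of_nat j) / X ^ j * ptr (u \<omega>) (int j)"
  by (simp add: logZ_term_def ptr_trace[OF unitary_carrier[OF u_unitary]])

lemma logZ_term_measurable: "(\<lambda>\<omega>. logZ_term (u \<omega>) X j) \<in> borel_measurable P"
proof -
  have "(\<lambda>\<omega>. - (1 / of_nat j) / X ^ j * ptr (u \<omega>) (int j)) \<in> borel_measurable P"
    by (intro measurable_law[of "\<lambda>W. - (1 / of_nat j) / X ^ j * ptr W (int j)"] U.bm_measurable U.bm_mult U.bm_const U.bm_ptr)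
  then show ?thesis by (subst measurable_cong[OF logZ_term_eq])
qed

definition partial :: "complex \<Rightarrow> nat \<Rightarrow> 'w \<Rightarrow> complex" where
  "partial X J \<omega> = (\<Sum>j=1..J. logZ_term (u \<omega>) X j)"

lemma partial_measurable: "partial X J \<in> borel_measurable P"
  unfolding partial_def by (intro borel_measurable_sum logZ_term_measurable)

text \<open>The variance of the terms with \<open>m < j \<le> J\<close>, traces of different powers
  being orthogonal.\<close>

definition tail_var :: "complex \<Rightarrow> nat \<Rightarrow> nat \<Rightarrow> real" where
  "tail_var X m J = (\<Sum>j=m + 1..J. U.trace_var j / (real j)\<^sup>2 / (norm X) ^ (2 * j))"

lemma partial_diff_var:
  assumes "m \<le> J"
  shows "(\<integral>\<^sup>+ \<omega>. ennreal ((norm (partial X J \<omega> - partial X m \<omega>))\<^sup>2) \<partial>P) = ennreal (tail_var X m J)"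
proof -
  define \<beta> where "\<beta> j = - (1 / of_nat j) / X ^ j" for j :: nat
  let ?F = "\<lambda>W. (norm (\<Sum>j\<in>{m + 1..J}. \<beta> j * ptr W (int j)))\<^sup>2"
  have bm: "U.bm (\<lambda>W. \<Sum>j\<in>{m + 1..J}. \<beta> j * ptr W (int j))"
    by (intro U.bm_sum U.bm_mult U.bm_const U.bm_ptr) simp
  then obtain C where C: "\<And>W. W \<in> unitary_group n \<Longrightarrow> norm (\<Sum>j\<in>{m + 1..J}. \<beta> j * ptr W (int j)) \<le> C"
    unfolding U.bm_def by blast
  have Fm: "?F \<in> borel_measurable law" using U.bm_measurable[OF bm] by measurable
  have int: "integrable law ?F"
    by (rule U.integrable_const_bound[of _ "C\<^sup>2"]) (use C Fm in \<open>auto simp: U.space_eq intro!: power_mono\<close>)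
  have eq: "partial X J \<omega> - partial X m \<omega> = (\<Sum>j\<in>{m + 1..J}. \<beta> j * ptr (u \<omega>) (int j))" if "\<omega> \<in> space P" for \<omega>
  proof -
    have "{1..J} = {1..m} \<union> {m + 1..J}" using assms by auto
    then have "partial X J \<omega> = partial X m \<omega> + (\<Sum>j\<in>{m + 1..J}. logZ_term (u \<omega>) X j)"
      unfolding partial_def by (simp only:) (rule sum.union_disjoint, auto)
    then show ?thesis using that by (simp add: logZ_term_eq \<beta>_def)
  qed
  have "(\<integral>\<^sup>+ \<omega>. ennreal ((norm (partial X J \<omega> - partial X m \<omega>))\<^sup>2) \<partial>P) = (\<integral>\<^sup>+ \<omega>. ennreal (?F (u \<omega>)) \<partial>P)"
    by (intro nn_integral_cong) (simp add: eq)
  also have "\<dots> = (\<integral>\<^sup>+ W. ennreal (?F W) \<partial>law)"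
    using nn_integral_distr[OF u_measurable, of "\<lambda>W. ennreal (?F W)"] Fm by (simp add: law_distr)
  also have "\<dots> = ennreal (\<integral>W. ?F W \<partial>law)"
    by (rule nn_integral_eq_integral[OF int]) simp
  also have "(\<integral>W. ?F W \<partial>law) = (\<Sum>j\<in>{m + 1..J}. (norm (\<beta> j))\<^sup>2 * U.trace_var j)"
    by (rule U.integral_norm_sum_ptr) simp
  also have "\<dots> = tail_var X m J"
    unfolding tail_var_def \<beta>_def
    by (intro sum.cong) (simp_all add: norm_divide norm_power norm_mult power_divide power_mult_distrib power_mult[symmetric] mult.commute[of _ 2])
  finally show ?thesis .
qed

text \<open>A crude bound from \<open>trace_var j \<le> n^2\<close>. With \<open>n\<close> fixed it
  suffices for convergence of the series, also on the unit circle.\<close>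

lemma tail_var_le:
  assumes X: "norm X \<ge> 1" and N: "N \<ge> 1"
  shows "tail_var X N J \<le> (real n)\<^sup>2 / real N" and "0 \<le> tail_var X N J"
proof -
  have t: "U.trace_var j / (real j)\<^sup>2 / (norm X) ^ (2 * j) \<le> (real n)\<^sup>2 * (1 / (real j)\<^sup>2)" for j
  proof -
    have "U.trace_var j / (real j)\<^sup>2 / (norm X) ^ (2 * j) \<le> U.trace_var j / (real j)\<^sup>2 / 1"
      using U.trace_var_le[of j] one_le_power[OF X, of "2 * j"] by (intro divide_left_mono) auto
    also have "\<dots> \<le> (real n)\<^sup>2 / (real j)\<^sup>2" using U.trace_var_le[of j] by (simp add: divide_right_mono)
    finally show ?thesis by simp
  qed
  have "tail_var X N J \<le> (\<Sum>j=N + 1..J. (real n)\<^sup>2 * (1 / (real j)\<^sup>2))"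
    unfolding tail_var_def by (intro sum_mono t)
  also have "\<dots> = (real n)\<^sup>2 * (\<Sum>j=N + 1..J. 1 / (real j)\<^sup>2)" by (simp only: sum_distrib_left)
  also have "\<dots> \<le> (real n)\<^sup>2 * (1 / real N)" using sum_inverse_square_le[OF N, of J] by (intro mult_left_mono) auto
  finally show "tail_var X N J \<le> (real n)\<^sup>2 / real N" by simp
  show "0 \<le> tail_var X N J"
    unfolding tail_var_def using U.trace_var_le by (intro sum_nonneg divide_nonneg_nonneg) auto
qed

text \<open>Completeness of \<open>L\<^sup>2\<close>, along the dyadic partial sums, whose increments are summable in \<open>L\<^sup>1\<close>.\<close>

lemma partial_L2_limit:
  assumes X: "norm X \<ge> 1"
  shows "\<exists>L. L \<in> borel_measurable P \<and>
    (\<lambda>N. \<integral>\<^sup>+ \<omega>. ennreal ((norm (L \<omega> - (\<Sum>j=1..N. logZ_term (u \<omega>) X j)))\<^sup>2) \<partial>P) \<longlonglongrightarrow> 0"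
proof -
  define T where "T k = partial X (2 ^ k)" for k :: nat
  have Tm: "T k \<in> borel_measurable P" for k unfolding T_def by (rule partial_measurable)
  define d where "d k \<omega> = norm (T (Suc k) \<omega> - T k \<omega>)" for k \<omega>
  have dm: "d k \<in> borel_measurable P" for k unfolding d_def using Tm by measurable
  define D where "D = ((real n)\<^sup>2 + 1) / 2"
  define r where "r = 1 / sqrt 2"
  have r: "0 < r" "r < 1" by (auto simp: r_def)
  have dk: "(\<integral>\<^sup>+ \<omega>. ennreal (d k \<omega>) \<partial>P) \<le> ennreal (D * r ^ k)" for k
  proof -
    \<comment> \<open>Weight in \<open>d \<le> a d^2 / 2 + 1 / (2 a)\<close>: against the
      \<open>L^2\<close> bound \<open>n^2 / 2 ^ k\<close> this choice gives both terms the order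
      \<open>1 / a\<close>, so the \<open>L^1\<close> bound is geometric.\<close>
    define a where "a = sqrt 2 ^ k"
    have a: "a > 0" "a * a = 2 ^ k" by (auto simp: a_def power_mult_distrib[symmetric])
    have ar: "1 / a = r ^ k" by (simp add: a_def r_def power_divide)
    have "d k \<omega> \<le> a / 2 * (d k \<omega>)\<^sup>2 + 1 / (2 * a)" for \<omega>
    proof -
      have "0 \<le> (a * d k \<omega> - 1)\<^sup>2 / (2 * a)" using a by simp
      also have "\<dots> = a / 2 * (d k \<omega>)\<^sup>2 + 1 / (2 * a) - d k \<omega>"
        using a by (simp add: power2_eq_square field_simps)
      finally show ?thesis by simp
    qed
    then have "(\<integral>\<^sup>+ \<omega>. ennreal (d k \<omega>) \<partial>P) \<le> (\<integral>\<^sup>+ \<omega>. ennreal (a / 2) * ennreal ((d k \<omega>)\<^sup>2) + ennreal (1 / (2 * a)) \<partial>P)"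
      using a by (intro nn_integral_mono) (auto simp: ennreal_mult[symmetric] ennreal_plus[symmetric] simp del: ennreal_plus intro!: ennreal_leI)
    also have "\<dots> = ennreal (a / 2) * (\<integral>\<^sup>+ \<omega>. ennreal ((d k \<omega>)\<^sup>2) \<partial>P) + ennreal (1 / (2 * a))"
      using dm by (subst nn_integral_add) (auto simp: nn_integral_cmult emeasure_space_1)
    also have "(\<integral>\<^sup>+ \<omega>. ennreal ((d k \<omega>)\<^sup>2) \<partial>P) = ennreal (tail_var X (2 ^ k) (2 ^ Suc k))"
      unfolding d_def T_def by (rule partial_diff_var) simp
    also have "ennreal (a / 2) * ennreal (tail_var X (2 ^ k) (2 ^ Suc k)) + ennreal (1 / (2 * a))
      = ennreal (a / 2 * tail_var X (2 ^ k) (2 ^ Suc k) + 1 / (2 * a))"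
    proof -
      have t: "0 \<le> tail_var X (2 ^ k) (2 ^ Suc k)" by (rule tail_var_le(2)[OF X]) simp
      have "ennreal (a / 2) * ennreal (tail_var X (2 ^ k) (2 ^ Suc k)) = ennreal (a / 2 * tail_var X (2 ^ k) (2 ^ Suc k))"
        using a(1) t by (intro ennreal_mult[symmetric]) auto
      moreover have "ennreal (a / 2 * tail_var X (2 ^ k) (2 ^ Suc k)) + ennreal (1 / (2 * a))
        = ennreal (a / 2 * tail_var X (2 ^ k) (2 ^ Suc k) + 1 / (2 * a))"
        using a(1) t by (intro ennreal_plus[symmetric] mult_nonneg_nonneg) auto
      ultimately show ?thesis by simp
    qed
    also have "\<dots> \<le> ennreal (D * r ^ k)"
    proof (rule ennreal_leI)
      have "a / 2 * tail_var X (2 ^ k) (2 ^ Suc k) \<le> a / 2 * ((real n)\<^sup>2 / real (2 ^ k))"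
        using a by (intro mult_left_mono tail_var_le(1)[OF X]) auto
      also have "\<dots> = (real n)\<^sup>2 / 2 * (1 / a)" using a(1) by (simp add: a(2)[symmetric])
      finally show "a / 2 * tail_var X (2 ^ k) (2 ^ Suc k) + 1 / (2 * a) \<le> D * r ^ k"
        unfolding ar[symmetric] D_def using a(1)
        by (simp only: add_divide_distrib distrib_right)
    qed
    finally show ?thesis .
  qed
  have geo: "(\<lambda>k. D * r ^ k) sums (D * (1 / (1 - r)))" using r by (intro sums_mult geometric_sums) simp
  have D0: "D \<ge> 0" by (simp add: D_def)
  have "(\<integral>\<^sup>+ \<omega>. (\<Sum>k. ennreal (d k \<omega>)) \<partial>P) = (\<Sum>k. \<integral>\<^sup>+ \<omega>. ennreal (d k \<omega>) \<partial>P)"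
    using dm by (intro nn_integral_suminf) measurable
  also have "\<dots> \<le> (\<Sum>k. ennreal (D * r ^ k))" by (intro suminf_le dk) auto
  also have "\<dots> = ennreal (D * (1 / (1 - r)))"
    using geo D0 r by (intro suminf_ennreal_eq) auto
  finally have "(\<integral>\<^sup>+ \<omega>. (\<Sum>k. ennreal (d k \<omega>)) \<partial>P) \<noteq> \<infinity>" by (auto simp: top_unique)
  then have "AE \<omega> in P. (\<Sum>k. ennreal (d k \<omega>)) \<noteq> \<infinity>"
    using dm by (intro nn_integral_noteq_infinite) measurable
  then have conv: "AE \<omega> in P. convergent (\<lambda>k. T k \<omega>)"
  proof eventually_elim
    case (elim \<omega>)
    then have "summable (\<lambda>k. d k \<omega>)" by (intro summable_suminf_not_top) (auto simp: d_def)
    then have "summable (\<lambda>k. T (Suc k) \<omega> - T k \<omega>)" unfolding d_def by (rule summable_norm_cancel)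
    then have "convergent (\<lambda>K. \<Sum>k<K. T (Suc k) \<omega> - T k \<omega>)" by (simp add: summable_iff_convergent)
    then have "convergent (\<lambda>K. T K \<omega> - T 0 \<omega>)" using sum_lessThan_telescope[of "\<lambda>k. T k \<omega>"] by simp
    then show ?case by (simp add: convergent_diff_const_right_iff)
  qed
  define L where "L \<omega> = lim (\<lambda>k. T k \<omega>)" for \<omega>
  have Lm: "L \<in> borel_measurable P" unfolding L_def by (rule borel_measurable_lim_metric[OF Tm])
  have limL: "AE \<omega> in P. (\<lambda>k. T k \<omega>) \<longlonglongrightarrow> L \<omega>"
    using conv by eventually_elim (simp add: L_def convergent_LIMSEQ_iff)
  \<comment> \<open>Fatou's lemma transfers the dyadic limit to partial sums of every
    length.\<close>
  have bound: "(\<integral>\<^sup>+ \<omega>. ennreal ((norm (L \<omega> - partial X N \<omega>))\<^sup>2) \<partial>P) \<le> ennreal ((real n)\<^sup>2 / real N)" if N: "N \<ge> 1" for N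
  proof (rule nn_integral_limit_le[OF Tm partial_measurable limL])
    have "\<forall>\<^sub>F k in sequentially. N \<le> 2 ^ k"
      using eventually_ge_at_top[of N] by eventually_elim (meson less_exp less_imp_le order_trans)
    then show "\<forall>\<^sub>F k in sequentially. (\<integral>\<^sup>+ \<omega>. ennreal ((norm (T k \<omega> - partial X N \<omega>))\<^sup>2) \<partial>P) \<le> ennreal ((real n)\<^sup>2 / real N)"
      by eventually_elim (simp add: T_def partial_diff_var tail_var_le(1)[OF X N] ennreal_leI)
  qed
  have "(\<lambda>N. ennreal ((real n)\<^sup>2 / real N)) \<longlonglongrightarrow> ennreal 0"
    by (intro tendsto_ennrealI) real_asymp
  then have lim0: "(\<lambda>N. ennreal ((real n)\<^sup>2 / real N)) \<longlonglongrightarrow> 0" by (simp only: ennreal_0)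
  have "(\<lambda>N. \<integral>\<^sup>+ \<omega>. ennreal ((norm (L \<omega> - partial X N \<omega>))\<^sup>2) \<partial>P) \<longlonglongrightarrow> 0"
    by (rule tendsto_sandwich[OF always_eventually eventually_sequentiallyI[of 1] tendsto_const lim0])
      (use bound in \<open>simp_all\<close>)
  then show ?thesis using Lm unfolding partial_def by blast
qed

text \<open>On the unit circle the chosen version is an \<open>L^2\<close> limit, outside it a
  pointwise sum, so the two cases pass to the limit differently. The factor \<open>2\<close> comes
  from \<open>(x + y)^2 \<le> 2 x^2 + 2 y^2\<close> in the first case.\<close>

theorem logZ_approx:
  assumes X: "norm X \<ge> 1" and K: "\<And>J. tail_var X m J \<le> K"
  shows "logZ P u X \<in> borel_measurable P"
    and "(\<integral>\<^sup>+ \<omega>. ennreal ((norm (logZ P u X \<omega> - partial X m \<omega>))\<^sup>2) \<partial>P) \<le> ennreal (2 * K)"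
proof -
  have K0: "K \<ge> 0" using K[of m] by (simp add: tail_var_def)
  have "logZ P u X \<in> borel_measurable P \<and>
    (\<integral>\<^sup>+ \<omega>. ennreal ((norm (logZ P u X \<omega> - partial X m \<omega>))\<^sup>2) \<partial>P) \<le> ennreal (2 * K)"
  proof (cases "norm X = 1")
    case True
    define L where "L = logZ P u X"
    have L: "L \<in> borel_measurable P" "(\<lambda>N. \<integral>\<^sup>+ \<omega>. ennreal ((norm (L \<omega> - partial X N \<omega>))\<^sup>2) \<partial>P) \<longlonglongrightarrow> 0"
      using someI_ex[OF partial_L2_limit[OF X]] True by (auto simp: L_def logZ_def partial_def)
    have "(\<integral>\<^sup>+ \<omega>. ennreal ((norm (L \<omega> - partial X m \<omega>))\<^sup>2) \<partial>P)
      \<le> 2 * (\<integral>\<^sup>+ \<omega>. ennreal ((norm (L \<omega> - partial X N \<omega>))\<^sup>2) \<partial>P) + ennreal (2 * K)" if N: "N \<ge> m" for N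
    proof -
      have e: "(norm (L \<omega> - partial X m \<omega>))\<^sup>2 \<le> 2 * (norm (L \<omega> - partial X N \<omega>))\<^sup>2 + 2 * (norm (partial X N \<omega> - partial X m \<omega>))\<^sup>2" for \<omega>
      proof -
        let ?x = "norm (L \<omega> - partial X N \<omega>)" and ?y = "norm (partial X N \<omega> - partial X m \<omega>)"
        have "norm (L \<omega> - partial X m \<omega>) \<le> ?x + ?y"
          using norm_triangle_ineq[of "L \<omega> - partial X N \<omega>" "partial X N \<omega> - partial X m \<omega>"] by simp
        then have "(norm (L \<omega> - partial X m \<omega>))\<^sup>2 \<le> (?x + ?y)\<^sup>2" by (intro power_mono) auto
        also have "\<dots> \<le> 2 * ?x\<^sup>2 + 2 * ?y\<^sup>2"
          using zero_le_power2[of "?x - ?y"] by (simp add: power2_eq_square algebra_simps)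
        finally show ?thesis .
      qed
      have "(\<integral>\<^sup>+ \<omega>. ennreal ((norm (L \<omega> - partial X m \<omega>))\<^sup>2) \<partial>P)
        \<le> (\<integral>\<^sup>+ \<omega>. 2 * ennreal ((norm (L \<omega> - partial X N \<omega>))\<^sup>2) + 2 * ennreal ((norm (partial X N \<omega> - partial X m \<omega>))\<^sup>2) \<partial>P)"
      proof (intro nn_integral_mono)
        fix \<omega>
        have "ennreal ((norm (L \<omega> - partial X m \<omega>))\<^sup>2)
          \<le> ennreal (2 * (norm (L \<omega> - partial X N \<omega>))\<^sup>2 + 2 * (norm (partial X N \<omega> - partial X m \<omega>))\<^sup>2)"
          by (rule ennreal_leI[OF e])
        also have "\<dots> = 2 * ennreal ((norm (L \<omega> - partial X N \<omega>))\<^sup>2) + 2 * ennreal ((norm (partial X N \<omega> - partial X m \<omega>))\<^sup>2)"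
          by (simp add: ennreal_plus ennreal_mult)
        finally show "ennreal ((norm (L \<omega> - partial X m \<omega>))\<^sup>2)
          \<le> 2 * ennreal ((norm (L \<omega> - partial X N \<omega>))\<^sup>2) + 2 * ennreal ((norm (partial X N \<omega> - partial X m \<omega>))\<^sup>2)" .
      qed
      also have "\<dots> = 2 * (\<integral>\<^sup>+ \<omega>. ennreal ((norm (L \<omega> - partial X N \<omega>))\<^sup>2) \<partial>P) + 2 * ennreal (tail_var X m N)"
        using L(1) partial_measurable partial_diff_var[OF N, of X]
        by (subst nn_integral_add) (auto simp: nn_integral_cmult)
      also have "2 * ennreal (tail_var X m N) \<le> ennreal (2 * K)"
        using K[of N] K0 by (simp add: ennreal_mult mult_left_mono ennreal_leI)
      finally show ?thesis by (simp add: add_left_mono)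
    qed
    moreover have "(\<lambda>N. 2 * (\<integral>\<^sup>+ \<omega>. ennreal ((norm (L \<omega> - partial X N \<omega>))\<^sup>2) \<partial>P) + ennreal (2 * K)) \<longlonglongrightarrow> 2 * 0 + ennreal (2 * K)"
      by (intro tendsto_add tendsto_const ennreal_tendsto_cmult L(2)) simp
    ultimately have "(\<integral>\<^sup>+ \<omega>. ennreal ((norm (L \<omega> - partial X m \<omega>))\<^sup>2) \<partial>P) \<le> 2 * 0 + ennreal (2 * K)"
      by (intro LIMSEQ_le_const) auto
    then show ?thesis using L(1) by (simp add: L_def)
  next
    case False
    then have X1: "norm X > 1" using X by simp
    have eq: "logZ P u X = (\<lambda>\<omega>. \<Sum>j. logZ_term (u \<omega>) X (Suc j))" using False by (simp add: logZ_def)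
    have lim: "(\<lambda>J. partial X J \<omega>) \<longlonglongrightarrow> logZ P u X \<omega>" if \<omega>: "\<omega> \<in> space P" for \<omega>
    proof -
      have geo: "summable (\<lambda>j. real n * (1 / norm X) ^ Suc j)"
        using X1 by (intro summable_mult, subst summable_Suc_iff) (simp add: summable_geometric divide_simps)
      have "norm (logZ_term (u \<omega>) X (Suc j)) \<le> real n * (1 / norm X) ^ Suc j" for j
      proof -
        have "norm (logZ_term (u \<omega>) X (Suc j)) = (1 / real (Suc j)) * norm (ptr (u \<omega>) (int (Suc j))) * (1 / norm X) ^ Suc j"
          unfolding logZ_term_eq[OF \<omega>] by (simp add: norm_mult norm_divide norm_power power_divide del: of_nat_Suc power_Suc)
        also have "\<dots> \<le> 1 * real n * (1 / norm X) ^ Suc j"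
          using norm_ptr_le[OF u_unitary[OF \<omega>], of "int (Suc j)"] by (intro mult_mono) auto
        finally show ?thesis by simp
      qed
      then have "summable (\<lambda>j. logZ_term (u \<omega>) X (Suc j))"
        by (intro summable_comparison_test'[OF geo, of 0]) auto
      then have "(\<lambda>J. \<Sum>j<J. logZ_term (u \<omega>) X (Suc j)) \<longlonglongrightarrow> logZ P u X \<omega>"
        unfolding eq by (rule summable_LIMSEQ)
      moreover have "(\<Sum>j<J. logZ_term (u \<omega>) X (Suc j)) = partial X J \<omega>" for J
        unfolding partial_def by (rule sum.reindex_bij_witness[of _ "\<lambda>j. j - 1" Suc]) auto
      ultimately show ?thesis by simp
    qed
    have "logZ P u X \<in> borel_measurable P"
      by (rule borel_measurable_LIMSEQ_metric[OF partial_measurable lim])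
    moreover have "(\<integral>\<^sup>+ \<omega>. ennreal ((norm (logZ P u X \<omega> - partial X m \<omega>))\<^sup>2) \<partial>P) \<le> ennreal (2 * K)"
    proof (rule nn_integral_limit_le[OF partial_measurable partial_measurable])
      show "AE \<omega> in P. (\<lambda>J. partial X J \<omega>) \<longlonglongrightarrow> logZ P u X \<omega>" using lim by (rule AE_I2)
      show "\<forall>\<^sub>F J in sequentially. (\<integral>\<^sup>+ \<omega>. ennreal ((norm (partial X J \<omega> - partial X m \<omega>))\<^sup>2) \<partial>P) \<le> ennreal (2 * K)"
        using eventually_ge_at_top[of m]
      proof eventually_elim
        case (elim J)
        have "tail_var X m J \<le> 2 * K" using K[of J] K0 by linarith
        then show ?case using elim by (simp add: partial_diff_var ennreal_leI)
      qed
    qed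
    ultimately show ?thesis by blast
  qed
  then show "logZ P u X \<in> borel_measurable P"
    "(\<integral>\<^sup>+ \<omega>. ennreal ((norm (logZ P u X \<omega> - partial X m \<omega>))\<^sup>2) \<partial>P) \<le> ennreal (2 * K)" by auto
qed

lemma logZ_L1_approx:
  assumes X: "norm X \<ge> 1" and K: "\<And>J. tail_var X m J \<le> K"
  shows "integrable P (\<lambda>\<omega>. norm (logZ P u X \<omega> - partial X m \<omega>))"
    and "(\<integral>\<omega>. norm (logZ P u X \<omega> - partial X m \<omega>) \<partial>P) \<le> sqrt (2 * K)"
proof -
  let ?f = "\<lambda>\<omega>. norm (logZ P u X \<omega> - partial X m \<omega>)"
  note a = logZ_approx[OF X K]
  have K0: "K \<ge> 0" using K[of m] by (simp add: tail_var_def)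
  have fm: "?f \<in> borel_measurable P" using a(1) partial_measurable by measurable
  have i2: "integrable P (\<lambda>\<omega>. (?f \<omega>)\<^sup>2)"
    by (rule integrableI_bounded) (use fm a(2) in \<open>auto simp: le_less_trans[OF a(2)]\<close>)
  show i1: "integrable P ?f"
    by (rule square_integrable_imp_integrable[OF fm i2])
  have "ennreal (\<integral>\<omega>. (?f \<omega>)\<^sup>2 \<partial>P) \<le> ennreal (2 * K)"
    using a(2) nn_integral_eq_integral[OF i2] by simp
  then have "(\<integral>\<omega>. (?f \<omega>)\<^sup>2 \<partial>P) \<le> 2 * K" using K0 by (simp add: ennreal_le_iff)
  \<comment> \<open>The Cauchy-Schwarz inequality, as nonnegativity of the variance.\<close>
  moreover have "(\<integral>\<omega>. ?f \<omega> \<partial>P)\<^sup>2 \<le> (\<integral>\<omega>. (?f \<omega>)\<^sup>2 \<partial>P)"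
    using variance_positive[of ?f] variance_eq[OF i1 i2] by simp
  ultimately show "(\<integral>\<omega>. ?f \<omega> \<partial>P) \<le> sqrt (2 * K)" by (intro real_le_rsqrt) simp
qed

end

section \<open>Variance and characteristic function of the truncated series\<close>

lemma norm_cis_diff_le: "norm (cis a - cis b) \<le> \<bar>a - b\<bar>"
proof -
  have "cis a - cis b = cis b * (cis (a - b) - 1)" by (simp add: algebra_simps cis_mult)
  then have "norm (cis a - cis b) = norm (cis (a - b) - 1)" by (simp add: norm_mult)
  also have "\<dots> \<le> \<bar>a - b\<bar>" using iexp_approx1[of "a - b" 0] by (simp add: cis_conv_exp)
  finally show ?thesis .
qed

context haar_variable
begin

text \<open>Up to \<open>n\<close> the variance of \<open>tr U^j\<close> is exactly
  \<open>j\<close>, so the terms are at most \<open>1 / j\<close> and give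
  \<open>ln (n / m)\<close>; the \<open>2\<close> is the error of two harmonic sums. Beyond
  \<open>n\<close> the factor \<open>norm X ^ (- 2 j)\<close> is at most
  \<open>exp (- 2 n \<epsilon>)\<close>.\<close>

lemma tail_var_bound:
  assumes n: "n \<ge> 8" and m: "1 \<le> m" "m \<le> n" and \<epsilon>: "\<epsilon> \<ge> 0" "norm X = exp \<epsilon>"
  shows "tail_var X m J \<le> ln (real n / real m) + 2 + exp (- 2 * real n * \<epsilon>) * (8 * (2 + ln (16 * ln (real n))))"
proof -
  define J' where "J' = max J n"
  let ?f = "\<lambda>j. U.trace_var j / (real j)\<^sup>2 / (norm X) ^ (2 * j)"
  have X: "norm X \<ge> 1" using \<epsilon> by simp
  have f0: "?f j \<ge> 0" for j using U.trace_var_le[of j] by simp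
  have "tail_var X m J \<le> tail_var X m J'"
    unfolding tail_var_def J'_def by (rule sum_mono2) (use f0 in auto)
  also have "\<dots> = (\<Sum>j=m + 1..n. ?f j) + (\<Sum>j=n + 1..J'. ?f j)"
  proof -
    have "{m + 1..J'} = {m + 1..n} \<union> {n + 1..J'}" using m by (auto simp: J'_def)
    then show ?thesis unfolding tail_var_def by (simp only:) (rule sum.union_disjoint, auto)
  qed
  also have "(\<Sum>j=m + 1..n. ?f j) \<le> (\<Sum>j=m + 1..n. 1 / real j)"
  proof (rule sum_mono)
    fix j assume j: "j \<in> {m + 1..n}"
    have "?f j = 1 / real j / (norm X) ^ (2 * j)"
      using j m U.trace_var_eq[of j] by (simp add: power2_eq_square)
    also have "\<dots> \<le> 1 / real j / 1"
      using one_le_power[OF X, of "2 * j"] j by (intro divide_left_mono) auto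
    finally show "?f j \<le> 1 / real j" by simp
  qed
  also have "(\<Sum>j=m + 1..n. 1 / real j) \<le> ln (real n / real m) + 2"
  proof -
    have "{1..n} = {1..m} \<union> {m + 1..n}" using m by auto
    then have "(\<Sum>j=1..n. 1 / real j) = (\<Sum>j=1..m. 1 / real j) + (\<Sum>j=m + 1..n. 1 / real j)"
      by (simp only:) (rule sum.union_disjoint, auto)
    moreover have "ln (real n / real m) = ln (real n) - ln (real m)" using m by (simp add: ln_div)
    ultimately show ?thesis using sum_inverse_ln[of n] sum_inverse_ln[of m] m n by linarith
  qed
  also have "(\<Sum>j=n + 1..J'. ?f j) \<le> (\<Sum>j=n + 1..J'. exp (- 2 * real n * \<epsilon>) * (U.trace_var j / (real j)\<^sup>2))"
  proof (rule sum_mono)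
    fix j assume j: "j \<in> {n + 1..J'}"
    have "exp (2 * real n * \<epsilon>) \<le> exp (real (2 * j) * \<epsilon>)"
      using j \<epsilon>(1) by (intro iffD2[OF exp_le_cancel_iff] mult_right_mono) auto
    also have "\<dots> = norm X ^ (2 * j)" by (simp only: \<epsilon>(2) exp_of_nat_mult)
    finally have "?f j \<le> U.trace_var j / (real j)\<^sup>2 / exp (2 * real n * \<epsilon>)"
      using U.trace_var_le[of j] X
      by (intro divide_left_mono mult_pos_pos zero_less_power) (auto intro: less_le_trans[of 0 1])
    also have "\<dots> = exp (- 2 * real n * \<epsilon>) * (U.trace_var j / (real j)\<^sup>2)"
      by (simp add: exp_minus field_simps)
    finally show "?f j \<le> exp (- 2 * real n * \<epsilon>) * (U.trace_var j / (real j)\<^sup>2)" .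
  qed
  also have "\<dots> = exp (- 2 * real n * \<epsilon>) * (\<Sum>j=n + 1..J'. U.trace_var j / (real j)\<^sup>2)"
    by (simp only: sum_distrib_left)
  also have "\<dots> \<le> exp (- 2 * real n * \<epsilon>) * (8 * (2 + ln (16 * ln (real n))))"
    by (intro mult_left_mono U.trace_var_tail n) auto
  finally show ?thesis by simp
qed

text \<open>Bounds the variance of the whole series, for tightness: the first \<open>m\<close> terms
  have exact variances and form the logarithmic sum that also gives the diagonal covariance.\<close>

lemma tail_var_0_le:
  assumes m: "m \<le> n" and K: "\<And>J. tail_var X m J \<le> K"
  shows "tail_var X 0 J \<le> Re (\<Sum>j=1..m. inverse (X * cnj X) ^ j / of_nat j) + K"
proof -
  define J' where "J' = max J m"
  let ?f = "\<lambda>j. U.trace_var j / (real j)\<^sup>2 / (norm X) ^ (2 * j)"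
  have f0: "?f j \<ge> 0" for j using U.trace_var_le[of j] by simp
  have "tail_var X 0 J \<le> tail_var X 0 J'"
    unfolding tail_var_def J'_def by (rule sum_mono2) (use f0 in auto)
  also have "\<dots> = (\<Sum>j=1..m. ?f j) + tail_var X m J'"
  proof -
    have "{0 + 1..J'} = {1..m} \<union> {m + 1..J'}" by (auto simp: J'_def)
    then show ?thesis unfolding tail_var_def by (simp only:) (rule sum.union_disjoint, auto)
  qed
  also have "(\<Sum>j=1..m. ?f j) = Re (\<Sum>j=1..m. inverse (X * cnj X) ^ j / of_nat j)"
    unfolding Re_sum
  proof (rule sum.cong[OF refl])
    fix j assume j: "j \<in> {1..m}"
    have "inverse (X * cnj X) ^ j / of_nat j = of_real (inverse ((norm X)\<^sup>2) ^ j / real j)"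
      by (simp add: complex_norm_square[symmetric])
    moreover have "?f j = inverse ((norm X)\<^sup>2) ^ j / real j"
      using j m U.trace_var_eq[of j] by (simp add: power2_eq_square[of "real j"] power_mult inverse_eq_divide power_divide)
    ultimately show "?f j = Re (inverse (X * cnj X) ^ j / of_nat j)" by (simp only: Re_complex_of_real)
  qed
  also have "tail_var X m J' \<le> K" by (rule K)
  finally show ?thesis by simp
qed

definition log_coeff :: "'i set \<Rightarrow> ('i \<Rightarrow> complex) \<Rightarrow> ('i \<Rightarrow> complex) \<Rightarrow> nat \<Rightarrow> complex" where
  "log_coeff I a X j = (\<Sum>i\<in>I. a i * (- (1 / of_nat j) / X i ^ j))"

lemma sum_partial_eq:
  assumes "\<omega> \<in> space P"
  shows "(\<Sum>i\<in>I. a i * partial (X i) m \<omega>) = U.linear_stat m (log_coeff I a X) (u \<omega>)"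
  unfolding partial_def U.linear_stat_def log_coeff_def
  by (simp only: logZ_term_eq[OF assms] sum_distrib_left sum_distrib_right mult.assoc, rule sum.swap)

text \<open>The variance \<open>j\<close> of \<open>tr U^j\<close> turns the coefficients
  \<open>1 / j^2\<close> into \<open>1 / j\<close>, so each pair of points contributes a truncated
  logarithm.\<close>

lemma variance_log_coeff:
  assumes "\<And>i. i \<in> I \<Longrightarrow> X i \<noteq> 0"
  shows "complex_of_real (U.variance_stat m (log_coeff I a X))
    = (\<Sum>i\<in>I. \<Sum>k\<in>I. a i * cnj (a k) * (\<Sum>j=1..m. inverse (X i * cnj (X k)) ^ j / of_nat j))"
proof -
  have "complex_of_real (U.variance_stat m (log_coeff I a X))
    = (\<Sum>j=1..m. of_nat j * (log_coeff I a X j * cnj (log_coeff I a X j)))"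
    unfolding U.variance_stat_def by (simp only: of_real_sum of_real_mult of_real_of_nat_eq complex_norm_square)
  also have "\<dots> = (\<Sum>j=1..m. \<Sum>i\<in>I. \<Sum>k\<in>I. a i * cnj (a k) * (inverse (X i * cnj (X k)) ^ j / of_nat j))"
  proof (rule sum.cong[OF refl])
    fix j assume j: "j \<in> {1..m}"
    have "log_coeff I a X j * cnj (log_coeff I a X j)
      = (\<Sum>i\<in>I. \<Sum>k\<in>I. (a i * (- (1 / of_nat j) / X i ^ j)) * cnj (a k * (- (1 / of_nat j) / X k ^ j)))"
      unfolding log_coeff_def cnj_sum by (rule sum_product)
    then have "of_nat j * (log_coeff I a X j * cnj (log_coeff I a X j))
      = (\<Sum>i\<in>I. \<Sum>k\<in>I. of_nat j * ((a i * (- (1 / of_nat j) / X i ^ j)) * cnj (a k * (- (1 / of_nat j) / X k ^ j))))"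
      by (simp only: sum_distrib_left)
    also have "\<dots> = (\<Sum>i\<in>I. \<Sum>k\<in>I. a i * cnj (a k) * (inverse (X i * cnj (X k)) ^ j / of_nat j))"
    proof (intro sum.cong refl)
      fix i k assume "i \<in> I" "k \<in> I"
      then have "X i \<noteq> 0" "X k \<noteq> 0" using assms by auto
      then show "of_nat j * ((a i * (- (1 / of_nat j) / X i ^ j)) * cnj (a k * (- (1 / of_nat j) / X k ^ j)))
        = a i * cnj (a k) * (inverse (X i * cnj (X k)) ^ j / of_nat j)"
        using j by (simp add: field_simps)
    qed
    finally show "of_nat j * (log_coeff I a X j * cnj (log_coeff I a X j))
      = (\<Sum>i\<in>I. \<Sum>k\<in>I. a i * cnj (a k) * (inverse (X i * cnj (X k)) ^ j / of_nat j))" .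
  qed
  also have "\<dots> = (\<Sum>i\<in>I. \<Sum>k\<in>I. \<Sum>j=1..m. a i * cnj (a k) * (inverse (X i * cnj (X k)) ^ j / of_nat j))"
    by (subst sum.swap, intro sum.cong refl, rule sum.swap)
  finally show ?thesis by (simp only: sum_distrib_left)
qed

text \<open>\<open>cis\<close> is Lipschitz with constant \<open>1\<close>, so the
  \<open>L^1\<close> error of the truncation bounds the difference of the characteristic
  functions.\<close>

lemma char_logZ_approx:
  assumes I: "finite I" and X: "\<And>i. i \<in> I \<Longrightarrow> norm (X i) \<ge> 1"
    and K: "\<And>i J. i \<in> I \<Longrightarrow> tail_var (X i) m J \<le> K"
  shows "norm ((\<integral>\<omega>. cis (Re (\<Sum>i\<in>I. a i * logZ P u (X i) \<omega>)) \<partial>P)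
    - (\<integral>W. cis (Re (U.linear_stat m (log_coeff I a X) W)) \<partial>law)) \<le> (\<Sum>i\<in>I. norm (a i)) * sqrt (2 * K)"
proof -
  let ?Y = "\<lambda>\<omega>. Re (\<Sum>i\<in>I. a i * logZ P u (X i) \<omega>)"
  let ?S = "\<lambda>\<omega>. Re (\<Sum>i\<in>I. a i * partial (X i) m \<omega>)"
  let ?E = "\<lambda>\<omega>. \<Sum>i\<in>I. norm (a i) * norm (logZ P u (X i) \<omega> - partial (X i) m \<omega>)"
  have cis_m: "(\<lambda>x. cis (Re (f x))) \<in> borel_measurable M" if "f \<in> borel_measurable M" for f and M :: "'z measure"
    by (rule measurable_compose[OF that], intro borel_measurable_continuous_onI continuous_intros)
  have lm: "(\<lambda>W. cis (Re (U.linear_stat m (log_coeff I a X) W))) \<in> borel_measurable law"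
    by (intro cis_m U.bm_measurable U.bm_linear_stat)
  have "(\<integral>W. cis (Re (U.linear_stat m (log_coeff I a X) W)) \<partial>law)
    = (\<integral>\<omega>. cis (Re (U.linear_stat m (log_coeff I a X) (u \<omega>))) \<partial>P)"
    by (rule integral_law[OF lm, symmetric])
  also have "\<dots> = (\<integral>\<omega>. cis (?S \<omega>) \<partial>P)"
    by (intro Bochner_Integration.integral_cong refl) (simp only: sum_partial_eq)
  finally have law: "(\<integral>W. cis (Re (U.linear_stat m (log_coeff I a X) W)) \<partial>law) = (\<integral>\<omega>. cis (?S \<omega>) \<partial>P)" .
  have Ym: "(\<lambda>\<omega>. cis (?Y \<omega>)) \<in> borel_measurable P"
    by (intro cis_m borel_measurable_sum borel_measurable_times borel_measurable_const logZ_approx(1)[OF X K])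
  have Sm: "(\<lambda>\<omega>. cis (?S \<omega>)) \<in> borel_measurable P"
    by (intro cis_m borel_measurable_sum borel_measurable_times borel_measurable_const partial_measurable)
  have Yi: "integrable P (\<lambda>\<omega>. cis (?Y \<omega>))" by (rule integrable_const_bound[of _ 1]) (use Ym in auto)
  have Si: "integrable P (\<lambda>\<omega>. cis (?S \<omega>))" by (rule integrable_const_bound[of _ 1]) (use Sm in auto)
  have ei: "integrable P (\<lambda>\<omega>. norm (a i) * norm (logZ P u (X i) \<omega> - partial (X i) m \<omega>))" if "i \<in> I" for i
    using logZ_L1_approx(1)[OF X[OF that] K[OF that]] by simp
  have "norm ((\<integral>\<omega>. cis (?Y \<omega>) \<partial>P) - (\<integral>\<omega>. cis (?S \<omega>) \<partial>P)) = norm (\<integral>\<omega>. cis (?Y \<omega>) - cis (?S \<omega>) \<partial>P)"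
    using Yi Si by simp
  also have "\<dots> \<le> (\<integral>\<omega>. norm (cis (?Y \<omega>) - cis (?S \<omega>)) \<partial>P)" by (rule integral_norm_bound)
  also have "\<dots> \<le> (\<integral>\<omega>. ?E \<omega> \<partial>P)"
  proof (rule integral_mono)
    show "integrable P (\<lambda>\<omega>. norm (cis (?Y \<omega>) - cis (?S \<omega>)))" using Yi Si by simp
    show "integrable P ?E" by (intro Bochner_Integration.integrable_sum ei)
    fix \<omega>
    have "norm (cis (?Y \<omega>) - cis (?S \<omega>)) \<le> \<bar>?Y \<omega> - ?S \<omega>\<bar>" by (rule norm_cis_diff_le)
    also have "\<dots> = \<bar>Re (\<Sum>i\<in>I. a i * (logZ P u (X i) \<omega> - partial (X i) m \<omega>))\<bar>"
      by (simp only: right_diff_distrib sum_subtractf minus_complex.sel)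
    also have "\<dots> \<le> norm (\<Sum>i\<in>I. a i * (logZ P u (X i) \<omega> - partial (X i) m \<omega>))" by (rule abs_Re_le_cmod)
    also have "\<dots> \<le> ?E \<omega>" unfolding norm_mult[symmetric] by (rule norm_sum)
    finally show "norm (cis (?Y \<omega>) - cis (?S \<omega>)) \<le> ?E \<omega>" .
  qed
  also have "\<dots> = (\<Sum>i\<in>I. norm (a i) * (\<integral>\<omega>. norm (logZ P u (X i) \<omega> - partial (X i) m \<omega>) \<partial>P))"
    by (subst Bochner_Integration.integral_sum[OF ei]) auto
  also have "\<dots> \<le> (\<Sum>i\<in>I. norm (a i) * sqrt (2 * K))"
    by (intro sum_mono mult_left_mono logZ_L1_approx(2)[OF X K]) auto
  also have "\<dots> = (\<Sum>i\<in>I. norm (a i)) * sqrt (2 * K)" by (simp only: sum_distrib_right)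
  finally show ?thesis unfolding law .
qed

end

section \<open>The Gaussian limit\<close>

lemma log_cutoff_antimono_size:
  assumes m: "1 \<le> m" "m \<le> n" and \<kappa>: "\<kappa> \<ge> 0"
  shows "\<bar>log_cutoff m \<kappa> - log_cutoff n \<kappa>\<bar> \<le> ln (real n / real m)"
proof -
  have l: "ln (real n / real m) = ln (real n) - ln (real m)" "ln (real m) \<le> ln (real n)"
    using m by (auto simp: ln_div)
  consider "\<kappa> * real n \<le> 1" | "\<kappa> * real m \<le> 1" "\<kappa> * real n > 1" | "\<kappa> * real m > 1" by linarith
  then show ?thesis
  proof cases
    case 1
    have "\<kappa> * real m \<le> \<kappa> * real n" using m \<kappa> by (intro mult_left_mono) auto
    then show ?thesis using 1 l by (simp add: log_cutoff_def)
  next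
    case 2
    then have k: "\<kappa> > 0" using \<kappa> by (cases "\<kappa> = 0") auto
    have "ln (real m) \<le> ln (1 / \<kappa>)" using 2(1) k m by (subst ln_le_cancel_iff) (auto simp: field_simps)
    moreover have "ln (1 / \<kappa>) \<le> ln (real n)" using 2(2) k m by (subst ln_le_cancel_iff) (auto simp: field_simps)
    ultimately show ?thesis using 2 l by (simp add: log_cutoff_def)
  next
    case 3
    have "\<kappa> * real m \<le> \<kappa> * real n" using m \<kappa> by (intro mult_left_mono) auto
    then show ?thesis using 3 l by (simp add: log_cutoff_def)
  qed
qed

lemma log_cutoff_le_ln:
  assumes "n \<ge> 1" "\<kappa> \<ge> 0"
  shows "log_cutoff n \<kappa> \<le> ln (real n)"
proof (cases "\<kappa> * real n \<le> 1")
  case False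
  then have k: "\<kappa> > 0" using assms by (cases "\<kappa> = 0") auto
  have "ln (1 / \<kappa>) \<le> ln (real n)" using False k assms by (subst ln_le_cancel_iff) (auto simp: field_simps)
  then show ?thesis using False by (simp add: log_cutoff_def)
qed (simp add: log_cutoff_def)

lemma log_cutoff_eq_min:
  assumes "n \<ge> 1" "\<kappa> > 0"
  shows "log_cutoff n \<kappa> = min (ln (real n)) (- ln \<kappa>)"
proof -
  have "\<kappa> * real n \<le> 1 \<longleftrightarrow> real n \<le> 1 / \<kappa>" using assms by (simp add: field_simps)
  also have "\<dots> \<longleftrightarrow> ln (real n) \<le> ln (1 / \<kappa>)" using assms by (subst ln_le_cancel_iff) auto
  finally show ?thesis using assms by (auto simp: log_cutoff_def ln_div min_def)
qed

text \<open>Separates the angle from radius and size. Divided by the normalisation, the two entries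
  of the minimum tend to \<open>1\<close> and to \<open>c\<close>; this is the origin of
  \<open>min 1 c\<close>.\<close>

lemma log_cutoff_max:
  assumes "n \<ge> 1" "\<epsilon> \<ge> 0" "x > 0"
  shows "log_cutoff n (max \<epsilon> x) = min (log_cutoff n \<epsilon>) (- ln x)"
proof (cases "\<epsilon> = 0")
  case True
  then show ?thesis using assms log_cutoff_eq_min[of n x] by (simp add: log_cutoff_def max_def)
next
  case False
  then have e: "\<epsilon> > 0" using assms by simp
  have "- ln (max \<epsilon> x) = min (- ln \<epsilon>) (- ln x)" using e assms by (auto simp: max_def min_def)
  then show ?thesis using log_cutoff_eq_min[OF assms(1) e] log_cutoff_eq_min[of n "max \<epsilon> x"] assms e
    by (simp add: min.assoc less_max_iff_disj)
qed

text \<open>Common setting of both regimes. The normalisation \<open>L\<close> is abstract: it tends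
  to infinity, is asymptotic to the cutoff at \<open>\<epsilon>\<close>, and is the scale on which
  the logarithms of the angles are measured.\<close>

locale log_correlated =
  fixes P :: "nat \<Rightarrow> 'w measure" and u :: "nat \<Rightarrow> 'w \<Rightarrow> complex mat"
    and \<epsilon> :: "nat \<Rightarrow> real" and \<delta> :: real and \<phi> :: "nat \<Rightarrow> 'l::finite \<Rightarrow> real"
    and c :: "'l \<Rightarrow> 'l \<Rightarrow> ereal" and L :: "nat \<Rightarrow> real"
  assumes haar: "\<And>n. n \<ge> 1 \<Longrightarrow> haar_distributed n (P n) (u n)"
    and eps_nonneg: "\<And>n. n \<ge> 1 \<Longrightarrow> 0 \<le> \<epsilon> n"
    and \<delta>: "0 < \<delta>" "\<delta> < 2 * pi"
    and phi_inj: "\<And>n. n \<ge> 1 \<Longrightarrow> inj (\<phi> n)"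
    and phi_diff: "\<And>n i j. n \<ge> 1 \<Longrightarrow> \<bar>\<phi> n j - \<phi> n i\<bar> \<le> 2 * pi - \<delta>"
    and c_nonneg: "\<And>i j. i \<noteq> j \<Longrightarrow> 0 \<le> c i j"
    and L_top: "filterlim L at_top sequentially"
    and eps_le_1: "\<forall>\<^sub>F n in sequentially. \<epsilon> n \<le> 1"
    and cutoff: "(\<lambda>n. log_cutoff n (\<epsilon> n) / L n) \<longlonglongrightarrow> 1"
    and cov: "\<And>i j. i \<noteq> j \<Longrightarrow> (\<lambda>n. ereal (- ln \<bar>\<phi> n j - \<phi> n i\<bar> / L n)) \<longlonglongrightarrow> c i j"
begin

lemma haar_variable: "n \<ge> 1 \<Longrightarrow> haar_variable (P n) n (u n)"
  using haar[of n] by (simp add: haar_variable_def haar_variable_axioms_def haar_distributed_def)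

definition \<Gamma> :: "'l \<Rightarrow> 'l \<Rightarrow> real" where
  "\<Gamma> i j = (if i = j then 1 else real_of_ereal (min 1 (c i j)))"

definition X :: "nat \<Rightarrow> 'l \<Rightarrow> complex" where
  "X n i = exp (complex_of_real (\<epsilon> n) + \<i> * complex_of_real (\<phi> n i))"

text \<open>Truncating the series after \<open>m\<close> terms makes the trace moments Gaussian up to an order tending
  to infinity, while only \<open>ln (n / m) = O(ln L)\<close> of the variance is lost.\<close>

definition m :: "nat \<Rightarrow> nat" where "m n = n div nat \<lceil>L n\<rceil>"

text \<open>Bounds the variance left out by the truncation, with \<open>n / m\<close> replaced by
  \<open>4 * L\<close>.\<close>

definition K :: "nat \<Rightarrow> real" where
  "K n = ln (4 * L n) + 2 + exp (- 2 * real n * \<epsilon> n) * (8 * (2 + ln (16 * ln (real n))))"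

lemma X_norm: "norm (X n i) = exp (\<epsilon> n)" by (simp add: X_def)

lemma X_norm_ge: "n \<ge> 1 \<Longrightarrow> norm (X n i) \<ge> 1"
  using eps_nonneg[of n] by (simp add: X_norm)

lemma X_inverse: "inverse (X n i * cnj (X n j)) = of_real (exp (- 2 * \<epsilon> n)) * cis (\<phi> n j - \<phi> n i)"
proof -
  have "inverse (X n i * cnj (X n j)) = exp (- ((of_real (\<epsilon> n) + \<i> * of_real (\<phi> n i)) + (of_real (\<epsilon> n) - \<i> * of_real (\<phi> n j))))"
    unfolding X_def exp_minus exp_add by (simp add: exp_cnj exp_diff exp_minus exp_add field_simps)
  also have "\<dots> = exp (of_real (- 2 * \<epsilon> n)) * exp (\<i> * of_real (\<phi> n j - \<phi> n i))"
    unfolding exp_add[symmetric] by (simp add: algebra_simps)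
  finally show ?thesis by (simp only: exp_of_real cis_conv_exp)
qed

lemma ln_4L_over_L: "(\<lambda>n. (ln (4 * L n) + C) / L n) \<longlonglongrightarrow> 0"
proof -
  have "((\<lambda>x :: real. (ln (4 * x) + C) / x) \<longlongrightarrow> 0) at_top" by real_asymp
  then show ?thesis by (rule filterlim_compose[OF _ L_top])
qed

lemma L_large: "\<forall>\<^sub>F n in sequentially. L n \<ge> C"
  using L_top by (auto simp: filterlim_at_top)

text \<open>The cutoff never exceeds \<open>ln n\<close>, so \<open>L\<close>, being asymptotic to
  it, grows at most logarithmically; hence dividing \<open>n\<close> by \<open>L\<close> leaves room
  for many terms.\<close>

lemma L_le_ln: "\<forall>\<^sub>F n in sequentially. L n \<le> 2 * ln (real n)"
proof -
  have "\<forall>\<^sub>F n in sequentially. log_cutoff n (\<epsilon> n) / L n > 1 / 2"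
    using cutoff by (rule order_tendstoD) simp
  then show ?thesis using L_large[of 1] eventually_ge_at_top[of 1]
  proof eventually_elim
    case (elim n)
    then have "L n < 2 * log_cutoff n (\<epsilon> n)" by (simp add: field_simps)
    also have "\<dots> \<le> 2 * ln (real n)" using log_cutoff_le_ln[of n "\<epsilon> n"] elim eps_nonneg[of n] by simp
    finally show ?case by simp
  qed
qed

lemma m_facts: "\<forall>\<^sub>F n in sequentially. 1 \<le> m n \<and> m n \<le> n \<and> real n / real (m n) \<le> 4 * L n"
proof -
  have "\<forall>\<^sub>F n in sequentially. 4 * ln (real n) \<le> real n" by real_asymp
  then show ?thesis using L_large[of 1] L_le_ln eventually_ge_at_top[of 1]
  proof eventually_elim
    case (elim n)
    define k where "k = nat \<lceil>L n\<rceil>"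
    have "1 \<le> \<lceil>L n\<rceil>" using elim by linarith
    then have k1: "k \<ge> 1" by (simp add: k_def le_nat_iff)
    have kL: "real k \<le> 2 * L n" using elim by (simp add: k_def) linarith
    have kn: "k \<le> n" using kL elim by linarith
    have m1: "1 \<le> m n" using kn k1 by (simp add: m_def k_def[symmetric] Suc_le_eq div_greater_zero_iff)
    \<comment> \<open>Rounding down in \<open>n div k\<close> costs a factor \<open>2\<close>, and
      rounding \<open>L\<close> up another one; hence the \<open>4\<close>.\<close>
    have "n < k * (n div k) + k" using k1 by (metis less_le_trans mod_less_divisor add_strict_left_mono mult_div_mod_eq less_one not_le zero_less_one neq0_conv)
    also have "\<dots> \<le> 2 * (k * m n)" using m1 by (simp add: m_def k_def[symmetric])
    finally have "real n \<le> 2 * (real k * real (m n))" by (metis less_imp_le of_nat_le_iff of_nat_mult of_nat_numeral)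
    then have "real n / real (m n) \<le> 2 * real k" using m1 by (simp add: field_simps)
    then show ?case using m1 kL by (simp add: m_def)
  qed
qed

lemma m_small: "\<forall>\<^sub>F n in sequentially. 2 * q * m n \<le> n"
  using L_large[of "real (2 * q)"]
proof eventually_elim
  case (elim n)
  have "2 * q \<le> nat \<lceil>L n\<rceil>" using elim by linarith
  then have "2 * q * m n \<le> nat \<lceil>L n\<rceil> * m n" by (rule mult_right_mono) simp
  also have "\<dots> \<le> n" by (simp add: m_def)
  finally show ?case .
qed

text \<open>\<open>ln (ln n)\<close> alone is not small against \<open>L\<close>, which may grow
  very slowly. Either \<open>L\<close> is at least \<open>ln n / 4\<close>, or
  \<open>\<epsilon>\<close> exceeds \<open>1 / sqrt n\<close> and the exponential factor is below
  \<open>exp (- 2 sqrt n)\<close>; the bound adds up both cases.\<close>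

lemma K_over_L: "(\<lambda>n. K n / L n) \<longlonglongrightarrow> 0"
proof -
  define R where "R n = 8 * (2 + ln (16 * ln (real n)))" for n :: nat
  have A: "(\<lambda>n. 4 * R n / ln (real n) + exp (- 2 * sqrt (real n)) * R n) \<longlonglongrightarrow> 0"
    unfolding R_def by real_asymp
  have R0: "\<forall>\<^sub>F n in sequentially. R n \<ge> 0" unfolding R_def by real_asymp
  have half: "\<forall>\<^sub>F n in sequentially. log_cutoff n (\<epsilon> n) / L n < 2"
    using cutoff by (rule order_tendstoD) simp
  have le: "\<forall>\<^sub>F n in sequentially. exp (- 2 * real n * \<epsilon> n) * R n / L n
    \<le> 4 * R n / ln (real n) + exp (- 2 * sqrt (real n)) * R n"
    using R0 half L_large[of 1] eventually_ge_at_top[of 2]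
  proof eventually_elim
    case (elim n)
    have ln0: "ln (real n) > 0" using elim by simp
    have e0: "\<epsilon> n \<ge> 0" using eps_nonneg[of n] elim by simp
    show ?case
    proof (cases "log_cutoff n (\<epsilon> n) \<ge> ln (real n) / 2")
      case True
      have "ln (real n) / 4 \<le> L n" using True elim by (simp add: field_simps)
      moreover have "exp (- 2 * real n * \<epsilon> n) * R n \<le> 1 * R n"
        using e0 elim by (intro mult_right_mono) auto
      ultimately have "exp (- 2 * real n * \<epsilon> n) * R n / L n \<le> R n / (ln (real n) / 4)"
        using ln0 elim by (intro frac_le) auto
      moreover have "exp (- 2 * sqrt (real n)) * R n \<ge> 0" using elim by simp
      ultimately have "exp (- 2 * real n * \<epsilon> n) * R n / L n + 0 \<le> R n / (ln (real n) / 4) + exp (- 2 * sqrt (real n)) * R n"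
        by (rule add_mono)
      moreover have "R n / (ln (real n) / 4) = 4 * R n / ln (real n)" by simp
      ultimately show ?thesis by (simp only: add_0_right)
    next
      case False
      then have "\<epsilon> n * real n > 1" and lt: "ln (1 / \<epsilon> n) < ln (real n) / 2"
        using ln0 by (auto simp: log_cutoff_def split: if_splits)
      then have e: "\<epsilon> n > 0" using e0 by (cases "\<epsilon> n = 0") auto
      have "ln (1 / \<epsilon> n) < ln (sqrt (real n))" using lt elim by (simp add: ln_sqrt)
      then have inv: "1 / \<epsilon> n < sqrt (real n)" using e elim by simp
      have "sqrt (real n) = real n / sqrt (real n)" using elim by (simp add: real_div_sqrt)
      also have "\<dots> \<le> real n / (1 / \<epsilon> n)" using inv e elim by (intro divide_left_mono) auto
      finally have "exp (- 2 * real n * \<epsilon> n) \<le> exp (- 2 * sqrt (real n))" by simp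
      then have "exp (- 2 * real n * \<epsilon> n) * R n / L n \<le> exp (- 2 * sqrt (real n)) * R n / 1"
        using elim by (intro frac_le mult_right_mono) auto
      moreover have "4 * R n / ln (real n) \<ge> 0" using elim ln0 by simp
      ultimately show ?thesis by simp
    qed
  qed
  have "(\<lambda>n. exp (- 2 * real n * \<epsilon> n) * R n / L n) \<longlonglongrightarrow> 0"
  proof (rule tendsto_sandwich[OF _ le tendsto_const A])
    show "\<forall>\<^sub>F n in sequentially. 0 \<le> exp (- 2 * real n * \<epsilon> n) * R n / L n"
      using R0 L_large[of 1] by eventually_elim simp
  qed
  from tendsto_add[OF ln_4L_over_L[of 2] this] show ?thesis
    by (simp add: K_def R_def add_divide_distrib)
qed

lemma tail_var_le_K:
  "\<forall>\<^sub>F n in sequentially. \<forall>i J. haar_variable.tail_var (P n) n (u n) (X n i) (m n) J \<le> K n"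
  using m_facts eventually_ge_at_top[of 8] L_large[of 1]
proof eventually_elim
  case (elim n)
  have "haar_variable (P n) n (u n)" using elim by (intro haar_variable) simp
  then interpret V: haar_variable "P n" n "u n" .
  have "ln (real n / real (m n)) \<le> ln (4 * L n)" using elim by (subst ln_le_cancel_iff) auto
  moreover have "V.tail_var (X n i) (m n) J \<le> ln (real n / real (m n)) + 2
    + exp (- 2 * real n * \<epsilon> n) * (8 * (2 + ln (16 * ln (real n))))" for i J
    using elim by (intro V.tail_var_bound eps_nonneg X_norm) auto
  ultimately show ?case unfolding K_def by (meson add_right_mono order_trans)
qed

definition S :: "'l \<Rightarrow> 'l \<Rightarrow> nat \<Rightarrow> complex" where
  "S i j n = (\<Sum>p=1..m n. inverse (X n i * cnj (X n j)) ^ p / of_nat p)"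

text \<open>The minimum is taken in \<open>ereal\<close> since the limit \<open>c\<close> may be
  infinite; the other entry keeps it finite.\<close>

lemma cutoff_limit:
  "(\<lambda>n. log_cutoff n (max (\<epsilon> n) \<bar>\<phi> n j - \<phi> n i\<bar>) / L n) \<longlonglongrightarrow> \<Gamma> i j"
proof (cases "i = j")
  case True
  have "\<forall>\<^sub>F n in sequentially. log_cutoff n (\<epsilon> n) / L n = log_cutoff n (max (\<epsilon> n) \<bar>\<phi> n j - \<phi> n i\<bar>) / L n"
    using eventually_ge_at_top[of 1] by eventually_elim (use eps_nonneg True in \<open>simp add: max.absorb1\<close>)
  from Lim_transform_eventually[OF cutoff this] show ?thesis using True by (simp add: \<Gamma>_def)
next
  case False
  have "(\<lambda>n. min (ereal (log_cutoff n (\<epsilon> n) / L n)) (ereal (- ln \<bar>\<phi> n j - \<phi> n i\<bar> / L n))) \<longlonglongrightarrow> min (ereal 1) (c i j)"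
    by (intro tendsto_min cov[OF False] tendsto_ereal cutoff)
  moreover have "min (ereal 1) (c i j) = ereal (\<Gamma> i j)"
    using c_nonneg[OF False] False by (cases "c i j") (auto simp: \<Gamma>_def min_def one_ereal_def)
  ultimately have lim: "(\<lambda>n. ereal (min (log_cutoff n (\<epsilon> n) / L n) (- ln \<bar>\<phi> n j - \<phi> n i\<bar> / L n))) \<longlonglongrightarrow> ereal (\<Gamma> i j)"
    by (simp add: ereal_min)
  have "\<forall>\<^sub>F n in sequentially. min (log_cutoff n (\<epsilon> n) / L n) (- ln \<bar>\<phi> n j - \<phi> n i\<bar> / L n)
    = log_cutoff n (max (\<epsilon> n) \<bar>\<phi> n j - \<phi> n i\<bar>) / L n"
    using eventually_ge_at_top[of 1] L_large[of 1]
  proof eventually_elim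
    case (elim n)
    have "\<phi> n j \<noteq> \<phi> n i" using phi_inj[OF elim(1)] False by (auto dest: injD)
    then show ?case
      using log_cutoff_max[OF elim(1) eps_nonneg[OF elim(1)], of "\<bar>\<phi> n j - \<phi> n i\<bar>"] elim
      by (simp add: min_divide_distrib_right)
  qed
  then show ?thesis by (rule Lim_transform_eventually[OF lim[unfolded lim_ereal]])
qed

text \<open>The constant error of the logarithmic series and the change of cutoff from
  \<open>m\<close> to \<open>n\<close> are together \<open>O(ln L)\<close>, which disappears after
  division by \<open>L\<close>.\<close>

lemma S_limit: "(\<lambda>n. S i j n / of_real (L n)) \<longlonglongrightarrow> of_real (\<Gamma> i j)"
proof -
  obtain C where C: "\<And>\<epsilon> \<Delta> m. 0 \<le> \<epsilon> \<Longrightarrow> \<epsilon> \<le> 1 \<Longrightarrow> \<bar>\<Delta>\<bar> \<le> 2 * pi - \<delta> \<Longrightarrow> m \<ge> 1 \<Longrightarrow>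
    norm ((\<Sum>j=1..m. (complex_of_real (exp (- 2 * \<epsilon>)) * cis \<Delta>) ^ j / of_nat j)
      - of_real (log_cutoff m (max \<epsilon> \<bar>\<Delta>\<bar>))) \<le> C"
    using log_series_cutoff_uniform[OF \<delta>] by blast
  let ?c = "\<lambda>n. log_cutoff n (max (\<epsilon> n) \<bar>\<phi> n j - \<phi> n i\<bar>)"
  have "\<forall>\<^sub>F n in sequentially. norm (S i j n / of_real (L n) - of_real (?c n / L n)) \<le> (ln (4 * L n) + C) / L n"
    using m_facts eventually_ge_at_top[of 1] L_large[of 1] eps_le_1
  proof eventually_elim
    case (elim n)
    let ?k = "max (\<epsilon> n) \<bar>\<phi> n j - \<phi> n i\<bar>"
    have "norm (S i j n - of_real (log_cutoff (m n) ?k)) \<le> C"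
      unfolding S_def X_inverse using elim by (intro C eps_nonneg phi_diff) auto
    moreover have "\<bar>log_cutoff (m n) ?k - ?c n\<bar> \<le> ln (real n / real (m n))"
      using elim by (intro log_cutoff_antimono_size) auto
    then have "norm (complex_of_real (log_cutoff (m n) ?k) - of_real (?c n)) \<le> ln (real n / real (m n))"
      by (simp only: of_real_diff[symmetric] norm_of_real)
    moreover have "ln (real n / real (m n)) \<le> ln (4 * L n)" using elim by (subst ln_le_cancel_iff) auto
    ultimately have "norm (S i j n - of_real (?c n)) \<le> ln (4 * L n) + C"
      using norm_triangle_ineq[of "S i j n - of_real (log_cutoff (m n) ?k)" "of_real (log_cutoff (m n) ?k) - of_real (?c n)"]
      by simp
    then have "norm (S i j n - of_real (?c n)) / L n \<le> (ln (4 * L n) + C) / L n"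
      using elim by (intro divide_right_mono) auto
    moreover have "S i j n / of_real (L n) - of_real (?c n / L n) = (S i j n - of_real (?c n)) / of_real (L n)"
      by (simp add: diff_divide_distrib)
    ultimately show ?case using elim by (simp add: norm_divide)
  qed
  then have "(\<lambda>n. S i j n / of_real (L n) - of_real (?c n / L n)) \<longlonglongrightarrow> 0"
    by (rule Lim_null_comparison[OF _ ln_4L_over_L])
  from tendsto_add[OF this tendsto_of_real[OF cutoff_limit[of j i]]] show ?thesis by simp
qed

text \<open>Off the diagonal \<open>c\<close> is the limit of a quantity symmetric in the two
  angles.\<close>

lemma \<Gamma>_sym: "\<Gamma> i j = \<Gamma> j i"
proof (cases "i = j")
  case False
  have "(\<lambda>n. ereal (- ln \<bar>\<phi> n j - \<phi> n i\<bar> / L n)) \<longlonglongrightarrow> c j i"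
    using cov[of j i] False by (simp add: abs_minus_commute)
  then have "c i j = c j i" using cov[OF False] LIMSEQ_unique by blast
  then show ?thesis by (simp add: \<Gamma>_def)
qed simp

text \<open>The coefficients of the linear statistic \<open>Re (\<Sum>i. a i * logZ (X i))\<close> for which
  \<open>Re (a i * z) = z \<bullet> t i / sqrt L\<close>.\<close>

definition a :: "(complex, 'l) Finite_Cartesian_Product.vec \<Rightarrow> nat \<Rightarrow> 'l \<Rightarrow> complex" where
  "a t n i = of_real (1 / sqrt (L n)) * cnj (vec_nth t i)"

definition variance :: "(complex, 'l) Finite_Cartesian_Product.vec \<Rightarrow> nat \<Rightarrow> real" where
  "variance t n = haar_unitary.variance_stat (m n) (haar_variable.log_coeff UNIV (a t n) (X n))"

lemma variance_limit: "variance t \<longlonglongrightarrow> (\<Sum>i\<in>UNIV. \<Sum>j\<in>UNIV. \<Gamma> i j * (vec_nth t i \<bullet> vec_nth t j))"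
proof -
  have eq: "\<forall>\<^sub>F n in sequentially. (\<Sum>i\<in>UNIV. \<Sum>j\<in>UNIV. (cnj (vec_nth t i) * vec_nth t j) * (S i j n / of_real (L n)))
    = complex_of_real (variance t n)"
    using eventually_ge_at_top[of 1] L_large[of 1]
  proof eventually_elim
    case (elim n)
    interpret V: haar_variable "P n" n "u n" using elim by (intro haar_variable) simp
    have s: "complex_of_real (1 / sqrt (L n)) * complex_of_real (1 / sqrt (L n)) = 1 / of_real (L n)"
      using elim by (simp add: of_real_mult[symmetric] del: of_real_mult)
    have "complex_of_real (variance t n) = (\<Sum>i\<in>UNIV. \<Sum>j\<in>UNIV. a t n i * cnj (a t n j) * S i j n)"
      unfolding variance_def S_def by (rule V.variance_log_coeff) (simp add: X_def)
    also have "\<dots> = (\<Sum>i\<in>UNIV. \<Sum>j\<in>UNIV. (cnj (vec_nth t i) * vec_nth t j) * (S i j n / of_real (L n)))"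
    proof (intro sum.cong refl)
      fix i j
      have "a t n i * cnj (a t n j) = (complex_of_real (1 / sqrt (L n)) * complex_of_real (1 / sqrt (L n))) * (cnj (vec_nth t i) * vec_nth t j)"
        unfolding a_def by simp
      then show "a t n i * cnj (a t n j) * S i j n = (cnj (vec_nth t i) * vec_nth t j) * (S i j n / of_real (L n))"
        unfolding s by simp
    qed
    finally show ?case by simp
  qed
  have "(\<lambda>n. \<Sum>i\<in>UNIV. \<Sum>j\<in>UNIV. (cnj (vec_nth t i) * vec_nth t j) * (S i j n / of_real (L n)))
    \<longlonglongrightarrow> (\<Sum>i\<in>UNIV. \<Sum>j\<in>UNIV. (cnj (vec_nth t i) * vec_nth t j) * of_real (\<Gamma> i j))"
    by (intro tendsto_intros S_limit)
  then have "(\<lambda>n. Re (complex_of_real (variance t n))) \<longlonglongrightarrow> Re (\<Sum>i\<in>UNIV. \<Sum>j\<in>UNIV. (cnj (vec_nth t i) * vec_nth t j) * of_real (\<Gamma> i j))"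
    by (intro tendsto_Re) (rule Lim_transform_eventually[OF _ eq])
  moreover have "Re (\<Sum>i\<in>UNIV. \<Sum>j\<in>UNIV. (cnj (vec_nth t i) * vec_nth t j) * of_real (\<Gamma> i j))
    = (\<Sum>i\<in>UNIV. \<Sum>j\<in>UNIV. \<Gamma> i j * (vec_nth t i \<bullet> vec_nth t j))"
    by (simp add: inner_complex_def mult.commute)
  ultimately show ?thesis by simp
qed

text \<open>Inherited from the variances of linear statistics, whose limit is this quadratic
  form.\<close>

lemma \<Gamma>_psd: "0 \<le> (\<Sum>i\<in>UNIV. \<Sum>j\<in>UNIV. x i * x j * \<Gamma> i j)"
proof -
  define t :: "(complex, 'l) Finite_Cartesian_Product.vec" where "t = (\<chi> i. of_real (x i))"
  have "0 \<le> (\<Sum>i\<in>UNIV. \<Sum>j\<in>UNIV. \<Gamma> i j * (vec_nth t i \<bullet> vec_nth t j))"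
  proof (rule LIMSEQ_le_const[OF variance_limit[of t]])
    have "0 \<le> variance t n" if "n \<ge> 1" for n
    proof -
      interpret V: haar_variable "P n" n "u n" using that by (rule haar_variable)
      show ?thesis unfolding variance_def V.U.variance_stat_def by (intro sum_nonneg) simp
    qed
    then show "\<exists>N. \<forall>n\<ge>N. 0 \<le> variance t n" by blast
  qed
  then show ?thesis by (simp add: t_def inner_complex_def mult_ac)
qed

definition Y :: "nat \<Rightarrow> 'w \<Rightarrow> (complex, 'l) Finite_Cartesian_Product.vec" where
  "Y n \<omega> = (\<chi> i. of_real (1 / sqrt (L n)) * logZ (P n) (u n) (X n i) \<omega>)"

lemma logZ_measurable: "\<forall>\<^sub>F n in sequentially. \<forall>i. logZ (P n) (u n) (X n i) \<in> borel_measurable (P n)"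
  using tail_var_le_K eventually_ge_at_top[of 1]
proof eventually_elim
  case (elim n)
  interpret V: haar_variable "P n" n "u n" using elim by (intro haar_variable) simp
  show ?case using elim X_norm_ge by (intro allI V.logZ_approx(1)) auto
qed

lemma Y_measurable: "\<forall>\<^sub>F n in sequentially. Y n \<in> borel_measurable (P n)"
  using logZ_measurable
proof eventually_elim
  case (elim n)
  then show ?case unfolding Y_def
    by (intro borel_measurable_vec) (simp only: vec_lambda_beta, intro borel_measurable_times borel_measurable_const, blast)
qed

text \<open>The truncated statistic has the Gaussian limit because, for every fixed Taylor order
  \<open>q\<close>, eventually \<open>2 * q * m \<le> n\<close>. The rest is small in
  \<open>L^1\<close> after normalisation.\<close>

lemma char_limit_Y:
  "(\<lambda>n. \<integral>\<omega>. cis (Y n \<omega> \<bullet> t) \<partial>P n)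
    \<longlonglongrightarrow> of_real (exp (- (\<Sum>i\<in>UNIV. \<Sum>j\<in>UNIV. \<Gamma> i j * (vec_nth t i \<bullet> vec_nth t j)) / 4))"
proof -
  define lin where "lin n = (\<integral>W. cis (Re (haar_unitary.linear_stat (m n) (haar_variable.log_coeff UNIV (a t n) (X n)) W)) \<partial>haar_variable.law (P n) n (u n))" for n
  have lin: "lin \<longlonglongrightarrow> of_real (exp (- (\<Sum>i\<in>UNIV. \<Sum>j\<in>UNIV. \<Gamma> i j * (vec_nth t i \<bullet> vec_nth t j)) / 4))"
  proof (rule char_limit[OF variance_limit])
    fix q
    show "\<forall>\<^sub>F n in sequentially. norm (lin n - of_real (\<Sum>k<q. (- variance t n / 4) ^ k / fact k)) \<le> (variance t n / 4) ^ q / fact q"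
      using m_small[of q] eventually_ge_at_top[of 1]
    proof eventually_elim
      case (elim n)
      interpret V: haar_variable "P n" n "u n" using elim by (intro haar_variable) simp
      show ?case unfolding lin_def variance_def by (rule V.U.char_linear_stat[OF elim(1)])
    qed
  qed
  have "(\<lambda>n. (\<integral>\<omega>. cis (Y n \<omega> \<bullet> t) \<partial>P n) - lin n) \<longlonglongrightarrow> 0"
  proof (rule Lim_null_comparison)
    show "\<forall>\<^sub>F n in sequentially. norm ((\<integral>\<omega>. cis (Y n \<omega> \<bullet> t) \<partial>P n) - lin n)
      \<le> (\<Sum>i\<in>UNIV. norm (vec_nth t i)) * sqrt (2 * (K n / L n))"
      using tail_var_le_K eventually_ge_at_top[of 1] L_large[of 1]
    proof eventually_elim
      case (elim n)
      interpret V: haar_variable "P n" n "u n" using elim by (intro haar_variable) simp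
      have Yt: "Y n \<omega> \<bullet> t = Re (\<Sum>i\<in>UNIV. a t n i * logZ (P n) (u n) (X n i) \<omega>)" for \<omega>
        by (simp add: Y_def a_def inner_vec_def inner_complex_def algebra_simps sum.distrib add_divide_distrib)
      have "(\<Sum>i\<in>UNIV. norm (a t n i)) * sqrt (2 * K n) = (\<Sum>i\<in>UNIV. norm (vec_nth t i)) * sqrt (2 * (K n / L n))"
      proof -
        have "norm (a t n i) = norm (vec_nth t i) / sqrt (L n)" for i
          using elim by (simp add: a_def norm_divide)
        then show ?thesis by (simp add: real_sqrt_divide sum_divide_distrib[symmetric])
      qed
      moreover have "norm ((\<integral>\<omega>. cis (Y n \<omega> \<bullet> t) \<partial>P n) - lin n) \<le> (\<Sum>i\<in>UNIV. norm (a t n i)) * sqrt (2 * K n)"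
        unfolding Yt lin_def using elim X_norm_ge by (intro V.char_logZ_approx) auto
      ultimately show ?case by simp
    qed
    have "(\<lambda>n. (\<Sum>i\<in>UNIV. norm (vec_nth t i)) * sqrt (2 * (K n / L n))) \<longlonglongrightarrow> (\<Sum>i\<in>UNIV. norm (vec_nth t i)) * sqrt (2 * 0)"
      by (intro tendsto_intros K_over_L)
    then show "(\<lambda>n. (\<Sum>i\<in>UNIV. norm (vec_nth t i)) * sqrt (2 * (K n / L n))) \<longlonglongrightarrow> 0" by simp
  qed
  from tendsto_add[OF this lin] show ?thesis by simp
qed

text \<open>Markov's inequality with a first moment. The whole series has variance at most
  \<open>3 * L\<close>: \<open>2 * L\<close> from the logarithmic sum and \<open>L\<close> from the
  tail. The factor \<open>2\<close> in \<open>logZ_L1_approx\<close> then gives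
  \<open>sqrt 6\<close>.\<close>

lemma Y_tight:
  assumes e: "e > 0"
  shows "\<exists>R. \<forall>\<^sub>F n in sequentially. measure (P n) {\<omega> \<in> space (P n). norm (Y n \<omega>) > R} \<le> e"
proof -
  define B where "B = real CARD('l) * sqrt 6"
  have "\<forall>\<^sub>F n in sequentially. \<forall>i. Re (S i i n / of_real (L n)) < 2"
  proof (rule eventually_all_finite)
    fix i
    show "\<forall>\<^sub>F n in sequentially. Re (S i i n / of_real (L n)) < 2"
      using tendsto_Re[OF S_limit[of i i]] by (rule order_tendstoD) (simp add: \<Gamma>_def)
  qed
  moreover have "\<forall>\<^sub>F n in sequentially. K n / L n < 1"
    using K_over_L by (rule order_tendstoD) simp
  ultimately have "\<forall>\<^sub>F n in sequentially. measure (P n) {\<omega> \<in> space (P n). norm (Y n \<omega>) > B / e} \<le> e"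
    using tail_var_le_K m_facts Y_measurable L_large[of 1] eventually_ge_at_top[of 1]
  proof eventually_elim
    case (elim n)
    interpret V: haar_variable "P n" n "u n" using elim by (intro haar_variable) simp
    have T: "V.tail_var (X n i) 0 J \<le> 3 * L n" for i J
    proof -
      have "V.tail_var (X n i) 0 J \<le> Re (S i i n) + K n"
        unfolding S_def using elim by (intro V.tail_var_0_le) auto
      moreover have "Re (S i i n) < 2 * L n" using elim(1)[rule_format, of i] elim by (simp add: field_simps)
      moreover have "K n < L n" using elim by (simp add: field_simps)
      ultimately show ?thesis by linarith
    qed
    \<comment> \<open>The partial sum of length \<open>0\<close> is zero, so
      \<open>logZ_L1_approx\<close> bounds the logarithm itself.\<close>
    have p0: "V.partial Z 0 = (\<lambda>_. 0)" for Z by (simp add: V.partial_def fun_eq_iff)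
    have L1: "integrable (P n) (\<lambda>\<omega>. norm (logZ (P n) (u n) (X n i) \<omega>))"
      "(\<integral>\<omega>. norm (logZ (P n) (u n) (X n i) \<omega>) \<partial>P n) \<le> sqrt (6 * L n)" for i
      using V.logZ_L1_approx[OF X_norm_ge T, of i] elim by (simp_all add: p0)
    let ?F = "\<lambda>\<omega>. \<Sum>i\<in>UNIV. (1 / sqrt (L n)) * norm (logZ (P n) (u n) (X n i) \<omega>)"
    have Fi: "integrable (P n) ?F" using L1(1) by (intro Bochner_Integration.integrable_sum) simp
    have le: "norm (Y n \<omega>) \<le> ?F \<omega>" for \<omega>
    proof -
      have "norm (Y n \<omega>) \<le> (\<Sum>i\<in>UNIV. norm (vec_nth (Y n \<omega>) i))" unfolding norm_vec_def by (rule L2_set_le_sum) simp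
      also have "\<dots> = ?F \<omega>" using elim by (simp add: Y_def norm_mult norm_divide)
      finally show ?thesis .
    qed
    have "(\<integral>\<omega>. ?F \<omega> \<partial>P n) = (\<Sum>i\<in>UNIV. (1 / sqrt (L n)) * (\<integral>\<omega>. norm (logZ (P n) (u n) (X n i) \<omega>) \<partial>P n))"
      using L1(1) by (subst Bochner_Integration.integral_sum) auto
    also have "\<dots> \<le> (\<Sum>i\<in>(UNIV :: 'l set). (1 / sqrt (L n)) * sqrt (6 * L n))"
      using L1(2) elim by (intro sum_mono mult_left_mono) auto
    also have "\<dots> = B" using elim by (simp add: B_def real_sqrt_mult)
    finally have F: "(\<integral>\<omega>. ?F \<omega> \<partial>P n) \<le> B" .
    have B0: "B > 0" by (simp add: B_def)
    have F0: "?F \<omega> \<ge> 0" for \<omega> using elim by (intro sum_nonneg) auto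
    have "measure (P n) {\<omega> \<in> space (P n). norm (Y n \<omega>) > B / e} \<le> measure (P n) {\<omega> \<in> space (P n). ?F \<omega> \<ge> B / e}"
    proof (rule V.finite_measure_mono)
      show "{\<omega> \<in> space (P n). norm (Y n \<omega>) > B / e} \<subseteq> {\<omega> \<in> space (P n). ?F \<omega> \<ge> B / e}"
        using le by (auto intro: order_trans[OF less_imp_le])
      show "{\<omega> \<in> space (P n). ?F \<omega> \<ge> B / e} \<in> sets (P n)"
        using borel_measurable_integrable[OF Fi] by (rule borel_measurable_le[OF borel_measurable_const])
    qed
    also have "\<dots> \<le> (\<integral>\<omega>. ?F \<omega> \<partial>P n) / (B / e)"
      by (rule integral_Markov_inequality_measure[OF Fi sets.empty_sets]) (use F0 B0 e in auto)
    also have "\<dots> \<le> B / (B / e)" using F B0 e by (intro divide_right_mono) auto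
    also have "\<dots> = e" using B0 by simp
    finally show ?case .
  qed
  then show ?thesis by blast
qed

theorem gaussian_limit:
  "\<exists>\<nu> :: (complex, 'l) Finite_Cartesian_Product.vec measure.
     complex_gaussian_vector \<nu> \<and> (\<forall>i. cmean \<nu> i = 0) \<and> (\<forall>i. ccov \<nu> i i = 1) \<and>
     (\<forall>i j. i \<noteq> j \<longrightarrow> ccov \<nu> i j = complex_of_real (real_of_ereal (min 1 (c i j)))) \<and>
     converges_in_law P Y \<nu>"
proof -
  obtain \<nu> :: "(complex, 'l) Finite_Cartesian_Product.vec measure" where
    \<nu>: "complex_gaussian_vector \<nu>" "\<And>i. cmean \<nu> i = 0" "\<And>i j. ccov \<nu> i j = of_real (\<Gamma> i j)"
    and char: "\<And>t. (\<integral>y. cis (y \<bullet> t) \<partial>\<nu>) = of_real (exp (- (\<Sum>i\<in>UNIV. \<Sum>j\<in>UNIV. \<Gamma> i j * (vec_nth t i \<bullet> vec_nth t j)) / 4))"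
    using gaussian_vector_exists[OF \<Gamma>_sym \<Gamma>_psd] by blast
  have ps: "\<forall>\<^sub>F n in sequentially. prob_space (P n) \<and> Y n \<in> borel_measurable (P n)"
    using Y_measurable eventually_ge_at_top[of 1]
    by eventually_elim (use haar in \<open>auto simp: haar_distributed_def\<close>)
  have "converges_in_law P Y \<nu>"
    unfolding converges_in_law_def
  proof (intro conjI allI impI)
    show "\<forall>\<^sub>F n in sequentially. Y n \<in> borel_measurable (P n)" by (rule Y_measurable)
    fix f :: "(complex, 'l) Finite_Cartesian_Product.vec \<Rightarrow> real"
    assume f: "continuous_on UNIV f \<and> bounded (range f)"
    show "(\<lambda>n. \<integral>\<omega>. f (Y n \<omega>) \<partial>P n) \<longlonglongrightarrow> (\<integral>y. f y \<partial>\<nu>)"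
    proof (rule levy_continuity_euclidean[OF ps])
      show "prob_space \<nu>" "sets \<nu> = sets borel" using \<nu>(1) by (auto simp: complex_gaussian_vector_def)
      show "(\<lambda>n. \<integral>\<omega>. cis (Y n \<omega> \<bullet> t) \<partial>P n) \<longlonglongrightarrow> (\<integral>y. cis (y \<bullet> t) \<partial>\<nu>)" for t
        unfolding char by (rule char_limit_Y)
      show "\<exists>R. \<forall>\<^sub>F n in sequentially. measure (P n) {\<omega> \<in> space (P n). norm (Y n \<omega>) > R} \<le> e" if "e > 0" for e
        by (rule Y_tight[OF that])
    qed (use f in auto)
  qed
  then show ?thesis using \<nu> by (intro exI[of _ \<nu>]) (auto simp: \<Gamma>_def)
qed

end

section \<open>The two regimes of the radius\<close>

lemma ratio_tendsto_1:
  fixes L f :: "nat \<Rightarrow> real"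
  assumes L: "filterlim L at_top sequentially"
    and f: "\<forall>\<^sub>F n in sequentially. L n - B \<le> f n \<and> f n \<le> L n"
  shows "(\<lambda>n. f n / L n) \<longlonglongrightarrow> 1"
proof (rule tendsto_sandwich)
  have "(\<lambda>n. 1 - B / L n) \<longlonglongrightarrow> 1 - 0"
    by (intro tendsto_intros real_tendsto_divide_at_top[OF tendsto_const L])
  then show "(\<lambda>n. 1 - B / L n) \<longlonglongrightarrow> 1" by simp
  have pos: "\<forall>\<^sub>F n in sequentially. L n \<ge> 1" using L by (auto simp: filterlim_at_top)
  show "\<forall>\<^sub>F n in sequentially. 1 - B / L n \<le> f n / L n"
    using f pos
  proof eventually_elim
    case (elim n)
    then have "(L n - B) / L n \<le> f n / L n" by (intro divide_right_mono) auto
    then show ?case using elim by (simp add: diff_divide_distrib)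
  qed
  show "\<forall>\<^sub>F n in sequentially. f n / L n \<le> 1"
    using f pos by eventually_elim (simp add: field_simps)
qed simp

theorem theorem1p4:
  fixes P :: "nat \<Rightarrow> 'w measure"
    and u :: "nat \<Rightarrow> 'w \<Rightarrow> complex mat"
    and \<epsilon> :: "nat \<Rightarrow> real"
    and \<delta> :: real
    and \<phi> :: "nat \<Rightarrow> 'l::{finite,linorder} \<Rightarrow> real"
    and c :: "'l \<Rightarrow> 'l \<Rightarrow> ereal"
  assumes haar: "\<And>n. n \<ge> 1 \<Longrightarrow> haar_distributed n (P n) (u n)"
    and eps_nonneg: "\<And>n. n \<ge> 1 \<Longrightarrow> 0 \<le> \<epsilon> n"
    and delta: "\<delta> > 0"
    and phi_nonneg: "\<And>n i. n \<ge> 1 \<Longrightarrow> 0 \<le> \<phi> n i"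
    and phi_mono: "\<And>n. n \<ge> 1 \<Longrightarrow> strict_mono (\<phi> n)"
    and phi_less: "\<And>n i. n \<ge> 1 \<Longrightarrow> \<phi> n i < 2 * pi - \<delta>"
    and c_nonneg: "\<And>i j. i \<noteq> j \<Longrightarrow> 0 \<le> c i j"
  shows
    "(\<epsilon> \<longlonglongrightarrow> 0 \<and> (\<lambda>n. 1 / real n) \<in> O(\<epsilon>) \<and>
      (\<forall>i j. i \<noteq> j \<longrightarrow>
         (\<lambda>n. ereal (ln \<bar>\<phi> n j - \<phi> n i\<bar> / ln (\<epsilon> n))) \<longlonglongrightarrow> c i j)
      \<longrightarrow>
      (\<exists>\<nu> :: (complex, 'l) Finite_Cartesian_Product.vec measure.
         complex_gaussian_vector \<nu> \<and>
         (\<forall>i. cmean \<nu> i = 0) \<and>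
         (\<forall>i. ccov \<nu> i i = 1) \<and>
         (\<forall>i j. i \<noteq> j \<longrightarrow> ccov \<nu> i j = complex_of_real (real_of_ereal (min 1 (c i j)))) \<and>
         converges_in_law P
           (\<lambda>n \<omega>. \<chi> i. complex_of_real (1 / sqrt (- ln (\<epsilon> n))) *
              logZ (P n) (u n) (exp (complex_of_real (\<epsilon> n) + \<i> * complex_of_real (\<phi> n i))) \<omega>)
           \<nu>))
     \<and>
     (\<epsilon> \<in> O(\<lambda>n. 1 / real n) \<and>
      (\<forall>i j. i \<noteq> j \<longrightarrow>
         (\<lambda>n. ereal (- ln \<bar>\<phi> n j - \<phi> n i\<bar> / ln (real n))) \<longlonglongrightarrow> c i j)
      \<longrightarrow>
      (\<exists>\<nu> :: (complex, 'l) Finite_Cartesian_Product.vec measure.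
         complex_gaussian_vector \<nu> \<and>
         (\<forall>i. cmean \<nu> i = 0) \<and>
         (\<forall>i. ccov \<nu> i i = 1) \<and>
         (\<forall>i j. i \<noteq> j \<longrightarrow> ccov \<nu> i j = complex_of_real (real_of_ereal (min 1 (c i j)))) \<and>
         converges_in_law P
           (\<lambda>n \<omega>. \<chi> i. complex_of_real (1 / sqrt (ln (real n))) *
              logZ (P n) (u n) (exp (complex_of_real (\<epsilon> n) + \<i> * complex_of_real (\<phi> n i))) \<omega>)
           \<nu>))"
proof (intro conjI impI)
  \<comment> \<open>Any index will do; the index type is not empty.\<close>
  have d2: "\<delta> < 2 * pi" using phi_nonneg[of 1 undefined] phi_less[of 1 undefined] by linarith
  have inj: "inj (\<phi> n)" if "n \<ge> 1" for n using phi_mono[OF that] by (rule strict_mono_imp_inj_on)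
  have diff: "\<bar>\<phi> n j - \<phi> n i\<bar> \<le> 2 * pi - \<delta>" if "n \<ge> 1" for n i j
    using phi_nonneg[OF that, of i] phi_nonneg[OF that, of j] phi_less[OF that, of i] phi_less[OF that, of j]
    by linarith
  {
    assume asm: "\<epsilon> \<longlonglongrightarrow> 0 \<and> (\<lambda>n. 1 / real n) \<in> O(\<epsilon>) \<and>
      (\<forall>i j. i \<noteq> j \<longrightarrow> (\<lambda>n. ereal (ln \<bar>\<phi> n j - \<phi> n i\<bar> / ln (\<epsilon> n))) \<longlonglongrightarrow> c i j)"
    obtain C where C: "C > 0" "\<forall>\<^sub>F n in sequentially. norm (1 / real n) \<le> C * norm (\<epsilon> n)"
      using asm by (auto elim!: landau_o.bigE)
    \<comment> \<open>\<open>1 / n = O(\<epsilon>)\<close> makes \<open>\<epsilon>\<close>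
      eventually positive, so that its logarithm is meaningful, and gives
      \<open>- ln \<epsilon> \<le> ln n + ln C\<close>.\<close>
    have b: "\<forall>\<^sub>F n in sequentially. n \<ge> 1 \<and> \<epsilon> n > 0 \<and> 1 / \<epsilon> n \<le> C * real n"
      using C(2) eventually_ge_at_top[of 1]
    proof eventually_elim
      case (elim n)
      then have le: "1 / real n \<le> C * \<epsilon> n" using eps_nonneg[of n] by simp
      moreover have "1 / real n > 0" using elim by simp
      ultimately have "C * \<epsilon> n > 0" by linarith
      then have "\<epsilon> n > 0" using C(1) by (simp add: zero_less_mult_iff)
      then show ?case using le elim by (simp add: field_simps)
    qed
    have top: "filterlim (\<lambda>n. - ln (\<epsilon> n)) at_top sequentially"
    proof -
      have "filterlim \<epsilon> (at_right 0) sequentially"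
        using asm b by (auto simp: filterlim_at elim!: eventually_mono)
      then have "filterlim (\<lambda>n. ln (\<epsilon> n)) at_bot sequentially" by (rule filterlim_compose[OF ln_at_0])
      then show ?thesis by (simp add: filterlim_uminus_at_bot)
    qed
    \<comment> \<open>As \<open>1 / \<epsilon>\<close> is at most \<open>C\<close> times
      \<open>n\<close>, the cutoff is \<open>- ln \<epsilon>\<close> up to
      \<open>|ln C|\<close>.\<close>
    interpret G: log_correlated P u \<epsilon> \<delta> \<phi> c "\<lambda>n. - ln (\<epsilon> n)"
    proof unfold_locales
      show "\<forall>\<^sub>F n in sequentially. \<epsilon> n \<le> 1"
        using order_tendstoD(2)[of \<epsilon> 0 sequentially 1] asm by (auto elim!: eventually_mono)
      have "\<forall>\<^sub>F n in sequentially. - ln (\<epsilon> n) - \<bar>ln C\<bar> \<le> log_cutoff n (\<epsilon> n) \<and> log_cutoff n (\<epsilon> n) \<le> - ln (\<epsilon> n)"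
        using b
      proof eventually_elim
        case (elim n)
        have "ln (1 / \<epsilon> n) \<le> ln (C * real n)" using elim C(1) by (subst ln_le_cancel_iff) auto
        then have "- ln (\<epsilon> n) \<le> ln C + ln (real n)" using elim C(1) by (simp add: ln_div ln_mult)
        then show ?case using elim log_cutoff_eq_min[of n "\<epsilon> n"] by (auto simp: min_def)
      qed
      then show "(\<lambda>n. log_cutoff n (\<epsilon> n) / - ln (\<epsilon> n)) \<longlonglongrightarrow> 1" by (rule ratio_tendsto_1[OF top])
    qed (use asm top haar eps_nonneg delta d2 inj diff c_nonneg in auto)
    have "G.Y = (\<lambda>n \<omega>. \<chi> i. complex_of_real (1 / sqrt (- ln (\<epsilon> n))) *
      logZ (P n) (u n) (exp (complex_of_real (\<epsilon> n) + \<i> * complex_of_real (\<phi> n i))) \<omega>)"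
      by (intro ext) (simp only: G.Y_def G.X_def)
    then show "\<exists>\<nu> :: (complex, 'l) Finite_Cartesian_Product.vec measure.
         complex_gaussian_vector \<nu> \<and>
         (\<forall>i. cmean \<nu> i = 0) \<and>
         (\<forall>i. ccov \<nu> i i = 1) \<and>
         (\<forall>i j. i \<noteq> j \<longrightarrow> ccov \<nu> i j = complex_of_real (real_of_ereal (min 1 (c i j)))) \<and>
         converges_in_law P
           (\<lambda>n \<omega>. \<chi> i. complex_of_real (1 / sqrt (- ln (\<epsilon> n))) *
              logZ (P n) (u n) (exp (complex_of_real (\<epsilon> n) + \<i> * complex_of_real (\<phi> n i))) \<omega>)
           \<nu>"
      using G.gaussian_limit by (simp only:)
  }
  {
    assume asm: "\<epsilon> \<in> O(\<lambda>n. 1 / real n) \<and>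
      (\<forall>i j. i \<noteq> j \<longrightarrow> (\<lambda>n. ereal (- ln \<bar>\<phi> n j - \<phi> n i\<bar> / ln (real n))) \<longlonglongrightarrow> c i j)"
    obtain C where C: "C > 0" "\<forall>\<^sub>F n in sequentially. norm (\<epsilon> n) \<le> C * norm (1 / real n)"
      using asm by (auto elim!: landau_o.bigE)
    have b: "\<forall>\<^sub>F n in sequentially. n \<ge> 1 \<and> \<epsilon> n * real n \<le> C"
      using C(2) eventually_ge_at_top[of 1]
    proof eventually_elim
      case (elim n)
      then have "\<epsilon> n \<le> C * (1 / real n)" using eps_nonneg[of n] by simp
      then show ?case using elim by (simp add: field_simps)
    qed
    have top: "filterlim (\<lambda>n. ln (real n)) at_top sequentially" by real_asymp
    \<comment> \<open>Here the product of \<open>\<epsilon>\<close> and \<open>n\<close> is bounded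
      by \<open>C\<close>, so the cutoff is \<open>ln n\<close> up to \<open>|ln C|\<close>; for
      \<open>\<epsilon> = 0\<close> it is \<open>ln n\<close> by definition.\<close>
    interpret G: log_correlated P u \<epsilon> \<delta> \<phi> c "\<lambda>n. ln (real n)"
    proof unfold_locales
      show "\<forall>\<^sub>F n in sequentially. \<epsilon> n \<le> 1"
        using b eventually_ge_at_top[of "nat \<lceil>C\<rceil>"]
      proof eventually_elim
        case (elim n)
        then have "\<epsilon> n * real n \<le> 1 * real n" by linarith
        then show ?case using elim by (simp only: mult_le_cancel_right) simp
      qed
      have "\<forall>\<^sub>F n in sequentially. ln (real n) - \<bar>ln C\<bar> \<le> log_cutoff n (\<epsilon> n) \<and> log_cutoff n (\<epsilon> n) \<le> ln (real n)"
        using b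
      proof eventually_elim
        case (elim n)
        have e0: "0 \<le> \<epsilon> n" using elim eps_nonneg by simp
        have "ln (real n) - \<bar>ln C\<bar> \<le> log_cutoff n (\<epsilon> n)"
        proof (cases "\<epsilon> n = 0")
          case False
          then have "ln (\<epsilon> n * real n) \<le> ln C" using elim e0 C(1) by (subst ln_le_cancel_iff) auto
          then have "ln (\<epsilon> n) + ln (real n) \<le> ln C" using elim e0 False by (simp add: ln_mult)
          then show ?thesis using elim False e0 log_cutoff_eq_min[of n "\<epsilon> n"] by (auto simp: min_def)
        qed (simp add: log_cutoff_def)
        then show ?case using log_cutoff_le_ln[of n "\<epsilon> n"] elim e0 by simp
      qed
      then show "(\<lambda>n. log_cutoff n (\<epsilon> n) / ln (real n)) \<longlonglongrightarrow> 1" by (rule ratio_tendsto_1[OF top])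
    qed (use asm top haar eps_nonneg delta d2 inj diff c_nonneg in auto)
    have "G.Y = (\<lambda>n \<omega>. \<chi> i. complex_of_real (1 / sqrt (ln (real n))) *
      logZ (P n) (u n) (exp (complex_of_real (\<epsilon> n) + \<i> * complex_of_real (\<phi> n i))) \<omega>)"
      by (intro ext) (simp only: G.Y_def G.X_def)
    then show "\<exists>\<nu> :: (complex, 'l) Finite_Cartesian_Product.vec measure.
         complex_gaussian_vector \<nu> \<and>
         (\<forall>i. cmean \<nu> i = 0) \<and>
         (\<forall>i. ccov \<nu> i i = 1) \<and>
         (\<forall>i j. i \<noteq> j \<longrightarrow> ccov \<nu> i j = complex_of_real (real_of_ereal (min 1 (c i j)))) \<and>
         converges_in_law P
           (\<lambda>n \<omega>. \<chi> i. complex_of_real (1 / sqrt (ln (real n))) *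
              logZ (P n) (u n) (exp (complex_of_real (\<epsilon> n) + \<i> * complex_of_real (\<phi> n i))) \<omega>)
           \<nu>"
      using G.gaussian_limit by (simp only:)
  }
qed

end
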